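(* Let $\mathbf{X}_1,\mathbf X_2,\dots$ be i.i.d. bivariate random vectors with continuous distribution function $F$, continuous marginals and copula $C$. Assume: (i) for $p=1,2$ the partial derivative $\dot C_p$ of $C$ with respect to the $p$-th coordinate exists and is continuous on $\{\mathbf{u}\in[0,1]^2:0<u_p<1\}$; (ii) for $p=1,2$, $\widehat{\dot C_p}$ is an estimator of $\dot C_p$ (a function on $[0,1]^2$ depending on $\mathbf{X}_1,\dots,\mathbf{X}_n$) with $\|\widehat{\dot C_p}\|_\infty\le K$ for a constant $K$ and all $n\in\mathbb{N}$, $p=1,2$, and $\sup_{\mathbf{u}\in[0,1]^2:\,u_p\in[\delta,1-\delta]}|\widehat{\dot C_p}(\mathbf{u})-\dot C_p(\mathbf{u})|\to0$ in probability for all $\delta\in(0,1/2)$; (iii) the multipliers are i.i.d., independent of the data, with mean $1$, variance $1$ and $\int_0^\infty\sqrt{\mathbb{P}(|\xi_1|>x)}\,dx<\infty$. Let $\mathbb{T}_{n,\mathrm{L}_2},\mathbb{T}_{n,\mathrm{KS}}$, $\mathbb{T}^\xi_{n,\mathrm{L}_2},\mathbb{T}^\xi_{n,\mathrm{KS}}$ and $\mathbb{T}_{C,\mathrm{L}_2},\mathbb{T}_{C,\mathrm{KS}}$ be obtained from $\mathbb{H}_n$, $\mathbb{H}_n^\xi$ and $\mathbb{H}_C$, respectively, as the integral over $[0,1]^3$ of the square ($\mathrm{L}_2$) and the supremum over $[0,1]^3$ of the absolute value ($\mathrm{KS}$). Then for $\mathrm{M}\in\{\mathrm{L}_2,\mathrm{KS}\}$: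 (1) $\mathbb{T}^\xi_{n,\mathrm{M}}$ converges weakly to $\mathbb{T}_{C,\mathrm{M}}$ conditionally on the data in probability (whether or not $C$ is associative). (2) If $C$ is not associative, i.e. $C(x,C(y,z))\ne C(C(x,y),z)$ for some $(x,y,z)\in[0,1]^3$, then $\mathbb{T}_{n,\mathrm{M}}\to\infty$ in probability and the multiplier bootstrap test is consistent: for every $\alpha\in(0,1)$ and $B\in\mathbb{N}$, $$\lim_{n\to\infty}\mathbb{P}\big(\mathbb{T}_{n,\mathrm{M}}>q^\xi_{1-\alpha,\mathrm{M}}\big)=1,$$ where $q^\xi_{1-\alpha,\mathrm{M}}$ is the $(1-\alpha)$-quantile of the empirical distribution of $\mathbb{T}_{n,\mathrm{M}}^{(\xi,1)},\dots,\mathbb{T}_{n,\mathrm{M}}^{(\xi,B)}$, with $\mathbb{T}_{n,\mathrm{M}}^{(\xi,b)}$ being the statistic $\mathbb{T}^\xi_{n,\mathrm{M}}$ computed from $\mathbf{X}_1,\dots,\mathbf{X}_n$ and the $b$-th of $B$ independent copies $(\xi_{1,b},\dots,\xi_{n,b})$ of the multipliers.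
   Context: Empirical copula: $C_n(\mathbf{u})=F_n(F_{n1}^-(u_1),F_{n2}^-(u_2))$, where $F_n(\mathbf{x})=n^{-1}\sum_{i=1}^n\mathbb{I}\{X_{i1}\le x_1,X_{i2}\le x_2\}$, $F_{np}(x)=n^{-1}\sum_{i=1}^n\mathbb{I}\{X_{ip}\le x\}$, and $G^-(u)=\inf\{x\in\mathbb{R}:G(x)\ge u\}$ (so $G^-(0)=-\infty$). Set $\mathbb{H}_n(x,y,z)=\sqrt{n}\{C_n(x,C_n(y,z))-C_n(C_n(x,y),z)\}$. With $\bar\xi_n=n^{-1}\sum_{i=1}^n\xi_i$ let $C_n^\xi(\mathbf{x})=n^{-1}\sum_{i=1}^n\frac{\xi_i}{\bar\xi_n}\mathbb{I}\{X_{i1}\le F_{n1}^-(x_1),X_{i2}\le F_{n2}^-(x_2)\}$ (with $\xi_i/\bar\xi_n$ read as $0$ if $\bar\xi_n=0$), $\alpha_n^\xi=\sqrt{n}(C_n^\xi-C_n)$ and $$\begin{aligned}\mathbb{H}_n^\xi(x,y,z)&=\alpha_n^\xi(x,C_n(y,z))-\widehat{\dot C_1}(x,C_n(y,z))\alpha_n^\xi(x,1)-\widehat{\dot C_2}(x,C_n(y,z))\alpha_n^\xi(1,C_n(y,z))\\ &\quad-\{\alpha_n^\xi(C_n(x,y),z)-\widehat{\dot C_1}(C_n(x,y),z)\alpha_n^\xi(C_n(x,y),1)-\widehat{\dot C_2}(C_n(x,y),z)\alpha_n^\xi(1,z)\}\\ &\quad+\widehat{\dot C_2}(x,C_n(y,z))\{\alpha_n^\xi(y,z)-\widehat{\dot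 C_1}(y,z)\alpha_n^\xi(y,1)-\widehat{\dot C_2}(y,z)\alpha_n^\xi(1,z)\}\\ &\quad-\widehat{\dot C_1}(C_n(x,y),z)\{\alpha_n^\xi(x,y)-\widehat{\dot C_1}(x,y)\alpha_n^\xi(x,1)-\widehat{\dot C_2}(x,y)\alpha_n^\xi(1,y)\}.\end{aligned}$$ $\mathbb{B}_C$ is a centered Gaussian field on $[0,1]^2$ with continuous sample paths and $\mathrm{Cov}(\mathbb{B}_C(\mathbf{x}),\mathbb{B}_C(\mathbf{y}))=C(\mathbf{x}\wedge\mathbf{y})-C(\mathbf{x})C(\mathbf{y})$; $\mathbb{G}_C(\mathbf{x})=\mathbb{B}_C(\mathbf{x})-\dot C_1(\mathbf{x})\mathbb{B}_C(x_1,1)-\dot C_2(\mathbf{x})\mathbb{B}_C(1,x_2)$; and $$\mathbb{H}_C(x,y,z)=\mathbb{G}_C(x,C(y,z))-\mathbb{G}_C(C(x,y),z)+\dot C_2(x,C(y,z))\mathbb{G}_C(y,z)-\dot C_1(C(x,y),z)\mathbb{G}_C(x,y).$$ Convention: $\dot C_p$ is set to $0$ at points with $u_p\in\{0,1\}$ (there it is only multiplied by quantities that vanish almost surely). Conditional weak convergence in probability of $G_n=G_n(\mathbf{X}_1,\dots,\mathbf{X}_n,\xi_1,\dots,\xi_n)$ to $G$ in a metric space $(\mathbb{D},d)$ means $\sup_{h\in BL_1(\mathbb{D})}|\mathbb{E}_\xi h(G_n)-\mathbb{E}h(G)|\to0$ in probability and $\mathbb{E}_\xi h(G_n)^*-\mathbb{E}_\xi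 h(G_n)_*\to0$ in probability for every $h\in BL_1(\mathbb{D})$, where $BL_1(\mathbb{D})$ is the set of $f:\mathbb{D}\to\mathbb{R}$ with $\|f\|_\infty\le1$ and $|f(\beta)-f(\gamma)|\le d(\beta,\gamma)$, $\mathbb{E}_\xi$ is conditional expectation over the multipliers given the data, and $h(G_n)^*,h(G_n)_*$ are measurable majorants and minorants with respect to the joint data including the multipliers. The estimators are assumed measurable enough that the integrals above are defined; for possibly non-measurable quantities, convergence in probability is in outer probability and $\mathbb{P}$ in (2) is inner probability. *)

theory Defs
  imports "HOL-Probability.Probability"
begin

section \<open>Coordinates, distribution functions and copulas\<close>

text \<open>Bivariate functions take pairs. Coordinates are indexed by \<open>p = 1, 2\<close>.\<close>

definition coord :: "nat \<Rightarrow> real \<times> real \<Rightarrow> real" where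
  "coord p u = (if p = 1 then fst u else snd u)"

definition replace_coord :: "nat \<Rightarrow> real \<Rightarrow> real \<times> real \<Rightarrow> real \<times> real" where
  "replace_coord p t u = (if p = 1 then (t, snd u) else (fst u, t))"

definition unit_square :: "(real \<times> real) set" where
  "unit_square = {0..1} \<times> {0..1}"

definition unit_cube :: "(real \<times> real \<times> real) set" where
  "unit_cube = {0..1} \<times> {0..1} \<times> {0..1}"

definition joint_df :: "'w measure \<Rightarrow> ('w \<Rightarrow> real \<times> real) \<Rightarrow> real \<times> real \<Rightarrow> real" where
  "joint_df M Z x = measure M {\<omega> \<in> space M. fst (Z \<omega>) \<le> fst x \<and> snd (Z \<omega>) \<le> snd x}"

definition marginal_df :: "'w measure \<Rightarrow> ('w \<Rightarrow> real \<times> real) \<Rightarrow> nat \<Rightarrow> real \<Rightarrow> real" where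
  "marginal_df M Z p x = measure M {\<omega> \<in> space M. coord p (Z \<omega>) \<le> x}"

text \<open>Only the values of \<open>C\<close> on the unit square matter.\<close>

definition is_copula :: "(real \<times> real \<Rightarrow> real) \<Rightarrow> bool" where
  "is_copula C \<longleftrightarrow>
     (\<forall>t\<in>{0..1}. C (t, 0) = 0 \<and> C (0, t) = 0 \<and> C (t, 1) = t \<and> C (1, t) = t) \<and>
     (\<forall>a b c d. 0 \<le> a \<and> a \<le> b \<and> b \<le> 1 \<and> 0 \<le> c \<and> c \<le> d \<and> d \<le> 1 \<longrightarrow>
        0 \<le> C (b, d) - C (a, d) - C (b, c) + C (a, c))"

definition is_copula_of :: "'w measure \<Rightarrow> ('w \<Rightarrow> real \<times> real) \<Rightarrow> (real \<times> real \<Rightarrow> real) \<Rightarrow> bool" where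
  "is_copula_of M Z C \<longleftrightarrow> is_copula C \<and>
     (\<forall>x. joint_df M Z x = C (marginal_df M Z 1 (fst x), marginal_df M Z 2 (snd x)))"

definition associative_copula :: "(real \<times> real \<Rightarrow> real) \<Rightarrow> bool" where
  "associative_copula C \<longleftrightarrow>
     (\<forall>x\<in>{0..1}. \<forall>y\<in>{0..1}. \<forall>z\<in>{0..1}. C (x, C (y, z)) = C (C (x, y), z))"

text \<open>The set on which the \<open>p\<close>-th partial derivative is required to exist and be continuous.\<close>

definition strip :: "nat \<Rightarrow> (real \<times> real) set" where
  "strip p = {u \<in> unit_square. 0 < coord p u \<and> coord p u < 1}"

definition dotC :: "(real \<times> real \<Rightarrow> real) \<Rightarrow> nat \<Rightarrow> real \<times> real \<Rightarrow> real" where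
  "dotC C p u =
     (if 0 < coord p u \<and> coord p u < 1 then deriv (\<lambda>t. C (replace_coord p t u)) (coord p u) else 0)"

section \<open>Empirical copulas and the processes\<close>

text \<open>Samples of size \<open>n\<close> are indexed by \<open>{..<n}\<close>. A sample is restricted to its index set, so a
  function of \<open>sample X n \<omega>\<close> depends on \<open>X 0 \<omega>, \<dots>, X (n - 1) \<omega>\<close> only.\<close>

definition sample :: "(nat \<Rightarrow> 'w \<Rightarrow> 'b) \<Rightarrow> nat \<Rightarrow> 'w \<Rightarrow> nat \<Rightarrow> 'b" where
  "sample Y n \<omega> = restrict (\<lambda>i. Y i \<omega>) {..<n}"

text \<open>Extended real values, so that \<open>gen_inv G 0 = -\<infinity>\<close>.\<close>

definition gen_inv :: "(real \<Rightarrow> real) \<Rightarrow> real \<Rightarrow> ereal" where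
  "gen_inv G u = Inf (ereal ` {x. u \<le> G x})"

definition emp_marginal :: "nat \<Rightarrow> (nat \<Rightarrow> real \<times> real) \<Rightarrow> nat \<Rightarrow> real \<Rightarrow> real" where
  "emp_marginal n x p t = (\<Sum>i<n. of_bool (coord p (x i) \<le> t)) / real n"

definition emp_df :: "nat \<Rightarrow> (nat \<Rightarrow> real \<times> real) \<Rightarrow> ereal \<times> ereal \<Rightarrow> real" where
  "emp_df n x s = (\<Sum>i<n. of_bool (ereal (fst (x i)) \<le> fst s \<and> ereal (snd (x i)) \<le> snd s)) / real n"

definition marginal_quantiles :: "nat \<Rightarrow> (nat \<Rightarrow> real \<times> real) \<Rightarrow> real \<times> real \<Rightarrow> ereal \<times> ereal" where
  "marginal_quantiles n x u =
     (gen_inv (emp_marginal n x 1) (fst u), gen_inv (emp_marginal n x 2) (snd u))"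

definition emp_copula :: "nat \<Rightarrow> (nat \<Rightarrow> real \<times> real) \<Rightarrow> real \<times> real \<Rightarrow> real" where
  "emp_copula n x u = emp_df n x (marginal_quantiles n x u)"

definition mean :: "nat \<Rightarrow> (nat \<Rightarrow> real) \<Rightarrow> real" where
  "mean n w = (\<Sum>i<n. w i) / real n"

text \<open>Division by zero yields the required value \<open>0\<close> when the mean of the multipliers vanishes.\<close>

definition mult_copula ::
  "nat \<Rightarrow> (nat \<Rightarrow> real \<times> real) \<Rightarrow> (nat \<Rightarrow> real) \<Rightarrow> real \<times> real \<Rightarrow> real" where
  "mult_copula n x w u =
     (\<Sum>i<n. w i / mean n w *
        of_bool (ereal (fst (x i)) \<le> fst (marginal_quantiles n x u) \<and>
                 ereal (snd (x i)) \<le> snd (marginal_quantiles n x u))) / real n"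

definition mult_process ::
  "nat \<Rightarrow> (nat \<Rightarrow> real \<times> real) \<Rightarrow> (nat \<Rightarrow> real) \<Rightarrow> real \<times> real \<Rightarrow> real" where
  "mult_process n x w u = sqrt (real n) * (mult_copula n x w u - emp_copula n x u)"

definition H_emp :: "nat \<Rightarrow> (nat \<Rightarrow> real \<times> real) \<Rightarrow> real \<times> real \<times> real \<Rightarrow> real" where
  "H_emp n x = (\<lambda>(a, b, c). sqrt (real n) *
     (emp_copula n x (a, emp_copula n x (b, c)) - emp_copula n x (emp_copula n x (a, b), c)))"

text \<open>The limit process and its bootstrap version are built by the same formula, from
  the copula, its partial derivatives and the Gaussian field and from the empirical copula, the estimated partial derivatives and
  \<open>mult_process\<close>. Here \<open>d p\<close> plays the role of the \<open>p\<close>-th partial derivative.\<close>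

definition G_form ::
  "(nat \<Rightarrow> real \<times> real \<Rightarrow> real) \<Rightarrow> (real \<times> real \<Rightarrow> real) \<Rightarrow> real \<times> real \<Rightarrow> real" where
  "G_form d A u = A u - d 1 u * A (fst u, 1) - d 2 u * A (1, snd u)"

definition H_form ::
  "(real \<times> real \<Rightarrow> real) \<Rightarrow> (nat \<Rightarrow> real \<times> real \<Rightarrow> real) \<Rightarrow> (real \<times> real \<Rightarrow> real) \<Rightarrow>
    real \<times> real \<times> real \<Rightarrow> real" where
  "H_form C d A = (\<lambda>(x, y, z).
     G_form d A (x, C (y, z)) - G_form d A (C (x, y), z)
     + d 2 (x, C (y, z)) * G_form d A (y, z)
     - d 1 (C (x, y), z) * G_form d A (x, y))"

definition H_limit ::
  "(real \<times> real \<Rightarrow> real) \<Rightarrow> (real \<times> real \<Rightarrow> 'v \<Rightarrow> real) \<Rightarrow> 'v \<Rightarrow> real \<times> real \<times> real \<Rightarrow> real" where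
  "H_limit C B \<omega> = H_form C (dotC C) (\<lambda>u. B u \<omega>)"

text \<open>An estimator \<open>D\<close> of the partial derivatives maps a sample size, a sample, the index \<open>p\<close> and
  a point to a real.\<close>

definition H_mult ::
  "(nat \<Rightarrow> (nat \<Rightarrow> real \<times> real) \<Rightarrow> nat \<Rightarrow> real \<times> real \<Rightarrow> real) \<Rightarrow>
    nat \<Rightarrow> (nat \<Rightarrow> real \<times> real) \<Rightarrow> (nat \<Rightarrow> real) \<Rightarrow> real \<times> real \<times> real \<Rightarrow> real" where
  "H_mult D n x w = H_form (emp_copula n x) (D n x) (mult_process n x w)"

definition L2_stat :: "(real \<times> real \<times> real \<Rightarrow> real) \<Rightarrow> real" where
  "L2_stat f = (LINT v | lebesgue_on unit_cube. (f v)\<^sup>2)"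

definition KS_stat :: "(real \<times> real \<times> real \<Rightarrow> real) \<Rightarrow> real" where
  "KS_stat f = (SUP v\<in>unit_cube. \<bar>f v\<bar>)"

text \<open>The left-continuous generalised inverse, as for the marginals, applied to the empirical
  distribution function of \<open>T 0, \<dots>, T (B - 1)\<close>.\<close>

definition emp_quantile :: "nat \<Rightarrow> (nat \<Rightarrow> real) \<Rightarrow> real \<Rightarrow> ereal" where
  "emp_quantile B T q = gen_inv (\<lambda>t. (\<Sum>b<B. of_bool (T b \<le> t)) / real B) q"

section \<open>The Gaussian limit\<close>

definition normal_rv :: "'v measure \<Rightarrow> ('v \<Rightarrow> real) \<Rightarrow> real \<Rightarrow> real \<Rightarrow> bool" where
  "normal_rv N Y \<mu> \<sigma> \<longleftrightarrow>
     (Y \<in> borel_measurable N \<and> \<sigma> = 0 \<and> (AE \<omega> in N. Y \<omega> = \<mu>)) \<or>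
     (0 < \<sigma> \<and> distributed N lborel Y (\<lambda>x. ennreal (normal_density \<mu> \<sigma> x)))"

definition gaussian_field :: "'v measure \<Rightarrow> 'b set \<Rightarrow> ('b \<Rightarrow> 'v \<Rightarrow> real) \<Rightarrow> bool" where
  "gaussian_field N S B \<longleftrightarrow>
     (\<forall>I c. finite I \<and> I \<subseteq> S \<longrightarrow> (\<exists>\<mu> \<sigma>. normal_rv N (\<lambda>\<omega>. \<Sum>u\<in>I. c u * B u \<omega>) \<mu> \<sigma>))"

definition cov :: "'v measure \<Rightarrow> ('v \<Rightarrow> real) \<Rightarrow> ('v \<Rightarrow> real) \<Rightarrow> real" where
  "cov N Y Z = (LINT \<omega>|N. (Y \<omega> - integral\<^sup>L N Y) * (Z \<omega> - integral\<^sup>L N Z))"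

definition copula_brownian_field ::
  "'v measure \<Rightarrow> (real \<times> real \<Rightarrow> real) \<Rightarrow> (real \<times> real \<Rightarrow> 'v \<Rightarrow> real) \<Rightarrow> bool" where
  "copula_brownian_field N C B \<longleftrightarrow>
     prob_space N \<and>
     gaussian_field N unit_square B \<and>
     (\<forall>u\<in>unit_square. integral\<^sup>L N (B u) = 0) \<and>
     (\<forall>u\<in>unit_square. \<forall>v\<in>unit_square.
        cov N (B u) (B v) = C (min (fst u) (fst v), min (snd u) (snd v)) - C u * C v) \<and>
     (\<forall>\<omega>\<in>space N. continuous_on unit_square (\<lambda>u. B u \<omega>))"

section \<open>Sampling\<close>

definition iid :: "'w measure \<Rightarrow> 'i set \<Rightarrow> ('i \<Rightarrow> 'w \<Rightarrow> 'b::topological_space) \<Rightarrow> bool" where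
  "iid M I Y \<longleftrightarrow> prob_space.indep_vars M (\<lambda>_. borel) Y I \<and>
     (\<forall>i\<in>I. \<forall>j\<in>I. distr M borel (Y i) = distr M borel (Y j))"

text \<open>The \<open>\<sigma>\<close>-algebra generated by a family. Independence of two families with values in different
  types is independence of these, since \<open>indep_var\<close> relates variables of one type only.\<close>

definition generated_algebra ::
  "'w measure \<Rightarrow> 'i set \<Rightarrow> ('i \<Rightarrow> 'w \<Rightarrow> 'b::topological_space) \<Rightarrow> 'w measure" where
  "generated_algebra M I Y = vimage_algebra (space M) (\<lambda>\<omega>. \<lambda>i\<in>I. Y i \<omega>) (PiM I (\<lambda>_. borel))"

definition independent_families ::
  "'w measure \<Rightarrow> 'i set \<Rightarrow> ('i \<Rightarrow> 'w \<Rightarrow> 'b::topological_space) \<Rightarrow>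
    'j set \<Rightarrow> ('j \<Rightarrow> 'w \<Rightarrow> 'c::topological_space) \<Rightarrow> bool" where
  "independent_families M I Y J Z \<longleftrightarrow>
     prob_space.indep_set M (sets (generated_algebra M I Y)) (sets (generated_algebra M J Z))"

definition multiplier_copies ::
  "'w measure \<Rightarrow> (nat \<Rightarrow> 'w \<Rightarrow> real \<times> real) \<Rightarrow> (nat \<Rightarrow> 'w \<Rightarrow> real) \<Rightarrow>
    nat \<Rightarrow> (nat \<Rightarrow> nat \<Rightarrow> 'w \<Rightarrow> real) \<Rightarrow> bool" where
  "multiplier_copies M X \<xi> B \<Xi> \<longleftrightarrow>
     iid M ({..<B} \<times> UNIV) (\<lambda>(b, i). \<Xi> b i) \<and>
     (\<forall>b<B. \<forall>i. distr M borel (\<Xi> b i) = distr M borel (\<xi> 0)) \<and>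
     independent_families M UNIV X ({..<B} \<times> UNIV) (\<lambda>(b, i). \<Xi> b i)"

section \<open>Convergence of possibly non-measurable quantities\<close>

definition inner_measure_of :: "'w measure \<Rightarrow> 'w set \<Rightarrow> ennreal" where
  "inner_measure_of M A = (SUP E\<in>{E \<in> sets M. E \<subseteq> A}. emeasure M E)"

definition null_in_prob :: "'w measure \<Rightarrow> (nat \<Rightarrow> 'w \<Rightarrow> real) \<Rightarrow> bool" where
  "null_in_prob M Y \<longleftrightarrow>
     (\<forall>\<epsilon>>0. (\<lambda>n. outer_measure_of M {\<omega> \<in> space M. \<epsilon> < \<bar>Y n \<omega>\<bar>}) \<longlonglongrightarrow> 0)"

definition infinite_in_prob :: "'w measure \<Rightarrow> (nat \<Rightarrow> 'w \<Rightarrow> real) \<Rightarrow> bool" where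
  "infinite_in_prob M Y \<longleftrightarrow>
     (\<forall>c. (\<lambda>n. outer_measure_of M {\<omega> \<in> space M. Y n \<omega> \<le> c}) \<longlonglongrightarrow> 0)"

definition BL1 :: "('d::metric_space \<Rightarrow> real) set" where
  "BL1 = {h. (\<forall>x. \<bar>h x\<bar> \<le> 1) \<and> (\<forall>x y. \<bar>h x - h y\<bar> \<le> dist x y)}"

text \<open>The minimal measurable majorant, unique almost surely; it exists for bounded \<open>Y\<close>, the only
  case in which it is used.\<close>

definition is_majorant :: "'w measure \<Rightarrow> ('w \<Rightarrow> real) \<Rightarrow> ('w \<Rightarrow> real) \<Rightarrow> bool" where
  "is_majorant M Y Z \<longleftrightarrow> Z \<in> borel_measurable M \<and> (\<forall>\<omega>\<in>space M. Y \<omega> \<le> Z \<omega>) \<and>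
     (\<forall>U\<in>borel_measurable M. (AE \<omega> in M. Y \<omega> \<le> U \<omega>) \<longrightarrow> (AE \<omega> in M. Z \<omega> \<le> U \<omega>))"

definition majorant :: "'w measure \<Rightarrow> ('w \<Rightarrow> real) \<Rightarrow> 'w \<Rightarrow> real" where
  "majorant M Y = (SOME Z. is_majorant M Y Z)"

definition minorant :: "'w measure \<Rightarrow> ('w \<Rightarrow> real) \<Rightarrow> 'w \<Rightarrow> real" where
  "minorant M Y = (\<lambda>\<omega>. - majorant M (\<lambda>\<omega>. - Y \<omega>) \<omega>)"

text \<open>Data and multipliers are independent, so the conditional expectation of
  \<open>h (G n (sample X n \<omega>) (sample \<xi> n \<omega>))\<close> given the data is obtained by integrating out the
  multipliers with the data held fixed. This fixes one version simultaneously for all \<open>h\<close>, which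
  the supremum requires, and needs no joint measurability of \<open>G n\<close>. The majorants and minorants are
  measurable on the underlying space but not given as functions of data and multipliers; the
  library's conditional expectation applies to them.\<close>

definition mult_expectation ::
  "'w measure \<Rightarrow> (nat \<Rightarrow> 'w \<Rightarrow> real \<times> real) \<Rightarrow> (nat \<Rightarrow> 'w \<Rightarrow> real) \<Rightarrow>
    nat \<Rightarrow> ((nat \<Rightarrow> real \<times> real) \<Rightarrow> (nat \<Rightarrow> real) \<Rightarrow> real) \<Rightarrow> 'w \<Rightarrow> real" where
  "mult_expectation M X \<xi> n f \<omega> = (LINT \<omega>'|M. f (sample X n \<omega>) (sample \<xi> n \<omega>'))"

definition cond_weak_conv ::
  "'w measure \<Rightarrow> (nat \<Rightarrow> 'w \<Rightarrow> real \<times> real) \<Rightarrow> (nat \<Rightarrow> 'w \<Rightarrow> real) \<Rightarrow>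
    (nat \<Rightarrow> (nat \<Rightarrow> real \<times> real) \<Rightarrow> (nat \<Rightarrow> real) \<Rightarrow> 'd::metric_space) \<Rightarrow>
    'v measure \<Rightarrow> ('v \<Rightarrow> 'd) \<Rightarrow> bool" where
  "cond_weak_conv M X \<xi> G N L \<longleftrightarrow>
     null_in_prob M (\<lambda>n \<omega>. SUP h\<in>BL1.
       \<bar>mult_expectation M X \<xi> n (\<lambda>x w. h (G n x w)) \<omega> - (LINT v|N. h (L v))\<bar>) \<and>
     (\<forall>h\<in>BL1. null_in_prob M (\<lambda>n \<omega>.
       real_cond_exp M (generated_algebra M {..<n} X)
         (majorant M (\<lambda>\<omega>. h (G n (sample X n \<omega>) (sample \<xi> n \<omega>)))) \<omega> -
       real_cond_exp M (generated_algebra M {..<n} X)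
         (minorant M (\<lambda>\<omega>. h (G n (sample X n \<omega>) (sample \<xi> n \<omega>)))) \<omega>))"

end

theory Submission
  imports Defs
begin

text \<open>
  In terms of ranks, the bootstrap process equals \<open>Z u - C\<^sub>n u * Z (1, 1)\<close> divided by the mean multiplier,
  where \<open>Z u\<close> is the normalised sum of the centred multipliers over the observations whose ranks lie
  below \<open>n u\<close>. With the data held fixed, all bounds on \<open>Z\<close> are uniform over the finitely many pairs of
  rankings: Etemadi's inequality, applied once per coordinate, reduces suprema of \<open>Z\<close> to single sums;
  these are controlled by Chebyshev's inequality and, for the increments, by truncation and
  Hoeffding's inequality. Characteristic functions and the Stone-Weierstrass theorem
  yield convergence of the values on a grid, uniformly over \<open>BL1\<close>.
  The statistics are Lipschitz functionals of the path, and equicontinuity allows the path to be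
  replaced by its values on the grid. The estimated derivatives need only be close away from the
  boundary, because near it the terms of \<open>G_form\<close> cancel. Since only the rankings of the data
  matter, independence transfers the bounds to the joint distribution.

  If \<open>C\<close> is not associative, it fails to be so by a fixed amount on a box, where \<open>H_emp\<close> grows like
  \<open>sqrt n\<close>, whereas \<open>H_mult\<close> stays bounded in probability.\<close>

section \<open>Maximal inequalities\<close>

text \<open>The estimators are arbitrary functions of the data, so the bootstrap statistic need not
  be jointly measurable. Probability is therefore used only to bound measurable exceptional sets;
  off them every estimate is a deterministic inequality whose constants do not depend on the sample.
  This forces an order of choice: the bound \<open>R\<close> on the path comes from the tolerated
  probability alone, then the accuracy, which must be small relative to \<open>R\<close>, then
  moduli of continuity and mesh, and the sample size last.

  Truncation answers a counting problem. The modulus of continuity at scale 1/m requires a union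
  bound over about m windows. A variance bound gives each window a probability of order 1/m, so the
  total does not become small; Hoeffding's bound is exponentially small in m. Etemadi's inequality
  asks only for tail bounds of single sums, without symmetry or moments, and so serves the bounded
  part and the small remainder alike.\<close>

context prob_space
begin

text \<open>The form of block independence that first-passage arguments use: the past is a predicate
  of one block of variables, the later increment a predicate of another.\<close>

lemma prob_Int_restrict:
  assumes ind: "indep_vars (\<lambda>_. borel) \<eta> J" and "A \<inter> B = {}" "A \<subseteq> J" "B \<subseteq> J"
    and P: "{v\<in>space (PiM A (\<lambda>_. borel)). P v} \<in> sets (PiM A (\<lambda>_. borel))"
    and Q: "{v\<in>space (PiM B (\<lambda>_. borel)). Q v} \<in> sets (PiM B (\<lambda>_. borel))"
  shows "prob {\<omega>\<in>space M. P (\<lambda>i\<in>A. \<eta> i \<omega>) \<and> Q (\<lambda>i\<in>B. \<eta> i \<omega>)} =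
    prob {\<omega>\<in>space M. P (\<lambda>i\<in>A. \<eta> i \<omega>)} * prob {\<omega>\<in>space M. Q (\<lambda>i\<in>B. \<eta> i \<omega>)}"
proof -
  have iv: "indep_var (PiM A (\<lambda>_. borel)) (\<lambda>\<omega>. \<lambda>i\<in>A. \<eta> i \<omega>) (PiM B (\<lambda>_. borel)) (\<lambda>\<omega>. \<lambda>i\<in>B. \<eta> i \<omega>)"
    using assms by (intro indep_var_restrict[OF ind]) auto
  have sA: "(\<lambda>i\<in>A. \<eta> i \<omega>) \<in> space (PiM A (\<lambda>_. borel))" for \<omega> by (simp add: space_PiM)
  have sB: "(\<lambda>i\<in>B. \<eta> i \<omega>) \<in> space (PiM B (\<lambda>_. borel))" for \<omega> by (simp add: space_PiM)
  have "prob ((\<lambda>\<omega>. \<lambda>i\<in>A. \<eta> i \<omega>) -` {v\<in>space (PiM A (\<lambda>_. borel)). P v} \<inter> space M \<inter>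
      ((\<lambda>\<omega>. \<lambda>i\<in>B. \<eta> i \<omega>) -` {v\<in>space (PiM B (\<lambda>_. borel)). Q v} \<inter> space M)) =
     prob ((\<lambda>\<omega>. \<lambda>i\<in>A. \<eta> i \<omega>) -` {v\<in>space (PiM A (\<lambda>_. borel)). P v} \<inter> space M) *
     prob ((\<lambda>\<omega>. \<lambda>i\<in>B. \<eta> i \<omega>) -` {v\<in>space (PiM B (\<lambda>_. borel)). Q v} \<inter> space M)"
    by (rule indep_setD[OF iv[unfolded indep_var_eq, THEN conjunct2]])
      (use P Q in \<open>blast intro: sigma_sets.Basic\<close>)+
  moreover have "(\<lambda>\<omega>. \<lambda>i\<in>A. \<eta> i \<omega>) -` {v\<in>space (PiM A (\<lambda>_. borel)). P v} \<inter> space M = {\<omega>\<in>space M. P (\<lambda>i\<in>A. \<eta> i \<omega>)}"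
    using sA by auto
  moreover have "(\<lambda>\<omega>. \<lambda>i\<in>B. \<eta> i \<omega>) -` {v\<in>space (PiM B (\<lambda>_. borel)). Q v} \<inter> space M = {\<omega>\<in>space M. Q (\<lambda>i\<in>B. \<eta> i \<omega>)}"
    using sB by auto
  moreover have "{\<omega>\<in>space M. P (\<lambda>i\<in>A. \<eta> i \<omega>)} \<inter> {\<omega>\<in>space M. Q (\<lambda>i\<in>B. \<eta> i \<omega>)} =
     {\<omega>\<in>space M. P (\<lambda>i\<in>A. \<eta> i \<omega>) \<and> Q (\<lambda>i\<in>B. \<eta> i \<omega>)}" by auto
  ultimately show ?thesis by simp
qed

text \<open>Etemadi's inequality for the seminorm \<open>max {\<bar>\<Sum>i\<in>A \<inter> D. \<eta> i\<bar> | A \<in> F}\<close> along the chain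
  \<open>D = B 0, B 1, \<dots>\<close>.\<close>

lemma etemadi:
  fixes \<eta> :: "'i \<Rightarrow> 'a \<Rightarrow> real" and B :: "nat \<Rightarrow> 'i set"
  assumes ind: "indep_vars (\<lambda>_. borel) \<eta> J" and J: "finite J" and F: "finite F"
    and B: "mono B" and BJ: "\<And>l. B l \<subseteq> J" and t: "0 < t"
    and p: "\<And>l. l \<le> m \<Longrightarrow> prob {\<omega>\<in>space M. \<exists>A\<in>F. t \<le> \<bar>\<Sum>i\<in>A \<inter> B l. \<eta> i \<omega>\<bar>} \<le> p"
  shows "prob {\<omega>\<in>space M. \<exists>l\<le>m. \<exists>A\<in>F. 3 * t \<le> \<bar>\<Sum>i\<in>A \<inter> B l. \<eta> i \<omega>\<bar>} \<le> 3 * p"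
proof -
  have rv: "\<eta> i \<in> borel_measurable M" if "i \<in> J" for i
    using ind that by (auto simp: indep_vars_def)
  define E where "E D s = {\<omega>\<in>space M. \<exists>A\<in>F. s \<le> \<bar>\<Sum>i\<in>A \<inter> D. \<eta> i \<omega>\<bar>}" for D s
  have Sm: "(\<lambda>\<omega>. \<Sum>i\<in>A \<inter> D. \<eta> i \<omega>) \<in> borel_measurable M" if "D \<subseteq> J" for A D
    using that by (intro borel_measurable_sum rv) auto
  have Em: "E D s \<in> events" if "D \<subseteq> J" for D s
  proof -
    note Sm[OF that, measurable]
    have "E D s = (\<Union>A\<in>F. {\<omega>\<in>space M. s \<le> \<bar>\<Sum>i\<in>A \<inter> D. \<eta> i \<omega>\<bar>})" by (auto simp: E_def)
    also have "\<dots> \<in> events" using F by (intro sets.finite_UN) auto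
    finally show ?thesis .
  qed
  \<comment> \<open>First-passage events: \<open>l\<close> is the first index at which level
    \<open>3 * t\<close> is reached. They are disjoint, and \<open>T l\<close> is determined by the
    variables in \<open>B l\<close>, hence independent of the increment over
    \<open>B m - B l\<close>.\<close>
  define T where "T l = E (B l) (3 * t) - (\<Union>l'<l. E (B l') (3 * t))" for l
  have Tm: "T l \<in> events" for l
    unfolding T_def by (intro sets.Diff sets.finite_UN Em BJ) auto
  have Tdisj: "disjoint_family_on T {..m}"
    unfolding disjoint_family_on_def
  proof (intro ballI impI)
    fix a b :: nat assume "a \<noteq> b"
    then show "T a \<inter> T b = {}" by (cases "a < b") (auto simp: T_def)
  qed
  have indep: "prob (T l \<inter> E (B m - B l) (2 * t)) = prob (T l) * prob (E (B m - B l) (2 * t))" if "l \<le> m" for l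
  proof -
    define P where "P v \<longleftrightarrow> (\<exists>A\<in>F. 3 * t \<le> \<bar>\<Sum>i\<in>A \<inter> B l. v i\<bar>) \<and> \<not> (\<exists>l'<l. \<exists>A\<in>F. 3 * t \<le> \<bar>\<Sum>i\<in>A \<inter> B l'. v i\<bar>)"
      for v :: "'i \<Rightarrow> real"
    define Q where "Q v \<longleftrightarrow> (\<exists>A\<in>F. 2 * t \<le> \<bar>\<Sum>i\<in>A \<inter> (B m - B l). v i\<bar>)" for v :: "'i \<Rightarrow> real"
    have Bl: "B l' \<subseteq> B l" if "l' < l" for l' using B that by (simp add: monoD)
    have comp: "(\<lambda>v. \<Sum>i\<in>A \<inter> D'. v i) \<in> borel_measurable (PiM D (\<lambda>_. borel :: real measure))"
      if "D' \<subseteq> D" for A D D' :: "'i set"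
      using that by (intro borel_measurable_sum measurable_component_singleton) auto
    have mex: "{v\<in>space (PiM D (\<lambda>_. borel)). \<exists>A\<in>F. s \<le> \<bar>\<Sum>i\<in>A \<inter> D'. v i\<bar>} \<in> sets (PiM D (\<lambda>_. borel :: real measure))"
      if "D' \<subseteq> D" for D D' :: "'i set" and s
    proof -
      note comp[OF that, measurable]
      have "{v\<in>space (PiM D (\<lambda>_. borel)). \<exists>A\<in>F. s \<le> \<bar>\<Sum>i\<in>A \<inter> D'. v i\<bar>} =
        (\<Union>A\<in>F. {v\<in>space (PiM D (\<lambda>_. borel)). s \<le> \<bar>\<Sum>i\<in>A \<inter> D'. v i\<bar>})" by auto
      also have "\<dots> \<in> sets (PiM D (\<lambda>_. borel))" using F by (intro sets.finite_UN) auto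
      finally show ?thesis .
    qed
    have 1: "{v\<in>space (PiM (B l) (\<lambda>_. borel)). P v} \<in> sets (PiM (B l) (\<lambda>_. borel))"
    proof -
      have "{v\<in>space (PiM (B l) (\<lambda>_. borel)). P v} =
        {v\<in>space (PiM (B l) (\<lambda>_. borel)). \<exists>A\<in>F. 3 * t \<le> \<bar>\<Sum>i\<in>A \<inter> B l. v i\<bar>} -
        (\<Union>l'<l. {v\<in>space (PiM (B l) (\<lambda>_. borel)). \<exists>A\<in>F. 3 * t \<le> \<bar>\<Sum>i\<in>A \<inter> B l'. v i\<bar>})"
        by (auto simp: P_def)
      also have "\<dots> \<in> sets (PiM (B l) (\<lambda>_. borel))"
        by (intro sets.Diff sets.finite_UN mex[OF order_refl] mex[OF Bl]) auto
      finally show ?thesis .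
    qed
    have 2: "{v\<in>space (PiM (B m - B l) (\<lambda>_. borel)). Q v} \<in> sets (PiM (B m - B l) (\<lambda>_. borel))"
      unfolding Q_def by (rule mex) auto
    have rs: "(\<Sum>i\<in>A \<inter> D'. (\<lambda>i\<in>D. \<eta> i \<omega>) i) = (\<Sum>i\<in>A \<inter> D'. \<eta> i \<omega>)" if "D' \<subseteq> D" for A D D' \<omega>
      using that by (intro sum.cong) auto
    have PT: "P (\<lambda>i\<in>B l. \<eta> i \<omega>) \<longleftrightarrow> (\<exists>A\<in>F. 3 * t \<le> \<bar>\<Sum>i\<in>A \<inter> B l. \<eta> i \<omega>\<bar>) \<and> \<not> (\<exists>l'<l. \<exists>A\<in>F. 3 * t \<le> \<bar>\<Sum>i\<in>A \<inter> B l'. \<eta> i \<omega>\<bar>)" for \<omega>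
      unfolding P_def using rs[OF Bl] rs[OF order_refl] by auto
    have QE: "Q (\<lambda>i\<in>B m - B l. \<eta> i \<omega>) \<longleftrightarrow> (\<exists>A\<in>F. 2 * t \<le> \<bar>\<Sum>i\<in>A \<inter> (B m - B l). \<eta> i \<omega>\<bar>)" for \<omega>
      unfolding Q_def using rs[OF order_refl] by auto
    have "prob {\<omega>\<in>space M. P (\<lambda>i\<in>B l. \<eta> i \<omega>) \<and> Q (\<lambda>i\<in>B m - B l. \<eta> i \<omega>)} =
      prob {\<omega>\<in>space M. P (\<lambda>i\<in>B l. \<eta> i \<omega>)} * prob {\<omega>\<in>space M. Q (\<lambda>i\<in>B m - B l. \<eta> i \<omega>)}"
      using BJ by (intro prob_Int_restrict[OF ind _ _ _ 1 2]) auto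
    moreover have "{\<omega>\<in>space M. P (\<lambda>i\<in>B l. \<eta> i \<omega>)} = T l"
      unfolding PT T_def E_def by auto
    moreover have "{\<omega>\<in>space M. Q (\<lambda>i\<in>B m - B l. \<eta> i \<omega>)} = E (B m - B l) (2 * t)"
      unfolding QE E_def by auto
    moreover have "{\<omega>\<in>space M. P (\<lambda>i\<in>B l. \<eta> i \<omega>) \<and> Q (\<lambda>i\<in>B m - B l. \<eta> i \<omega>)} = T l \<inter> E (B m - B l) (2 * t)"
      unfolding PT QE T_def E_def by auto
    ultimately show ?thesis by simp
  qed
  have split: "(\<Sum>i\<in>A \<inter> B m. \<eta> i \<omega>) = (\<Sum>i\<in>A \<inter> B l. \<eta> i \<omega>) + (\<Sum>i\<in>A \<inter> (B m - B l). \<eta> i \<omega>)"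
    if "l \<le> m" for A l \<omega>
  proof -
    have "A \<inter> B m = (A \<inter> B l) \<union> (A \<inter> (B m - B l))" using monoD[OF B that] by auto
    moreover have "finite (B m)" using BJ J finite_subset by blast
    moreover have "finite (B l)" using BJ J finite_subset by blast
    ultimately show ?thesis by (metis (no_types, lifting) Diff_disjoint Int_Diff Int_assoc Int_commute Int_empty_right Int_left_commute finite_Diff finite_Int sum.union_disjoint)
  qed
  \<comment> \<open>An increment of size \<open>2 * t\<close> forces one of its two endpoints to
    have size at least \<open>t\<close>, hence twice the single-index bound.\<close>
  have incr: "prob (E (B m - B l) (2 * t)) \<le> 2 * p" if "l \<le> m" for l
  proof -
    have "E (B m - B l) (2 * t) \<subseteq> E (B m) t \<union> E (B l) t"
    proof
      fix \<omega> assume "\<omega> \<in> E (B m - B l) (2 * t)"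
      then obtain A where "\<omega> \<in> space M" "A \<in> F" "2 * t \<le> \<bar>\<Sum>i\<in>A \<inter> (B m - B l). \<eta> i \<omega>\<bar>"
        by (auto simp: E_def)
      moreover from this have "t \<le> \<bar>\<Sum>i\<in>A \<inter> B m. \<eta> i \<omega>\<bar> \<or> t \<le> \<bar>\<Sum>i\<in>A \<inter> B l. \<eta> i \<omega>\<bar>"
        using split[OF that, of \<omega> A] by linarith
      ultimately show "\<omega> \<in> E (B m) t \<union> E (B l) t" by (auto simp: E_def)
    qed
    then have "prob (E (B m - B l) (2 * t)) \<le> prob (E (B m) t \<union> E (B l) t)"
      by (intro finite_measure_mono sets.Un Em BJ)
    also have "\<dots> \<le> prob (E (B m) t) + prob (E (B l) t)"
      by (intro measure_Un_le Em BJ)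
    finally show ?thesis using p[OF that] p[OF order_refl] by (simp add: E_def)
  qed
  have p0: "0 \<le> p" using p[of 0] measure_nonneg[of M] by (meson le0 order_trans)
  \<comment> \<open>At first passage some \<open>A\<close> has a sum of at least
    \<open>3 * t\<close>; if its final sum stays below \<open>t\<close>, the increment is at least
    \<open>2 * t\<close>. The two cases cost \<open>p\<close> and \<open>2 * p\<close>, whence the
    factor 3.\<close>
  have sub: "{\<omega>\<in>space M. \<exists>l\<le>m. \<exists>A\<in>F. 3 * t \<le> \<bar>\<Sum>i\<in>A \<inter> B l. \<eta> i \<omega>\<bar>} \<subseteq>
     E (B m) t \<union> (\<Union>l\<in>{..m}. T l \<inter> E (B m - B l) (2 * t))"
  proof
    fix \<omega> assume "\<omega> \<in> {\<omega>\<in>space M. \<exists>l\<le>m. \<exists>A\<in>F. 3 * t \<le> \<bar>\<Sum>i\<in>A \<inter> B l. \<eta> i \<omega>\<bar>}"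
    then have sp: "\<omega> \<in> space M" and ex: "\<exists>l. l \<le> m \<and> \<omega> \<in> E (B l) (3 * t)" by (auto simp: E_def)
    define l where "l = (LEAST l. l \<le> m \<and> \<omega> \<in> E (B l) (3 * t))"
    have l: "l \<le> m" "\<omega> \<in> E (B l) (3 * t)" using LeastI_ex[OF ex] by (auto simp: l_def)
    have "\<omega> \<notin> E (B l') (3 * t)" if "l' < l" for l'
      using not_less_Least[OF that[unfolded l_def]] that l(1) by auto
    then have T: "\<omega> \<in> T l" using l by (auto simp: T_def)
    from l(2) obtain A where A: "A \<in> F" "3 * t \<le> \<bar>\<Sum>i\<in>A \<inter> B l. \<eta> i \<omega>\<bar>" by (auto simp: E_def)
    show "\<omega> \<in> E (B m) t \<union> (\<Union>l\<in>{..m}. T l \<inter> E (B m - B l) (2 * t))"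
    proof (cases "t \<le> \<bar>\<Sum>i\<in>A \<inter> B m. \<eta> i \<omega>\<bar>")
      case True then show ?thesis using A sp by (auto simp: E_def)
    next
      case False
      then have "2 * t \<le> \<bar>\<Sum>i\<in>A \<inter> (B m - B l). \<eta> i \<omega>\<bar>"
        using split[OF l(1), of \<omega> A] A(2) by linarith
      then show ?thesis using T l(1) A(1) sp by (auto simp: E_def)
    qed
  qed
  have TE: "T l \<inter> E (B m - B l) (2 * t) \<in> events" for l
    using BJ by (intro sets.Int Tm Em) auto
  have "prob {\<omega>\<in>space M. \<exists>l\<le>m. \<exists>A\<in>F. 3 * t \<le> \<bar>\<Sum>i\<in>A \<inter> B l. \<eta> i \<omega>\<bar>} \<le>
     prob (E (B m) t \<union> (\<Union>l\<in>{..m}. T l \<inter> E (B m - B l) (2 * t)))"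
    using TE by (intro finite_measure_mono[OF sub] sets.Un sets.finite_UN Em BJ) auto
  also have "\<dots> \<le> prob (E (B m) t) + prob (\<Union>l\<in>{..m}. T l \<inter> E (B m - B l) (2 * t))"
    using TE by (intro measure_Un_le sets.finite_UN Em BJ) auto
  also have "prob (\<Union>l\<in>{..m}. T l \<inter> E (B m - B l) (2 * t)) \<le> (\<Sum>l\<le>m. prob (T l \<inter> E (B m - B l) (2 * t)))"
    using TE by (intro finite_measure_subadditive_finite) auto
  also have "\<dots> \<le> (\<Sum>l\<le>m. prob (T l) * (2 * p))"
    using incr indep by (intro sum_mono) (auto intro!: mult_left_mono)
  also have "\<dots> = prob (\<Union>l\<in>{..m}. T l) * (2 * p)"
    using Tdisj Tm by (subst finite_measure_finite_Union) (auto simp: sum_distrib_right)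
  also have "\<dots> \<le> 1 * (2 * p)" using p0 by (intro mult_right_mono) auto
  also have "prob (E (B m) t) \<le> p" using p[of m] by (simp add: E_def)
  finally show ?thesis by simp
qed

text \<open>Etemadi's inequality is run along the \<open>r\<close>-chain with a one-element family
  for each fixed \<open>l\<close>, then along the \<open>s\<close>-chain with the family of all
  \<open>r\<close>-sections. Each run multiplies level and probability by 3.\<close>

lemma two_parameter_maximal:
  fixes \<eta> :: "'i \<Rightarrow> 'a \<Rightarrow> real" and r s :: "'i \<Rightarrow> nat"
  assumes ind: "indep_vars (\<lambda>_. borel) \<eta> J" and J: "finite J" and t: "0 < t"
    and p: "\<And>A. A \<subseteq> J \<Longrightarrow> prob {\<omega>\<in>space M. t \<le> \<bar>\<Sum>i\<in>A. \<eta> i \<omega>\<bar>} \<le> p"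
  shows "prob {\<omega>\<in>space M. \<exists>k\<le>m. \<exists>l\<le>m. 9 * t \<le> \<bar>\<Sum>i\<in>{i\<in>J. r i < k \<and> s i < l}. \<eta> i \<omega>\<bar>} \<le> 9 * p"
proof -
  define F where "F = (\<lambda>k. {i\<in>J. r i < k}) ` {..m}"
  have 1: "prob {\<omega>\<in>space M. \<exists>A\<in>F. 3 * t \<le> \<bar>\<Sum>i\<in>A \<inter> {i\<in>J. s i < l}. \<eta> i \<omega>\<bar>} \<le> 3 * p" for l
  proof -
    have "prob {\<omega>\<in>space M. \<exists>k\<le>m. \<exists>A\<in>{{i\<in>J. s i < l}}. 3 * t \<le> \<bar>\<Sum>i\<in>A \<inter> {i\<in>J. r i < k}. \<eta> i \<omega>\<bar>} \<le> 3 * p"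
      by (rule etemadi[OF ind J]) (use t in \<open>auto simp: mono_def intro!: p\<close>)
    then show ?thesis by (simp add: F_def Bex_def Int_commute)
  qed
  have "prob {\<omega>\<in>space M. \<exists>l\<le>m. \<exists>A\<in>F. 3 * (3 * t) \<le> \<bar>\<Sum>i\<in>A \<inter> {i\<in>J. s i < l}. \<eta> i \<omega>\<bar>} \<le> 3 * (3 * p)"
    by (rule etemadi[OF ind J]) (use t 1 in \<open>auto simp: mono_def F_def\<close>)
  also have "{\<omega>\<in>space M. \<exists>l\<le>m. \<exists>A\<in>F. 3 * (3 * t) \<le> \<bar>\<Sum>i\<in>A \<inter> {i\<in>J. s i < l}. \<eta> i \<omega>\<bar>} =
     {\<omega>\<in>space M. \<exists>k\<le>m. \<exists>l\<le>m. 9 * t \<le> \<bar>\<Sum>i\<in>{i\<in>J. r i < k \<and> s i < l}. \<eta> i \<omega>\<bar>}"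
  proof -
    have "{i\<in>J. r i < k} \<inter> {i\<in>J. s i < l} = {i\<in>J. r i < k \<and> s i < l}" for k l by auto
    then show ?thesis by (auto simp: F_def)
  qed
  finally show ?thesis by simp
qed

end

section \<open>Tail bounds for single sums of independent variables\<close>

lemma (in prob_space) second_moment_sum_indep:
  fixes X :: "'i \<Rightarrow> 'a \<Rightarrow> real"
  assumes ind: "indep_vars (\<lambda>_. borel) X I" and "finite A" "A \<subseteq> I"
    and int: "\<And>i. i \<in> I \<Longrightarrow> integrable M (\<lambda>\<omega>. (X i \<omega>)\<^sup>2)"
    and mean: "\<And>i. i \<in> I \<Longrightarrow> expectation (X i) = 0"
  shows "integrable M (\<lambda>\<omega>. (\<Sum>i\<in>A. X i \<omega>)\<^sup>2) \<and> integrable M (\<lambda>\<omega>. \<Sum>i\<in>A. X i \<omega>) \<and>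
    expectation (\<lambda>\<omega>. \<Sum>i\<in>A. X i \<omega>) = 0 \<and>
    expectation (\<lambda>\<omega>. (\<Sum>i\<in>A. X i \<omega>)\<^sup>2) = (\<Sum>i\<in>A. expectation (\<lambda>\<omega>. (X i \<omega>)\<^sup>2))"
  using \<open>finite A\<close> \<open>A \<subseteq> I\<close>
proof (induction A rule: finite_induct)
  case empty
  then show ?case by simp
next
  case (insert a A)
  have rv: "random_variable borel (X i)" if "i \<in> I" for i using ind that by (auto simp: indep_vars_def)
  have aI: "a \<in> I" and AI: "A \<subseteq> I" using insert by auto
  have i1: "integrable M (X i)" if "i \<in> I" for i
    using square_integrable_imp_integrable[OF rv[OF that] int[OF that]] .
  define S where "S = (\<lambda>\<omega>. \<Sum>i\<in>A. X i \<omega>)"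
  have S: "integrable M (\<lambda>\<omega>. (S \<omega>)\<^sup>2)" "integrable M S" "expectation S = 0"
    "expectation (\<lambda>\<omega>. (S \<omega>)\<^sup>2) = (\<Sum>i\<in>A. expectation (\<lambda>\<omega>. (X i \<omega>)\<^sup>2))"
    using insert.IH AI by (auto simp: S_def)
  have iv: "indep_var borel (X a) borel S"
    unfolding S_def using insert.hyps indep_vars_subset[OF ind insert.prems]
    by (intro indep_vars_sum) auto
  have pr: "integrable M (\<lambda>\<omega>. X a \<omega> * S \<omega>)" and pr0: "expectation (\<lambda>\<omega>. X a \<omega> * S \<omega>) = 0"
    using indep_var_integrable[OF iv i1[OF aI] S(2)] indep_var_lebesgue_integral[OF iv i1[OF aI] S(2)] S(3) by auto
  have sum: "(\<Sum>i\<in>insert a A. X i \<omega>) = X a \<omega> + S \<omega>" for \<omega>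
    using insert.hyps by (simp add: S_def)
  have sq: "(X a \<omega> + S \<omega>)\<^sup>2 = (X a \<omega>)\<^sup>2 + (S \<omega>)\<^sup>2 + 2 * (X a \<omega> * S \<omega>)" for \<omega>
    by (simp add: power2_eq_square algebra_simps)
  show ?case
    unfolding sum sq using insert.hyps S pr pr0 i1[OF aI] int[OF aI] mean[OF aI] by simp
qed

lemma (in prob_space) Chebyshev_sum_indep:
  fixes X :: "'i \<Rightarrow> 'a \<Rightarrow> real"
  assumes "indep_vars (\<lambda>_. borel) X I" and "finite A" "A \<subseteq> I"
    and "\<And>i. i \<in> I \<Longrightarrow> integrable M (\<lambda>\<omega>. (X i \<omega>)\<^sup>2)"
    and "\<And>i. i \<in> I \<Longrightarrow> expectation (X i) = 0" and t: "0 < t"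
  shows "prob {\<omega>\<in>space M. t \<le> \<bar>\<Sum>i\<in>A. X i \<omega>\<bar>} \<le> (\<Sum>i\<in>A. expectation (\<lambda>\<omega>. (X i \<omega>)\<^sup>2)) / t\<^sup>2"
  using Chebyshev_inequality[of "\<lambda>\<omega>. \<Sum>i\<in>A. X i \<omega>" t] second_moment_sum_indep[OF assms(1-5)] t
  by (simp add: borel_measurable_integrable)

text \<open>\<open>N\<close> replaces the size of \<open>A\<close> so that one bound holds for all
  subsets of a window, as \<open>two_parameter_maximal\<close> requires. The empty sum is treated
  apart because the exponent divides by \<open>card A\<close>.\<close>

lemma (in prob_space) Hoeffding_centered_sum:
  fixes X :: "'i \<Rightarrow> 'a \<Rightarrow> real"
  assumes ind: "indep_vars (\<lambda>_. borel) X I" and A: "finite A" "A \<subseteq> I"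
    and bd: "\<And>i \<omega>. i \<in> I \<Longrightarrow> \<omega> \<in> space M \<Longrightarrow> \<bar>X i \<omega>\<bar> \<le> c"
    and mean: "\<And>i. i \<in> I \<Longrightarrow> expectation (X i) = 0"
    and t: "0 < t" and c: "0 < c" and N: "real (card A) \<le> N" "0 < N"
  shows "prob {\<omega>\<in>space M. t \<le> \<bar>\<Sum>i\<in>A. X i \<omega>\<bar>} \<le> 2 * exp (- t\<^sup>2 / (2 * c\<^sup>2 * N))"
proof (cases "A = {}")
  case True
  then show ?thesis using t by simp
next
  case False
  interpret H: Hoeffding_ineq M A X "\<lambda>_. - c" "\<lambda>_. c" "\<Sum>i\<in>A. expectation (X i)"
    using A bd
    by unfold_locales (auto intro: indep_vars_subset[OF ind] AE_I2 simp: abs_le_iff minus_le_iff)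
  have cA: "0 < real (card A)" using A False by (simp add: card_gt_0_iff)
  have e: "(\<Sum>i\<in>A. (c - - c)\<^sup>2) = 4 * c\<^sup>2 * real (card A)" by (simp add: power2_eq_square)
  have z: "(\<Sum>i\<in>A. expectation (X i)) = 0" using mean A by (intro sum.neutral) auto
  have "prob {\<omega>\<in>space M. t \<le> \<bar>\<Sum>i\<in>A. X i \<omega>\<bar>} \<le> 2 * exp (- 2 * t\<^sup>2 / (4 * c\<^sup>2 * real (card A)))"
    using H.Hoeffding_ineq_abs_ge[of t] t c cA unfolding e z by simp
  also have "- 2 * t\<^sup>2 / (4 * c\<^sup>2 * real (card A)) \<le> - t\<^sup>2 / (2 * c\<^sup>2 * N)"
    using N c cA t by (simp add: field_simps)
  finally show ?thesis by simp
qed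

section \<open>Partial sums of the multipliers\<close>

text \<open>When \<open>r\<close> and \<open>s\<close> are ranks counted from 0, this is the set of
  observations lying at or below both marginal empirical quantiles at \<open>u\<close>, see
  \<open>le_gen_inv_iff_rank\<close>; hence the strict inequalities. Keeping \<open>r\<close> and
  \<open>s\<close> arbitrary yields bounds that are uniform over the data.\<close>

definition below :: "nat \<Rightarrow> (nat \<Rightarrow> nat) \<Rightarrow> (nat \<Rightarrow> nat) \<Rightarrow> real \<times> real \<Rightarrow> nat set" where
  "below n r s u = {i. i < n \<and> real (r i) < real n * fst u \<and> real (s i) < real n * snd u}"

lemma below_subset: "below n r s u \<subseteq> {..<n}" by (auto simp: below_def)

lemma finite_below [simp]: "finite (below n r s u)"
  by (rule finite_subset[OF below_subset]) auto

lemma real_less_iff_nat_ceiling: "real k < x \<longleftrightarrow> k < nat \<lceil>x\<rceil>"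
  by (metis less_ceiling_iff of_int_of_nat_eq zless_nat_eq_int_zless)

lemma below_eq_ranks:
  "below n r s u = {i\<in>{..<n}. r i < nat \<lceil>real n * fst u\<rceil> \<and> s i < nat \<lceil>real n * snd u\<rceil>}"
  unfolding below_def real_less_iff_nat_ceiling by auto

lemma nat_ceiling_le: "x \<le> 1 \<Longrightarrow> nat \<lceil>real n * x\<rceil> \<le> n"
  by (metis ceiling_mono ceiling_of_nat mult.right_neutral mult_left_mono nat_int nat_mono of_nat_0_le_iff)

lemma below_swap: "below n s r (prod.swap u) = below n r s u"
  by (auto simp: below_def)

text \<open>Distinct ranks are distinct integers, and a half-open interval contains at most its
  length plus one of these.\<close>

lemma card_rank_window:
  assumes "inj_on r {..<n}" "a \<le> b"
  shows "real (card {i\<in>{..<n}. a \<le> real (r i) \<and> real (r i) < b}) \<le> b - a + 1"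
proof -
  have "card {i\<in>{..<n}. a \<le> real (r i) \<and> real (r i) < b} \<le> card {nat \<lceil>a\<rceil>..<nat \<lceil>b\<rceil>}"
  proof (rule card_inj_on_le)
    show "inj_on r {i\<in>{..<n}. a \<le> real (r i) \<and> real (r i) < b}"
      using assms(1) by (rule inj_on_subset) auto
    show "r ` {i\<in>{..<n}. a \<le> real (r i) \<and> real (r i) < b} \<subseteq> {nat \<lceil>a\<rceil>..<nat \<lceil>b\<rceil>}"
      by (auto simp: real_less_iff_nat_ceiling nat_le_iff ceiling_le_iff)
  qed auto
  then have "real (card {i\<in>{..<n}. a \<le> real (r i) \<and> real (r i) < b}) \<le> real (nat \<lceil>b\<rceil> - nat \<lceil>a\<rceil>)" by simp
  also have "\<dots> \<le> b - a + 1"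
  proof (cases "nat \<lceil>a\<rceil> \<le> nat \<lceil>b\<rceil>")
    case True
    show ?thesis
    proof (cases "0 \<le> \<lceil>b\<rceil>")
      case True
      have "real (nat \<lceil>b\<rceil> - nat \<lceil>a\<rceil>) = real (nat \<lceil>b\<rceil>) - real (nat \<lceil>a\<rceil>)" using \<open>nat \<lceil>a\<rceil> \<le> nat \<lceil>b\<rceil>\<close> by simp
      moreover have "real (nat \<lceil>b\<rceil>) \<le> b + 1" using True by linarith
      moreover have "a \<le> real (nat \<lceil>a\<rceil>)" by linarith
      ultimately show ?thesis by linarith
    qed (use assms in auto)
  next
    case False
    then show ?thesis using nat_mono[OF ceiling_mono[OF assms(2)]] by blast
  qed
  finally show ?thesis .
qed

locale multiplier_law =
  fixes \<mu> :: "real measure"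
  assumes prob_\<mu>: "prob_space \<mu>" and sets_\<mu> [measurable_cong]: "sets \<mu> = sets borel"
    and int_id: "integrable \<mu> (\<lambda>x. x)" and int_sq: "integrable \<mu> (\<lambda>x. x\<^sup>2)"
    and mean_1: "(LINT x|\<mu>. x) = 1" and var_1: "(LINT x|\<mu>. (x - 1)\<^sup>2) = 1"
begin

sublocale prob_space \<mu> by (rule prob_\<mu>)

text \<open>The law of the multipliers alone. With the data held fixed, probabilities are computed
  here; \<open>sample_law\<close> and \<open>joint_event\<close> carry them back to the original
  space.\<close>

definition W :: "nat \<Rightarrow> (nat \<Rightarrow> real) measure" where
  "W n = PiM {..<n} (\<lambda>_. \<mu>)"

lemma space_\<mu> [simp]: "space \<mu> = UNIV" using sets_eq_imp_space_eq[OF sets_\<mu>] by simp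

lemma prob_space_W: "prob_space (W n)"
  unfolding W_def by (rule prob_space_PiM) (rule prob_\<mu>)

lemma measurable_coordinate: "i < n \<Longrightarrow> (\<lambda>w. w i) \<in> measurable (W n) \<mu>"
  unfolding W_def by (rule measurable_component_singleton) auto

lemma coordinate_borel [measurable (raw)]: "i < n \<Longrightarrow> (\<lambda>w. w i) \<in> borel_measurable (W n)"
  using measurable_coordinate sets_\<mu> measurable_cong_sets by blast

lemma distr_coordinate: "i < n \<Longrightarrow> distr (W n) \<mu> (\<lambda>w. w i) = \<mu>"
  unfolding W_def by (rule distr_PiM_component) (use prob_\<mu> in auto)

lemma integral_coordinate:
  fixes f :: "real \<Rightarrow> 'b::{banach, second_countable_topology}"
  assumes "i < n" "f \<in> borel_measurable borel"
  shows "(LINT w|W n. f (w i)) = (LINT x|\<mu>. f x)"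
    "integrable (W n) (\<lambda>w. f (w i)) = integrable \<mu> f"
proof -
  have f: "f \<in> borel_measurable \<mu>" using assms(2) by measurable
  show "(LINT w|W n. f (w i)) = (LINT x|\<mu>. f x)"
    using integral_distr[OF measurable_coordinate[OF assms(1)] f] distr_coordinate[OF assms(1)] by simp
  show "integrable (W n) (\<lambda>w. f (w i)) = integrable \<mu> f"
    using integrable_distr_eq[OF measurable_coordinate[OF assms(1)] f] distr_coordinate[OF assms(1)] by simp
qed

lemma indep_coordinates:
  fixes f :: "nat \<Rightarrow> real \<Rightarrow> real"
  assumes "\<And>i. f i \<in> borel_measurable borel"
  shows "prob_space.indep_vars (W n) (\<lambda>_. borel) (\<lambda>i w. f i (w i)) {..<n}"
proof -
  interpret Wn: prob_space "W n" by (rule prob_space_W)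
  have "Wn.indep_vars (\<lambda>_. \<mu>) (\<lambda>i w. w i) {..<n}"
  \<comment> \<open>The criterion by product measures applies to nonempty index sets only.\<close>
  proof (cases "n = 0")
    case True
    then show ?thesis unfolding Wn.indep_vars_def Wn.indep_sets_def by auto
  next
    case False
    then have "{..<n} \<noteq> {}" by auto
    then show ?thesis
    proof (subst Wn.indep_vars_iff_distr_eq_PiM')
      have "distr (W n) (PiM {..<n} (\<lambda>_. \<mu>)) (\<lambda>w. \<lambda>i\<in>{..<n}. w i) = distr (W n) (W n) (\<lambda>w. w)"
        unfolding W_def by (intro distr_cong) (auto simp: space_PiM PiE_def extensional_def)
      also have "\<dots> = PiM {..<n} (\<lambda>i. distr (W n) \<mu> (\<lambda>w. w i))"
        unfolding distr_id2[OF refl] unfolding W_def by (rule PiM_cong) (auto simp: distr_coordinate[unfolded W_def])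
      finally show "distr (W n) (PiM {..<n} (\<lambda>_. \<mu>)) (\<lambda>w. \<lambda>i\<in>{..<n}. w i) = PiM {..<n} (\<lambda>i. distr (W n) \<mu> (\<lambda>w. w i))" .
    qed (auto intro: measurable_coordinate)
  qed
  then show ?thesis
    by (rule Wn.indep_vars_compose2) (use assms in measurable)
qed

text \<open>The rankings do not enter the bound, which makes it uniform over the data. The constant
  18 is 9 from the two runs of Etemadi's inequality times 2 from the two-sided Hoeffding bound. The
  exponent depends on the window through \<open>N\<close> only, so short windows have small
  probabilities.\<close>

lemma maximal_bounded:
  fixes f :: "real \<Rightarrow> real" and r s :: "nat \<Rightarrow> nat"
  assumes f: "f \<in> borel_measurable borel" and mean: "(LINT x|\<mu>. f x) = 0" and bd: "\<And>x. \<bar>f x\<bar> \<le> c"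
    and c: "0 < c" and t: "0 < t" and J: "J \<subseteq> {..<n}" and N: "real (card J) \<le> N" "0 < N"
  shows "measure (W n) {w\<in>space (W n). \<exists>k\<le>m. \<exists>l\<le>m. 9 * t \<le> \<bar>\<Sum>i\<in>{i\<in>J. r i < k \<and> s i < l}. f (w i)\<bar>}
    \<le> 18 * exp (- t\<^sup>2 / (2 * c\<^sup>2 * N))"
proof -
  interpret Wn: prob_space "W n" by (rule prob_space_W)
  have ind: "Wn.indep_vars (\<lambda>_. borel) (\<lambda>i w. f (w i)) {..<n}" using indep_coordinates[of "\<lambda>_. f"] f by simp
  have finJ: "finite J" using J finite_subset by blast
  have "measure (W n) {w\<in>space (W n). \<exists>k\<le>m. \<exists>l\<le>m. 9 * t \<le> \<bar>\<Sum>i\<in>{i\<in>J. r i < k \<and> s i < l}. f (w i)\<bar>}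
     \<le> 9 * (2 * exp (- t\<^sup>2 / (2 * c\<^sup>2 * N)))"
  proof (rule Wn.two_parameter_maximal[OF Wn.indep_vars_subset[OF ind J] finJ t])
    fix A assume A: "A \<subseteq> J"
    have cA: "real (card A) \<le> N" using card_mono[OF finJ A] N by linarith
    show "Wn.prob {\<omega> \<in> space (W n). t \<le> \<bar>\<Sum>i\<in>A. f (\<omega> i)\<bar>} \<le> 2 * exp (- t\<^sup>2 / (2 * c\<^sup>2 * N))"
      by (rule Wn.Hoeffding_centered_sum[OF ind _ _ _ _ t c cA N(2)])
        (use A J finJ bd in \<open>auto intro: finite_subset simp: integral_coordinate f mean\<close>)
  qed
  then show ?thesis by simp
qed

lemma maximal_square_integrable:
  fixes f :: "real \<Rightarrow> real" and r s :: "nat \<Rightarrow> nat"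
  assumes f: "f \<in> borel_measurable borel" and mean: "(LINT x|\<mu>. f x) = 0" and sq: "integrable \<mu> (\<lambda>x. (f x)\<^sup>2)"
    and t: "0 < t" and J: "J \<subseteq> {..<n}"
  shows "measure (W n) {w\<in>space (W n). \<exists>k\<le>m. \<exists>l\<le>m. 9 * t \<le> \<bar>\<Sum>i\<in>{i\<in>J. r i < k \<and> s i < l}. f (w i)\<bar>}
    \<le> 9 * (real n * (LINT x|\<mu>. (f x)\<^sup>2) / t\<^sup>2)"
proof -
  interpret Wn: prob_space "W n" by (rule prob_space_W)
  have ind: "Wn.indep_vars (\<lambda>_. borel) (\<lambda>i w. f (w i)) {..<n}" using indep_coordinates[of "\<lambda>_. f"] f by simp
  have finJ: "finite J" using J finite_subset by blast
  have f2: "(\<lambda>x. (f x)\<^sup>2) \<in> borel_measurable borel" using f by measurable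
  show ?thesis
  proof (rule Wn.two_parameter_maximal[OF Wn.indep_vars_subset[OF ind J] finJ t])
    fix A assume A: "A \<subseteq> J"
    then have An: "A \<subseteq> {..<n}" "finite A" using J finJ finite_subset by auto
    have cA: "card A \<le> n" using card_mono[OF _ An(1)] by simp
    have "Wn.prob {\<omega> \<in> space (W n). t \<le> \<bar>\<Sum>i\<in>A. f (\<omega> i)\<bar>} \<le> (\<Sum>i\<in>A. LINT w|W n. (f (w i))\<^sup>2) / t\<^sup>2"
      by (rule Wn.Chebyshev_sum_indep[OF ind An(2,1) _ _ t])
        (use sq in \<open>auto simp: integral_coordinate[OF _ f] integral_coordinate[OF _ f2] mean\<close>)
    also have "(\<Sum>i\<in>A. LINT w|W n. (f (w i))\<^sup>2) = (\<Sum>i\<in>A. LINT x|\<mu>. (f x)\<^sup>2)"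
      using An by (intro sum.cong refl integral_coordinate[OF _ f2]) auto
    also have "\<dots> = real (card A) * (LINT x|\<mu>. (f x)\<^sup>2)" by simp
    also have "\<dots> / t\<^sup>2 \<le> real n * (LINT x|\<mu>. (f x)\<^sup>2) / t\<^sup>2"
      using cA by (intro divide_right_mono mult_right_mono) auto
    finally show "Wn.prob {\<omega> \<in> space (W n). t \<le> \<bar>\<Sum>i\<in>A. f (\<omega> i)\<bar>} \<le> real n * (LINT x|\<mu>. (f x)\<^sup>2) / t\<^sup>2" .
  qed
qed

lemma maximal_event_measurable:
  fixes r s :: "nat \<Rightarrow> nat"
  assumes f: "f \<in> borel_measurable borel" and J: "J \<subseteq> {..<n}"
  shows "{w\<in>space (W n). \<exists>k\<le>m. \<exists>l\<le>m. t \<le> \<bar>\<Sum>i\<in>{i\<in>J. r i < k \<and> s i < l}. f (w i) :: real\<bar>} \<in> sets (W n)"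
proof -
  have 1: "(\<lambda>w. \<Sum>i\<in>{i\<in>J. r i < k \<and> s i < l}. f (w i)) \<in> borel_measurable (W n)" for k l :: nat
    by (intro borel_measurable_sum measurable_compose[OF coordinate_borel f]) (use J in auto)
  have "{w\<in>space (W n). \<exists>k\<le>m. \<exists>l\<le>m. t \<le> \<bar>\<Sum>i\<in>{i\<in>J. r i < k \<and> s i < l}. f (w i)\<bar>} =
     (\<Union>k\<le>m. \<Union>l\<le>m. {w\<in>space (W n). t \<le> \<bar>\<Sum>i\<in>{i\<in>J. r i < k \<and> s i < l}. f (w i)\<bar>})" by auto
  also have "\<dots> \<in> sets (W n)"
    by (intro sets.finite_UN) (use 1 in auto)
  finally show ?thesis .
qed

text \<open>Although \<open>u\<close> ranges over a continuum, the sum depends on it only through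
  two integers between 0 and \<open>n\<close>, so a single measurable exceptional set serves all
  \<open>u\<close>. Scaling the level with \<open>sqrt (real n)\<close> makes the bound free of
  \<open>n\<close>.\<close>

lemma uniform_bound_below:
  fixes f :: "real \<Rightarrow> real" and r s :: "nat \<Rightarrow> nat"
  assumes f: "f \<in> borel_measurable borel" and mean: "(LINT x|\<mu>. f x) = 0" and sq: "integrable \<mu> (\<lambda>x. (f x)\<^sup>2)"
    and t: "0 < t" and n: "1 \<le> n"
  shows "\<exists>E\<in>sets (W n). measure (W n) E \<le> 9 * (LINT x|\<mu>. (f x)\<^sup>2) / t\<^sup>2 \<and>
    (\<forall>w\<in>space (W n) - E. \<forall>u\<in>unit_square. \<bar>\<Sum>i\<in>below n r s u. f (w i)\<bar> < 9 * t * sqrt (real n))"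
proof -
  define E where "E = {w\<in>space (W n). \<exists>k\<le>n. \<exists>l\<le>n. 9 * (t * sqrt (real n)) \<le> \<bar>\<Sum>i\<in>{i\<in>{..<n}. r i < k \<and> s i < l}. f (w i)\<bar>}"
  have tn: "0 < t * sqrt (real n)" using t n by simp
  have "E \<in> sets (W n)" unfolding E_def by (rule maximal_event_measurable[OF f]) auto
  moreover have "measure (W n) E \<le> 9 * (real n * (LINT x|\<mu>. (f x)\<^sup>2) / (t * sqrt (real n))\<^sup>2)"
    unfolding E_def by (rule maximal_square_integrable[OF f mean sq tn]) auto
  moreover have "9 * (real n * (LINT x|\<mu>. (f x)\<^sup>2) / (t * sqrt (real n))\<^sup>2) = 9 * (LINT x|\<mu>. (f x)\<^sup>2) / t\<^sup>2"
    using n t by (simp add: power_mult_distrib field_simps)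
  moreover have "\<bar>\<Sum>i\<in>below n r s u. f (w i)\<bar> < 9 * t * sqrt (real n)" if "w \<in> space (W n) - E" "u \<in> unit_square" for w u
  proof -
    have "nat \<lceil>real n * fst u\<rceil> \<le> n" "nat \<lceil>real n * snd u\<rceil> \<le> n"
      using that(2) by (intro nat_ceiling_le; auto simp: unit_square_def)+
    moreover have "\<forall>k\<le>n. \<forall>l\<le>n. \<bar>\<Sum>i\<in>{i\<in>{..<n}. r i < k \<and> s i < l}. f (w i)\<bar> < 9 * (t * sqrt (real n))"
    proof (intro allI impI, rule ccontr)
      fix k l assume "k \<le> n" "l \<le> n" "\<not> \<bar>\<Sum>i\<in>{i\<in>{..<n}. r i < k \<and> s i < l}. f (w i)\<bar> < 9 * (t * sqrt (real n))"
      then have "w \<in> E" using that(1) unfolding E_def not_less by blast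
      then show False using that(1) by blast
    qed
    ultimately show ?thesis unfolding below_eq_ranks mult.assoc by blast
  qed
  ultimately show ?thesis by metis
qed

text \<open>The windows \<open>q/m \<le> r i / n < (q+2)/m\<close> contain at most \<open>3n/m\<close> indices, and any \<open>a, b\<close> with
  \<open>\<bar>a - b\<bar> \<le> 1/m\<close> lie in a common window.\<close>

lemma increments_bounded:
  fixes f :: "real \<Rightarrow> real" and r s :: "nat \<Rightarrow> nat"
  assumes f: "f \<in> borel_measurable borel" and mean: "(LINT x|\<mu>. f x) = 0" and bd: "\<And>x. \<bar>f x\<bar> \<le> c"
    and c: "0 < c" and t: "0 < t" and m: "1 \<le> m" and n: "m \<le> n" and inj: "inj_on r {..<n}"
  shows "\<exists>E\<in>sets (W n). measure (W n) E \<le> real (m + 1) * (18 * exp (- t\<^sup>2 * real m / (6 * c\<^sup>2))) \<and>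
    (\<forall>w\<in>space (W n) - E. \<forall>a\<in>{0..1}. \<forall>b\<in>{0..1}. \<forall>d\<in>{0..1}. \<bar>a - b\<bar> \<le> 1 / real m \<longrightarrow>
      \<bar>(\<Sum>i\<in>below n r s (a, d). f (w i)) - (\<Sum>i\<in>below n r s (b, d). f (w i))\<bar> \<le> 18 * t * sqrt (real n))"
proof -
  interpret Wn: prob_space "W n" by (rule prob_space_W)
  define J where "J q = {i\<in>{..<n}. real n * (real q / m) \<le> real (r i) \<and> real (r i) < real n * ((real q + 2) / m)}" for q
  define tn where "tn = t * sqrt (real n)"
  define E where "E q = {w\<in>space (W n). \<exists>k\<le>n. \<exists>l\<le>n. 9 * tn \<le> \<bar>\<Sum>i\<in>{i\<in>J q. r i < k \<and> s i < l}. f (w i)\<bar>}" for q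
  have n0: "0 < real n" "0 < real m" using n m by auto
  have tn: "0 < tn" using t n0 by (simp add: tn_def)
  have JI: "J q \<subseteq> {..<n}" for q by (auto simp: J_def)
  have cJ: "real (card (J q)) \<le> 3 * real n / m" for q
  proof -
    have "real (card (J q)) \<le> real n * ((real q + 2) / m) - real n * (real q / m) + 1"
      unfolding J_def using n0 by (intro card_rank_window[OF inj]) (auto intro!: divide_right_mono)
    also have "\<dots> = 2 * real n / m + 1" by (simp add: field_simps add_divide_distrib)
    \<comment> \<open>The rounding term 1 is at most \<open>real n / m\<close> because
      \<open>m \<le> n\<close>.\<close>
    also have "\<dots> \<le> 3 * real n / m" using n n0 by (simp add: divide_simps)
    finally show ?thesis .
  qed
  have Em: "E q \<in> sets (W n)" for q unfolding E_def by (rule maximal_event_measurable[OF f JI])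
  have Eq: "measure (W n) (E q) \<le> 18 * exp (- t\<^sup>2 * real m / (6 * c\<^sup>2))" for q
  proof -
    have "measure (W n) (E q) \<le> 18 * exp (- tn\<^sup>2 / (2 * c\<^sup>2 * (3 * real n / m)))"
      unfolding E_def using n0 by (intro maximal_bounded[OF f mean bd c tn JI cJ]) auto
    also have "- tn\<^sup>2 / (2 * c\<^sup>2 * (3 * real n / m)) = - t\<^sup>2 * real m / (6 * c\<^sup>2)"
      using n0 c by (simp add: tn_def power_mult_distrib field_simps)
    finally show ?thesis .
  qed
  have "measure (W n) (\<Union>q\<le>m. E q) \<le> (\<Sum>q\<le>m. measure (W n) (E q))"
    using Em by (intro Wn.finite_measure_subadditive_finite) auto
  also have "\<dots> \<le> (\<Sum>q\<le>m. 18 * exp (- t\<^sup>2 * real m / (6 * c\<^sup>2)))" by (intro sum_mono Eq)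
  also have "\<dots> = real (m + 1) * (18 * exp (- t\<^sup>2 * real m / (6 * c\<^sup>2)))" by simp
  finally have me: "measure (W n) (\<Union>q\<le>m. E q) \<le> real (m + 1) * (18 * exp (- t\<^sup>2 * real m / (6 * c\<^sup>2)))" .
  have incr: "\<bar>(\<Sum>i\<in>below n r s (a, d). f (w i)) - (\<Sum>i\<in>below n r s (b, d). f (w i))\<bar> \<le> 18 * t * sqrt (real n)"
    if w: "w \<in> space (W n) - (\<Union>q\<le>m. E q)" and ab: "a \<in> {0..1}" "b \<in> {0..1}" "d \<in> {0..1}" "\<bar>a - b\<bar> \<le> 1 / real m" for w a b d
  proof -
    \<comment> \<open>The window begins at the multiple of 1/m just below the smaller of
      \<open>a\<close> and \<open>b\<close>. The larger one is at most 1/m above the smaller, so two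
      mesh widths contain both.\<close>
    define q where "q = nat \<lfloor>m * min a b\<rfloor>"
    have mm: "0 \<le> m * min a b" "m * min a b \<le> m" using ab n0 by (auto simp: min_def)
    have q: "real q \<le> m * min a b" "m * min a b < real q + 1" "q \<le> m" using mm unfolding q_def by linarith+
    have q1: "real q / m \<le> min a b" using q(1) n0 by (metis mult.commute pos_divide_le_eq)
    have "m * max a b \<le> m * min a b + 1"
    proof -
      have "max a b \<le> min a b + 1 / real m" using ab by linarith
      then have "m * max a b \<le> m * (min a b + 1 / real m)" using n0 by (intro mult_left_mono) auto
      then show ?thesis using n0 by (simp add: distrib_left)
    qed
    then have "m * max a b \<le> real q + 2" using q(2) by linarith
    then have q2: "max a b \<le> (real q + 2) / m" using n0 by (metis mult.commute pos_le_divide_eq)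
    \<comment> \<open>Indices left of the window occur in both sums and cancel in the difference.
      What remains are two sums inside the window, each below \<open>9 * tn\<close>.\<close>
    define base where "base = {i\<in>{..<n}. real (r i) < real n * (real q / m) \<and> real (s i) < real n * d}"
    have dec: "(\<Sum>i\<in>below n r s (x, d). f (w i)) = (\<Sum>i\<in>base. f (w i)) +
        (\<Sum>i\<in>{i\<in>J q. r i < nat \<lceil>real n * x\<rceil> \<and> s i < nat \<lceil>real n * d\<rceil>}. f (w i))"
      if "real q / m \<le> x" "x \<le> (real q + 2) / m" for x
    proof -
      have "real n * (real q / m) \<le> real n * x" "real n * x \<le> real n * ((real q + 2) / m)"
        using mult_left_mono[OF that(1), of "real n"] mult_left_mono[OF that(2), of "real n"] n0 by auto
      then have "below n r s (x, d) = base \<union> {i\<in>J q. r i < nat \<lceil>real n * x\<rceil> \<and> s i < nat \<lceil>real n * d\<rceil>}"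
        unfolding below_def base_def J_def real_less_iff_nat_ceiling[symmetric] by auto
      moreover have "base \<inter> {i\<in>J q. r i < nat \<lceil>real n * x\<rceil> \<and> s i < nat \<lceil>real n * d\<rceil>} = {}"
        unfolding base_def J_def by auto
      ultimately show ?thesis
        using finite_subset[OF JI] by (simp add: sum.union_disjoint base_def)
    qed
    have small: "\<bar>\<Sum>i\<in>{i\<in>J q. r i < nat \<lceil>real n * x\<rceil> \<and> s i < nat \<lceil>real n * d\<rceil>}. f (w i)\<bar> < 9 * tn" if "x \<le> 1" for x
    proof -
      have "w \<notin> E q" using w q by auto
      moreover have "nat \<lceil>real n * x\<rceil> \<le> n" "nat \<lceil>real n * d\<rceil> \<le> n" using that ab by (intro nat_ceiling_le; simp)+
      ultimately show ?thesis using w unfolding E_def mem_Collect_eq not_less[symmetric] by blast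
    qed
    have "real q / m \<le> a" "a \<le> (real q + 2) / m" "real q / m \<le> b" "b \<le> (real q + 2) / m" "a \<le> 1" "b \<le> 1"
      using q1 q2 ab by auto
    note d = dec[OF this(1,2)] dec[OF this(3,4)] small[OF this(5)] small[OF this(6)]
    have "18 * t * sqrt (real n) = 18 * tn" by (simp add: tn_def)
    then show ?thesis using d by linarith
  qed
  show ?thesis
    using me incr Em by (intro bexI[of _ "\<Union>q\<le>m. E q"]) auto
qed

end

section \<open>Boundedness and equicontinuity of the normalised partial sums\<close>

definition mult_partial_sum ::
  "nat \<Rightarrow> (nat \<Rightarrow> nat) \<Rightarrow> (nat \<Rightarrow> nat) \<Rightarrow> (nat \<Rightarrow> real) \<Rightarrow> real \<times> real \<Rightarrow> real" where
  "mult_partial_sum n r s w u = (\<Sum>i\<in>below n r s u. w i - 1) / sqrt (real n)"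

context multiplier_law
begin

lemma prob_UNIV [simp]: "prob UNIV = 1"
  using prob_space by simp

lemma centered: "(LINT x|\<mu>. x - 1) = 0" "integrable \<mu> (\<lambda>x. x - 1)" "integrable \<mu> (\<lambda>x. (x - 1)\<^sup>2)"
  using int_id int_sq mean_1 by (auto simp: prob_space power2_diff)

lemma mult_partial_sum_bounded:
  assumes t: "0 < t" and n: "1 \<le> n"
  shows "\<exists>E\<in>sets (W n). measure (W n) E \<le> 9 / t\<^sup>2 \<and>
    (\<forall>w\<in>space (W n) - E. \<forall>u\<in>unit_square. \<bar>mult_partial_sum n r s w u\<bar> < 9 * t)"
proof -
  obtain E where "E\<in>sets (W n)" "measure (W n) E \<le> 9 * (LINT x|\<mu>. (x - 1)\<^sup>2) / t\<^sup>2"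
    and E: "\<And>w u. w \<in> space (W n) - E \<Longrightarrow> u \<in> unit_square \<Longrightarrow> \<bar>\<Sum>i\<in>below n r s u. w i - 1\<bar> < 9 * t * sqrt (real n)"
    using uniform_bound_below[of "\<lambda>x. x - 1" t n r s] t n centered by auto
  moreover have "\<bar>mult_partial_sum n r s w u\<bar> < 9 * t" if "w \<in> space (W n) - E" "u \<in> unit_square" for w u
    using E[OF that] n by (simp add: mult_partial_sum_def pos_divide_less_eq)
  ultimately show ?thesis using var_1 by auto
qed

text \<open>Truncation: the bounded part of a multiplier obeys Hoeffding's inequality, the rest has small
  variance.\<close>

lemma truncation:
  assumes "0 < \<tau>"
  shows "\<exists>f g c. f \<in> borel_measurable borel \<and> g \<in> borel_measurable borel \<and> (0::real) < c \<and>
    (\<forall>x. \<bar>f x\<bar> \<le> c) \<and> (\<forall>x. x - 1 = f x + g x) \<and> (LINT x|\<mu>. f x) = 0 \<and> (LINT x|\<mu>. g x) = 0 \<and>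
    integrable \<mu> (\<lambda>x. (g x)\<^sup>2) \<and> (LINT x|\<mu>. (g x)\<^sup>2) \<le> \<tau>"
proof -
  \<comment> \<open>The tail of \<open>x\<close> beyond level \<open>k\<close>; its second moment
    tends to 0 by dominated convergence. It still has to be centred, since both tail bounds are for
    mean-zero variables.\<close>
  define h where "h k x = (if real k < \<bar>x\<bar> then x else 0)" for k :: nat and x :: real
  have hm [measurable]: "h k \<in> borel_measurable borel" for k unfolding h_def by measurable
  have h0: "(\<lambda>k. h k x) \<longlonglongrightarrow> 0" for x
  proof (rule tendsto_eventually)
    obtain K :: nat where "\<bar>x\<bar> \<le> real K" using real_arch_simple by blast
    then show "\<forall>\<^sub>F k in sequentially. h k x = 0"
      unfolding h_def by (intro eventually_sequentiallyI[of K]) auto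
  qed
  have "(\<lambda>k. LINT x|\<mu>. (h k x)\<^sup>2) \<longlonglongrightarrow> (LINT x|\<mu>. 0)"
  proof (rule integral_dominated_convergence[where w = "\<lambda>x. x\<^sup>2"])
    show "AE x in \<mu>. (\<lambda>k. (h k x)\<^sup>2) \<longlonglongrightarrow> 0"
    proof (rule AE_I2)
      fix x show "(\<lambda>k. (h k x)\<^sup>2) \<longlonglongrightarrow> 0" using tendsto_power[OF h0, of x 2] by simp
    qed
  qed (use int_sq in \<open>auto simp: h_def\<close>)
  then have "\<forall>\<^sub>F k in sequentially. (LINT x|\<mu>. (h k x)\<^sup>2) < \<tau>"
    using assms by (intro order_tendstoD(2)) auto
  then obtain k where "(LINT x|\<mu>. (h k x)\<^sup>2) < \<tau>"
    by (auto simp: eventually_sequentially)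
  then have k: "(LINT x|\<mu>. (h k x)\<^sup>2) \<le> \<tau>" by simp
  have hsq: "integrable \<mu> (\<lambda>x. (h k x)\<^sup>2)"
    by (rule Bochner_Integration.integrable_bound[OF int_sq]) (auto simp: h_def)
  have hi: "integrable \<mu> (h k)"
    by (rule Bochner_Integration.integrable_bound[OF int_id]) (auto simp: h_def)
  define g where "g x = h k x - expectation (h k)" for x
  define f where "f x = x - 1 - g x" for x
  have gm: "g \<in> borel_measurable borel" unfolding g_def by measurable
  have fm: "f \<in> borel_measurable borel" unfolding f_def using gm by measurable
  have gi: "integrable \<mu> g" "expectation g = 0" using hi by (auto simp: g_def[abs_def] prob_space)
  have fi: "expectation f = 0" using centered gi by (simp add: f_def[abs_def])
  have g2: "integrable \<mu> (\<lambda>x. (g x)\<^sup>2)" using hsq hi by (simp add: g_def power2_diff)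
  \<comment> \<open>Centring can only lower the second moment of the tail.\<close>
  have "expectation (\<lambda>x. (g x)\<^sup>2) = expectation (\<lambda>x. (h k x)\<^sup>2) - (expectation (h k))\<^sup>2"
    using variance_eq[OF hi hsq] by (simp add: g_def)
  then have "expectation (\<lambda>x. (g x)\<^sup>2) \<le> \<tau>" using k by (smt (verit) zero_le_power2)
  moreover have "\<bar>f x\<bar> \<le> real k + 1 + \<bar>expectation (h k)\<bar>" for x
    by (auto simp: f_def g_def h_def)
  moreover have "x - 1 = f x + g x" for x by (simp add: f_def)
  moreover have "0 < real k + 1 + \<bar>expectation (h k)\<bar>" by linarith
  ultimately show ?thesis using gm fm gi fi g2 by blast
qed

text \<open>The linear factor is the number of windows in the union bound. Because the exponential
  wins, the mesh can be fixed before the sample size.\<close>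

lemma window_probability_tendsto_0:
  fixes a :: real assumes "0 < a"
  shows "(\<lambda>m. real (m + 1) * (18 * exp (- a * real m))) \<longlonglongrightarrow> 0"
proof -
  have "exp (- a) < 1" using assms by simp
  then have "(\<lambda>m. 18 * (real m * exp (- a) ^ m) + 18 * exp (- a) ^ m) \<longlonglongrightarrow> 18 * 0 + 18 * 0"
    by (intro tendsto_intros powser_times_n_limit_0 LIMSEQ_power_zero) auto
  moreover have "exp (- a * real m) = exp (- a) ^ m" for m
    by (metis exp_of_nat_mult mult.commute)
  ultimately show ?thesis by (simp add: algebra_simps)
qed

text \<open>The two coordinates are moved one after the other. \<open>increments_bounded\<close>
  handles the first; \<open>below_swap\<close> turns a move of the second into a move of the first
  with the rankings exchanged. Only the bounded part is treated by increments, the remainder is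
  small everywhere.\<close>

lemma mult_partial_sum_equicontinuous:
  assumes e: "0 < \<epsilon>"
  shows "\<exists>\<delta>>0. \<exists>n0. \<forall>n\<ge>n0. \<forall>r s. inj_on r {..<n} \<longrightarrow> inj_on s {..<n} \<longrightarrow>
    (\<exists>E\<in>sets (W n). measure (W n) E \<le> \<epsilon> \<and> (\<forall>w\<in>space (W n) - E. \<forall>u\<in>unit_square. \<forall>v\<in>unit_square.
       \<bar>fst u - fst v\<bar> \<le> \<delta> \<longrightarrow> \<bar>snd u - snd v\<bar> \<le> \<delta> \<longrightarrow>
       \<bar>mult_partial_sum n r s w u - mult_partial_sum n r s w v\<bar> \<le> \<epsilon>))"
proof -
  \<comment> \<open>Two increments of the bounded part cost \<open>18 * t\<close> each and two
    values of the remainder \<open>9 * t\<close> each; the total \<open>54 * t\<close> is below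
    \<open>\<epsilon>\<close>.\<close>
  define t where "t = \<epsilon> / 72"
  have t: "0 < t" using e by (simp add: t_def)
  \<comment> \<open>With this variance of the remainder, the bound 9 times the variance over
    \<open>t\<close> squared in \<open>uniform_bound_below\<close> equals
    \<open>\<epsilon> / 3\<close>, the share of one of three exceptional sets.\<close>
  obtain f g c where fg: "f \<in> borel_measurable borel" "g \<in> borel_measurable borel" "0 < c"
    "\<And>x. \<bar>f x\<bar> \<le> c" "\<And>x. x - 1 = f x + g x" "(LINT x|\<mu>. f x) = 0" "(LINT x|\<mu>. g x) = 0"
    "integrable \<mu> (\<lambda>x. (g x)\<^sup>2)" "(LINT x|\<mu>. (g x)\<^sup>2) \<le> \<epsilon> * t\<^sup>2 / 27"
    using truncation[of "\<epsilon> * t\<^sup>2 / 27"] e t by auto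
  obtain m :: nat where m: "1 \<le> m" and mp: "real (m + 1) * (18 * exp (- t\<^sup>2 * real m / (6 * c\<^sup>2))) \<le> \<epsilon> / 3"
  proof -
    have "0 < t\<^sup>2 / (6 * c\<^sup>2)" using t fg(3) by simp
    then have "\<forall>\<^sub>F m in sequentially. real (m + 1) * (18 * exp (- (t\<^sup>2 / (6 * c\<^sup>2)) * real m)) < \<epsilon> / 3"
      using e by (intro order_tendstoD(2)[OF window_probability_tendsto_0]) auto
    then obtain N where N: "\<And>m. m \<ge> N \<Longrightarrow> real (m + 1) * (18 * exp (- (t\<^sup>2 / (6 * c\<^sup>2)) * real m)) < \<epsilon> / 3"
      by (auto simp: eventually_sequentially)
    show ?thesis using N[of "max 1 N"] by (intro that[of "max 1 N"]) (simp_all add: less_imp_le)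
  qed
  have main: "\<exists>E\<in>sets (W n). measure (W n) E \<le> \<epsilon> \<and> (\<forall>w\<in>space (W n) - E. \<forall>u\<in>unit_square. \<forall>v\<in>unit_square.
       \<bar>fst u - fst v\<bar> \<le> 1 / real m \<longrightarrow> \<bar>snd u - snd v\<bar> \<le> 1 / real m \<longrightarrow>
       \<bar>mult_partial_sum n r s w u - mult_partial_sum n r s w v\<bar> \<le> \<epsilon>)"
    if n: "m \<le> n" and inj: "inj_on r {..<n}" "inj_on s {..<n}" for n r s
  proof -
    interpret Wn: prob_space "W n" by (rule prob_space_W)
    have n1: "1 \<le> n" using n m by simp
    obtain E1 where E1: "E1 \<in> sets (W n)" "measure (W n) E1 \<le> \<epsilon> / 3"
      "\<And>w a b d. w \<in> space (W n) - E1 \<Longrightarrow> a \<in> {0..1} \<Longrightarrow> b \<in> {0..1} \<Longrightarrow> d \<in> {0..1} \<Longrightarrow> \<bar>a - b\<bar> \<le> 1 / real m \<Longrightarrow>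
      \<bar>(\<Sum>i\<in>below n r s (a, d). f (w i)) - (\<Sum>i\<in>below n r s (b, d). f (w i))\<bar> \<le> 18 * t * sqrt (real n)"
      using increments_bounded[OF fg(1) fg(6) fg(4) fg(3) t m n inj(1), of s] mp by (meson order_trans)
    obtain E2 where E2: "E2 \<in> sets (W n)" "measure (W n) E2 \<le> \<epsilon> / 3"
      "\<And>w a b d. w \<in> space (W n) - E2 \<Longrightarrow> a \<in> {0..1} \<Longrightarrow> b \<in> {0..1} \<Longrightarrow> d \<in> {0..1} \<Longrightarrow> \<bar>a - b\<bar> \<le> 1 / real m \<Longrightarrow>
      \<bar>(\<Sum>i\<in>below n s r (a, d). f (w i)) - (\<Sum>i\<in>below n s r (b, d). f (w i))\<bar> \<le> 18 * t * sqrt (real n)"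
      using increments_bounded[OF fg(1) fg(6) fg(4) fg(3) t m n inj(2), of r] mp by (meson order_trans)
    obtain E3 where E3: "E3 \<in> sets (W n)" "measure (W n) E3 \<le> 9 * (LINT x|\<mu>. (g x)\<^sup>2) / t\<^sup>2"
      "\<And>w u. w \<in> space (W n) - E3 \<Longrightarrow> u \<in> unit_square \<Longrightarrow> \<bar>\<Sum>i\<in>below n r s u. g (w i)\<bar> < 9 * t * sqrt (real n)"
      using uniform_bound_below[OF fg(2) fg(7) fg(8) t n1, of r s] by auto
    have "9 * (LINT x|\<mu>. (g x)\<^sup>2) / t\<^sup>2 \<le> 9 * (\<epsilon> * t\<^sup>2 / 27) / t\<^sup>2"
      using fg(9) by (intro divide_right_mono) auto
    also have "\<dots> = \<epsilon> / 3" using t by simp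
    finally have E3': "measure (W n) E3 \<le> \<epsilon> / 3" using E3(2) by simp
    have "measure (W n) (E1 \<union> E2 \<union> E3) \<le> measure (W n) E1 + measure (W n) E2 + measure (W n) E3"
      using measure_Un_le[of "E1 \<union> E2" "W n" E3] measure_Un_le[of E1 "W n" E2] E1(1) E2(1) E3(1) by simp
    then have mE: "measure (W n) (E1 \<union> E2 \<union> E3) \<le> \<epsilon>" using E1(2) E2(2) E3' by simp
    have "\<bar>mult_partial_sum n r s w u - mult_partial_sum n r s w v\<bar> \<le> \<epsilon>"
      if w: "w \<in> space (W n) - (E1 \<union> E2 \<union> E3)" and uv: "u \<in> unit_square" "v \<in> unit_square"
        "\<bar>fst u - fst v\<bar> \<le> 1 / real m" "\<bar>snd u - snd v\<bar> \<le> 1 / real m" for w u v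
    proof -
      obtain a d where u: "u = (a, d)" by (cases u)
      obtain b e where v: "v = (b, e)" by (cases v)
      have abc: "a \<in> {0..1}" "b \<in> {0..1}" "d \<in> {0..1}" "e \<in> {0..1}" using uv by (auto simp: u v unit_square_def)
      let ?F = "\<lambda>u. \<Sum>i\<in>below n r s u. f (w i)" and ?G = "\<lambda>u. \<Sum>i\<in>below n r s u. g (w i)"
      have sp: "(\<Sum>i\<in>below n r s u. w i - 1) = ?F u + ?G u" for u
        by (simp add: fg(5) sum.distrib)
      have 1: "\<bar>?F (a, d) - ?F (b, d)\<bar> \<le> 18 * t * sqrt (real n)"
        using E1(3)[of w a b d] w abc uv by (simp add: u v)
      have 2: "\<bar>?F (b, d) - ?F (b, e)\<bar> \<le> 18 * t * sqrt (real n)"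
        using E2(3)[of w d e b] w abc uv below_swap[of n s r "(b, d)"] below_swap[of n s r "(b, e)"] by (simp add: u v)
      have 3: "\<bar>?G (a, d)\<bar> \<le> 9 * t * sqrt (real n)" "\<bar>?G (b, e)\<bar> \<le> 9 * t * sqrt (real n)"
        using E3(3)[of w u] E3(3)[of w v] w uv by (auto simp: u v)
      have "\<bar>(\<Sum>i\<in>below n r s u. w i - 1) - (\<Sum>i\<in>below n r s v. w i - 1)\<bar> \<le> 54 * t * sqrt (real n)"
        unfolding sp u v using 1 2 3 by linarith
      also have "\<dots> \<le> \<epsilon> * sqrt (real n)" using e by (intro mult_right_mono) (auto simp: t_def)
      finally show ?thesis
        using n1 by (simp add: mult_partial_sum_def diff_divide_distrib[symmetric] pos_divide_le_eq)
    qed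
    then show ?thesis using mE E1(1) E2(1) E3(1) by (intro bexI[of _ "E1 \<union> E2 \<union> E3"]) auto
  qed
  show ?thesis
    using main m by (intro exI[of _ "1 / real m"] conjI exI[of _ m]) auto
qed

text \<open>The variance of the partial sum at \<open>u\<close> is the fraction of observations
  counted there, that is, the empirical copula at \<open>u\<close>. Hence the path is small where
  the copula is small; Chebyshev's inequality suffices since only finitely many grid points will be
  used.\<close>

lemma mult_partial_sum_small_at:
  assumes t: "0 < t" and n: "1 \<le> n"
  shows "\<exists>E\<in>sets (W n). measure (W n) E \<le> (real (card (below n r s u)) / real n) / t\<^sup>2 \<and>
    (\<forall>w\<in>space (W n) - E. \<bar>mult_partial_sum n r s w u\<bar> < t)"
proof -
  interpret Wn: prob_space "W n" by (rule prob_space_W)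
  have ind: "Wn.indep_vars (\<lambda>_. borel) (\<lambda>i w. w i - 1) {..<n}" using indep_coordinates[of "\<lambda>_ x. x - 1"] by simp
  define E where "E = {w\<in>space (W n). t * sqrt (real n) \<le> \<bar>\<Sum>i\<in>below n r s u. w i - 1\<bar>}"
  have "(\<lambda>w. \<Sum>i\<in>below n r s u. w i - 1) \<in> borel_measurable (W n)"
    by (intro borel_measurable_sum borel_measurable_diff coordinate_borel) (auto simp: below_def)
  then have "E \<in> sets (W n)" unfolding E_def by measurable
  moreover have "Wn.prob E \<le> (\<Sum>i\<in>below n r s u. LINT w|W n. (w i - 1)\<^sup>2) / (t * sqrt (real n))\<^sup>2"
    unfolding E_def using t n centered
    by (intro Wn.Chebyshev_sum_indep[OF ind]) (auto simp: below_subset integral_coordinate[of _ _ "\<lambda>x. x - 1"] integral_coordinate[of _ _ "\<lambda>x. (x - 1)\<^sup>2"])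
  moreover have "(\<Sum>i\<in>below n r s u. LINT w|W n. (w i - 1)\<^sup>2) = (\<Sum>i\<in>below n r s u. 1)"
    using below_subset[of n r s u] by (intro sum.cong refl) (auto simp: integral_coordinate[of _ _ "\<lambda>x. (x - 1)\<^sup>2"] var_1)
  moreover have "\<bar>mult_partial_sum n r s w u\<bar> < t" if "w \<in> space (W n) - E" for w
    using that n by (auto simp: E_def not_le mult_partial_sum_def pos_divide_less_eq)
  moreover have "(\<Sum>i\<in>below n r s u. 1) / (t * sqrt (real n))\<^sup>2 = (real (card (below n r s u)) / real n) / t\<^sup>2"
    using n by (simp add: power_mult_distrib)
  ultimately show ?thesis by metis
qed

end

section \<open>A central limit theorem for weighted multiplier sums\<close>

lemma exp_minus_bounds:
  fixes y :: real assumes "0 \<le> y"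
  shows "\<bar>exp (- y) - (1 - y)\<bar> \<le> y\<^sup>2"
proof -
  have "exp (- y) \<le> 1 / (1 + y)" using assms exp_ge_add_one_self[of y] by (simp add: exp_minus field_simps)
  also have "\<dots> \<le> 1 - y + y\<^sup>2"
  proof -
    have "1 \<le> (1 - y + y\<^sup>2) * (1 + y)" using assms by (simp add: algebra_simps power2_eq_square)
    then show ?thesis using assms by (simp add: pos_divide_le_eq)
  qed
  finally show ?thesis using exp_ge_add_one_self[of "- y"] by simp
qed

context multiplier_law
begin

lemma integral_iexp_weighted_sum:
  "(LINT w|W n. iexp (\<Sum>i<n. b i * (w i - 1))) = (\<Prod>i<n. LINT x|\<mu>. iexp (b i * (x - 1)))"
proof -
  interpret Wn: prob_space "W n" by (rule prob_space_W)
  have ind: "Wn.indep_vars (\<lambda>_. borel) (\<lambda>i w. b i * (w i - 1)) {..<n}"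
    using indep_coordinates[of "\<lambda>i x. b i * (x - 1)"] by simp
  have m: "(\<lambda>w. b i * (w i - 1)) \<in> borel_measurable (W n)" if "i < n" for i
    using ind that unfolding Wn.indep_vars_def by auto
  have "(LINT w|W n. iexp (\<Sum>i<n. b i * (w i - 1))) = char (distr (W n) borel (\<lambda>w. \<Sum>i<n. b i * (w i - 1))) 1"
    unfolding char_def using m by (subst integral_distr) (auto intro!: borel_measurable_sum)
  also have "\<dots> = (\<Prod>i<n. char (distr (W n) borel (\<lambda>w. b i * (w i - 1))) 1)"
    by (rule Wn.char_distr_sum[OF ind])
  also have "\<dots> = (\<Prod>i<n. LINT x|\<mu>. iexp (b i * (x - 1)))"
  proof (rule prod.cong)
    fix i assume "i \<in> {..<n}"
    then have i: "i < n" by simp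
    have "char (distr (W n) borel (\<lambda>w. b i * (w i - 1))) 1 = (LINT w|W n. iexp (b i * (w i - 1)))"
      unfolding char_def using m[OF i] by (subst integral_distr) auto
    also have "\<dots> = (LINT x|\<mu>. iexp (b i * (x - 1)))"
      by (rule integral_coordinate[OF i]) measurable
    finally show "char (distr (W n) borel (\<lambda>w. b i * (w i - 1))) 1 = (LINT x|\<mu>. iexp (b i * (x - 1)))" .
  qed simp
  finally show ?thesis .
qed

text \<open>\<open>n0\<close> is uniform over all weights of size \<open>T / sqrt (real n)\<close>,
  because the weights will depend on the rankings. The characteristic function is compared with the
  Gaussian one factor by factor; each of the \<open>n\<close> errors is of smaller order than
  \<open>1 / real n\<close>.\<close>

lemma multiplier_CLT_char:
  assumes e: "0 < \<epsilon>" and T: "0 \<le> T"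
  shows "\<exists>n0. \<forall>n\<ge>n0. \<forall>b. (\<forall>i<n. \<bar>b i\<bar> \<le> T / sqrt (real n)) \<longrightarrow>
    cmod ((LINT w|W n. iexp (\<Sum>i<n. b i * (w i - 1))) - exp (- (\<Sum>i<n. (b i)\<^sup>2) / 2)) \<le> \<epsilon>"
proof -
  define \<nu> where "\<nu> = distr \<mu> borel (\<lambda>x. x - 1)"
  \<comment> \<open>The Taylor remainder of the characteristic function with a cut-off: the minimum
    is dominated by a multiple of the square, so \<open>g s\<close> tends to 0 with \<open>s\<close>
    under a second moment only.\<close>
  define g where "g s = (LINT x|\<mu>. min (6 * (x - 1)\<^sup>2) (s * \<bar>x - 1\<bar> ^ 3))" for s
  have phi: "(LINT x|\<mu>. iexp (t * (x - 1))) = char \<nu> t" for t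
    unfolding char_def \<nu>_def by (subst integral_distr) auto
  have gi: "integrable \<mu> (\<lambda>x. min (6 * (x - 1)\<^sup>2) (s * \<bar>x - 1\<bar> ^ 3))" if "0 \<le> s" for s
    by (rule Bochner_Integration.integrable_bound[OF integrable_mult_right[OF centered(3), of 6]])
      (use that in \<open>auto intro!: AE_I2\<close>)
  have approx: "cmod (char \<nu> t - (1 - t\<^sup>2 / 2)) \<le> t\<^sup>2 / 6 * g \<bar>t\<bar>" for t
    using char_approx3'[of "\<lambda>x. x - 1" 1 \<nu> t] centered var_1 by (simp add: \<nu>_def g_def)
  have gmono: "g s \<le> g s'" if "0 \<le> s" "s \<le> s'" for s s'
    unfolding g_def using that
    by (intro integral_mono gi min.mono order_refl mult_right_mono) auto
  have one: "cmod (char \<nu> t - exp (- (t\<^sup>2) / 2)) \<le> t\<^sup>2 / 6 * g s + t ^ 4 / 4" if "\<bar>t\<bar> \<le> s" for t s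
  proof -
    have "cmod (char \<nu> t - exp (- (t\<^sup>2) / 2)) \<le> cmod (char \<nu> t - (1 - t\<^sup>2 / 2)) + cmod (complex_of_real (1 - t\<^sup>2 / 2) - exp (- (t\<^sup>2) / 2))"
      by (rule order_trans[OF _ norm_triangle_ineq]) (simp add: algebra_simps)
    also have "cmod (complex_of_real (1 - t\<^sup>2 / 2) - exp (- (t\<^sup>2) / 2)) = \<bar>exp (- (t\<^sup>2 / 2)) - (1 - t\<^sup>2 / 2)\<bar>"
      by (simp only: of_real_diff[symmetric] norm_of_real abs_minus_commute) simp
    also have "\<dots> \<le> (t\<^sup>2 / 2)\<^sup>2" by (rule exp_minus_bounds) simp
    also have "\<dots> = t ^ 4 / 4" by (simp add: power_divide)
    also have "cmod (char \<nu> t - (1 - t\<^sup>2 / 2)) \<le> t\<^sup>2 / 6 * g s"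
      by (rule order_trans[OF approx mult_left_mono[OF gmono[OF abs_ge_zero that]]]) simp
    finally show ?thesis by simp
  qed
  have lim: "(\<lambda>n. T\<^sup>2 / 6 * g (T / sqrt (real n)) + T ^ 4 / (4 * real n)) \<longlonglongrightarrow> T\<^sup>2 / 6 * 0 + 0"
  proof (intro tendsto_intros)
    have s0: "(\<lambda>n. T / sqrt (real n)) \<longlonglongrightarrow> 0"
      by (intro tendsto_divide_0[OF tendsto_const] filterlim_at_top_imp_at_infinity filterlim_compose[OF sqrt_at_top] filterlim_real_sequentially)
    have "(\<lambda>n. g (T / sqrt (real n))) \<longlonglongrightarrow> (LINT x|\<mu>. 0)"
      unfolding g_def
    proof (rule integral_dominated_convergence[where w = "\<lambda>x. 6 * (x - 1)\<^sup>2"])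
      show "AE x in \<mu>. (\<lambda>n. min (6 * (x - 1)\<^sup>2) (T / sqrt (real n) * \<bar>x - 1\<bar> ^ 3)) \<longlonglongrightarrow> 0"
      proof (rule AE_I2)
        fix x :: real
        have "(\<lambda>n. min (6 * (x - 1)\<^sup>2) (T / sqrt (real n) * \<bar>x - 1\<bar> ^ 3)) \<longlonglongrightarrow> min (6 * (x - 1)\<^sup>2) (0 * \<bar>x - 1\<bar> ^ 3)"
          by (intro tendsto_intros s0)
        then show "(\<lambda>n. min (6 * (x - 1)\<^sup>2) (T / sqrt (real n) * \<bar>x - 1\<bar> ^ 3)) \<longlonglongrightarrow> 0" by simp
      qed
      show "integrable \<mu> (\<lambda>x. 6 * (x - 1)\<^sup>2)" using centered(3) by simp
      show "AE x in \<mu>. norm (min (6 * (x - 1)\<^sup>2) (T / sqrt (real n) * \<bar>x - 1\<bar> ^ 3)) \<le> 6 * (x - 1)\<^sup>2" for n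
        using T by (auto intro!: AE_I2)
    qed auto
    then show "(\<lambda>n. g (T / sqrt (real n))) \<longlonglongrightarrow> 0" by simp
    show "(\<lambda>n. T ^ 4 / (4 * real n)) \<longlonglongrightarrow> 0"
      using tendsto_mult[OF tendsto_const[of "T ^ 4 / 4"] lim_1_over_n] by simp
  qed
  then have "\<forall>\<^sub>F n in sequentially. T\<^sup>2 / 6 * g (T / sqrt (real n)) + T ^ 4 / (4 * real n) < \<epsilon>"
    using e by (intro order_tendstoD(2)) auto
  then obtain n0 where n0: "\<And>n. n \<ge> n0 \<Longrightarrow> T\<^sup>2 / 6 * g (T / sqrt (real n)) + T ^ 4 / (4 * real n) < \<epsilon>"
    by (auto simp: eventually_sequentially)
  have "cmod ((LINT w|W n. iexp (\<Sum>i<n. b i * (w i - 1))) - exp (- (\<Sum>i<n. (b i)\<^sup>2) / 2)) \<le> \<epsilon>"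
    if n: "n \<ge> max 1 n0" and b: "\<forall>i<n. \<bar>b i\<bar> \<le> T / sqrt (real n)" for n b
  proof -
    have np: "0 < real n" using n by simp
    define s where "s = T / sqrt (real n)"
    have s0: "0 \<le> s" using T by (simp add: s_def)
    have g0: "0 \<le> g s" unfolding g_def using s0 by (intro integral_nonneg_AE AE_I2) auto
    interpret D: real_distribution \<nu> unfolding \<nu>_def by (rule real_distribution_distr) measurable
    have "exp (- (\<Sum>i<n. (b i)\<^sup>2) / 2) = (\<Prod>i<n. exp (- ((b i)\<^sup>2) / 2))"
      by (simp add: exp_sum[symmetric] sum_negf sum_divide_distrib)
    then have "cmod ((LINT w|W n. iexp (\<Sum>i<n. b i * (w i - 1))) - exp (- (\<Sum>i<n. (b i)\<^sup>2) / 2)) =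
       cmod ((\<Prod>i<n. char \<nu> (b i)) - (\<Prod>i<n. complex_of_real (exp (- ((b i)\<^sup>2) / 2))))"
      unfolding integral_iexp_weighted_sum phi by simp
    also have "\<dots> \<le> (\<Sum>i<n. cmod (char \<nu> (b i) - complex_of_real (exp (- ((b i)\<^sup>2) / 2))))"
      by (rule norm_prod_diff) (auto simp: D.cmod_char_le_1)
    also have "\<dots> \<le> (\<Sum>i<n. s\<^sup>2 / 6 * g s + s ^ 4 / 4)"
    proof (rule sum_mono)
      fix i assume "i \<in> {..<n}"
      then have bs: "\<bar>b i\<bar> \<le> s" using b by (auto simp: s_def)
      then have "(b i)\<^sup>2 \<le> s\<^sup>2" by (metis abs_le_square_iff abs_of_nonneg s0)
      moreover have "(b i) ^ 4 \<le> s ^ 4" using power_mono[OF bs abs_ge_zero, of 4] by (simp add: power_even_abs)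
      ultimately show "cmod (char \<nu> (b i) - complex_of_real (exp (- ((b i)\<^sup>2) / 2))) \<le> s\<^sup>2 / 6 * g s + s ^ 4 / 4"
        using one[OF bs] mult_right_mono[OF _ g0, of "(b i)\<^sup>2" "s\<^sup>2"] by simp
    qed
    also have "\<dots> = T\<^sup>2 / 6 * g s + T ^ 4 / (4 * real n)"
    proof -
      have "s\<^sup>2 = T\<^sup>2 / real n" using np by (simp add: s_def power_divide)
      moreover have "s ^ 4 = T ^ 4 / (real n)\<^sup>2"
      proof -
        have "sqrt (real n) ^ 4 = (real n)\<^sup>2" using power_mult[of "sqrt (real n)" 2 2] by simp
        then show ?thesis using np by (simp add: s_def power_divide)
      qed
      ultimately have ab: "real n * s\<^sup>2 = T\<^sup>2" "real n * s ^ 4 = T ^ 4 / real n"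
        using np by (simp_all add: power2_eq_square)
      have "(\<Sum>i<n. s\<^sup>2 / 6 * g s + s ^ 4 / 4) = (real n * s\<^sup>2) / 6 * g s + (real n * s ^ 4) / 4"
        by (simp add: algebra_simps)
      then show ?thesis unfolding ab by (simp add: mult.commute)
    qed
    finally show ?thesis using n0[of n] n by (simp add: s_def)
  qed
  then show ?thesis by blast
qed

end

text \<open>Normality comes with unknown and possibly degenerate parameters. Centring forces
  \<open>m = 0\<close>, and then the second moment determines the characteristic function at 1;
  other arguments are absorbed into the coefficients of the linear combinations to which this is
  applied.\<close>

lemma normal_rv_centered:
  assumes "prob_space N" and Y: "normal_rv N Y m \<sigma>" and m0: "integral\<^sup>L N Y = 0"
  shows "integrable N Y" "integrable N (\<lambda>v. (Y v)\<^sup>2)"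
    "(LINT v|N. iexp (Y v)) = exp (- (LINT v|N. (Y v)\<^sup>2) / 2)"
proof -
  interpret prob_space N by fact
  have "integrable N Y \<and> integrable N (\<lambda>v. (Y v)\<^sup>2) \<and> (LINT v|N. iexp (Y v)) = exp (- (LINT v|N. (Y v)\<^sup>2) / 2)"
  proof (cases "\<sigma> = 0")
    case True
    then have Ym: "Y \<in> borel_measurable N" and ae: "AE v in N. Y v = m"
      using Y by (auto simp: normal_rv_def)
    have iY: "integrable N Y" by (rule integrable_const_bound[of _ "\<bar>m\<bar>"]) (use ae Ym in auto)
    have "integral\<^sup>L N Y = (LINT v|N. m)" by (rule integral_cong_AE) (use ae Ym in auto)
    then have "m = 0" using m0 by (simp add: prob_space)
    then have ae0: "AE v in N. Y v = 0" using ae by simp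
    have "(LINT v|N. (Y v)\<^sup>2) = (LINT v|N. 0)" by (rule integral_cong_AE) (use ae0 Ym in auto)
    moreover have "(LINT v|N. iexp (Y v)) = (LINT v|N. 1)" by (rule integral_cong_AE) (use ae0 Ym in auto)
    moreover have "integrable N (\<lambda>v. (Y v)\<^sup>2)" by (rule integrable_const_bound[of _ 0]) (use ae0 Ym in auto)
    ultimately show ?thesis using iY by (simp add: prob_space)
  next
    case False
    then have s: "0 < \<sigma>" and D: "distributed N lborel Y (normal_density m \<sigma>)" using Y by (auto simp: normal_rv_def)
    define Z where "Z v = (Y v - m) / \<sigma>" for v
    have Zd: "distributed N lborel Z std_normal_density"
      using D normal_standard_normal_convert[OF s, of Y m] by (simp add: Z_def[abs_def])
    have YZ: "Y v = m + \<sigma> * Z v" for v using s by (simp add: Z_def)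
    have Zi: "integrable N Z"
      using distributed_integrable[OF Zd, of "\<lambda>x. x"] integrable_std_normal_moment[of 1] by simp
    have Zi2: "integrable N (\<lambda>v. (Z v)\<^sup>2)"
      using distributed_integrable[OF Zd, of "\<lambda>x. x\<^sup>2"] integrable_std_normal_moment[of 2] by simp
    have Z1: "integral\<^sup>L N Z = 0"
      using distributed_integral[OF Zd, of "\<lambda>x. x"] integral_std_normal_moment_odd[of 0] by simp
    have Z2: "(LINT v|N. (Z v)\<^sup>2) = 1"
      using distributed_integral[OF Zd, of "\<lambda>x. x\<^sup>2"] integral_std_normal_moment_even[of 1] by simp
    have Yi: "integrable N Y" unfolding YZ[abs_def] using Zi by simp
    have "integral\<^sup>L N Y = m" unfolding YZ[abs_def] using Zi Z1 by (simp add: prob_space)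
    then have Y0: "Y v = \<sigma> * Z v" for v using m0 YZ by simp
    have Zm: "Z \<in> measurable N lborel" using distributed_measurable[OF Zd] .
    have "(LINT v|N. iexp (\<sigma> * Z v)) = char (distr N lborel Z) \<sigma>"
      unfolding char_def using Zm by (subst integral_distr) auto
    also have "\<dots> = exp (- \<sigma>\<^sup>2 / 2)"
      unfolding distributed_distr_eq_density[OF Zd] by (simp add: char_std_normal_distribution)
    finally have "(LINT v|N. iexp (\<sigma> * Z v)) = exp (- \<sigma>\<^sup>2 / 2)" .
    then show ?thesis using Yi Zi2 Z2 unfolding Y0 by (simp add: power_mult_distrib)
  qed
  then show "integrable N Y" "integrable N (\<lambda>v. (Y v)\<^sup>2)"
    "(LINT v|N. iexp (Y v)) = exp (- (LINT v|N. (Y v)\<^sup>2) / 2)" by auto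
qed

section \<open>Moments and characteristic functions of the limit field\<close>

abbreviation brownian_cov :: "(real \<times> real \<Rightarrow> real) \<Rightarrow> real \<times> real \<Rightarrow> real \<times> real \<Rightarrow> real" where
  "brownian_cov C u v \<equiv> C (min (fst u) (fst v), min (snd u) (snd v)) - C u * C v"

context
  fixes N :: "'v measure" and C B
  assumes B: "copula_brownian_field N C B"
begin

lemma brownian_prob_space: "prob_space N" using B by (simp add: copula_brownian_field_def)

lemma brownian_normal:
  assumes "finite I" "I \<subseteq> unit_square"
  shows "\<exists>m \<sigma>. normal_rv N (\<lambda>v. \<Sum>u\<in>I. c u * B u v) m \<sigma>"
  using B assms unfolding copula_brownian_field_def gaussian_field_def by blast

text \<open>Integrability is not a clause of \<open>copula_brownian_field\<close>; it follows from
  normality of the one-term combination. Without it a vanishing integral might merely be the default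
  value for non-integrable functions.\<close>

lemma brownian_square_integrable:
  assumes "u \<in> unit_square"
  shows "integrable N (B u)" "integrable N (\<lambda>v. (B u v)\<^sup>2)" "integral\<^sup>L N (B u) = 0"
proof -
  show 0: "integral\<^sup>L N (B u) = 0" using B assms by (simp add: copula_brownian_field_def)
  obtain m \<sigma> where "normal_rv N (\<lambda>v. \<Sum>u\<in>{u}. 1 * B u v) m \<sigma>"
    using brownian_normal[of "{u}" "\<lambda>_. 1"] assms by auto
  then have "normal_rv N (B u) m \<sigma>" by simp
  from normal_rv_centered[OF brownian_prob_space this 0]
  show "integrable N (B u)" "integrable N (\<lambda>v. (B u v)\<^sup>2)" by auto
qed

lemma brownian_product:
  assumes "u \<in> unit_square" "v \<in> unit_square"
  shows "integrable N (\<lambda>x. B u x * B v x)" "(LINT x|N. B u x * B v x) = brownian_cov C u v"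
proof -
  have m: "B u \<in> borel_measurable N" "B v \<in> borel_measurable N"
    using brownian_square_integrable(1)[OF assms(1)] brownian_square_integrable(1)[OF assms(2)] by auto
  show "integrable N (\<lambda>x. B u x * B v x)"
  proof (rule Bochner_Integration.integrable_bound)
    show "integrable N (\<lambda>x. (B u x)\<^sup>2 + (B v x)\<^sup>2)"
      using brownian_square_integrable assms by auto
    have "\<bar>a * b\<bar> \<le> \<bar>a\<^sup>2 + b\<^sup>2\<bar>" for a b :: real
    proof -
      have "2 * (\<bar>a\<bar> * \<bar>b\<bar>) \<le> a\<^sup>2 + b\<^sup>2" using sum_squares_bound[of "\<bar>a\<bar>" "\<bar>b\<bar>"] by simp
      moreover have "0 \<le> \<bar>a\<bar> * \<bar>b\<bar>" by simp
      ultimately have "\<bar>a\<bar> * \<bar>b\<bar> \<le> \<bar>a\<^sup>2 + b\<^sup>2\<bar>" by linarith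
      then show ?thesis by (simp only: abs_mult)
    qed
    then show "AE x in N. norm (B u x * B v x) \<le> norm ((B u x)\<^sup>2 + (B v x)\<^sup>2)" by simp
  qed (use m in measurable)
  show "(LINT x|N. B u x * B v x) = brownian_cov C u v"
    using B assms brownian_square_integrable(3)[OF assms(1)] brownian_square_integrable(3)[OF assms(2)]
    by (auto simp: copula_brownian_field_def cov_def)
qed

lemma brownian_char:
  assumes I: "finite I" "I \<subseteq> unit_square"
  shows "(LINT v|N. iexp (\<Sum>u\<in>I. c u * B u v)) = exp (- (\<Sum>u\<in>I. \<Sum>u'\<in>I. c u * c u' * brownian_cov C u u') / 2)"
proof -
  obtain m \<sigma> where nr: "normal_rv N (\<lambda>v. \<Sum>u\<in>I. c u * B u v) m \<sigma>" using brownian_normal[OF I] by blast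
  have 0: "(LINT v|N. (\<Sum>u\<in>I. c u * B u v)) = 0"
    using I brownian_square_integrable by (subst Bochner_Integration.integral_sum) (auto intro!: sum.neutral)
  have pi: "integrable N (\<lambda>v. c u * c u' * (B u v * B u' v))" if "u \<in> I" "u' \<in> I" for u u'
    using that I by (intro integrable_mult_right brownian_product(1)) auto
  have "(\<Sum>u\<in>I. c u * B u v)\<^sup>2 = (\<Sum>u\<in>I. \<Sum>u'\<in>I. c u * c u' * (B u v * B u' v))" for v
    unfolding power2_eq_square sum_product by (intro sum.cong refl) (simp only: ac_simps)
  then have "(LINT v|N. (\<Sum>u\<in>I. c u * B u v)\<^sup>2) = (LINT v|N. (\<Sum>u\<in>I. \<Sum>u'\<in>I. c u * c u' * (B u v * B u' v)))"
    by simp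
  also have "\<dots> = (\<Sum>u\<in>I. LINT v|N. (\<Sum>u'\<in>I. c u * c u' * (B u v * B u' v)))"
    by (intro Bochner_Integration.integral_sum Bochner_Integration.integrable_sum pi)
  also have "\<dots> = (\<Sum>u\<in>I. \<Sum>u'\<in>I. LINT v|N. c u * c u' * (B u v * B u' v))"
    by (intro sum.cong refl Bochner_Integration.integral_sum pi)
  also have "\<dots> = (\<Sum>u\<in>I. \<Sum>u'\<in>I. c u * c u' * brownian_cov C u u')"
    using I by (intro sum.cong refl) (auto simp: brownian_product(2) subset_iff)
  finally show ?thesis using normal_rv_centered(3)[OF brownian_prob_space nr 0] by simp
qed

end

section \<open>Convergence from characteristic functions\<close>

text \<open>The phase form lets products reduce to sums.\<close>

inductive_set trig_polys :: "'i set \<Rightarrow> (('i \<Rightarrow> real) \<Rightarrow> real) set" for J where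
  cosine: "(\<lambda>y. a * cos ((\<Sum>j\<in>J. t j * y j) + \<phi>)) \<in> trig_polys J"
| plus: "f \<in> trig_polys J \<Longrightarrow> g \<in> trig_polys J \<Longrightarrow> (\<lambda>y. f y + g y) \<in> trig_polys J"

lemma trig_polys_const: "(\<lambda>y. c) \<in> trig_polys J"
  using cosine[where a = c and t = "\<lambda>_. 0" and \<phi> = 0] by simp

lemma trig_polys_times_cosine:
  assumes "g \<in> trig_polys J"
  shows "(\<lambda>y. (a * cos ((\<Sum>j\<in>J. t j * y j) + \<phi>)) * g y) \<in> trig_polys J"
  using assms
proof induction
  case (cosine b s \<psi>)
  have eq: "(\<lambda>y. (a * cos ((\<Sum>j\<in>J. t j * y j) + \<phi>)) * (b * cos ((\<Sum>j\<in>J. s j * y j) + \<psi>))) =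
    (\<lambda>y. (a * b / 2) * cos ((\<Sum>j\<in>J. (t j - s j) * y j) + (\<phi> - \<psi>)) +
         (a * b / 2) * cos ((\<Sum>j\<in>J. (t j + s j) * y j) + (\<phi> + \<psi>)))"
  proof
    fix y
    have 1: "(\<Sum>j\<in>J. (t j - s j) * y j) + (\<phi> - \<psi>) = ((\<Sum>j\<in>J. t j * y j) + \<phi>) - ((\<Sum>j\<in>J. s j * y j) + \<psi>)"
      by (simp add: left_diff_distrib sum_subtractf)
    have 2: "(\<Sum>j\<in>J. (t j + s j) * y j) + (\<phi> + \<psi>) = ((\<Sum>j\<in>J. t j * y j) + \<phi>) + ((\<Sum>j\<in>J. s j * y j) + \<psi>)"
      by (simp add: distrib_right sum.distrib)
    have "(a * cos A) * (b * cos B') = (a * b / 2) * cos (A - B') + (a * b / 2) * cos (A + B')" for A B'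
      using cos_times_cos[of A B'] by (simp add: field_simps)
    then show "(a * cos ((\<Sum>j\<in>J. t j * y j) + \<phi>)) * (b * cos ((\<Sum>j\<in>J. s j * y j) + \<psi>)) =
      (a * b / 2) * cos ((\<Sum>j\<in>J. (t j - s j) * y j) + (\<phi> - \<psi>)) +
         (a * b / 2) * cos ((\<Sum>j\<in>J. (t j + s j) * y j) + (\<phi> + \<psi>))"
      unfolding 1 2 .
  qed
  show ?case unfolding eq by (rule trig_polys.plus[OF trig_polys.cosine trig_polys.cosine])
next
  case (plus f g)
  then show ?case using trig_polys.plus by (simp add: distrib_left)
qed

lemma trig_polys_times:
  assumes "f \<in> trig_polys J" "g \<in> trig_polys J"
  shows "(\<lambda>y. f y * g y) \<in> trig_polys J"
  using assms(1)
proof induction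
  case (cosine a t \<phi>)
  then show ?case using trig_polys_times_cosine[OF assms(2)] by simp
next
  case (plus f1 f2)
  then show ?case using trig_polys.plus by (simp add: distrib_right)
qed

lemma trig_polys_continuous:
  fixes J :: "'i::countable set"
  shows "f \<in> trig_polys J \<Longrightarrow> continuous_on UNIV f"
proof (induction rule: trig_polys.induct)
  case (cosine a t \<phi>)
  have "continuous_on UNIV (\<lambda>y::'i \<Rightarrow> real. \<Sum>j\<in>J. t j * y j)"
    by (rule continuous_on_sum) (rule continuous_on_mult[OF continuous_on_const continuous_on_product_coordinates])
  then show ?case by (intro continuous_intros continuous_on_product_coordinates)
next
  case (plus f g)
  then show ?case by (intro continuous_on_add)
qed

lemma trig_polys_bounded:
  "f \<in> trig_polys J \<Longrightarrow> \<exists>b. \<forall>y. \<bar>f y\<bar> \<le> b"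
proof (induction rule: trig_polys.induct)
  case (cosine a t \<phi>)
  have "\<bar>a * cos x\<bar> \<le> \<bar>a\<bar>" for x by (simp add: abs_mult mult_left_le)
  then show ?case by blast
next
  case (plus f g)
  then show ?case by (metis abs_triangle_ineq add_mono order_trans)
qed

lemma trig_polys_polynomial:
  fixes p :: "real \<Rightarrow> real"
  assumes "real_polynomial_function p" "g \<in> trig_polys J"
  shows "(\<lambda>y. p (g y)) \<in> trig_polys J"
  using assms(1)
proof induction
  case (linear p)
  have eq: "p x = p 1 * x" for x using linear_simps(5)[OF linear, of x 1] by simp
  have "(\<lambda>y. p (g y)) = (\<lambda>y. p 1 * g y)" by (rule ext) (rule eq)
  then show ?case using trig_polys_times[OF trig_polys_const assms(2), of "p 1"] by metis
qed (auto intro: trig_polys_const trig_polys.plus trig_polys_times)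

text \<open>Coordinates outside \<open>J\<close> are pinned to 0. This makes the box compact in the
  product topology and lets functions of the coordinates in \<open>J\<close> separate its
  points.\<close>

definition coord_box :: "'i set \<Rightarrow> real \<Rightarrow> ('i \<Rightarrow> real) set" where
  "coord_box J R = PiE UNIV (\<lambda>j. if j \<in> J then {-R..R} else {0})"

lemma mem_coord_box: "y \<in> coord_box J R \<longleftrightarrow> (\<forall>j\<in>J. \<bar>y j\<bar> \<le> R) \<and> (\<forall>j. j \<notin> J \<longrightarrow> y j = 0)"
  unfolding coord_box_def by (auto simp: PiE_iff abs_le_iff split: if_splits)

lemma compact_coord_box: "compact (coord_box J R)"
proof -
  have "compactin (product_topology (\<lambda>_. euclidean) UNIV) (coord_box J R)"
    unfolding coord_box_def compactin_PiE by auto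
  then show ?thesis by (simp add: euclidean_product_topology)
qed

lemma sin_inj_unit:
  fixes a b :: real
  assumes "\<bar>a\<bar> \<le> 1" "\<bar>b\<bar> \<le> 1" "sin a = sin b"
  shows "a = b"
proof -
  have "- (pi / 2) \<le> a" "a \<le> pi / 2" "- (pi / 2) \<le> b" "b \<le> pi / 2"
    using assms(1,2) pi_gt3 by (auto simp: abs_le_iff)
  then show ?thesis using assms(3) sin_inj_pi by blast
qed

text \<open>Stone-Weierstrass on the box; composing with a polynomial close to the clamp function makes the
  approximant bounded off the box as well.\<close>

lemma trig_approximation:
  fixes f :: "('i::countable \<Rightarrow> real) \<Rightarrow> real"
  assumes J: "finite J" and f: "continuous_on (coord_box J R) f" "\<And>y. \<bar>f y\<bar> \<le> 1" and e: "0 < e" "e \<le> 1" and R: "0 < R"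
  shows "\<exists>g\<in>trig_polys J. (\<forall>y. \<bar>g y\<bar> \<le> 2) \<and> (\<forall>y\<in>coord_box J R. \<bar>f y - g y\<bar> \<le> e)"
proof -
  have "\<exists>g. g \<in> trig_polys J \<and> (\<forall>y\<in>coord_box J R. \<bar>f y - g y\<bar> < e / 2)"
  proof (rule Stone_Weierstrass_HOL[OF compact_coord_box])
    show "(\<lambda>x. c) \<in> trig_polys J" for c by (rule trig_polys_const)
    show "continuous_on (coord_box J R) g" if "g \<in> trig_polys J" for g
      by (rule continuous_on_subset[OF trig_polys_continuous[OF that]]) simp
    show "\<exists>g. g \<in> trig_polys J \<and> g x \<noteq> g y" if "x \<in> coord_box J R \<and> y \<in> coord_box J R \<and> x \<noteq> y" for x y
    proof -
      have "\<exists>j. x j \<noteq> y j" using that by (simp add: fun_eq_iff)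
      then obtain j where j: "x j \<noteq> y j" ..
      then have jJ: "j \<in> J" using that by (metis mem_coord_box)
      \<comment> \<open>This is the sine of \<open>y j / R\<close>, written with a phase so that it
        has the shape of a generator. On the box its argument stays in [-1, 1], where the sine is
        injective.\<close>
      define g where "g y = 1 * cos ((\<Sum>i\<in>J. (if i = j then 1 / R else 0) * y i) + - (pi / 2))" for y :: "'i \<Rightarrow> real"
      have g: "g y = sin (y j / R)" for y :: "'i \<Rightarrow> real"
      proof -
        have "(\<Sum>i\<in>J. (if i = j then 1 / R else 0) * y i) = (\<Sum>i\<in>J. if i = j then y j / R else 0)"
          by (intro sum.cong) auto
        also have "\<dots> = y j / R" using J jJ by simp
        finally show ?thesis unfolding g_def cos_add by simp
      qed
      have "\<bar>x j\<bar> \<le> R" "\<bar>y j\<bar> \<le> R" using that jJ by (auto simp: mem_coord_box)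
      then have xy: "\<bar>x j / R\<bar> \<le> 1" "\<bar>y j / R\<bar> \<le> 1" using R by (simp_all add: abs_divide)
      have "sin (x j / R) \<noteq> sin (y j / R)"
      proof
        assume "sin (x j / R) = sin (y j / R)"
        then have "x j / R = y j / R" by (rule sin_inj_unit[OF xy])
        then show False using j R by simp
      qed
      moreover have "g \<in> trig_polys J" unfolding g_def[abs_def] by (rule trig_polys.cosine)
      ultimately show ?thesis using g by metis
    qed
  qed (use f e in \<open>auto intro: trig_polys.plus trig_polys_times\<close>)
  then obtain g where g: "g \<in> trig_polys J" "\<And>y. y \<in> coord_box J R \<Longrightarrow> \<bar>f y - g y\<bar> < e / 2" by blast
  obtain b where b: "\<And>y. \<bar>g y\<bar> \<le> b" using trig_polys_bounded[OF g(1)] by auto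
  define clamp where "clamp x = max (- 1) (min 1 x)" for x :: real
  have "continuous_on {-b..b} clamp" unfolding clamp_def by (intro continuous_intros)
  then obtain p where p: "real_polynomial_function p" "\<And>x. x \<in> {-b..b} \<Longrightarrow> \<bar>clamp x - p x\<bar> < e / 2"
    using Stone_Weierstrass_real_polynomial_function[of "{-b..b}" clamp "e / 2"] e by auto
  have pg: "\<bar>clamp (g y) - p (g y)\<bar> < e / 2" for y using b[of y] by (intro p(2)) (auto simp: abs_le_iff)
  have c1: "\<bar>clamp x\<bar> \<le> 1" for x by (auto simp: clamp_def)
  have 1: "\<bar>p (g y)\<bar> \<le> 2" for y using pg[of y] c1[of "g y"] e by linarith
  \<comment> \<open>\<open>f\<close> takes values in [-1, 1], and moving a number to the nearest
    point of that interval does not increase its distance to such a value.\<close>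
  have c2: "\<bar>z - clamp x\<bar> \<le> \<bar>z - x\<bar>" if "\<bar>z\<bar> \<le> 1" for z x
    using that unfolding clamp_def by linarith
  have 2: "\<bar>f y - p (g y)\<bar> \<le> e" if "y \<in> coord_box J R" for y
    using pg[of y] g(2)[OF that] c2[OF f(2)[of y], of "g y"] by linarith
  show ?thesis
    by (rule bexI[OF _ trig_polys_polynomial[OF p(1) g(1)]]) (use 1 2 in blast)
qed

definition coord_vec :: "'i set \<Rightarrow> ('i \<Rightarrow> 'a \<Rightarrow> real) \<Rightarrow> 'a \<Rightarrow> 'i \<Rightarrow> real" where
  "coord_vec J Y \<omega> = (\<lambda>j. if j \<in> J then Y j \<omega> else 0)"

text \<open>The tail bound is Chebyshev's for variance at most 1, shared by the bootstrap vectors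
  and the Gaussian limit. That it is the same for all laws keeps later choices independent of the
  law, hence of the data.\<close>

definition tight_family :: "'i set \<Rightarrow> 'a measure \<Rightarrow> ('i \<Rightarrow> 'a \<Rightarrow> real) \<Rightarrow> bool" where
  "tight_family J P Y \<longleftrightarrow> prob_space P \<and> (\<forall>j\<in>J. Y j \<in> borel_measurable P) \<and>
     (\<forall>j\<in>J. \<forall>R>0. measure P {\<omega>\<in>space P. R \<le> \<bar>Y j \<omega>\<bar>} \<le> 1 / R\<^sup>2)"

text \<open>Used for a quantitative continuity theorem: for each test function, finitely many
  frequencies \<open>T\<close> and a tolerance \<open>\<delta>\<close> are determined by the limit
  alone and then work for every tight law \<open>P\<close>.\<close>

definition char_close :: "'i set \<Rightarrow> ('i \<Rightarrow> real) set \<Rightarrow> real \<Rightarrow> 'a measure \<Rightarrow> ('i \<Rightarrow> 'a \<Rightarrow> real) \<Rightarrow>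
    'b measure \<Rightarrow> ('i \<Rightarrow> 'b \<Rightarrow> real) \<Rightarrow> bool" where
  "char_close J T \<delta> P Y N Z \<longleftrightarrow> (\<forall>t\<in>T.
     cmod ((LINT \<omega>|P. iexp (\<Sum>j\<in>J. t j * Y j \<omega>)) - (LINT \<omega>|N. iexp (\<Sum>j\<in>J. t j * Z j \<omega>))) \<le> \<delta>)"

lemma char_close_mono: "char_close J T \<delta> P Y N Z \<Longrightarrow> T' \<subseteq> T \<Longrightarrow> \<delta> \<le> \<delta>' \<Longrightarrow> char_close J T' \<delta>' P Y N Z"
  unfolding char_close_def by force

lemma coord_vec_measurable:
  fixes J :: "'i::countable set"
  assumes "tight_family J P Y"
  shows "coord_vec J Y \<in> borel_measurable P"
proof (rule measurable_coordinatewise_then_product)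
  fix i show "(\<lambda>\<omega>. coord_vec J Y \<omega> i) \<in> borel_measurable P"
    using assms by (cases "i \<in> J") (auto simp: coord_vec_def tight_family_def)
qed

lemma sum_coord_vec: "(\<Sum>j\<in>J. t j * coord_vec J Y \<omega> j) = (\<Sum>j\<in>J. t j * Y j \<omega>)"
  by (simp add: coord_vec_def)

text \<open>The expectation of a cosine with phase is the real part of a fixed number times the
  characteristic function at one frequency, so a generator needs a single frequency and sums take
  unions.\<close>

lemma trig_polys_expectation_close:
  fixes g :: "('i::countable \<Rightarrow> real) \<Rightarrow> real" and Z :: "'i \<Rightarrow> 'b \<Rightarrow> real"
  assumes "g \<in> trig_polys J" "finite J" "tight_family J N Z" "0 < e"
  shows "\<exists>\<delta>>0. \<exists>T. finite T \<and> (\<forall>(P::'a measure) Y. tight_family J P Y \<longrightarrow> char_close J T \<delta> P Y N Z \<longrightarrow>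
    \<bar>(LINT \<omega>|P. g (coord_vec J Y \<omega>)) - (LINT \<omega>|N. g (coord_vec J Z \<omega>))\<bar> \<le> e)"
  using assms(1,4)
proof (induction arbitrary: e)
  case (cosine a t \<phi>)
  have eq: "(LINT \<omega>|P. a * cos ((\<Sum>j\<in>J. t j * coord_vec J Y \<omega> j) + \<phi>)) = Re (a * iexp \<phi> * (LINT \<omega>|P. iexp (\<Sum>j\<in>J. t j * Y j \<omega>)))"
    if "tight_family J P Y" for P :: "'c measure" and Y
  proof -
    interpret prob_space P using that by (simp add: tight_family_def)
    have m: "(\<lambda>\<omega>. \<Sum>j\<in>J. t j * Y j \<omega>) \<in> borel_measurable P"
      using that by (intro borel_measurable_sum borel_measurable_times) (auto simp: tight_family_def)
    have i: "integrable P (\<lambda>\<omega>. iexp (\<Sum>j\<in>J. t j * Y j \<omega>))"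
      by (rule integrable_iexp[OF measurable_compose[OF m borel_measurable_continuous_onI]]) (auto intro!: continuous_intros)
    have "Re (a * iexp \<phi> * (LINT \<omega>|P. iexp (\<Sum>j\<in>J. t j * Y j \<omega>))) =
      Re (LINT \<omega>|P. a * iexp \<phi> * iexp (\<Sum>j\<in>J. t j * Y j \<omega>))" using i by simp
    also have "\<dots> = (LINT \<omega>|P. Re (a * iexp \<phi> * iexp (\<Sum>j\<in>J. t j * Y j \<omega>)))"
      using i by (intro integral_Re[symmetric] integrable_mult_right)
    also have "(\<lambda>\<omega>. Re (a * iexp \<phi> * iexp (\<Sum>j\<in>J. t j * Y j \<omega>))) = (\<lambda>\<omega>. a * cos ((\<Sum>j\<in>J. t j * coord_vec J Y \<omega> j) + \<phi>))"
      unfolding sum_coord_vec mult.assoc exp_add[symmetric] distrib_left[symmetric] of_real_add[symmetric]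
      by (simp add: Re_exp add.commute)
    finally show ?thesis by simp
  qed
  define \<delta> where "\<delta> = e / (\<bar>a\<bar> + 1)"
  have d: "0 < \<delta>" "\<bar>a\<bar> * \<delta> \<le> e" using cosine by (auto simp: \<delta>_def field_simps)
  have "\<bar>(LINT \<omega>|P. a * cos ((\<Sum>j\<in>J. t j * coord_vec J Y \<omega> j) + \<phi>)) - (LINT \<omega>|N. a * cos ((\<Sum>j\<in>J. t j * coord_vec J Z \<omega> j) + \<phi>))\<bar> \<le> e"
    if P: "tight_family J P Y" and cc: "char_close J {t} \<delta> P Y N Z" for P :: "'a measure" and Y
  proof -
    have "\<bar>(LINT \<omega>|P. a * cos ((\<Sum>j\<in>J. t j * coord_vec J Y \<omega> j) + \<phi>)) - (LINT \<omega>|N. a * cos ((\<Sum>j\<in>J. t j * coord_vec J Z \<omega> j) + \<phi>))\<bar> =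
      \<bar>Re (a * iexp \<phi> * ((LINT \<omega>|P. iexp (\<Sum>j\<in>J. t j * Y j \<omega>)) - (LINT \<omega>|N. iexp (\<Sum>j\<in>J. t j * Z j \<omega>))))\<bar>"
      unfolding eq[OF P] eq[OF assms(3)] right_diff_distrib minus_complex.sel ..
    also have "\<dots> \<le> cmod (a * iexp \<phi> * ((LINT \<omega>|P. iexp (\<Sum>j\<in>J. t j * Y j \<omega>)) - (LINT \<omega>|N. iexp (\<Sum>j\<in>J. t j * Z j \<omega>))))"
      by (rule abs_Re_le_cmod)
    also have "\<dots> = \<bar>a\<bar> * cmod ((LINT \<omega>|P. iexp (\<Sum>j\<in>J. t j * Y j \<omega>)) - (LINT \<omega>|N. iexp (\<Sum>j\<in>J. t j * Z j \<omega>)))"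
      by (simp add: norm_mult)
    also have "\<dots> \<le> \<bar>a\<bar> * \<delta>" using cc by (intro mult_left_mono) (auto simp: char_close_def)
    finally show ?thesis using d(2) by simp
  qed
  then show ?case using d by (intro exI[of _ \<delta>] conjI exI[of _ "{t}"]) auto
next
  case (plus f g)
  have e2: "0 < e / 2" using plus by simp
  obtain \<delta>1 T1 where 1: "\<delta>1 > 0" "finite T1" "\<And>(P::'a measure) Y. tight_family J P Y \<Longrightarrow> char_close J T1 \<delta>1 P Y N Z \<Longrightarrow>
    \<bar>(LINT \<omega>|P. f (coord_vec J Y \<omega>)) - (LINT \<omega>|N. f (coord_vec J Z \<omega>))\<bar> \<le> e / 2" using plus.IH(1)[OF e2] by auto
  obtain \<delta>2 T2 where 2: "\<delta>2 > 0" "finite T2" "\<And>(P::'a measure) Y. tight_family J P Y \<Longrightarrow> char_close J T2 \<delta>2 P Y N Z \<Longrightarrow>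
    \<bar>(LINT \<omega>|P. g (coord_vec J Y \<omega>)) - (LINT \<omega>|N. g (coord_vec J Z \<omega>))\<bar> \<le> e / 2" using plus.IH(2)[OF e2] by auto
  have int: "integrable P (\<lambda>\<omega>. f (coord_vec J Y \<omega>))" if f: "f \<in> trig_polys J" and P: "tight_family J P Y" for P :: "'c measure" and Y f
  proof -
    interpret prob_space P using P by (simp add: tight_family_def)
    obtain b where "\<And>y. \<bar>f y\<bar> \<le> b" using trig_polys_bounded[OF f] by auto
    then show ?thesis
      using measurable_compose[OF coord_vec_measurable[OF P] borel_measurable_continuous_onI[OF trig_polys_continuous[OF f]]]
      by (intro integrable_const_bound[of _ b]) auto
  qed
  have "\<bar>(LINT \<omega>|P. f (coord_vec J Y \<omega>) + g (coord_vec J Y \<omega>)) - (LINT \<omega>|N. f (coord_vec J Z \<omega>) + g (coord_vec J Z \<omega>))\<bar> \<le> e"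
    if P: "tight_family J P Y" and cc: "char_close J (T1 \<union> T2) (min \<delta>1 \<delta>2) P Y N Z" for P :: "'a measure" and Y
  proof -
    have "\<bar>(LINT \<omega>|P. f (coord_vec J Y \<omega>)) - (LINT \<omega>|N. f (coord_vec J Z \<omega>))\<bar> \<le> e / 2"
      by (rule 1(3)[OF P char_close_mono[OF cc]]) auto
    moreover have "\<bar>(LINT \<omega>|P. g (coord_vec J Y \<omega>)) - (LINT \<omega>|N. g (coord_vec J Z \<omega>))\<bar> \<le> e / 2"
      by (rule 2(3)[OF P char_close_mono[OF cc]]) auto
    moreover have "(LINT \<omega>|P. f (coord_vec J Y \<omega>) + g (coord_vec J Y \<omega>)) = (LINT \<omega>|P. f (coord_vec J Y \<omega>)) + (LINT \<omega>|P. g (coord_vec J Y \<omega>))"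
      by (intro Bochner_Integration.integral_add int P plus.hyps)
    moreover have "(LINT \<omega>|N. f (coord_vec J Z \<omega>) + g (coord_vec J Z \<omega>)) = (LINT \<omega>|N. f (coord_vec J Z \<omega>)) + (LINT \<omega>|N. g (coord_vec J Z \<omega>))"
      by (intro Bochner_Integration.integral_add int assms(3) plus.hyps)
    ultimately show ?thesis by linarith
  qed
  then show ?case using 1 2 by (intro exI[of _ "min \<delta>1 \<delta>2"] conjI exI[of _ "T1 \<union> T2"]) auto
qed

lemma (in prob_space) expectation_diff_le:
  fixes F G :: "'a \<Rightarrow> real"
  assumes "integrable M F" "integrable M G" and E: "E \<in> events" and c: "0 \<le> c" "0 \<le> a"
    and 1: "\<And>\<omega>. \<omega> \<in> space M - E \<Longrightarrow> \<bar>F \<omega> - G \<omega>\<bar> \<le> a" and 2: "\<And>\<omega>. \<omega> \<in> space M \<Longrightarrow> \<bar>F \<omega> - G \<omega>\<bar> \<le> c"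
  shows "\<bar>expectation F - expectation G\<bar> \<le> a + c * prob E"
proof -
  have iI: "integrable M (indicat_real E)"
    using E by (intro integrable_real_indicator) (auto simp: emeasure_eq_measure)
  have "\<bar>expectation F - expectation G\<bar> = \<bar>expectation (\<lambda>\<omega>. F \<omega> - G \<omega>)\<bar>" using assms by simp
  also have "\<dots> \<le> expectation (\<lambda>\<omega>. \<bar>F \<omega> - G \<omega>\<bar>)" by (rule integral_abs_bound)
  also have "\<dots> \<le> expectation (\<lambda>\<omega>. a + c * indicator E \<omega>)"
  proof (rule integral_mono)
    show "integrable M (\<lambda>\<omega>. a + c * indicator E \<omega>)" using iI by simp
    fix \<omega> assume w: "\<omega> \<in> space M"
    show "\<bar>F \<omega> - G \<omega>\<bar> \<le> a + c * indicator E \<omega>"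
      using 1[of \<omega>] 2[OF w] w c by (cases "\<omega> \<in> E") auto
  qed (use assms in auto)
  also have "\<dots> = a + c * prob E" using iI E by (simp add: prob_space)
  finally show ?thesis .
qed

lemma tight_family_outside_box:
  assumes tf: "tight_family J P Y" and J: "finite J" and R: "0 < R"
  shows "{\<omega>\<in>space P. coord_vec J Y \<omega> \<notin> coord_box J R} \<in> sets P"
    "measure P {\<omega>\<in>space P. coord_vec J Y \<omega> \<notin> coord_box J R} \<le> real (card J) / R\<^sup>2"
proof -
  interpret prob_space P using tf by (simp add: tight_family_def)
  have [measurable]: "\<And>j. j \<in> J \<Longrightarrow> Y j \<in> borel_measurable P" using tf by (simp add: tight_family_def)
  have eq: "{\<omega>\<in>space P. coord_vec J Y \<omega> \<notin> coord_box J R} = (\<Union>j\<in>J. {\<omega>\<in>space P. R < \<bar>Y j \<omega>\<bar>})"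
    by (auto simp: mem_coord_box coord_vec_def not_le)
  show "{\<omega>\<in>space P. coord_vec J Y \<omega> \<notin> coord_box J R} \<in> sets P"
    unfolding eq by (intro sets.finite_UN J) auto
  have "prob (\<Union>j\<in>J. {\<omega>\<in>space P. R < \<bar>Y j \<omega>\<bar>}) \<le> (\<Sum>j\<in>J. prob {\<omega>\<in>space P. R < \<bar>Y j \<omega>\<bar>})"
    by (intro finite_measure_subadditive_finite J) auto
  also have "\<dots> \<le> (\<Sum>j\<in>J. 1 / R\<^sup>2)"
  proof (rule sum_mono)
    fix j assume j: "j \<in> J"
    have "prob {\<omega>\<in>space P. R < \<bar>Y j \<omega>\<bar>} \<le> prob {\<omega>\<in>space P. R \<le> \<bar>Y j \<omega>\<bar>}"
      using j by (intro finite_measure_mono) auto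
    also have "\<dots> \<le> 1 / R\<^sup>2" using tf j R by (simp add: tight_family_def)
    finally show "prob {\<omega>\<in>space P. R < \<bar>Y j \<omega>\<bar>} \<le> 1 / R\<^sup>2" .
  qed
  also have "\<dots> = real (card J) / R\<^sup>2" by simp
  finally show "measure P {\<omega>\<in>space P. coord_vec J Y \<omega> \<notin> coord_box J R} \<le> real (card J) / R\<^sup>2" unfolding eq .
qed

lemma exists_box_radius:
  fixes e :: real assumes "0 < e"
  shows "\<exists>R>0. real k / R\<^sup>2 \<le> e"
proof -
  define R where "R = sqrt ((real k + 1) / e)"
  have "R\<^sup>2 = (real k + 1) / e" using assms by (simp add: R_def)
  moreover have "0 < R" using assms by (simp add: R_def)
  moreover have "real k / ((real k + 1) / e) \<le> e" using assms by (simp add: field_simps)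
  ultimately show ?thesis by metis
qed

lemma bounded_continuous_integrable:
  fixes f :: "('i::countable \<Rightarrow> real) \<Rightarrow> real"
  assumes "tight_family J P Y" "continuous_on UNIV f" "\<And>y. \<bar>f y\<bar> \<le> b"
  shows "integrable P (\<lambda>\<omega>. f (coord_vec J Y \<omega>))"
proof -
  interpret prob_space P using assms by (simp add: tight_family_def)
  show ?thesis
    using measurable_compose[OF coord_vec_measurable[OF assms(1)] borel_measurable_continuous_onI[OF assms(2)]] assms(3)
    by (intro integrable_const_bound[of _ b]) auto
qed

lemma continuous_expectation_close:
  fixes f :: "('i::countable \<Rightarrow> real) \<Rightarrow> real" and Z :: "'i \<Rightarrow> 'b \<Rightarrow> real"
  assumes f: "continuous_on UNIV f" "\<And>y. \<bar>f y\<bar> \<le> 1" and J: "finite J" and Z: "tight_family J N Z" and e: "0 < e"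
  shows "\<exists>\<delta>>0. \<exists>T. finite T \<and> (\<forall>(P::'a measure) Y. tight_family J P Y \<longrightarrow> char_close J T \<delta> P Y N Z \<longrightarrow>
    \<bar>(LINT \<omega>|P. f (coord_vec J Y \<omega>)) - (LINT \<omega>|N. f (coord_vec J Z \<omega>))\<bar> \<le> e)"
proof -
  \<comment> \<open>\<open>trig_approximation\<close> needs a tolerance of at most 1.\<close>
  define e' where "e' = min e 1"
  have e': "0 < e'" "e' \<le> 1" "e' \<le> e" using e by (auto simp: e'_def)
  \<comment> \<open>Off the box \<open>f\<close> and the approximant differ by at most 3, so this
    radius adds \<open>e' / 8\<close> to the error \<open>e' / 8\<close> on the box:
    \<open>e' / 4\<close> for each of the two measures.\<close>
  obtain R where R: "0 < R" "real (card J) / R\<^sup>2 \<le> e' / 24" using exists_box_radius[of "e' / 24" "card J"] e' by auto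
  obtain g where g: "g \<in> trig_polys J" "\<And>y. \<bar>g y\<bar> \<le> 2" "\<And>y. y \<in> coord_box J R \<Longrightarrow> \<bar>f y - g y\<bar> \<le> e' / 8"
    using trig_approximation[OF J continuous_on_subset[OF f(1) subset_UNIV] f(2) _ _ R(1), of "e' / 8"] e' by auto
  have fg: "\<bar>(LINT \<omega>|P. f (coord_vec J Y \<omega>)) - (LINT \<omega>|P. g (coord_vec J Y \<omega>))\<bar> \<le> e' / 4" if P: "tight_family J P Y"
    for P :: "'c measure" and Y
  proof -
    interpret prob_space P using P by (simp add: tight_family_def)
    note b = tight_family_outside_box[OF P J R(1)]
    have "\<bar>(LINT \<omega>|P. f (coord_vec J Y \<omega>)) - (LINT \<omega>|P. g (coord_vec J Y \<omega>))\<bar> \<le>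
      e' / 8 + 3 * prob {\<omega>\<in>space P. coord_vec J Y \<omega> \<notin> coord_box J R}"
    proof (rule expectation_diff_le[OF _ _ b(1)])
      show "integrable P (\<lambda>\<omega>. f (coord_vec J Y \<omega>))" by (rule bounded_continuous_integrable[OF P f])
      show "integrable P (\<lambda>\<omega>. g (coord_vec J Y \<omega>))"
        by (rule bounded_continuous_integrable[OF P trig_polys_continuous[OF g(1)] g(2)])
      show "\<bar>f (coord_vec J Y \<omega>) - g (coord_vec J Y \<omega>)\<bar> \<le> 3" for \<omega>
        using f(2)[of "coord_vec J Y \<omega>"] g(2)[of "coord_vec J Y \<omega>"] by linarith
    qed (use g(3) e' in auto)
    then show ?thesis using b(2) R(2) by linarith
  qed
  obtain \<delta> T where dT: "0 < \<delta>" "finite T" "\<And>(P::'a measure) Y. tight_family J P Y \<Longrightarrow> char_close J T \<delta> P Y N Z \<Longrightarrow>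
    \<bar>(LINT \<omega>|P. g (coord_vec J Y \<omega>)) - (LINT \<omega>|N. g (coord_vec J Z \<omega>))\<bar> \<le> e' / 2"
    using trig_polys_expectation_close[OF g(1) J Z, of "e' / 2"] e' by auto
  have "\<bar>(LINT \<omega>|P. f (coord_vec J Y \<omega>)) - (LINT \<omega>|N. f (coord_vec J Z \<omega>))\<bar> \<le> e"
    if P: "tight_family J P Y" and cc: "char_close J T \<delta> P Y N Z" for P :: "'a measure" and Y
    using fg[OF P] fg[OF Z] dT(3)[OF P cc] e' by linarith
  then show ?thesis using dT(1,2) by blast
qed

section \<open>Piecewise linear approximation of bounded Lipschitz functions\<close>

definition ramp :: "real \<Rightarrow> real" where "ramp y = max 0 (min 1 y)"

text \<open>The linear interpolation of \<open>h\<close> at the nodes 0, \<open>d\<close>, ...,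
  \<open>real K * d\<close>, constant beyond the last node. In this form \<open>h\<close> enters
  only through the coefficients, which are at most \<open>d\<close> for \<open>h\<close> in
  \<open>BL1\<close>, while the ramps are the same for all \<open>h\<close>.\<close>

definition interp :: "(real \<Rightarrow> real) \<Rightarrow> real \<Rightarrow> nat \<Rightarrow> real \<Rightarrow> real" where
  "interp h d K x = h 0 + (\<Sum>k<K. (h (real (Suc k) * d) - h (real k * d)) * ramp (x / d - real k))"

lemma ramp_bounds: "0 \<le> ramp y" "ramp y \<le> 1" by (auto simp: ramp_def)

lemma interp_beyond:
  assumes "0 < d" "real K * d \<le> x" shows "interp h d K x = h (real K * d)"
proof -
  have "ramp (x / d - real k) = 1" if "k < K" for k
  proof -
    have "real k + 1 \<le> real K" using that by linarith
    then have "(real k + 1) * d \<le> real K * d" using assms(1) by (simp only: mult_le_cancel_right_pos)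
    then have "(real k + 1) * d \<le> x" using assms(2) by (rule order_trans)
    then have "real k + 1 \<le> x / d" using assms(1) by (simp only: pos_le_divide_eq)
    then have "1 \<le> x / d - real k" by linarith
    then show ?thesis unfolding ramp_def by simp
  qed
  then have "interp h d K x = h 0 + (\<Sum>k<K. h (real (Suc k) * d) - h (real k * d))"
    unfolding interp_def by (intro arg_cong2[where f = "(+)"] refl sum.cong) auto
  also have "\<dots> = h (real K * d)"
    using sum_lessThan_telescope[of "\<lambda>k. h (real k * d)" K] by simp
  finally show ?thesis .
qed

lemma BL1_D:
  assumes "h \<in> BL1" shows "\<bar>h x\<bar> \<le> 1" "\<bar>h x - h y\<bar> \<le> dist x y"
  using assms by (auto simp: BL1_def)

lemma BL1_continuous:
  fixes h :: "'a::metric_space \<Rightarrow> real"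
  assumes "h \<in> BL1" shows "continuous_on A h"
  using BL1_D(2)[OF assms] by (intro continuous_onI) (metis dist_commute dist_real_def le_less_trans order_less_imp_le)

text \<open>In the mesh interval containing \<open>x\<close>, both \<open>h\<close> and its
  interpolant move by at most \<open>d\<close> away from their common value at the left
  node.\<close>

lemma interp_close:
  assumes h: "h \<in> BL1" and d: "0 < d" and x: "0 \<le> x" "x \<le> real K * d"
  shows "\<bar>h x - interp h d K x\<bar> \<le> 2 * d"
  using x(2)
proof (induction K)
  case 0
  then show ?case using x d by (simp add: interp_def)
next
  case (Suc K)
  show ?case
  proof (cases "x \<le> real K * d")
    case True
    then have "x / d \<le> real K" using d by (simp add: pos_divide_le_eq)
    then have "ramp (x / d - real K) = 0" by (simp add: ramp_def)
    then show ?thesis using Suc.IH[OF True] by (simp add: interp_def)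
  next
    case False
    have 0: "interp h d (Suc K) x = interp h d K x + (h (real (Suc K) * d) - h (real K * d)) * ramp (x / d - real K)"
      by (simp add: interp_def)
    have 1: "interp h d K x = h (real K * d)" using False by (intro interp_beyond[OF d]) simp
    have Sd: "real (Suc K) * d = real K * d + d" by (simp add: distrib_right)
    have 2: "\<bar>h x - h (real K * d)\<bar> \<le> d"
      using BL1_D(2)[OF h, of x "real K * d"] False Suc.prems unfolding Sd dist_real_def by linarith
    have "\<bar>(h (real (Suc K) * d) - h (real K * d)) * ramp (x / d - real K)\<bar> \<le> d * 1"
      unfolding abs_mult
      using BL1_D(2)[OF h, of "real (Suc K) * d" "real K * d"] ramp_bounds[of "x / d - real K"] d
      unfolding Sd dist_real_def by (intro mult_mono) auto
    then show ?thesis unfolding 0 1 using 2 by linarith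
  qed
qed

lemma finite_char_close_uniform:
  fixes \<Phi> :: "nat \<Rightarrow> 'a measure \<Rightarrow> ('i \<Rightarrow> 'a \<Rightarrow> real) \<Rightarrow> bool" and N :: "'b measure"
  assumes "\<And>k. k < K \<Longrightarrow> \<exists>\<delta>>0. \<exists>T. finite T \<and> (\<forall>P Y. tight_family J P Y \<longrightarrow> char_close J T \<delta> P Y N Z \<longrightarrow> \<Phi> k P Y)"
  shows "\<exists>\<delta>>0. \<exists>T. finite T \<and> (\<forall>P Y. tight_family J P Y \<longrightarrow> char_close J T \<delta> P Y N Z \<longrightarrow> (\<forall>k<K. \<Phi> k P Y))"
  using assms
proof (induction K)
  case 0
  show ?case by (intro exI[of _ 1] conjI exI[of _ "{}"]) auto
next
  case (Suc K)
  obtain \<delta>1 T1 where 1: "\<delta>1 > 0" "finite T1" "\<And>P Y. tight_family J P Y \<Longrightarrow> char_close J T1 \<delta>1 P Y N Z \<Longrightarrow> \<forall>k<K. \<Phi> k P Y"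
    using Suc.IH Suc.prems by (metis less_SucI)
  obtain \<delta>2 T2 where 2: "\<delta>2 > 0" "finite T2" "\<And>P Y. tight_family J P Y \<Longrightarrow> char_close J T2 \<delta>2 P Y N Z \<Longrightarrow> \<Phi> K P Y"
    using Suc.prems[of K] by auto
  have "\<forall>k<Suc K. \<Phi> k P Y" if P: "tight_family J P Y" and cc: "char_close J (T1 \<union> T2) (min \<delta>1 \<delta>2) P Y N Z" for P Y
    using 1(3)[OF P char_close_mono[OF cc]] 2(3)[OF P char_close_mono[OF cc]] by (auto simp: less_Suc_eq)
  then show ?case using 1(1,2) 2(1,2) by (intro exI[of _ "min \<delta>1 \<delta>2"] conjI exI[of _ "T1 \<union> T2"]) auto
qed

text \<open>Uniformity over \<open>BL1\<close>: on a compact interval the functions of \<open>BL1\<close> are close to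
  combinations, with small coefficients, of finitely many ramp functions.\<close>

lemma BL1_expectation_close:
  fixes \<Psi> :: "('i::countable \<Rightarrow> real) \<Rightarrow> real" and Z :: "'i \<Rightarrow> 'b \<Rightarrow> real"
  assumes \<Psi>: "continuous_on UNIV \<Psi>" "\<And>y. 0 \<le> \<Psi> y" and J: "finite J" and Z: "tight_family J N Z" and e: "0 < e"
  shows "\<exists>\<delta>>0. \<exists>T. finite T \<and> (\<forall>(P::'a measure) Y. tight_family J P Y \<longrightarrow> char_close J T \<delta> P Y N Z \<longrightarrow>
    (\<forall>h\<in>BL1. \<bar>(LINT \<omega>|P. h (\<Psi> (coord_vec J Y \<omega>))) - (LINT \<omega>|N. h (\<Psi> (coord_vec J Z \<omega>)))\<bar> \<le> e))"
proof -
  \<comment> \<open>Replacing \<open>h\<close> by its interpolant costs at most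
    \<open>4 * d + e / 8\<close> under each measure, which this choice makes
    \<open>e / 4\<close>.\<close>
  define d where "d = e / 32"
  have d: "0 < d" using e by (simp add: d_def)
  obtain R where R: "0 < R" "real (card J) / R\<^sup>2 \<le> e / 16" using exists_box_radius[of "e / 16" "card J"] e by auto
  have "compact (\<Psi> ` coord_box J R)"
    by (rule compact_continuous_image[OF continuous_on_subset[OF \<Psi>(1) subset_UNIV] compact_coord_box])
  then obtain L where L: "\<And>y. y \<in> coord_box J R \<Longrightarrow> \<Psi> y \<le> L"
    by (metis abs_le_D1 bounded_real compact_imp_bounded imageI)
  obtain K :: nat where K: "L / d \<le> real K" using real_arch_simple by blast
  have LK: "L \<le> real K * d" using K d by (simp add: pos_divide_le_eq)
  \<comment> \<open>There are \<open>K\<close> ramps with coefficients of size at most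
    \<open>d\<close>, so their joint error is \<open>real K * d * \<kappa>\<close>, at most
    \<open>e / 2\<close>. The summand 1 guards against a zero denominator.\<close>
  define \<kappa> where "\<kappa> = e / (2 * (real K * d + 1))"
  have Kd: "0 \<le> real K * d" using d by simp
  have Kd1: "0 < 2 * (real K * d + 1)" using Kd by (intro mult_pos_pos add_nonneg_pos) auto
  have \<kappa>: "0 < \<kappa>" unfolding \<kappa>_def by (rule divide_pos_pos[OF e Kd1])
  have \<kappa>e: "real K * d * \<kappa> \<le> e / 2"
  proof -
    have "real K * d * \<kappa> \<le> (real K * d + 1) * \<kappa>" using \<kappa> by (intro mult_right_mono) auto
    also have "\<dots> = e / 2"
    proof -
      have "(c::real) * (e / (2 * c)) = e / 2" if "0 < 2 * c" for c using that by simp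
      from this[OF Kd1] show ?thesis by (simp only: \<kappa>_def)
    qed
    finally show ?thesis .
  qed
  define rho where "rho k y = ramp (\<Psi> y / d - real k)" for k :: nat and y
  have rc: "continuous_on UNIV (rho k)" for k
    unfolding rho_def ramp_def by (intro continuous_intros \<Psi>(1)) (use d in auto)
  have rb: "\<bar>rho k y\<bar> \<le> 1" for k y using ramp_bounds[of "\<Psi> y / d - real k"] by (simp add: rho_def)
  have "\<exists>\<delta>>0. \<exists>T. finite T \<and> (\<forall>(P::'a measure) Y. tight_family J P Y \<longrightarrow> char_close J T \<delta> P Y N Z \<longrightarrow>
     (\<forall>k<K. \<bar>(LINT \<omega>|P. rho k (coord_vec J Y \<omega>)) - (LINT \<omega>|N. rho k (coord_vec J Z \<omega>))\<bar> \<le> \<kappa>))"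
    by (rule finite_char_close_uniform) (rule continuous_expectation_close[OF rc rb J Z \<kappa>])
  then obtain \<delta> T where dT: "0 < \<delta>" "finite T" "\<And>(P::'a measure) Y k. tight_family J P Y \<Longrightarrow> char_close J T \<delta> P Y N Z \<Longrightarrow>
    k < K \<Longrightarrow> \<bar>(LINT \<omega>|P. rho k (coord_vec J Y \<omega>)) - (LINT \<omega>|N. rho k (coord_vec J Z \<omega>))\<bar> \<le> \<kappa>" by blast
  have hint: "\<bar>(LINT \<omega>|P. h (\<Psi> (coord_vec J Y \<omega>))) - (h 0 + (\<Sum>k<K. (h (real (Suc k) * d) - h (real k * d)) * (LINT \<omega>|P. rho k (coord_vec J Y \<omega>))))\<bar> \<le> e / 4"
    if P: "tight_family J P Y" and h: "h \<in> BL1" for P :: "'c measure" and Y and h :: "real \<Rightarrow> real"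
  proof -
    interpret prob_space P using P by (simp add: tight_family_def)
    note b = tight_family_outside_box[OF P J R(1)]
    have ri: "integrable P (\<lambda>\<omega>. rho k (coord_vec J Y \<omega>))" for k by (rule bounded_continuous_integrable[OF P rc rb])
    have ii: "interp h d K (\<Psi> (coord_vec J Y \<omega>)) = h 0 + (\<Sum>k<K. (h (real (Suc k) * d) - h (real k * d)) * rho k (coord_vec J Y \<omega>))" for \<omega>
      by (simp add: interp_def rho_def)
    have eqi: "(LINT \<omega>|P. interp h d K (\<Psi> (coord_vec J Y \<omega>))) =
      h 0 + (\<Sum>k<K. (h (real (Suc k) * d) - h (real k * d)) * (LINT \<omega>|P. rho k (coord_vec J Y \<omega>)))"
      unfolding ii using ri by (simp add: prob_space)
    have "\<bar>(LINT \<omega>|P. h (\<Psi> (coord_vec J Y \<omega>))) - (LINT \<omega>|P. interp h d K (\<Psi> (coord_vec J Y \<omega>)))\<bar> \<le>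
       2 * d + (2 + 2 * d) * prob {\<omega>\<in>space P. coord_vec J Y \<omega> \<notin> coord_box J R}"
    proof (rule expectation_diff_le[OF _ _ b(1)])
      have "continuous_on UNIV (\<lambda>y. h (\<Psi> y))"
        using continuous_on_compose2[OF BL1_continuous[OF h] \<Psi>(1)] by auto
      then show "integrable P (\<lambda>\<omega>. h (\<Psi> (coord_vec J Y \<omega>)))"
        by (rule bounded_continuous_integrable[OF P, where f = "\<lambda>y. h (\<Psi> y)"]) (rule BL1_D(1)[OF h])
      show "integrable P (\<lambda>\<omega>. interp h d K (\<Psi> (coord_vec J Y \<omega>)))"
        unfolding ii using ri by simp
      show "\<bar>h (\<Psi> (coord_vec J Y \<omega>)) - interp h d K (\<Psi> (coord_vec J Y \<omega>))\<bar> \<le> 2 * d" if "\<omega> \<in> space P - {\<omega>\<in>space P. coord_vec J Y \<omega> \<notin> coord_box J R}" for \<omega>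
        using that L LK by (intro interp_close[OF h d \<Psi>(2)]) (auto intro: order_trans)
      show "\<bar>h (\<Psi> (coord_vec J Y \<omega>)) - interp h d K (\<Psi> (coord_vec J Y \<omega>))\<bar> \<le> 2 + 2 * d" for \<omega>
      proof (cases "\<Psi> (coord_vec J Y \<omega>) \<le> real K * d")
        case True
        then show ?thesis using interp_close[OF h d \<Psi>(2) True] by linarith
      next
        case False
        then have "interp h d K (\<Psi> (coord_vec J Y \<omega>)) = h (real K * d)" by (intro interp_beyond[OF d]) simp
        then show ?thesis using BL1_D(1)[OF h, of "real K * d"] BL1_D(1)[OF h, of "\<Psi> (coord_vec J Y \<omega>)"] d by linarith
      qed
    qed (use d in auto)
    moreover have "(2 + 2 * d) * prob {\<omega>\<in>space P. coord_vec J Y \<omega> \<notin> coord_box J R} \<le> 2 * (e / 16) + 2 * d * 1"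
    proof -
      have "prob {\<omega>\<in>space P. coord_vec J Y \<omega> \<notin> coord_box J R} \<le> e / 16" using b(2) R(2) by linarith
      then show ?thesis unfolding distrib_right using d by (intro add_mono mult_left_mono) auto
    qed
    ultimately show ?thesis unfolding eqi using d_def by linarith
  qed
  have "\<bar>(LINT \<omega>|P. h (\<Psi> (coord_vec J Y \<omega>))) - (LINT \<omega>|N. h (\<Psi> (coord_vec J Z \<omega>)))\<bar> \<le> e"
    if P: "tight_family J P Y" and cc: "char_close J T \<delta> P Y N Z" and h: "h \<in> BL1" for P :: "'a measure" and Y and h :: "real \<Rightarrow> real"
  proof -
    let ?c = "\<lambda>k. h (real (Suc k) * d) - h (real k * d)"
    have c: "\<bar>?c k\<bar> \<le> d" for k
      using BL1_D(2)[OF h, of "real (Suc k) * d" "real k * d"] d by (simp add: dist_real_def distrib_right)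
    have "\<bar>(\<Sum>k<K. ?c k * (LINT \<omega>|P. rho k (coord_vec J Y \<omega>))) - (\<Sum>k<K. ?c k * (LINT \<omega>|N. rho k (coord_vec J Z \<omega>)))\<bar> =
       \<bar>\<Sum>k<K. ?c k * ((LINT \<omega>|P. rho k (coord_vec J Y \<omega>)) - (LINT \<omega>|N. rho k (coord_vec J Z \<omega>)))\<bar>"
      by (simp only: sum_subtractf[symmetric] right_diff_distrib)
    also have "\<dots> \<le> (\<Sum>k<K. \<bar>?c k * ((LINT \<omega>|P. rho k (coord_vec J Y \<omega>)) - (LINT \<omega>|N. rho k (coord_vec J Z \<omega>)))\<bar>)" by (rule sum_abs)
    also have "\<dots> \<le> (\<Sum>k<K. d * \<kappa>)"
      unfolding abs_mult using dT(3)[OF P cc] c d by (intro sum_mono mult_mono) auto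
    also have "\<dots> \<le> e / 2" using \<kappa>e by simp
    finally show ?thesis using hint[OF P h] hint[OF Z h] by linarith
  qed
  then show ?thesis using dT(1,2) by blast
qed

section \<open>Copulas, ranks and empirical copulas\<close>

lemma copula_rectangle:
  assumes "is_copula C" "0 \<le> a" "a \<le> b" "b \<le> 1" "0 \<le> c" "c \<le> d" "d \<le> 1"
  shows "C (a, d) + C (b, c) \<le> C (b, d) + C (a, c)"
  using assms unfolding is_copula_def by fastforce

lemma copula_boundary:
  assumes "is_copula C" "t \<in> {0..1}"
  shows "C (t, 0) = 0" "C (0, t) = 0" "C (t, 1) = t" "C (1, t) = t"
  using assms unfolding is_copula_def by auto

text \<open>A rectangle resting on the lower boundary gives monotonicity; one reaching the upper
  boundary, where the copula is the identity, gives the Lipschitz bound.\<close>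

lemma copula_increment:
  assumes C: "is_copula C" and ab: "0 \<le> a" "a \<le> b" "b \<le> 1" and t: "t \<in> {0..1}"
  shows "C (a, t) \<le> C (b, t)" "C (b, t) \<le> C (a, t) + (b - a)"
    "C (t, a) \<le> C (t, b)" "C (t, b) \<le> C (t, a) + (b - a)"
proof -
  have m: "a \<in> {0..1}" "b \<in> {0..1}" using ab by auto
  show "C (a, t) \<le> C (b, t)"
    using copula_rectangle[OF C ab, of 0 t] copula_boundary[OF C m(1)] copula_boundary[OF C m(2)] t by auto
  show "C (b, t) \<le> C (a, t) + (b - a)"
    using copula_rectangle[OF C ab, of t 1] copula_boundary[OF C m(1)] copula_boundary[OF C m(2)] t by auto
  show "C (t, a) \<le> C (t, b)"
    using copula_rectangle[OF C _ _ _ ab, of 0 t] copula_boundary[OF C m(1)] copula_boundary[OF C m(2)] t by auto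
  show "C (t, b) \<le> C (t, a) + (b - a)"
    using copula_rectangle[OF C _ _ _ ab, of t 1] copula_boundary[OF C m(1)] copula_boundary[OF C m(2)] t by auto
qed

lemma copula_mono:
  assumes C: "is_copula C" and uv: "u \<in> unit_square" "v \<in> unit_square" "fst u \<le> fst v" "snd u \<le> snd v"
  shows "C u \<le> C v"
proof -
  have "C (fst u, snd u) \<le> C (fst v, snd u)" by (rule copula_increment(1)[OF C]) (use uv in \<open>auto simp: unit_square_def\<close>)
  also have "\<dots> \<le> C (fst v, snd v)" by (rule copula_increment(3)[OF C]) (use uv in \<open>auto simp: unit_square_def\<close>)
  finally show ?thesis by simp
qed

lemma copula_Lipschitz:
  assumes C: "is_copula C" and uv: "u \<in> unit_square" "v \<in> unit_square"
  shows "\<bar>C u - C v\<bar> \<le> \<bar>fst u - fst v\<bar> + \<bar>snd u - snd v\<bar>"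
proof -
  have m: "fst u \<in> {0..1}" "snd u \<in> {0..1}" "fst v \<in> {0..1}" "snd v \<in> {0..1}" using uv by (auto simp: unit_square_def)
  have 1: "\<bar>C (a, t) - C (b, t)\<bar> \<le> \<bar>a - b\<bar>" if "a \<in> {0..1}" "b \<in> {0..1}" "t \<in> {0..1}" for a b t
    using copula_increment(1,2)[OF C, of a b t] copula_increment(1,2)[OF C, of b a t] that by (cases "a \<le> b") auto
  have 2: "\<bar>C (t, a) - C (t, b)\<bar> \<le> \<bar>a - b\<bar>" if "a \<in> {0..1}" "b \<in> {0..1}" "t \<in> {0..1}" for a b t
    using copula_increment(3,4)[OF C, of a b t] copula_increment(3,4)[OF C, of b a t] that by (cases "a \<le> b") auto
  show ?thesis using 1[OF m(1,3,2)] 2[OF m(2,4,3)] by simp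
qed

lemma copula_bounds:
  assumes C: "is_copula C" and u: "u \<in> unit_square"
  shows "0 \<le> C u" "C u \<le> fst u" "C u \<le> snd u" "C u \<le> 1"
proof -
  have m: "fst u \<in> {0..1}" "snd u \<in> {0..1}" using u by (auto simp: unit_square_def)
  show "0 \<le> C u" using copula_increment(1)[OF C, of 0 "fst u" "snd u"] copula_boundary[OF C m(2)] m by auto
  show *: "C u \<le> fst u" using copula_increment(3)[OF C, of "snd u" 1 "fst u"] copula_boundary[OF C m(1)] m by auto
  show "C u \<le> snd u" using copula_increment(1)[OF C, of "fst u" 1 "snd u"] copula_boundary[OF C m(2)] m by auto
  show "C u \<le> 1" using * m by simp
qed

section \<open>Ranks and the empirical copula\<close>

definition rank_below :: "nat \<Rightarrow> (nat \<Rightarrow> real \<times> real) \<Rightarrow> nat \<Rightarrow> nat \<Rightarrow> nat" where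
  "rank_below n x p i = card {j. j < n \<and> coord p (x j) < coord p (x i)}"

abbreviation ranked_below :: "nat \<Rightarrow> (nat \<Rightarrow> real \<times> real) \<Rightarrow> real \<times> real \<Rightarrow> nat set" where
  "ranked_below n x \<equiv> below n (rank_below n x 1) (rank_below n x 2)"

lemma emp_marginal_card: "emp_marginal n x p t = real (card {j. j < n \<and> coord p (x j) \<le> t}) / real n"
proof -
  have "{..<n} \<inter> {j. coord p (x j) \<le> t} = {j. j < n \<and> coord p (x j) \<le> t}" by auto
  then show ?thesis by (simp add: emp_marginal_def sum_of_bool_eq)
qed

lemma rank_below_less: "i < n \<Longrightarrow> rank_below n x p i < n"
proof -
  assume i: "i < n"
  have "card {j. j < n \<and> coord p (x j) < coord p (x i)} \<le> card ({..<n} - {i})"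
    by (rule card_mono) auto
  then show ?thesis using i by (simp add: rank_below_def)
qed

text \<open>An observation lies at or below the quantile iff the empirical distribution function is
  below \<open>t\<close> everywhere to the left of it, and just to its left that function equals
  rank over \<open>n\<close>. The case \<open>t = 0\<close>, with quantile minus infinity, is
  included.\<close>

lemma le_gen_inv_iff_rank:
  assumes n: "0 < n" and i: "i < n"
  shows "ereal (coord p (x i)) \<le> gen_inv (emp_marginal n x p) t \<longleftrightarrow> real (rank_below n x p i) < real n * t"
proof -
  let ?c = "\<lambda>j. coord p (x j)"
  have 1: "ereal (?c i) \<le> gen_inv (emp_marginal n x p) t \<longleftrightarrow> (\<forall>y. t \<le> emp_marginal n x p y \<longrightarrow> ?c i \<le> y)"
    unfolding gen_inv_def le_Inf_iff by auto
  show ?thesis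
  proof
    assume "ereal (?c i) \<le> gen_inv (emp_marginal n x p) t"
    then have *: "emp_marginal n x p y < t" if "y < ?c i" for y using 1 that by (meson not_le)
    define S where "S = ?c ` {j. j < n \<and> ?c j < ?c i}"
    \<comment> \<open>The largest observation below the given one, where the left limit is attained;
      if there is none, any smaller point does.\<close>
    define y where "y = (if S = {} then ?c i - 1 else Max S)"
    have fS: "finite S" by (simp add: S_def)
    have y: "y < ?c i"
    proof (cases "S = {}")
      case False
      then have "Max S \<in> S" using fS by (intro Max_in) auto
      then show ?thesis using False by (auto simp: y_def S_def)
    qed (simp add: y_def)
    have "{j. j < n \<and> ?c j \<le> y} = {j. j < n \<and> ?c j < ?c i}"
    proof (intro Collect_cong conj_cong refl iffI)
      fix j assume "j < n" "?c j < ?c i"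
      then have "?c j \<in> S" by (auto simp: S_def)
      then show "?c j \<le> y" using fS by (auto simp: y_def)
    qed (use y in auto)
    then have "real (rank_below n x p i) / real n < t" using *[OF y] by (simp add: emp_marginal_card rank_below_def)
    then show "real (rank_below n x p i) < real n * t" using n by (simp add: pos_divide_less_eq mult.commute)
  next
    assume r: "real (rank_below n x p i) < real n * t"
    have "\<not> t \<le> emp_marginal n x p y" if "y < ?c i" for y
    proof -
      have "card {j. j < n \<and> ?c j \<le> y} \<le> card {j. j < n \<and> ?c j < ?c i}"
        by (rule card_mono) (use that in auto)
      then have "real (card {j. j < n \<and> ?c j \<le> y}) < real n * t" using r by (simp add: rank_below_def)
      then show ?thesis using n by (simp add: emp_marginal_card not_le pos_divide_less_eq mult.commute)
    qed
    then show "ereal (?c i) \<le> gen_inv (emp_marginal n x p) t" using 1 by (meson not_le)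
  qed
qed

lemma below_quantiles_iff:
  assumes "0 < n" "i < n"
  shows "(ereal (fst (x i)) \<le> fst (marginal_quantiles n x u) \<and> ereal (snd (x i)) \<le> snd (marginal_quantiles n x u)) \<longleftrightarrow>
    i \<in> ranked_below n x u"
  using le_gen_inv_iff_rank[OF assms, of 1 x "fst u"] le_gen_inv_iff_rank[OF assms, of 2 x "snd u"] assms
  by (simp add: marginal_quantiles_def below_def coord_def)

lemma sum_of_bool_quantiles:
  assumes "0 < n"
  shows "(\<Sum>i<n. f i * of_bool (ereal (fst (x i)) \<le> fst (marginal_quantiles n x u) \<and> ereal (snd (x i)) \<le> snd (marginal_quantiles n x u))) =
    (\<Sum>i\<in>ranked_below n x u. f i :: real)"
proof -
  have "(\<Sum>i<n. f i * of_bool (ereal (fst (x i)) \<le> fst (marginal_quantiles n x u) \<and> ereal (snd (x i)) \<le> snd (marginal_quantiles n x u))) =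
    (\<Sum>i<n. if i \<in> ranked_below n x u then f i else 0)"
    using below_quantiles_iff[OF assms] by (intro sum.cong refl) auto
  also have "\<dots> = (\<Sum>i\<in>{..<n} \<inter> ranked_below n x u. f i)" by (rule sum.inter_restrict[symmetric]) simp
  also have "{..<n} \<inter> ranked_below n x u = ranked_below n x u" using below_subset by blast
  finally show ?thesis .
qed

lemma emp_copula_card:
  assumes "0 < n" shows "emp_copula n x u = real (card (ranked_below n x u)) / real n"
  using sum_of_bool_quantiles[OF assms, of "\<lambda>_. 1" x u] by (simp add: emp_copula_def emp_df_def)

lemma mult_copula_sum:
  assumes "0 < n" shows "mult_copula n x w u = (\<Sum>i\<in>ranked_below n x u. w i / mean n w) / real n"
  using sum_of_bool_quantiles[OF assms, of "\<lambda>i. w i / mean n w" x u] by (simp add: mult_copula_def)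

lemma mult_process_sum:
  assumes "0 < n"
  shows "mult_process n x w u = (\<Sum>i\<in>ranked_below n x u. (w i / mean n w - 1) / sqrt (real n))"
proof -
  have "mult_process n x w u = sqrt (real n) / real n * (\<Sum>i\<in>ranked_below n x u. w i / mean n w - 1)"
    unfolding mult_process_def mult_copula_sum[OF assms] emp_copula_card[OF assms] sum_subtractf
    by (simp add: right_diff_distrib del: One_nat_def)
  also have "sqrt (real n) / real n = 1 / sqrt (real n)" using assms by (simp add: real_div_sqrt field_simps)
  finally show ?thesis by (simp add: sum_divide_distrib)
qed

lemma ranked_below_one: "ranked_below n x (1, 1) = {..<n}"
  using rank_below_less by (auto simp: below_def)

lemma mean_eq_partial_sum:
  assumes "0 < n"
  shows "mean n w = 1 + mult_partial_sum n (rank_below n x 1) (rank_below n x 2) w (1, 1) / sqrt (real n)"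
  using assms unfolding mult_partial_sum_def ranked_below_one mean_def sum_subtractf by (simp add: field_simps)

text \<open>With \<open>m\<close> for the mean multiplier,
  \<open>w i / m - 1 = ((w i - 1) - (m - 1)) / m\<close>; summing the constant part over the counted
  indices produces \<open>emp_copula n x u * Z (1, 1)\<close>.\<close>

lemma mult_process_eq_partial_sum:
  fixes n x w defines "Z \<equiv> mult_partial_sum n (rank_below n x 1) (rank_below n x 2) w"
  assumes n: "0 < n" and m: "mean n w \<noteq> 0"
  shows "mult_process n x w u = (Z u - emp_copula n x u * Z (1, 1)) / mean n w"
proof -
  let ?b = "ranked_below n x u" and ?m = "mean n w"
  have s: "0 < sqrt (real n)" using n by simp
  have Z11: "Z (1, 1) = (?m - 1) * sqrt (real n)" using mean_eq_partial_sum[OF n, of w x] s by (simp add: Z_def)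
  have "(\<Sum>i\<in>?b. w i / ?m - 1) = ((\<Sum>i\<in>?b. w i - 1) - real (card ?b) * (?m - 1)) / ?m"
  proof -
    have "w i / ?m - 1 = ((w i - 1) - (?m - 1)) / ?m" for i using m by (simp add: field_simps)
    then have "(\<Sum>i\<in>?b. w i / ?m - 1) = (\<Sum>i\<in>?b. (w i - 1) - (?m - 1)) / ?m"
      by (simp only: sum_divide_distrib)
    also have "(\<Sum>i\<in>?b. (w i - 1) - (?m - 1)) = (\<Sum>i\<in>?b. w i - 1) - real (card ?b) * (?m - 1)"
      by (simp only: sum_subtractf[of "\<lambda>i. w i - 1" "\<lambda>_. ?m - 1"] sum_constant)
    finally show ?thesis .
  qed
  then have "mult_process n x w u = (((\<Sum>i\<in>?b. w i - 1) - real (card ?b) * (?m - 1)) / ?m) / sqrt (real n)"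
    unfolding mult_process_sum[OF n] by (simp add: sum_divide_distrib[symmetric])
  also have "\<dots> = (Z u - emp_copula n x u * Z (1, 1)) / ?m"
  proof -
    have *: "real (card ?b) * (?m - 1) / sqrt (real n) = emp_copula n x u * Z (1, 1)"
    proof -
      have "c * k / a = c / (a * a) * (k * a)" if "0 < a" for a c k :: real using that by simp
      from this[OF s, of "real (card ?b)" "?m - 1"] show ?thesis unfolding emp_copula_card[OF n] Z11 by simp
    qed
    have "((A - B) / m) / s = (A / s - B / s) / m" for A B m s :: real
      by (simp add: diff_divide_distrib mult.commute)
    moreover have "Z u = (\<Sum>i\<in>?b. w i - 1) / sqrt (real n)" by (simp only: Z_def mult_partial_sum_def)
    ultimately show ?thesis using * by presburger
  qed
  finally show ?thesis .
qed

definition no_ties :: "nat \<Rightarrow> (nat \<Rightarrow> real \<times> real) \<Rightarrow> bool" where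
  "no_ties n x \<longleftrightarrow> (\<forall>p\<in>{1, 2}. inj_on (\<lambda>i. coord p (x i)) {..<n})"

lemma inj_on_rank_below:
  assumes "inj_on (\<lambda>i. coord p (x i)) {..<n}" shows "inj_on (rank_below n x p) {..<n}"
proof (rule inj_onI)
  let ?c = "\<lambda>j. coord p (x j)"
  have less: "rank_below n x p i < rank_below n x p j" if "?c i < ?c j" "i < n" for i j
    unfolding rank_below_def by (rule psubset_card_mono) (use that in auto)
  fix i j assume ij: "i \<in> {..<n}" "j \<in> {..<n}" "rank_below n x p i = rank_below n x p j"
  then have "?c i = ?c j" using less[of i j] less[of j i] by fastforce
  then show "i = j" using assms ij by (auto dest: inj_onD)
qed

lemma no_ties_inj: "no_ties n x \<Longrightarrow> p \<in> {1, 2} \<Longrightarrow> inj_on (rank_below n x p) {..<n}"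
  unfolding no_ties_def using inj_on_rank_below by blast

text \<open>Without ties the ranks are a permutation of 0, ..., \<open>n - 1\<close>, so the count
  is \<open>real n * t\<close> rounded up.\<close>

lemma card_rank_less:
  assumes "inj_on (rank_below n x p) {..<n}" "0 < n" "t \<in> {0..1}"
  shows "\<bar>real (card {i. i < n \<and> real (rank_below n x p i) < real n * t}) / real n - t\<bar> \<le> 1 / real n"
proof -
  let ?S = "{i. i < n \<and> real (rank_below n x p i) < real n * t}" and ?r = "rank_below n x p"
  have "?r ` {..<n} \<subseteq> {..<n}" using rank_below_less by auto
  then have surj: "?r ` {..<n} = {..<n}" using assms(1) by (intro card_subset_eq) (auto simp: card_image)
  have im: "?r ` ?S = {..<nat \<lceil>real n * t\<rceil>}"
  proof (intro equalityI subsetI)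
    fix k assume "k \<in> {..<nat \<lceil>real n * t\<rceil>}"
    then have k: "real k < real n * t" by (simp add: real_less_iff_nat_ceiling)
    have "real n * t \<le> real n" using assms(3) by (simp add: mult_left_le)
    then have "k \<in> ?r ` {..<n}" using surj k by auto
    then show "k \<in> ?r ` ?S" using k by auto
  qed (auto simp: real_less_iff_nat_ceiling)
  have "inj_on ?r ?S" by (rule inj_on_subset[OF assms(1)]) auto
  then have "card ?S = nat \<lceil>real n * t\<rceil>" using im by (simp flip: card_image)
  moreover have "0 \<le> real n * t" using assms(3) by simp
  ultimately have "\<bar>real (card ?S) - real n * t\<bar> \<le> 1" by linarith
  then have "\<bar>real (card ?S) - real n * t\<bar> / real n \<le> 1 / real n" by (intro divide_right_mono) auto
  moreover have "real (card ?S) / real n - t = (real (card ?S) - real n * t) / real n"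
    using assms(2) by (simp add: diff_divide_distrib)
  ultimately show ?thesis by (simp only: abs_divide abs_of_nat)
qed

text \<open>The empirical copula is not a copula. Without ties, however, moving one coordinate adds
  at most the observations whose rank falls into a window, which is the Lipschitz bound up to one
  observation per coordinate.\<close>

lemma emp_copula_approx_Lipschitz:
  assumes nt: "no_ties n x" and n: "0 < n"
  shows "\<bar>emp_copula n x u - emp_copula n x v\<bar> \<le> \<bar>fst u - fst v\<bar> + \<bar>snd u - snd v\<bar> + 2 / real n"
proof -
  let ?r = "rank_below n x 1" and ?s = "rank_below n x 2"
  have inj: "inj_on ?r {..<n}" "inj_on ?s {..<n}" using no_ties_inj[OF nt] by auto
  have one: "emp_copula n x u \<le> emp_copula n x v + (\<bar>fst u - fst v\<bar> + \<bar>snd u - snd v\<bar> + 2 / real n)" for u v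
  proof -
    let ?A = "{i\<in>{..<n}. real n * fst v \<le> real (?r i) \<and> real (?r i) < real n * max (fst u) (fst v)}"
    let ?B = "{i\<in>{..<n}. real n * snd v \<le> real (?s i) \<and> real (?s i) < real n * max (snd u) (snd v)}"
    have A: "real (card ?A) \<le> real n * max (fst u) (fst v) - real n * fst v + 1"
      by (rule card_rank_window[OF inj(1)]) (auto intro: mult_left_mono)
    have B: "real (card ?B) \<le> real n * max (snd u) (snd v) - real n * snd v + 1"
      by (rule card_rank_window[OF inj(2)]) (auto intro: mult_left_mono)
    have "ranked_below n x u \<subseteq> ranked_below n x v \<union> (?A \<union> ?B)"
    proof
      fix i assume i: "i \<in> ranked_below n x u"
      have "real n * fst u \<le> real n * max (fst u) (fst v)" "real n * snd u \<le> real n * max (snd u) (snd v)"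
        by (auto intro: mult_left_mono)
      moreover have "i < n" "real (?r i) < real n * fst u" "real (?s i) < real n * snd u" using i by (auto simp: below_def)
      ultimately have "i < n" "real (?r i) < real n * max (fst u) (fst v)" "real (?s i) < real n * max (snd u) (snd v)" by linarith+
      then show "i \<in> ranked_below n x v \<union> (?A \<union> ?B)"
        unfolding below_def Un_iff mem_Collect_eq lessThan_iff by (meson not_less)
    qed
    then have "card (ranked_below n x u) \<le> card (ranked_below n x v \<union> (?A \<union> ?B))" by (intro card_mono) auto
    also have "\<dots> \<le> card (ranked_below n x v) + (card ?A + card ?B)"
      by (meson add_left_mono card_Un_le order_trans)
    finally have "real (card (ranked_below n x u)) \<le> real (card (ranked_below n x v)) + real (card ?A) + real (card ?B)" by linarith
    also have "\<dots> \<le> real (card (ranked_below n x v)) + real n * (max (fst u) (fst v) - fst v) + real n * (max (snd u) (snd v) - snd v) + 2"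
      using A B by (simp add: right_diff_distrib)
    also have "\<dots> \<le> real (card (ranked_below n x v)) + real n * \<bar>fst u - fst v\<bar> + real n * \<bar>snd u - snd v\<bar> + 2"
      by (intro add_mono mult_left_mono order_refl) auto
    finally have "real (card (ranked_below n x u)) / real n \<le>
      (real (card (ranked_below n x v)) + real n * \<bar>fst u - fst v\<bar> + real n * \<bar>snd u - snd v\<bar> + 2) / real n"
      by (rule divide_right_mono) simp
    then show ?thesis unfolding emp_copula_card[OF n] using n by (simp add: add_divide_distrib)
  qed
  show ?thesis using one[of u v] one[of v u] by (simp add: abs_le_iff abs_minus_commute)
qed

lemma emp_copula_bounds:
  assumes "0 < n" shows "0 \<le> emp_copula n x u" "emp_copula n x u \<le> 1"
proof -
  have "card (ranked_below n x u) \<le> card {..<n}" by (rule card_mono[OF _ below_subset]) simp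
  then show "0 \<le> emp_copula n x u" "emp_copula n x u \<le> 1" using assms unfolding emp_copula_card[OF assms] by (auto simp: divide_le_eq)
qed

text \<open>The value at (1, 1) vanishes thanks to the division by the mean; if the mean is 0, the
  convention for division gives \<open>- sqrt (real n)\<close> instead. These zeros anchor the
  equicontinuity argument near the boundary.\<close>

lemma mult_process_boundary:
  assumes "0 < n"
  shows "mult_process n x w (0, t) = 0" "mult_process n x w (t, 0) = 0"
    "mean n w \<noteq> 0 \<Longrightarrow> mult_process n x w (1, 1) = 0"
proof -
  have "ranked_below n x (0, t) = {}" "ranked_below n x (t, 0) = {}" by (auto simp: below_def)
  then show "mult_process n x w (0, t) = 0" "mult_process n x w (t, 0) = 0"
    by (simp_all add: mult_process_sum[OF assms])
  have "emp_copula n x (1, 1) = 1" using assms by (simp add: emp_copula_card ranked_below_one del: One_nat_def)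
  then show "mean n w \<noteq> 0 \<Longrightarrow> mult_process n x w (1, 1) = 0"
    using mult_process_eq_partial_sum[OF assms] by simp
qed

section \<open>The statistics as functionals\<close>

lemma unit_cube_nonempty: "(0, 0, 0) \<in> unit_cube" by (simp add: unit_cube_def)

lemma unit_cube_sets: "unit_cube \<in> sets lebesgue" "emeasure lebesgue unit_cube = 1" "measure lebesgue unit_cube = 1"
proof -
  have eq: "unit_cube = cbox (0, 0, 0) (1, 1, 1)" by (auto simp: unit_cube_def cbox_Pair_eq)
  show "unit_cube \<in> sets lebesgue" unfolding eq by simp
  have "measure lborel (cbox (0::real, 0::real, 0::real) (1, 1, 1)) = 1"
    by (simp add: content_Pair)
  then show "measure lebesgue unit_cube = 1" unfolding eq by simp
  then show "emeasure lebesgue unit_cube = 1" unfolding eq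
    by (metis emeasure_eq_ennreal_measure ennreal_1 fmeasurableD2 lmeasurable_cbox top.not_eq_extremum)
qed

abbreviation cube_measure :: "(real \<times> real \<times> real) measure" where
  "cube_measure \<equiv> lebesgue_on unit_cube"

lemma prob_space_cube: "prob_space cube_measure"
  by (rule prob_spaceI) (use unit_cube_sets in \<open>simp add: emeasure_restrict_space\<close>)

lemma L2_stat_integrable:
  fixes f :: "_ \<Rightarrow> real"
  assumes "f \<in> borel_measurable cube_measure" "\<And>v. v \<in> unit_cube \<Longrightarrow> \<bar>f v\<bar> \<le> b"
  shows "integrable cube_measure (\<lambda>v. (f v)\<^sup>2)"
proof -
  interpret prob_space cube_measure by (rule prob_space_cube)
  have b: "(f v)\<^sup>2 \<le> b\<^sup>2" if "v \<in> unit_cube" for v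
    using power_mono[OF assms(2)[OF that] abs_ge_zero, of 2] by simp
  show ?thesis by (rule integrable_const_bound[of _ "b\<^sup>2"]) (use assms(1) b in \<open>auto intro!: AE_I2\<close>)
qed

lemma KS_stat_bdd: "(\<And>v. v \<in> unit_cube \<Longrightarrow> \<bar>f v\<bar> \<le> b) \<Longrightarrow> bdd_above ((\<lambda>v. \<bar>f v\<bar>) ` unit_cube)"
  by (auto intro!: bdd_aboveI[of _ b])

lemma KS_stat_upper: "(\<And>v. v \<in> unit_cube \<Longrightarrow> \<bar>f v\<bar> \<le> b) \<Longrightarrow> KS_stat f \<le> b"
  unfolding KS_stat_def using unit_cube_nonempty by (intro cSUP_least) auto

lemma KS_stat_lower:
  assumes "v \<in> unit_cube" "\<And>v. v \<in> unit_cube \<Longrightarrow> \<bar>f v\<bar> \<le> b" shows "\<bar>f v\<bar> \<le> KS_stat f"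
  unfolding KS_stat_def by (intro cSUP_upper assms(1) KS_stat_bdd[OF assms(2)])

lemma KS_stat_diff:
  assumes d: "\<And>v. v \<in> unit_cube \<Longrightarrow> \<bar>f v - g v\<bar> \<le> a" and g: "\<And>v. v \<in> unit_cube \<Longrightarrow> \<bar>g v\<bar> \<le> b"
  shows "\<bar>KS_stat f - KS_stat g\<bar> \<le> a"
proof -
  have f: "\<bar>f v\<bar> \<le> a + b" if "v \<in> unit_cube" for v using d[OF that] g[OF that] by linarith
  have "KS_stat f \<le> KS_stat g + a"
  proof (rule KS_stat_upper)
    fix v assume v: "v \<in> unit_cube"
    have "\<bar>g v\<bar> \<le> KS_stat g" by (rule KS_stat_lower[OF v]) (rule g)
    then show "\<bar>f v\<bar> \<le> KS_stat g + a" using d[OF v] by linarith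
  qed
  moreover have "KS_stat g \<le> KS_stat f + a"
  proof (rule KS_stat_upper)
    fix v assume v: "v \<in> unit_cube"
    have "\<bar>f v\<bar> \<le> KS_stat f" by (rule KS_stat_lower[OF v]) (rule f)
    then show "\<bar>g v\<bar> \<le> KS_stat f + a" using d[OF v] by linarith
  qed
  ultimately show ?thesis by linarith
qed

lemma L2_stat_diff:
  assumes fm: "f \<in> borel_measurable cube_measure" and gm: "g \<in> borel_measurable cube_measure"
    and d: "\<And>v. v \<in> unit_cube \<Longrightarrow> \<bar>f v - g v\<bar> \<le> a" and g: "\<And>v. v \<in> unit_cube \<Longrightarrow> \<bar>g v\<bar> \<le> b"
  shows "\<bar>L2_stat f - L2_stat g\<bar> \<le> a * (2 * b + a)"
proof -
  interpret prob_space cube_measure by (rule prob_space_cube)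
  have f: "\<bar>f v\<bar> \<le> a + b" if "v \<in> unit_cube" for v using d[OF that] g[OF that] by linarith
  have ab: "0 \<le> a" "0 \<le> b" using d[OF unit_cube_nonempty] g[OF unit_cube_nonempty] by linarith+
  have sq: "\<bar>(f v)\<^sup>2 - (g v)\<^sup>2\<bar> \<le> a * (2 * b + a)" if v: "v \<in> unit_cube" for v
  proof -
    have "(f v)\<^sup>2 - (g v)\<^sup>2 = (f v - g v) * (f v + g v)" by (simp add: power2_eq_square algebra_simps)
    moreover have "\<bar>f v - g v\<bar> * \<bar>f v + g v\<bar> \<le> a * (2 * b + a)"
      using d[OF v] g[OF v] f[OF v] ab by (intro mult_mono) linarith+
    ultimately show ?thesis by (simp add: abs_mult)
  qed
  have "\<bar>L2_stat f - L2_stat g\<bar> \<le> a * (2 * b + a) + a * (2 * b + a) * prob {}"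
    unfolding L2_stat_def
  proof (rule expectation_diff_le)
    show "integrable cube_measure (\<lambda>v. (f v)\<^sup>2)" by (rule L2_stat_integrable[OF fm f])
    show "integrable cube_measure (\<lambda>v. (g v)\<^sup>2)" by (rule L2_stat_integrable[OF gm g])
  qed (use sq ab in auto)
  then show ?thesis by simp
qed

text \<open>One modulus for both statistics: the supremum is 1-Lipschitz, which the summand 1
  covers, and the difference of two squares is at most \<open>a * (2 * b + a)\<close>.\<close>

lemma stat_diff:
  assumes s: "stat \<in> {L2_stat, KS_stat}"
    and fm: "f \<in> borel_measurable cube_measure" and gm: "g \<in> borel_measurable cube_measure"
    and d: "\<And>v. v \<in> unit_cube \<Longrightarrow> \<bar>f v - g v\<bar> \<le> a" and g: "\<And>v. v \<in> unit_cube \<Longrightarrow> \<bar>g v\<bar> \<le> b"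
  shows "\<bar>stat f - stat g\<bar> \<le> a * (2 * b + a + 1)"
proof -
  have ab: "0 \<le> a" "0 \<le> b" using d[OF unit_cube_nonempty] g[OF unit_cube_nonempty] by linarith+
  have 1: "a \<le> a * (2 * b + a + 1)" using mult_left_mono[of 1 "2 * b + a + 1" a] ab by simp
  have 2: "a * (2 * b + a) \<le> a * (2 * b + a + 1)" using ab by (intro mult_left_mono) auto
  have "\<bar>KS_stat f - KS_stat g\<bar> \<le> a" by (rule KS_stat_diff) (rule d, assumption, rule g)
  moreover have "\<bar>L2_stat f - L2_stat g\<bar> \<le> a * (2 * b + a)" by (rule L2_stat_diff[OF fm gm]) (rule d, assumption, rule g)
  ultimately show ?thesis using s 1 2 by auto
qed

lemma stat_nonneg:
  assumes "stat \<in> {L2_stat, KS_stat}" "\<And>v. v \<in> unit_cube \<Longrightarrow> \<bar>f v\<bar> \<le> b"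
  shows "0 \<le> stat f"
proof -
  have "0 \<le> L2_stat f" unfolding L2_stat_def by simp
  moreover have "\<bar>f (0, 0, 0)\<bar> \<le> KS_stat f" by (rule KS_stat_lower[OF unit_cube_nonempty]) (rule assms(2))
  then have "0 \<le> KS_stat f" by (rule order_trans[OF abs_ge_zero])
  ultimately show ?thesis using assms(1) by auto
qed

lemma stat_cong:
  assumes "stat \<in> {L2_stat, KS_stat}" "\<And>v. v \<in> unit_cube \<Longrightarrow> f v = g v"
  shows "stat f = stat g"
proof -
  have "L2_stat f = L2_stat g" unfolding L2_stat_def by (rule Bochner_Integration.integral_cong) (use assms(2) in auto)
  moreover have "KS_stat f = KS_stat g" unfolding KS_stat_def by (rule SUP_cong) (use assms(2) in auto)
  ultimately show ?thesis using assms(1) by auto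
qed

text \<open>As a function of finitely many coefficients the statistic is continuous. This gives
  measurability of suprema over the cube and allows the convergence theorem to be applied to grid
  values.\<close>

lemma stat_linear_continuous:
  fixes f :: "'i::countable \<Rightarrow> real \<times> real \<times> real \<Rightarrow> real"
  assumes s: "stat \<in> {L2_stat, KS_stat}" and J: "finite J"
    and fm: "\<And>j. j \<in> J \<Longrightarrow> f j \<in> borel_measurable cube_measure"
    and fb: "\<And>j v. j \<in> J \<Longrightarrow> v \<in> unit_cube \<Longrightarrow> \<bar>f j v\<bar> \<le> b"
  shows "continuous_on UNIV (\<lambda>y. stat (\<lambda>v. \<Sum>j\<in>J. y j * f j v))"
proof -
  define F where "F y = (\<lambda>v. \<Sum>j\<in>J. y j * f j v)" for y
  have Fm: "F y \<in> borel_measurable cube_measure" for y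
    unfolding F_def by (intro borel_measurable_sum borel_measurable_times fm) auto
  have Fb: "\<bar>F y v\<bar> \<le> b * (\<Sum>j\<in>J. \<bar>y j\<bar>)" if v: "v \<in> unit_cube" for y v
  proof -
    have "\<bar>F y v\<bar> \<le> (\<Sum>j\<in>J. \<bar>y j * f j v\<bar>)" unfolding F_def by (rule sum_abs)
    also have "\<dots> \<le> (\<Sum>j\<in>J. \<bar>y j\<bar> * b)"
      using fb[OF _ v] by (intro sum_mono) (auto simp: abs_mult intro!: mult_left_mono)
    finally show ?thesis by (simp add: sum_distrib_left mult.commute)
  qed
  have Fd: "F y v - F z v = F (\<lambda>j. y j - z j) v" for y z v
    by (simp add: F_def left_diff_distrib sum_subtractf)
  have "((\<lambda>y. stat (F y)) \<longlongrightarrow> stat (F z)) (at z within UNIV)" for z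
  proof -
    define \<rho> where "\<rho> y = b * (\<Sum>j\<in>J. \<bar>y j - z j\<bar>)" for y :: "'i \<Rightarrow> real"
    have "continuous_on UNIV (\<lambda>y :: 'i \<Rightarrow> real. \<rho> y * (2 * (b * (\<Sum>j\<in>J. \<bar>z j\<bar>)) + \<rho> y + 1))"
      unfolding \<rho>_def by (intro continuous_intros continuous_on_product_coordinates)
    then have "((\<lambda>y. \<rho> y * (2 * (b * (\<Sum>j\<in>J. \<bar>z j\<bar>)) + \<rho> y + 1)) \<longlongrightarrow>
       \<rho> z * (2 * (b * (\<Sum>j\<in>J. \<bar>z j\<bar>)) + \<rho> z + 1)) (at z within UNIV)"
      by (auto simp: continuous_on_def)
    moreover have "\<rho> z = 0" by (simp add: \<rho>_def)
    ultimately have lim: "((\<lambda>y. \<rho> y * (2 * (b * (\<Sum>j\<in>J. \<bar>z j\<bar>)) + \<rho> y + 1)) \<longlongrightarrow> 0) (at z within UNIV)"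
      by simp
    have "\<bar>stat (F y) - stat (F z)\<bar> \<le> \<rho> y * (2 * (b * (\<Sum>j\<in>J. \<bar>z j\<bar>)) + \<rho> y + 1)" for y
    proof (rule stat_diff[OF s Fm Fm _ Fb])
      fix v assume "v \<in> unit_cube"
      then show "\<bar>F y v - F z v\<bar> \<le> \<rho> y" unfolding Fd \<rho>_def by (rule Fb)
    qed
    then have "((\<lambda>y. stat (F y) - stat (F z)) \<longlongrightarrow> 0) (at z within UNIV)"
      by (intro Lim_null_comparison[OF always_eventually lim]) auto
    then show ?thesis by (rule LIM_zero_cancel)
  qed
  then show ?thesis unfolding continuous_on_def F_def by blast
qed

section \<open>Perturbation of the process formulas\<close>

lemma H_form_diff: "H_form C d A v - H_form C d A' v = H_form C d (\<lambda>u. A u - A' u) v"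
  by (cases v) (simp add: H_form_def G_form_def algebra_simps)

lemma G_form_sum: "G_form d (\<lambda>u. \<Sum>j\<in>J. y j * e j u) u = (\<Sum>j\<in>J. y j * G_form d (e j) u)"
  by (simp add: G_form_def sum_subtractf[symmetric] sum_distrib_left)
    (intro sum.cong refl, simp add: algebra_simps)

lemma H_form_sum: "H_form C d (\<lambda>u. \<Sum>j\<in>J. y j * e j u) v = (\<Sum>j\<in>J. y j * H_form C d (e j) v)"
proof (cases v)
  case (fields a b c)
  show ?thesis unfolding H_form_def fields prod.case G_form_sum sum_distrib_left
    sum_subtractf[symmetric] sum.distrib[symmetric]
    by (intro sum.cong refl) (simp add: algebra_simps)
qed

lemma unit_square_iff: "(a, b) \<in> unit_square \<longleftrightarrow> 0 \<le> a \<and> a \<le> 1 \<and> 0 \<le> b \<and> b \<le> 1"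
  by (auto simp: unit_square_def)

lemma G_form_bound:
  assumes d: "\<And>p u. p \<in> {1, 2} \<Longrightarrow> u \<in> unit_square \<Longrightarrow> \<bar>d p u\<bar> \<le> K"
    and A: "\<And>u. u \<in> unit_square \<Longrightarrow> \<bar>A u\<bar> \<le> R" and u: "u \<in> unit_square"
  shows "\<bar>G_form d A u\<bar> \<le> (1 + 2 * K) * R"
proof -
  have m: "(fst u, 1) \<in> unit_square" "(1, snd u) \<in> unit_square" using u by (auto simp: unit_square_def)
  have "\<bar>d 1 u * A (fst u, 1)\<bar> \<le> K * R" unfolding abs_mult using d[of 1 u] A[OF m(1)] u by (intro mult_mono) auto
  moreover have "\<bar>d 2 u * A (1, snd u)\<bar> \<le> K * R" unfolding abs_mult using d[of 2 u] A[OF m(2)] u by (intro mult_mono) auto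
  moreover have "(1 + 2 * K) * R = R + K * R + K * R" by (simp add: algebra_simps)
  ultimately show ?thesis using A[OF u] unfolding G_form_def by linarith
qed

lemma H_form_bound:
  assumes C: "\<And>u. u \<in> unit_square \<Longrightarrow> 0 \<le> C u \<and> C u \<le> 1"
    and d: "\<And>p u. p \<in> {1, 2} \<Longrightarrow> u \<in> unit_square \<Longrightarrow> \<bar>d p u\<bar> \<le> K"
    and A: "\<And>u. u \<in> unit_square \<Longrightarrow> \<bar>A u\<bar> \<le> R" and K: "1 \<le> K" and v: "v \<in> unit_cube"
  shows "\<bar>H_form C d A v\<bar> \<le> 12 * K\<^sup>2 * R"
proof -
  obtain x y z where v': "v = (x, y, z)" by (cases v)
  have xyz: "(x, y) \<in> unit_square" "(y, z) \<in> unit_square" using v by (auto simp: v' unit_cube_def unit_square_def)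
  have m: "(x, C (y, z)) \<in> unit_square" "(C (x, y), z) \<in> unit_square"
    using C[OF xyz(1)] C[OF xyz(2)] xyz by (auto simp: unit_square_iff)
  have R: "0 \<le> R" using A[OF xyz(1)] by linarith
  let ?g = "(1 + 2 * K) * R"
  have g: "\<bar>G_form d A u\<bar> \<le> ?g" if "u \<in> unit_square" for u
    by (rule G_form_bound) (use d A that in auto)
  have 1: "\<bar>d 2 (x, C (y, z)) * G_form d A (y, z)\<bar> \<le> K * ?g"
    unfolding abs_mult using d[OF _ m(1), of 2] g[OF xyz(2)] K by (intro mult_mono) auto
  have 2: "\<bar>d 1 (C (x, y), z) * G_form d A (x, y)\<bar> \<le> K * ?g"
    unfolding abs_mult using d[OF _ m(2), of 1] g[OF xyz(1)] K by (intro mult_mono) auto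
  have "\<bar>H_form C d A v\<bar> \<le> ?g + ?g + K * ?g + K * ?g"
    unfolding H_form_def v' prod.case using g[OF m(1)] g[OF m(2)] 1 2 by linarith
  also have "\<dots> = (2 + 2 * K) * (1 + 2 * K) * R" by (simp add: algebra_simps)
  also have "\<dots> \<le> (4 * K) * (3 * K) * R" using K R by (intro mult_mono mult_right_mono) auto
  also have "\<dots> = 12 * K\<^sup>2 * R" by (simp add: power2_eq_square)
  finally show ?thesis .
qed

text \<open>The estimated derivatives are close to the true ones only away from the boundary. Near the
  boundary of the strips the path \<open>A\<close> is small, and where \<open>C (y, z)\<close> is near \<open>0\<close> or \<open>1\<close> the factor
  \<open>G_form d A (y, z)\<close> is small.\<close>

locale perturbed_path =
  fixes C C' A :: "real \<times> real \<Rightarrow> real" and d d' :: "nat \<Rightarrow> real \<times> real \<Rightarrow> real"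
    and K R \<epsilon> \<delta> \<eta> \<theta> :: real
  assumes copula: "is_copula C"
    and C': "\<And>u. u \<in> unit_square \<Longrightarrow> 0 \<le> C' u \<and> C' u \<le> 1" "\<And>u. u \<in> unit_square \<Longrightarrow> \<bar>C' u - C u\<bar> \<le> \<theta>"
    and K: "1 \<le> K" and pos: "0 \<le> \<epsilon>" "0 \<le> \<eta>" "0 < \<delta>" "\<theta> \<le> \<delta> / 2" "\<eta> * R \<le> \<epsilon>"
    and d: "\<And>p u. p \<in> {1, 2} \<Longrightarrow> u \<in> unit_square \<Longrightarrow> \<bar>d p u\<bar> \<le> K"
    and d': "\<And>p u. p \<in> {1, 2} \<Longrightarrow> u \<in> unit_square \<Longrightarrow> \<bar>d' p u\<bar> \<le> K"
    and A: "\<And>u. u \<in> unit_square \<Longrightarrow> \<bar>A u\<bar> \<le> R"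
    and A0: "\<And>t. A (0, t) = 0" "\<And>t. A (t, 0) = 0" "A (1, 1) = 0"
    and Ac: "\<And>u v. u \<in> unit_square \<Longrightarrow> v \<in> unit_square \<Longrightarrow> \<bar>fst u - fst v\<bar> \<le> \<delta> \<Longrightarrow> \<bar>snd u - snd v\<bar> \<le> \<delta> \<Longrightarrow> \<bar>A u - A v\<bar> \<le> \<epsilon>"
    and est: "\<And>p u. p \<in> {1, 2} \<Longrightarrow> u \<in> unit_square \<Longrightarrow> \<delta> / 2 \<le> coord p u \<Longrightarrow> coord p u \<le> 1 - \<delta> / 2 \<Longrightarrow> \<bar>d' p u - d p u\<bar> \<le> \<eta>"
    and dc: "\<And>p u v. p \<in> {1, 2} \<Longrightarrow> u \<in> unit_square \<Longrightarrow> v \<in> unit_square \<Longrightarrow> \<delta> / 2 \<le> coord p u \<Longrightarrow> coord p u \<le> 1 - \<delta> / 2 \<Longrightarrow>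
      \<delta> / 2 \<le> coord p v \<Longrightarrow> coord p v \<le> 1 - \<delta> / 2 \<Longrightarrow> \<bar>fst u - fst v\<bar> \<le> \<theta> \<Longrightarrow> \<bar>snd u - snd v\<bar> \<le> \<theta> \<Longrightarrow> \<bar>d p u - d p v\<bar> \<le> \<eta>"
    and small: "\<And>u. u \<in> unit_square \<Longrightarrow> C u \<le> \<delta> \<Longrightarrow>
      \<bar>A u\<bar> \<le> \<epsilon> \<and> \<bar>d 1 u * A (fst u, 1)\<bar> \<le> \<epsilon> \<and> \<bar>d 2 u * A (1, snd u)\<bar> \<le> \<epsilon>"
begin

lemma theta_nonneg: "0 \<le> \<theta>" using C'(2)[of "(0, 0)"] by (simp add: unit_square_def)

text \<open>The alternative in the fifth premise is the case split between interior and boundary: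
  either the derivative factors are close, or the other factor is small.\<close>

lemma product_diff:
  assumes "\<bar>a'\<bar> \<le> K" "\<bar>a\<bar> \<le> K" "\<bar>b' - b\<bar> \<le> g" "0 \<le> g" "\<bar>a' - a\<bar> \<le> 2 * \<eta> \<or> \<bar>b\<bar> \<le> h" "\<bar>b\<bar> \<le> r" "0 \<le> h"
  shows "\<bar>a' * b' - a * b\<bar> \<le> K * g + 2 * \<eta> * r + 2 * K * h"
proof -
  have "a' * b' - a * b = a' * (b' - b) + (a' - a) * b" by (simp add: algebra_simps)
  moreover have "\<bar>a' * (b' - b)\<bar> \<le> K * g" unfolding abs_mult using assms K by (intro mult_mono) auto
  moreover have "\<bar>(a' - a) * b\<bar> \<le> 2 * \<eta> * r + 2 * K * h"
    using assms(5)
  proof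
    assume *: "\<bar>a' - a\<bar> \<le> 2 * \<eta>"
    have "\<bar>(a' - a) * b\<bar> \<le> 2 * \<eta> * r" unfolding abs_mult using * assms pos by (intro mult_mono) auto
    moreover have "0 \<le> 2 * K * h" using K assms by simp
    ultimately show ?thesis by linarith
  next
    assume *: "\<bar>b\<bar> \<le> h"
    have "\<bar>(a' - a) * b\<bar> \<le> 2 * K * h" unfolding abs_mult using * assms K by (intro mult_mono) linarith+
    moreover have "0 \<le> 2 * \<eta> * r" using pos assms by (intro mult_nonneg_nonneg) linarith+
    ultimately show ?thesis by linarith
  qed
  ultimately show ?thesis by linarith
qed

text \<open>A point at distance \<open>\<delta>\<close> from the boundary stays at distance
  \<open>\<delta> / 2\<close> after a move by \<open>\<theta>\<close>, where both \<open>est\<close>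
  and \<open>dc\<close> apply.\<close>

lemma derivative_close:
  assumes p: "p \<in> {1, 2}" and u: "u \<in> unit_square" "u' \<in> unit_square" "\<bar>fst u - fst u'\<bar> \<le> \<theta>" "\<bar>snd u - snd u'\<bar> \<le> \<theta>"
    and int: "\<delta> \<le> coord p u" "coord p u \<le> 1 - \<delta>"
  shows "\<bar>d' p u' - d p u\<bar> \<le> 2 * \<eta>"
proof -
  have "\<bar>coord p u - coord p u'\<bar> \<le> \<theta>" using u by (simp add: coord_def)
  then have b: "\<delta> / 2 \<le> coord p u'" "coord p u' \<le> 1 - \<delta> / 2" "\<delta> / 2 \<le> coord p u" "coord p u \<le> 1 - \<delta> / 2"
    using int pos by linarith+
  show ?thesis using est[OF p u(2) b(1,2)] dc[OF p u(1,2) b(3,4,1,2) u(3,4)] by linarith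
qed

text \<open>The marginal paths vanish at both ends of the unit interval, so equicontinuity controls
  them near the ends.\<close>

lemma margin_small:
  assumes "t \<in> {0..1}" "t < \<delta> \<or> 1 - \<delta> < t"
  shows "\<bar>A (t, 1)\<bar> \<le> \<epsilon>" "\<bar>A (1, t)\<bar> \<le> \<epsilon>"
proof -
  have "\<bar>A (t, 1)\<bar> \<le> \<epsilon> \<and> \<bar>A (1, t)\<bar> \<le> \<epsilon>"
    using assms(2)
  proof
    assume "t < \<delta>"
    then show ?thesis using Ac[of "(t, 1)" "(0, 1)"] Ac[of "(1, t)" "(1, 0)"] assms A0 pos by (simp add: unit_square_iff)
  next
    assume "1 - \<delta> < t"
    then show ?thesis using Ac[of "(t, 1)" "(1, 1)"] Ac[of "(1, t)" "(1, 1)"] assms A0 pos by (simp add: unit_square_iff)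
  qed
  then show "\<bar>A (t, 1)\<bar> \<le> \<epsilon>" "\<bar>A (1, t)\<bar> \<le> \<epsilon>" by auto
qed

text \<open>The path term contributes \<open>\<epsilon>\<close> and each of the two products
  \<open>2 * \<epsilon> + 3 * K * \<epsilon>\<close>, where
  \<open>\<eta> * R \<le> \<epsilon>\<close> has been used.\<close>

lemma G_form_close:
  assumes u: "u \<in> unit_square" "u' \<in> unit_square" "\<bar>fst u - fst u'\<bar> \<le> \<theta>" "\<bar>snd u - snd u'\<bar> \<le> \<theta>"
  shows "\<bar>G_form d' A u' - G_form d A u\<bar> \<le> (5 + 6 * K) * \<epsilon>"
proof -
  have c: "fst u \<in> {0..1}" "snd u \<in> {0..1}" "fst u' \<in> {0..1}" "snd u' \<in> {0..1}" using u by (auto simp: unit_square_def)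
  have td: "\<theta> \<le> \<delta>" using pos by linarith
  have 0: "\<bar>A u' - A u\<bar> \<le> \<epsilon>" using Ac[OF u(2,1)] u td by (simp add: abs_minus_commute)
  have a1: "\<bar>A (fst u', 1) - A (fst u, 1)\<bar> \<le> \<epsilon>" using c u(3) td pos by (intro Ac) (auto simp: unit_square_iff)
  have a2: "\<bar>A (1, snd u') - A (1, snd u)\<bar> \<le> \<epsilon>" using c u(4) td pos by (intro Ac) (auto simp: unit_square_iff)
  have dK: "\<bar>d' 1 u'\<bar> \<le> K" "\<bar>d 1 u\<bar> \<le> K" "\<bar>d' 2 u'\<bar> \<le> K" "\<bar>d 2 u\<bar> \<le> K"
    using d[of 1 u] d'[of 1 u'] d[of 2 u] d'[of 2 u'] u by simp_all
  have AR: "\<bar>A (fst u, 1)\<bar> \<le> R" "\<bar>A (1, snd u)\<bar> \<le> R" using c by (auto intro!: A simp: unit_square_iff)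
  have e1: "\<bar>d' 1 u' - d 1 u\<bar> \<le> 2 * \<eta> \<or> \<bar>A (fst u, 1)\<bar> \<le> \<epsilon>"
  proof (cases "fst u < \<delta> \<or> 1 - \<delta> < fst u")
    case True then show ?thesis using margin_small(1)[OF c(1)] by blast
  next
    case False then show ?thesis using derivative_close[of 1, OF _ u] by (simp add: coord_def)
  qed
  have e2: "\<bar>d' 2 u' - d 2 u\<bar> \<le> 2 * \<eta> \<or> \<bar>A (1, snd u)\<bar> \<le> \<epsilon>"
  proof (cases "snd u < \<delta> \<or> 1 - \<delta> < snd u")
    case True then show ?thesis using margin_small(2)[OF c(2)] by blast
  next
    case False then show ?thesis using derivative_close[of 2, OF _ u] by (simp add: coord_def)
  qed
  note 1 = product_diff[OF dK(1,2) a1 pos(1) e1 AR(1) pos(1)]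
  note 2 = product_diff[OF dK(3,4) a2 pos(1) e2 AR(2) pos(1)]
  have "(5 + 6 * K) * \<epsilon> = \<epsilon> + 4 * \<epsilon> + 6 * (K * \<epsilon>)" by (simp add: algebra_simps)
  then show ?thesis using 0 1 2 pos(5) unfolding G_form_def mult.assoc by linarith
qed

text \<open>If \<open>C u\<close> is near 1, both coordinates are, since \<open>C u\<close> lies
  below each of them, and every path term is anchored at (1, 1). If \<open>C u\<close> is near 0,
  the hypothesis \<open>small\<close> applies; its origin is that the derivatives vanish at zeros of
  the copula.\<close>

lemma G_form_small:
  assumes u: "u \<in> unit_square" and "C u < \<delta> \<or> 1 - \<delta> < C u"
  shows "\<bar>G_form d A u\<bar> \<le> (3 + 2 * K) * \<epsilon>"
  using assms(2)
proof
  assume "C u < \<delta>"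
  then have "\<bar>G_form d A u\<bar> \<le> 3 * \<epsilon>" using small[OF u] unfolding G_form_def by linarith
  also have "\<dots> \<le> (3 + 2 * K) * \<epsilon>" using pos K by (intro mult_right_mono) auto
  finally show ?thesis .
next
  assume "1 - \<delta> < C u"
  then have f: "1 - \<delta> < fst u" "1 - \<delta> < snd u" using copula_bounds[OF copula u] by linarith+
  have c: "fst u \<in> {0..1}" "snd u \<in> {0..1}" using u by (auto simp: unit_square_def)
  have 0: "\<bar>A u\<bar> \<le> \<epsilon>" using Ac[OF u, of "(1, 1)"] f c A0 by (simp add: unit_square_iff)
  have 1: "\<bar>d 1 u * A (fst u, 1)\<bar> \<le> K * \<epsilon>"
    unfolding abs_mult using d[of 1 u] u margin_small(1)[OF c(1)] f K by (intro mult_mono) auto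
  have 2: "\<bar>d 2 u * A (1, snd u)\<bar> \<le> K * \<epsilon>"
    unfolding abs_mult using d[of 2 u] u margin_small(2)[OF c(2)] f K by (intro mult_mono) auto
  have "(3 + 2 * K) * \<epsilon> = 3 * \<epsilon> + K * \<epsilon> + K * \<epsilon>" by (simp add: algebra_simps)
  then show ?thesis using 0 1 2 pos unfolding G_form_def by linarith
qed

lemma H_form_close:
  assumes v: "v \<in> unit_cube"
  shows "\<bar>H_form C' d' A v - H_form C d A v\<bar> \<le> 80 * K\<^sup>2 * \<epsilon>"
proof -
  obtain x y z where v': "v = (x, y, z)" by (cases v)
  have xyz: "(x, y) \<in> unit_square" "(y, z) \<in> unit_square" using v by (auto simp: v' unit_cube_def unit_square_def)
  note bd = copula_bounds[OF copula xyz(1)] copula_bounds[OF copula xyz(2)] C'(1)[OF xyz(1)] C'(1)[OF xyz(2)]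
  have m: "(x, C (y, z)) \<in> unit_square" "(C (x, y), z) \<in> unit_square" "(x, C' (y, z)) \<in> unit_square" "(C' (x, y), z) \<in> unit_square"
    using bd xyz by (auto simp: unit_square_iff)
  note t = C'(2)[OF xyz(1)] C'(2)[OF xyz(2)] theta_nonneg
  let ?g = "(5 + 6 * K) * \<epsilon>" and ?r = "(1 + 2 * K) * R" and ?h = "(3 + 2 * K) * \<epsilon>"
  have gh: "0 \<le> ?g" "0 \<le> ?h" using K pos by auto
  have 1: "\<bar>G_form d' A (x, C' (y, z)) - G_form d A (x, C (y, z))\<bar> \<le> ?g"
    by (rule G_form_close[OF m(1) m(3)]) (use t in \<open>auto simp: abs_minus_commute\<close>)
  have 2: "\<bar>G_form d' A (C' (x, y), z) - G_form d A (C (x, y), z)\<bar> \<le> ?g"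
    by (rule G_form_close[OF m(2) m(4)]) (use t in \<open>auto simp: abs_minus_commute\<close>)
  have dK: "\<bar>d' 2 (x, C' (y, z))\<bar> \<le> K" "\<bar>d 2 (x, C (y, z))\<bar> \<le> K" "\<bar>d' 1 (C' (x, y), z)\<bar> \<le> K" "\<bar>d 1 (C (x, y), z)\<bar> \<le> K"
    using d[OF _ m(1), of 2] d'[OF _ m(3), of 2] d[OF _ m(2), of 1] d'[OF _ m(4), of 1] by simp_all
  have Gd: "\<bar>G_form d' A (y, z) - G_form d A (y, z)\<bar> \<le> ?g" "\<bar>G_form d' A (x, y) - G_form d A (x, y)\<bar> \<le> ?g"
    using G_form_close[OF xyz(2) xyz(2)] G_form_close[OF xyz(1) xyz(1)] t(3) by simp_all
  have Gr: "\<bar>G_form d A (y, z)\<bar> \<le> ?r" "\<bar>G_form d A (x, y)\<bar> \<le> ?r"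
    by (rule G_form_bound; use d A xyz in blast)+
  have e3: "\<bar>d' 2 (x, C' (y, z)) - d 2 (x, C (y, z))\<bar> \<le> 2 * \<eta> \<or> \<bar>G_form d A (y, z)\<bar> \<le> ?h"
  proof (cases "C (y, z) < \<delta> \<or> 1 - \<delta> < C (y, z)")
    case True then show ?thesis using G_form_small[OF xyz(2)] by blast
  next
    case False then show ?thesis using derivative_close[of 2, OF _ m(1) m(3)] t by (simp add: coord_def abs_minus_commute)
  qed
  have e4: "\<bar>d' 1 (C' (x, y), z) - d 1 (C (x, y), z)\<bar> \<le> 2 * \<eta> \<or> \<bar>G_form d A (x, y)\<bar> \<le> ?h"
  proof (cases "C (x, y) < \<delta> \<or> 1 - \<delta> < C (x, y)")
    case True then show ?thesis using G_form_small[OF xyz(1)] by blast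
  next
    case False then show ?thesis using derivative_close[of 1, OF _ m(2) m(4)] t by (simp add: coord_def abs_minus_commute)
  qed
  note 3 = product_diff[OF dK(1,2) Gd(1) gh(1) e3 Gr(1) gh(2)]
  note 4 = product_diff[OF dK(3,4) Gd(2) gh(1) e4 Gr(2) gh(2)]
  have "\<bar>H_form C' d' A v - H_form C d A v\<bar> \<le> 2 * ?g + 2 * (K * ?g + 2 * \<eta> * ?r + 2 * K * ?h)"
  proof -
    have tri: "\<bar>(a' - b' + c' - e') - (a - b + c - e)\<bar> \<le> 2 * g + 2 * h"
      if "\<bar>a' - a\<bar> \<le> g" "\<bar>b' - b\<bar> \<le> g" "\<bar>c' - c\<bar> \<le> h" "\<bar>e' - e\<bar> \<le> h" for a a' b b' c c' e e' g h :: real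
      using that by linarith
    show ?thesis unfolding H_form_def v' prod.case by (rule tri[OF 1 2 3 4])
  qed
  \<comment> \<open>The error of the derivatives is multiplied by the size of the path. The
    condition \<open>\<eta> * R \<le> \<epsilon>\<close> is imposed to turn this product into a
    multiple of \<open>\<epsilon>\<close>.\<close>
  also have "2 * \<eta> * ?r \<le> 2 * (1 + 2 * K) * \<epsilon>"
    using mult_left_mono[OF pos(5), of "2 * (1 + 2 * K)"] K by (simp add: algebra_simps)
  also have "2 * ?g + 2 * (K * ?g + 2 * (1 + 2 * K) * \<epsilon> + 2 * K * ?h) = (14 + 42 * K + 20 * K\<^sup>2) * \<epsilon>"
    by (simp add: algebra_simps power2_eq_square)
  also have "\<dots> \<le> 80 * K\<^sup>2 * \<epsilon>"
  proof (rule mult_right_mono)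
    have "K * 1 \<le> K * K" "1 * 1 \<le> K * K" using K by (intro mult_mono; simp)+
    then show "14 + 42 * K + 20 * K\<^sup>2 \<le> 80 * K\<^sup>2" unfolding power2_eq_square by linarith
  qed (rule pos)
  finally show ?thesis by simp
qed

end

section \<open>Copulas with continuous partial derivatives\<close>

locale smooth_copula =
  fixes C :: "real \<times> real \<Rightarrow> real"
  assumes C: "is_copula C"
    and partial_exists: "\<And>p u. p \<in> {1, 2} \<Longrightarrow> u \<in> strip p \<Longrightarrow>
      (\<lambda>t. C (replace_coord p t u)) field_differentiable (at (coord p u))"
    and partial_continuous: "\<And>p. p \<in> {1, 2} \<Longrightarrow> continuous_on (strip p) (dotC C p)"
begin

lemma strip_iff: "u \<in> strip p \<longleftrightarrow> u \<in> unit_square \<and> 0 < coord p u \<and> coord p u < 1"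
  by (simp add: strip_def)

lemma dotC_eq_0: "u \<in> unit_square \<Longrightarrow> u \<notin> strip p \<Longrightarrow> dotC C p u = 0"
  by (auto simp: strip_iff dotC_def)

lemma replace_coord_same [simp]: "replace_coord p (coord p u) u = u"
  by (simp add: replace_coord_def coord_def)

lemma replace_coord_in: "u \<in> unit_square \<Longrightarrow> 0 \<le> t \<Longrightarrow> t \<le> 1 \<Longrightarrow> replace_coord p t u \<in> unit_square"
  by (auto simp: replace_coord_def unit_square_def)

lemma partial_derivative:
  assumes "p \<in> {1, 2}" "u \<in> strip p"
  shows "((\<lambda>t. C (replace_coord p t u)) has_real_derivative dotC C p u) (at (coord p u))"
  using partial_exists[OF assms] assms(2) unfolding strip_iff
  by (simp add: dotC_def DERIV_deriv_iff_field_differentiable)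

lemma section_increment:
  assumes u: "u \<in> unit_square" and ab: "0 \<le> a" "a \<le> b" "b \<le> 1"
  shows "0 \<le> C (replace_coord p b u) - C (replace_coord p a u)" "C (replace_coord p b u) - C (replace_coord p a u) \<le> b - a"
  using copula_increment[OF C ab, of "snd u"] copula_increment[OF C ab, of "fst u"] u
  by (auto simp: replace_coord_def unit_square_def)

text \<open>The difference quotients of a nondecreasing 1-Lipschitz section lie in [0, 1]; off the
  strip the value is 0 by convention.\<close>

lemma dotC_bounds:
  assumes p: "p \<in> {1, 2}" and u: "u \<in> unit_square"
  shows "0 \<le> dotC C p u \<and> dotC C p u \<le> 1"
proof (cases "u \<in> strip p")
  case True
  let ?f = "\<lambda>t. C (replace_coord p t u)" and ?t = "coord p u"
  have t: "0 < ?t" "?t < 1" using True by (auto simp: strip_iff)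
  have lim: "((\<lambda>h. (?f (?t + h) - ?f ?t) / h) \<longlongrightarrow> dotC C p u) (at 0)"
    using partial_derivative[OF p True] by (simp add: DERIV_def)
  have "\<forall>\<^sub>F h in at (0::real). 0 \<le> (?f (?t + h) - ?f ?t) / h \<and> (?f (?t + h) - ?f ?t) / h \<le> 1"
    unfolding eventually_at
  proof (intro exI[of _ "min ?t (1 - ?t)"] conjI ballI impI)
    fix h :: real assume h: "h \<noteq> 0 \<and> dist h 0 < min ?t (1 - ?t)"
    then have hb: "0 \<le> ?t + h" "?t + h \<le> 1" by (auto simp: dist_real_def abs_less_iff)
    have "0 \<le> (?f (?t + h) - ?f ?t) / h \<and> (?f (?t + h) - ?f ?t) / h \<le> 1"
    proof (cases "0 < h")
      case True
      then show ?thesis using section_increment[OF u, of ?t "?t + h" p] hb t by (simp add: pos_divide_le_eq)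
    next
      case False
      then have "h < 0" using h by auto
      then show ?thesis using section_increment[OF u, of "?t + h" ?t p] hb t
        by (auto simp: neg_divide_le_eq divide_nonpos_nonpos)
    qed
    then show "0 \<le> (?f (?t + h) - ?f ?t) / h" "(?f (?t + h) - ?f ?t) / h \<le> 1" by auto
  qed (use t in auto)
  then show ?thesis
    using tendsto_lowerbound[OF lim, of 0] tendsto_upperbound[OF lim, of 1] by (auto simp: eventually_conj_iff)
next
  case False
  then show ?thesis using dotC_eq_0[OF u] by simp
qed

lemma abs_dotC_le: "p \<in> {1, 2} \<Longrightarrow> u \<in> unit_square \<Longrightarrow> \<bar>dotC C p u\<bar> \<le> 1"
  using dotC_bounds[of p u] by (simp add: abs_le_iff)

text \<open>A compact part of \<open>strip p\<close>, on which continuity of the derivative becomes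
  uniform; the consistency assumption on the estimators concerns these sets.\<close>

definition inner_strip :: "nat \<Rightarrow> real \<Rightarrow> (real \<times> real) set" where
  "inner_strip p a = {u \<in> unit_square. a \<le> coord p u \<and> coord p u \<le> 1 - a}"

lemma compact_unit_square: "compact unit_square"
  unfolding unit_square_def by (intro compact_Times compact_Icc)

lemma continuous_coord: "continuous_on S (coord p)"
  unfolding coord_def by (cases "p = 1") (auto intro!: continuous_intros)

lemma compact_inner_strip: "compact (inner_strip p a)"
proof -
  have "inner_strip p a = unit_square \<inter> (coord p -` {a..1 - a})" by (auto simp: inner_strip_def)
  moreover have "closed (coord p -` {a..1 - a})"
    by (intro continuous_closed_vimage closed_atLeastAtMost) (use continuous_coord[of UNIV] in \<open>auto simp: continuous_on_eq_continuous_at\<close>)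
  ultimately show ?thesis using compact_unit_square by (simp add: compact_Int_closed)
qed

lemma inner_strip_subset: "0 < a \<Longrightarrow> inner_strip p a \<subseteq> strip p"
  by (auto simp: inner_strip_def strip_def)

lemma continuous_on_copula: "continuous_on unit_square C"
proof (rule continuous_onI)
  fix u e assume u: "u \<in> unit_square" and e: "0 < (e::real)"
  have "dist (C v) (C u) \<le> e" if "v \<in> unit_square" "dist v u < e / 2" for v
  proof -
    have "\<bar>fst v - fst u\<bar> \<le> dist v u" "\<bar>snd v - snd u\<bar> \<le> dist v u"
      using dist_fst_le[of v u] dist_snd_le[of v u] by (auto simp: dist_real_def)
    then show ?thesis using copula_Lipschitz[OF C that(1) u] that(2) by (simp add: dist_real_def)
  qed
  then show "\<exists>d>0. \<forall>v\<in>unit_square. dist v u < d \<longrightarrow> dist (C v) (C u) \<le> e"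
    using e by (intro exI[of _ "e / 2"]) auto
qed

lemma dotC_uniformly_continuous:
  assumes p: "p \<in> {1, 2}" and a: "0 < a" and \<eta>: "0 < \<eta>"
  shows "\<exists>\<theta>>0. \<forall>u\<in>inner_strip p a. \<forall>v\<in>inner_strip p a.
    \<bar>fst u - fst v\<bar> \<le> \<theta> \<longrightarrow> \<bar>snd u - snd v\<bar> \<le> \<theta> \<longrightarrow> \<bar>dotC C p u - dotC C p v\<bar> \<le> \<eta>"
proof -
  have "uniformly_continuous_on (inner_strip p a) (dotC C p)"
    by (intro compact_uniformly_continuous compact_inner_strip continuous_on_subset[OF partial_continuous[OF p] inner_strip_subset[OF a]])
  then obtain d where d: "0 < d" "\<And>u v. u \<in> inner_strip p a \<Longrightarrow> v \<in> inner_strip p a \<Longrightarrow> dist v u < d \<Longrightarrow> dist (dotC C p v) (dotC C p u) < \<eta>"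
    unfolding uniformly_continuous_on_def using \<eta> by metis
  have "\<bar>dotC C p u - dotC C p v\<bar> \<le> \<eta>"
    if "u \<in> inner_strip p a" "v \<in> inner_strip p a" "\<bar>fst u - fst v\<bar> \<le> d / 3" "\<bar>snd u - snd v\<bar> \<le> d / 3" for u v
  proof -
    have "dist v u \<le> \<bar>fst v - fst u\<bar> + \<bar>snd v - snd u\<bar>"
      unfolding dist_prod_def dist_real_def using sqrt_sum_squares_le_sum_abs[of "fst v - fst u" "snd v - snd u"] by simp
    then have "dist v u < d" using that d(1) by linarith
    from d(2)[OF that(1,2) this] show ?thesis by (simp add: dist_real_def)
  qed
  then show ?thesis using d(1) by (intro exI[of _ "d / 3"]) auto
qed

text \<open>A zero of the copula is a minimum of its sections, so the derivative vanishes there.\<close>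

lemma dotC_small:
  assumes p: "p \<in> {1, 2}" and a: "0 < a" and \<eta>: "0 < \<eta>"
  shows "\<exists>\<delta>>0. \<forall>u\<in>inner_strip p a. C u \<le> \<delta> \<longrightarrow> dotC C p u \<le> \<eta>"
proof -
  define S where "S = {u\<in>inner_strip p a. \<eta> \<le> dotC C p u}"
  have cS: "compact S"
  proof -
    have "closedin (top_of_set (inner_strip p a)) (inner_strip p a \<inter> dotC C p -` {\<eta>..})"
      by (intro continuous_closedin_preimage continuous_on_subset[OF partial_continuous[OF p] inner_strip_subset[OF a]]) auto
    then have "compact (inner_strip p a \<inter> dotC C p -` {\<eta>..})"
      using compact_inner_strip closedin_compact by blast
    moreover have "S = inner_strip p a \<inter> dotC C p -` {\<eta>..}" by (auto simp: S_def)
    ultimately show ?thesis by simp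
  qed
  show ?thesis
  proof (cases "S = {}")
    case True
    then have "dotC C p u \<le> \<eta>" if "u \<in> inner_strip p a" for u
    proof -
      have "u \<notin> S" using True by simp
      then show ?thesis using that unfolding S_def by simp
    qed
    then show ?thesis by (intro exI[of _ 1]) auto
  next
    case False
    have SU: "S \<subseteq> unit_square" by (auto simp: S_def inner_strip_def)
    \<comment> \<open>\<open>u\<close> minimises the copula over the compact set of points with a
      large derivative. Since the derivative vanishes at zeros of the copula, the minimum is
      positive, and half of it serves as the threshold.\<close>
    obtain u where u: "u \<in> S" "\<And>v. v \<in> S \<Longrightarrow> C u \<le> C v"
      using continuous_attains_inf[OF cS False continuous_on_subset[OF continuous_on_copula SU]] by auto
    have us: "u \<in> strip p" "u \<in> unit_square" using u(1) inner_strip_subset[OF a] SU by (auto simp: S_def)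
    have t: "0 < coord p u" "coord p u < 1" using us by (auto simp: strip_iff)
    have "C u \<noteq> 0"
    proof
      assume 0: "C u = 0"
      have "dotC C p u = 0"
      proof (rule DERIV_local_min[OF partial_derivative[OF p us(1)]])
        show "0 < min (coord p u) (1 - coord p u)" using t by auto
        show "\<forall>y. \<bar>coord p u - y\<bar> < min (coord p u) (1 - coord p u) \<longrightarrow> C (replace_coord p (coord p u) u) \<le> C (replace_coord p y u)"
        proof (intro allI impI)
          fix y assume "\<bar>coord p u - y\<bar> < min (coord p u) (1 - coord p u)"
          then have "0 \<le> y" "y \<le> 1" by linarith+
          then show "C (replace_coord p (coord p u) u) \<le> C (replace_coord p y u)"
            using copula_bounds(1)[OF C replace_coord_in[OF us(2)]] 0 by simp
        qed
      qed
      then show False using u(1) \<eta> by (simp add: S_def)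
    qed
    then have pos: "0 < C u" using copula_bounds(1)[OF C us(2)] by simp
    have "dotC C p v \<le> \<eta>" if "v \<in> inner_strip p a" "C v \<le> C u / 2" for v
    proof (rule ccontr)
      assume "\<not> dotC C p v \<le> \<eta>"
      then have "v \<in> S" using that by (simp add: S_def)
      then show False using u(2)[of v] that(2) pos by simp
    qed
    then show ?thesis using pos by (intro exI[of _ "C u / 2"]) auto
  qed
qed

lemma sets_strip: "strip p \<in> sets borel"
proof -
  have "strip p = unit_square \<inter> coord p -` {0<..<1}" by (auto simp: strip_def)
  moreover have "unit_square \<in> sets borel" using compact_unit_square by (simp add: borel_compact)
  moreover have "open (coord p -` {0<..<1})"
    using continuous_coord[of UNIV p] by (intro open_vimage) auto
  ultimately show ?thesis by auto
qed

end

section \<open>Measurability of the process formula on the cube\<close>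

lemma borel_projections:
  "(\<lambda>u :: real \<times> real. fst u) \<in> borel_measurable borel" "(\<lambda>u :: real \<times> real. snd u) \<in> borel_measurable borel"
  "(\<lambda>v :: real \<times> real \<times> real. fst v) \<in> borel_measurable borel" "(\<lambda>v :: real \<times> real \<times> real. snd v) \<in> borel_measurable borel"
  "(\<lambda>v :: real \<times> real \<times> real. fst (snd v)) \<in> borel_measurable borel" "(\<lambda>v :: real \<times> real \<times> real. snd (snd v)) \<in> borel_measurable borel"
  by (intro borel_measurable_continuous_onI continuous_intros)+

lemma H_form_borel:
  fixes C A :: "real \<times> real \<Rightarrow> real"
  assumes "C \<in> borel_measurable borel" "d 1 \<in> borel_measurable borel" "d 2 \<in> borel_measurable borel" "A \<in> borel_measurable borel"
  shows "H_form C d A \<in> borel_measurable borel"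
proof -
  have eq: "H_form C d A = (\<lambda>v. G_form d A (fst v, C (snd v)) - G_form d A (C (fst v, fst (snd v)), snd (snd v))
     + d 2 (fst v, C (snd v)) * G_form d A (snd v) - d 1 (C (fst v, fst (snd v)), snd (snd v)) * G_form d A (fst v, fst (snd v)))"
    by (auto simp: H_form_def)
  note proj = borel_projections
  have G: "G_form d A \<in> borel_measurable borel"
    unfolding G_form_def
    by (intro borel_measurable_diff borel_measurable_times assms
        measurable_compose[OF borel_measurable_Pair[OF proj(1) borel_measurable_const] assms(4)]
        measurable_compose[OF borel_measurable_Pair[OF borel_measurable_const proj(2)] assms(4)])
  have c1: "(\<lambda>v :: real \<times> real \<times> real. (fst v, C (snd v))) \<in> borel_measurable borel"
    by (intro borel_measurable_Pair proj measurable_compose[OF proj(4) assms(1)])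
  have c3: "(\<lambda>v :: real \<times> real \<times> real. (fst v, fst (snd v))) \<in> borel_measurable borel"
    by (intro borel_measurable_Pair proj)
  have c2: "(\<lambda>v :: real \<times> real \<times> real. (C (fst v, fst (snd v)), snd (snd v))) \<in> borel_measurable borel"
    by (intro borel_measurable_Pair proj measurable_compose[OF c3 assms(1)])
  show ?thesis unfolding eq
    by (intro borel_measurable_add borel_measurable_diff borel_measurable_times
        measurable_compose[OF c1 G] measurable_compose[OF c2 G] measurable_compose[OF c3 G] measurable_compose[OF proj(4) G]
        measurable_compose[OF c1 assms(3)] measurable_compose[OF c2 assms(2)])
qed

lemma borel_measurable_cube:
  fixes f :: "real \<times> real \<times> real \<Rightarrow> real"
  assumes "f \<in> borel_measurable borel" shows "f \<in> borel_measurable cube_measure"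
  using assms by (intro measurable_restrict_space1 measurable_completion) simp

lemma H_form_cong:
  assumes CU: "\<And>u. u \<in> unit_square \<Longrightarrow> 0 \<le> C u \<and> C u \<le> 1"
    and "\<And>u. u \<in> unit_square \<Longrightarrow> C u = C' u" "\<And>p u. p \<in> {1, 2} \<Longrightarrow> u \<in> unit_square \<Longrightarrow> d p u = d' p u"
      "\<And>u. u \<in> unit_square \<Longrightarrow> A u = A' u" and v: "v \<in> unit_cube"
  shows "H_form C d A v = H_form C' d' A' v"
proof -
  obtain x y z where v': "v = (x, y, z)" by (cases v)
  have xyz: "(x, y) \<in> unit_square" "(y, z) \<in> unit_square" using v by (auto simp: v' unit_cube_def unit_square_def)
  have m: "(x, C (y, z)) \<in> unit_square" "(C (x, y), z) \<in> unit_square"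
    using CU[OF xyz(1)] CU[OF xyz(2)] xyz by (auto simp: unit_square_iff)
  have g: "G_form d A u = G_form d' A' u" if "u \<in> unit_square" for u
  proof -
    have "(fst u, 1) \<in> unit_square" "(1, snd u) \<in> unit_square" using that by (auto simp: unit_square_def)
    then show ?thesis using assms that by (simp add: G_form_def)
  qed
  show ?thesis
    using g[OF m(1)] g[OF m(2)] g[OF xyz(1)] g[OF xyz(2)] assms(2)[OF xyz(1)] assms(2)[OF xyz(2)]
      assms(3)[of 2, OF _ m(1)] assms(3)[of 1, OF _ m(2)]
    by (simp add: H_form_def v')
qed

context smooth_copula
begin

lemma C01: "u \<in> unit_square \<Longrightarrow> 0 \<le> C u \<and> C u \<le> 1"
  using copula_bounds[OF C] by auto

lemma H_form_measurable:
  assumes A: "A \<in> borel_measurable borel"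
  shows "H_form C (dotC C) A \<in> borel_measurable cube_measure"
proof -
  \<comment> \<open>The copula and its derivatives are controlled only on the square and the strips.
    Their extensions by 0 are Borel on the whole plane, and the process formula reads only values
    inside the square.\<close>
  define C' where "C' u = indicat_real unit_square u *\<^sub>R C u" for u
  define d' where "d' p u = indicat_real (strip p) u *\<^sub>R dotC C p u" for p :: nat and u
  have "C' \<in> borel_measurable borel" unfolding C'_def
    using borel_measurable_continuous_on_indicator[OF borel_compact[OF compact_unit_square] continuous_on_copula] by simp
  moreover have "d' p \<in> borel_measurable borel" if "p \<in> {1, 2}" for p
    unfolding d'_def using borel_measurable_continuous_on_indicator[OF sets_strip partial_continuous[OF that]] by simp
  ultimately have "H_form C' d' A \<in> borel_measurable borel" using A by (intro H_form_borel) auto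
  then have m: "H_form C' d' A \<in> borel_measurable cube_measure" by (rule borel_measurable_cube)
  have "H_form C (dotC C) A v = H_form C' d' A v" if "v \<in> unit_cube" for v
  proof (rule H_form_cong[OF C01 _ _ _ that])
    fix p :: nat and u assume "u \<in> unit_square"
    then show "dotC C p u = d' p u" using dotC_eq_0[of u p] by (auto simp: d'_def indicator_def)
  qed (auto simp: C'_def)
  then show ?thesis using m by (subst measurable_cong[of cube_measure _ "H_form C' d' A"]) auto
qed

lemma H_form_dotC_bound:
  assumes "\<And>u. u \<in> unit_square \<Longrightarrow> \<bar>A u\<bar> \<le> R" "v \<in> unit_cube"
  shows "\<bar>H_form C (dotC C) A v\<bar> \<le> 12 * R"
  using H_form_bound[of C "dotC C" 1 A R v] C01 abs_dotC_le assms by simp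

end

section \<open>Discretisation\<close>

text \<open>Rounding goes down, so the grid corner is below \<open>u\<close> in both coordinates and
  the copula is no larger there than at \<open>u\<close>. The value 1 has its own index
  \<open>m\<close>.\<close>

definition cell :: "nat \<Rightarrow> real \<times> real \<Rightarrow> nat \<times> nat" where
  "cell m u = (nat \<lfloor>real m * fst u\<rfloor>, nat \<lfloor>real m * snd u\<rfloor>)"

definition grid_point :: "nat \<Rightarrow> nat \<times> nat \<Rightarrow> real \<times> real" where
  "grid_point m j = (real (fst j) / real m, real (snd j) / real m)"

definition grid :: "nat \<Rightarrow> (nat \<times> nat) set" where "grid m = {..m} \<times> {..m}"

lemma finite_grid [simp]: "finite (grid m)" by (simp add: grid_def)

lemma card_grid: "card (grid m) = (m + 1)\<^sup>2" by (simp add: grid_def power2_eq_square)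

lemma grid_point_in: "0 < m \<Longrightarrow> j \<in> grid m \<Longrightarrow> grid_point m j \<in> unit_square"
  by (auto simp: grid_def grid_point_def unit_square_def)

lemma floor_div:
  assumes "0 < m" "0 \<le> t" "t \<le> 1"
  shows "nat \<lfloor>real m * t\<rfloor> \<le> m" "real (nat \<lfloor>real m * t\<rfloor>) / real m \<le> t" "\<bar>t - real (nat \<lfloor>real m * t\<rfloor>) / real m\<bar> \<le> 1 / real m"
proof -
  have mt: "0 \<le> real m * t" "real m * t \<le> real m" using assms by (auto simp: mult_left_le)
  then show "nat \<lfloor>real m * t\<rfloor> \<le> m" by linarith
  have b: "real (nat \<lfloor>real m * t\<rfloor>) \<le> real m * t" "real m * t \<le> real (nat \<lfloor>real m * t\<rfloor>) + 1" using mt by linarith+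
  have m: "0 < real m" using assms by simp
  show 1: "real (nat \<lfloor>real m * t\<rfloor>) / real m \<le> t" using b(1) m by (simp add: pos_divide_le_eq mult.commute)
  have "t \<le> (real (nat \<lfloor>real m * t\<rfloor>) + 1) / real m" using b(2) m by (simp add: pos_le_divide_eq mult.commute)
  then show "\<bar>t - real (nat \<lfloor>real m * t\<rfloor>) / real m\<bar> \<le> 1 / real m" using 1 by (simp add: add_divide_distrib)
qed

lemma cell_in_grid:
  assumes "0 < m" "u \<in> unit_square"
  shows "cell m u \<in> grid m" "grid_point m (cell m u) \<in> unit_square"
    "fst (grid_point m (cell m u)) \<le> fst u" "snd (grid_point m (cell m u)) \<le> snd u"
    "\<bar>fst u - fst (grid_point m (cell m u))\<bar> \<le> 1 / real m" "\<bar>snd u - snd (grid_point m (cell m u))\<bar> \<le> 1 / real m"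
proof -
  have u: "0 \<le> fst u" "fst u \<le> 1" "0 \<le> snd u" "snd u \<le> 1" using assms(2) by (auto simp: unit_square_def)
  note f = floor_div[OF assms(1) u(1,2)] floor_div[OF assms(1) u(3,4)]
  show "cell m u \<in> grid m" using f by (simp add: cell_def grid_def)
  then show "grid_point m (cell m u) \<in> unit_square" by (rule grid_point_in[OF assms(1)])
  show "fst (grid_point m (cell m u)) \<le> fst u" "snd (grid_point m (cell m u)) \<le> snd u"
    "\<bar>fst u - fst (grid_point m (cell m u))\<bar> \<le> 1 / real m" "\<bar>snd u - snd (grid_point m (cell m u))\<bar> \<le> 1 / real m"
    using f by (simp_all add: cell_def grid_point_def)
qed

definition cell_ind :: "nat \<Rightarrow> nat \<times> nat \<Rightarrow> real \<times> real \<Rightarrow> real" where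
  "cell_ind m j u = of_bool (cell m u = j)"

lemma cell_ind_borel: "cell_ind m j \<in> borel_measurable borel"
proof -
  note [measurable] = borel_projections
  have "Measurable.pred borel (\<lambda>u :: real \<times> real. nat \<lfloor>real m * fst u\<rfloor> = fst j \<and> nat \<lfloor>real m * snd u\<rfloor> = snd j)"
    by measurable
  then have "(\<lambda>u :: real \<times> real. of_bool (nat \<lfloor>real m * fst u\<rfloor> = fst j \<and> nat \<lfloor>real m * snd u\<rfloor> = snd j) :: real) \<in> borel_measurable borel"
    by measurable
  then show ?thesis by (simp add: cell_ind_def[abs_def] cell_def prod_eq_iff)
qed

lemma sum_cell_ind: "0 < m \<Longrightarrow> u \<in> unit_square \<Longrightarrow> (\<Sum>j\<in>grid m. y j * cell_ind m j u) = y (cell m u)"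
  using cell_in_grid(1) by (simp add: cell_ind_def of_bool_def if_distrib[of "\<lambda>c. _ * c"] cong: if_cong)

context smooth_copula
begin

text \<open>The statistic of the limit functional for the step path with value \<open>y j\<close> on
  cell \<open>j\<close>, expanded by linearity. It involves neither \<open>n\<close> nor the
  estimator, so the only randomness is in the vector \<open>y\<close>.\<close>

definition grid_stat :: "((real \<times> real \<times> real \<Rightarrow> real) \<Rightarrow> real) \<Rightarrow> nat \<Rightarrow> (nat \<times> nat \<Rightarrow> real) \<Rightarrow> real" where
  "grid_stat stat m y = stat (\<lambda>v. \<Sum>j\<in>grid m. y j * H_form C (dotC C) (cell_ind m j) v)"

lemma cell_form:
  "H_form C (dotC C) (cell_ind m j) \<in> borel_measurable cube_measure"
  "v \<in> unit_cube \<Longrightarrow> \<bar>H_form C (dotC C) (cell_ind m j) v\<bar> \<le> 12"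
  using H_form_measurable[OF cell_ind_borel] H_form_dotC_bound[of "cell_ind m j" 1 v] by (auto simp: cell_ind_def)

lemma grid_stat_continuous:
  assumes "stat \<in> {L2_stat, KS_stat}" shows "continuous_on UNIV (grid_stat stat m)"
  unfolding grid_stat_def using stat_linear_continuous[OF assms, of "grid m" "\<lambda>j. H_form C (dotC C) (cell_ind m j)" 12] cell_form by auto

lemma grid_sum_bound:
  assumes "v \<in> unit_cube"
  shows "\<bar>\<Sum>j\<in>grid m. y j * H_form C (dotC C) (cell_ind m j) v\<bar> \<le> (\<Sum>j\<in>grid m. \<bar>y j\<bar> * 12)"
  using cell_form(2)[OF assms] by (intro order_trans[OF sum_abs] sum_mono) (auto simp: abs_mult intro!: mult_left_mono)

lemma grid_stat_nonneg:
  assumes "stat \<in> {L2_stat, KS_stat}" shows "0 \<le> grid_stat stat m y"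
  unfolding grid_stat_def by (rule stat_nonneg[OF assms grid_sum_bound])

text \<open>The only property of \<open>f\<close> used is closeness to the process of \<open>A\<close>, so that the lemma applies to
  the bootstrap process and to the limit.\<close>

lemma stat_grid_close:
  assumes s: "stat \<in> {L2_stat, KS_stat}" and m: "0 < m" and fm: "f \<in> borel_measurable cube_measure"
    and f: "\<And>v. v \<in> unit_cube \<Longrightarrow> \<bar>f v - H_form C (dotC C) A v\<bar> \<le> \<epsilon>1"
    and A: "\<And>u. u \<in> unit_square \<Longrightarrow> \<bar>A u - y (cell m u)\<bar> \<le> \<epsilon>2" "\<And>u. u \<in> unit_square \<Longrightarrow> \<bar>A u\<bar> \<le> R"
  shows "\<bar>stat f - grid_stat stat m y\<bar> \<le> (\<epsilon>1 + 12 * \<epsilon>2) * (2 * (12 * (R + \<epsilon>2)) + (\<epsilon>1 + 12 * \<epsilon>2) + 1)"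
proof -
  let ?S = "\<lambda>u. \<Sum>j\<in>grid m. y j * cell_ind m j u"
  have eq: "(\<Sum>j\<in>grid m. y j * H_form C (dotC C) (cell_ind m j) v) = H_form C (dotC C) ?S v" for v
    by (rule H_form_sum[symmetric])
  have S: "?S u = y (cell m u)" if "u \<in> unit_square" for u using sum_cell_ind[OF m that] .
  have d: "\<bar>H_form C (dotC C) A v - H_form C (dotC C) ?S v\<bar> \<le> 12 * \<epsilon>2" if "v \<in> unit_cube" for v
    unfolding H_form_diff by (rule H_form_dotC_bound[OF _ that]) (simp add: S A(1))
  show ?thesis unfolding grid_stat_def eq
  proof (rule stat_diff[OF s fm])
    show "H_form C (dotC C) ?S \<in> borel_measurable cube_measure"
      by (intro H_form_measurable borel_measurable_sum borel_measurable_times cell_ind_borel) auto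
    fix v assume v: "v \<in> unit_cube"
    show "\<bar>f v - H_form C (dotC C) ?S v\<bar> \<le> \<epsilon>1 + 12 * \<epsilon>2" using f[OF v] d[OF v] by linarith
    show "\<bar>H_form C (dotC C) ?S v\<bar> \<le> 12 * (R + \<epsilon>2)"
    proof (rule H_form_dotC_bound[OF _ v])
      fix u assume u: "u \<in> unit_square"
      show "\<bar>?S u\<bar> \<le> R + \<epsilon>2" unfolding S[OF u] using A(1)[OF u] A(2)[OF u] by linarith
    qed
  qed
qed

end

section \<open>Good multiplier paths\<close>

text \<open>Replaces the data by their ranks. The result takes finitely many values (hence the
  restriction to the index set) but determines the empirical copula and the bootstrap path.\<close>

definition rankize :: "nat \<Rightarrow> (nat \<Rightarrow> real \<times> real) \<Rightarrow> nat \<Rightarrow> real \<times> real" where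
  "rankize n x = (\<lambda>i\<in>{..<n}. (real (rank_below n x 1 i), real (rank_below n x 2 i)))"

lemma coord_rankize: "i < n \<Longrightarrow> p \<in> {1, 2} \<Longrightarrow> coord p (rankize n x i) = real (rank_below n x p i)"
  by (auto simp: rankize_def coord_def)

lemma rank_below_strict_mono:
  assumes "i < n" "j < n"
  shows "rank_below n x p i < rank_below n x p j \<longleftrightarrow> coord p (x i) < coord p (x j)"
proof
  assume "coord p (x i) < coord p (x j)"
  then show "rank_below n x p i < rank_below n x p j"
    unfolding rank_below_def using assms by (intro psubset_card_mono) auto
next
  assume l: "rank_below n x p i < rank_below n x p j"
  show "coord p (x i) < coord p (x j)"
  proof (rule ccontr)
    assume "\<not> coord p (x i) < coord p (x j)"
    then have "rank_below n x p j \<le> rank_below n x p i"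
      unfolding rank_below_def by (intro card_mono) auto
    then show False using l by simp
  qed
qed

lemma rank_rankize:
  assumes "i < n" "p \<in> {1, 2}"
  shows "rank_below n (rankize n x) p i = rank_below n x p i"
proof -
  have "{j. j < n \<and> coord p (rankize n x j) < coord p (rankize n x i)} = {j. j < n \<and> coord p (x j) < coord p (x i)}"
    using rank_below_strict_mono[OF _ assms(1), of _ x p] assms by (auto simp: coord_rankize)
  then show ?thesis unfolding rank_below_def by simp
qed

lemma ranked_below_rankize: "ranked_below n (rankize n x) u = ranked_below n x u"
  by (auto simp: below_def rank_rankize simp del: One_nat_def)

lemma emp_copula_rankize: "0 < n \<Longrightarrow> emp_copula n (rankize n x) u = emp_copula n x u"
  by (simp only: emp_copula_card ranked_below_rankize)

lemma mult_process_rankize: "0 < n \<Longrightarrow> mult_process n (rankize n x) w u = mult_process n x w u"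
  by (simp only: mult_process_sum ranked_below_rankize)

lemma finite_rankize: "finite (range (rankize n))"
proof (rule finite_subset)
  show "range (rankize n) \<subseteq> PiE {..<n} (\<lambda>_. (real ` {..<n}) \<times> (real ` {..<n}))"
  proof (rule image_subsetI, rule PiE_I)
    fix x i assume "i \<in> {..<n}"
    then have "i < n" "rankize n x i = (real (rank_below n x 1 i), real (rank_below n x 2 i))"
      by (simp_all add: rankize_def)
    then show "rankize n x i \<in> (real ` {..<n}) \<times> (real ` {..<n})"
      by (simp only: mem_Times_iff fst_conv snd_conv) (intro conjI imageI; simp only: lessThan_iff rank_below_less)
  qed (simp add: rankize_def)
qed (auto intro!: finite_PiE)

text \<open>The bootstrap process before division by the mean multiplier. Unlike the latter it is
  linear in the multipliers, so the central limit theorem for weighted sums applies to it.\<close>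

definition linear_process ::
  "nat \<Rightarrow> (nat \<Rightarrow> real \<times> real) \<Rightarrow> (nat \<Rightarrow> real) \<Rightarrow> real \<times> real \<Rightarrow> real" where
  "linear_process n x w u =
     mult_partial_sum n (rank_below n x 1) (rank_below n x 2) w u -
     emp_copula n x u * mult_partial_sum n (rank_below n x 1) (rank_below n x 2) w (1, 1)"

text \<open>Collects what the deterministic part of the argument asks of a multiplier path, so that
  randomness enters only through the probability of this event. It depends on \<open>x\<close>
  through the ranks alone, see \<open>good_path_rankize\<close>.\<close>

definition good_path ::
  "(real \<times> real \<Rightarrow> real) \<Rightarrow> nat \<Rightarrow> (nat \<Rightarrow> real \<times> real) \<Rightarrow> (nat \<Rightarrow> real) \<Rightarrow> real \<Rightarrow> real \<Rightarrow> real \<Rightarrow> real \<Rightarrow> bool" where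
  "good_path C n x w R \<epsilon> \<delta> \<delta>' \<longleftrightarrow> mean n w \<noteq> 0 \<and>
     (\<forall>u\<in>unit_square. \<bar>mult_process n x w u\<bar> \<le> R) \<and>
     (\<forall>u\<in>unit_square. \<forall>v\<in>unit_square. \<bar>fst u - fst v\<bar> \<le> \<delta> \<longrightarrow> \<bar>snd u - snd v\<bar> \<le> \<delta> \<longrightarrow>
        \<bar>mult_process n x w u - mult_process n x w v\<bar> \<le> \<epsilon>) \<and>
     (\<forall>u\<in>unit_square. C u \<le> \<delta>' \<longrightarrow> \<bar>mult_process n x w u\<bar> \<le> \<epsilon>) \<and>
     (\<forall>u\<in>unit_square. \<bar>mult_process n x w u - linear_process n x w u\<bar> \<le> \<epsilon>)"

lemma good_path_rankize:
  assumes "0 < n" shows "good_path C n (rankize n x) w R \<epsilon> \<delta> \<delta>' \<longleftrightarrow> good_path C n x w R \<epsilon> \<delta> \<delta>'"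
proof -
  have "linear_process n (rankize n x) w u = linear_process n x w u" for u
    unfolding linear_process_def mult_partial_sum_def
    by (simp only: emp_copula_rankize[OF assms] ranked_below_rankize)
  then show ?thesis unfolding good_path_def by (simp only: mult_process_rankize[OF assms])
qed

lemma mean_near_one:
  assumes n: "0 < n" and Z: "\<bar>mult_partial_sum n (rank_below n x 1) (rank_below n x 2) w (1, 1)\<bar> \<le> R0"
    and big: "2 * R0 \<le> sqrt (real n)"
  shows "\<bar>mean n w - 1\<bar> \<le> R0 / sqrt (real n)" "1 / 2 \<le> mean n w"
proof -
  have s: "0 < sqrt (real n)" using n by simp
  have "\<bar>mean n w - 1\<bar> = \<bar>mult_partial_sum n (rank_below n x 1) (rank_below n x 2) w (1, 1)\<bar> / sqrt (real n)"
    using mean_eq_partial_sum[OF n, of w x] s by (simp add: abs_divide)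
  then show 1: "\<bar>mean n w - 1\<bar> \<le> R0 / sqrt (real n)" using Z s by (simp add: divide_right_mono)
  have "R0 / sqrt (real n) \<le> 1 / 2" using big s by (simp add: pos_divide_le_eq)
  then show "1 / 2 \<le> mean n w" using 1 by linarith
qed

lemma mult_process_eq_linear:
  assumes "0 < n" "mean n w \<noteq> 0"
  shows "mult_process n x w u = linear_process n x w u / mean n w"
  using mult_process_eq_partial_sum[OF assms] by (simp only: linear_process_def)

lemma linear_process_bounds:
  fixes n x w defines "Z \<equiv> mult_partial_sum n (rank_below n x 1) (rank_below n x 2) w"
  assumes n: "0 < n" and Z1: "\<bar>Z (1, 1)\<bar> \<le> R0"
  shows "\<bar>linear_process n x w u\<bar> \<le> \<bar>Z u\<bar> + emp_copula n x u * R0"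
    "\<bar>linear_process n x w u - linear_process n x w v\<bar> \<le> \<bar>Z u - Z v\<bar> + \<bar>emp_copula n x u - emp_copula n x v\<bar> * R0"
proof -
  have "\<bar>emp_copula n x u * Z (1, 1)\<bar> \<le> emp_copula n x u * R0"
    unfolding abs_mult using Z1 emp_copula_bounds[OF n] by (intro mult_mono) auto
  then show "\<bar>linear_process n x w u\<bar> \<le> \<bar>Z u\<bar> + emp_copula n x u * R0"
    unfolding linear_process_def Z_def by linarith
  have "linear_process n x w u - linear_process n x w v = (Z u - Z v) - (emp_copula n x u - emp_copula n x v) * Z (1, 1)"
    by (simp add: linear_process_def Z_def algebra_simps)
  moreover have "\<bar>(emp_copula n x u - emp_copula n x v) * Z (1, 1)\<bar> \<le> \<bar>emp_copula n x u - emp_copula n x v\<bar> * R0"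
    unfolding abs_mult using Z1 by (intro mult_left_mono) auto
  ultimately show "\<bar>linear_process n x w u - linear_process n x w v\<bar> \<le> \<bar>Z u - Z v\<bar> + \<bar>emp_copula n x u - emp_copula n x v\<bar> * R0"
    by linarith
qed

lemma divide_mean_le:
  fixes a m :: real assumes "1 / 2 \<le> m" shows "\<bar>a / m\<bar> \<le> 2 * \<bar>a\<bar>"
proof -
  have "\<bar>a / m\<bar> = \<bar>a\<bar> / m" using assms by (simp add: abs_divide)
  also have "\<dots> \<le> \<bar>a\<bar> / (1 / 2)" using assms by (intro divide_left_mono) auto
  finally show ?thesis by simp
qed

locale multiplier_bootstrap = multiplier_law \<mu> + smooth_copula C for \<mu> C
begin

text \<open>Off the exceptional set each of the two terms of the linear process is at most
  \<open>9 * t\<close>, and the mean is at least 1/2, whence \<open>36 * t\<close>. The level may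
  grow with \<open>n\<close> up to a multiple of \<open>sqrt (real n)\<close>, which the consistency
  proof exploits.\<close>

lemma mult_process_bounded:
  assumes t: "0 < t" and n: "0 < n" and big: "18 * t \<le> sqrt (real n)"
  shows "\<exists>E\<in>sets (W n). measure (W n) E \<le> 9 / t\<^sup>2 \<and>
    (\<forall>w\<in>space (W n) - E. mean n w \<noteq> 0 \<and> (\<forall>u\<in>unit_square. \<bar>mult_process n x w u\<bar> \<le> 36 * t))"
proof -
  let ?Z = "mult_partial_sum n (rank_below n x 1) (rank_below n x 2)"
  obtain E where E: "E\<in>sets (W n)" "measure (W n) E \<le> 9 / t\<^sup>2"
    "\<And>w u. w\<in>space (W n) - E \<Longrightarrow> u\<in>unit_square \<Longrightarrow> \<bar>?Z w u\<bar> < 9 * t"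
    using mult_partial_sum_bounded[OF t, of n "rank_below n x 1" "rank_below n x 2"] n by auto
  have "mean n w \<noteq> 0 \<and> (\<forall>u\<in>unit_square. \<bar>mult_process n x w u\<bar> \<le> 36 * t)" if w: "w\<in>space (W n) - E" for w
  proof -
    have Z1: "\<bar>?Z w (1, 1)\<bar> \<le> 9 * t" using E(3)[OF w, of "(1, 1)"] by (simp add: unit_square_def)
    have m: "1 / 2 \<le> mean n w" using mean_near_one(2)[OF n Z1] big by simp
    have "\<bar>mult_process n x w u\<bar> \<le> 36 * t" if u: "u \<in> unit_square" for u
    proof -
      have "emp_copula n x u * (9 * t) \<le> 1 * (9 * t)" using emp_copula_bounds[OF n] t by (intro mult_right_mono) auto
      then have "\<bar>linear_process n x w u\<bar> \<le> 18 * t"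
        using linear_process_bounds(1)[OF n Z1, of u] E(3)[OF w u] by linarith
      then show ?thesis
        using mult_process_eq_linear[OF n, of w x u] divide_mean_le[OF m, of "linear_process n x w u"] m by auto
    qed
    then show ?thesis using m by auto
  qed
  then show ?thesis using E(1,2) by blast
qed

text \<open>\<open>R\<close> precedes \<open>\<epsilon>\<close> in the quantifiers because later
  \<open>\<epsilon>\<close> is chosen in terms of \<open>R\<close>. The exceptional set has three
  parts: large partial sums, a bad modulus of continuity, and large values at grid points where the
  copula is small.\<close>

lemma good_path_probability:
  assumes e0: "0 < \<epsilon>0"
  shows "\<exists>R\<ge>1. \<forall>\<epsilon>>0. \<exists>\<delta>>0. \<exists>\<delta>'>0. \<exists>\<theta>>0. \<exists>n0\<ge>1. \<forall>n\<ge>n0. \<forall>x. no_ties n x \<longrightarrow>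
    (\<forall>u\<in>unit_square. \<bar>emp_copula n x u - C u\<bar> \<le> \<theta>) \<longrightarrow>
    (\<exists>E\<in>sets (W n). measure (W n) E \<le> \<epsilon>0 \<and> (\<forall>w\<in>space (W n) - E. good_path C n x w R \<epsilon> \<delta> \<delta>'))"
proof -
  \<comment> \<open>Makes \<open>9 / t\<^sup>2\<close> equal to a third of the allowed
    probability.\<close>
  define t where "t = sqrt (27 / \<epsilon>0)"
  have t: "0 < t" "9 / t\<^sup>2 = \<epsilon>0 / 3" using e0 by (auto simp: t_def)
  define R0 where "R0 = 9 * t"
  have R0: "0 < R0" using t by (simp add: R0_def)
  define R where "R = max 1 (4 * R0)"
  show ?thesis
  proof (rule exI[of _ R], intro conjI allI impI)
    show "1 \<le> R" by (simp add: R_def)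
    fix \<epsilon> :: real assume e: "0 < \<epsilon>"
    define \<epsilon>1 where "\<epsilon>1 = min (\<epsilon> / 8) (\<epsilon>0 / 3)"
    have e1: "0 < \<epsilon>1" "\<epsilon>1 \<le> \<epsilon> / 8" "\<epsilon>1 \<le> \<epsilon>0 / 3" using e e0 by (auto simp: \<epsilon>1_def)
    obtain \<delta>1 n1 where d1: "0 < \<delta>1" and n1: "\<And>n r s. n \<ge> n1 \<Longrightarrow> inj_on r {..<n} \<Longrightarrow> inj_on s {..<n} \<Longrightarrow>
      \<exists>E\<in>sets (W n). measure (W n) E \<le> \<epsilon>1 \<and> (\<forall>w\<in>space (W n) - E. \<forall>u\<in>unit_square. \<forall>v\<in>unit_square.
       \<bar>fst u - fst v\<bar> \<le> \<delta>1 \<longrightarrow> \<bar>snd u - snd v\<bar> \<le> \<delta>1 \<longrightarrow>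
       \<bar>mult_partial_sum n r s w u - mult_partial_sum n r s w v\<bar> \<le> \<epsilon>1)"
      using mult_partial_sum_equicontinuous[OF e1(1)] by blast
    \<comment> \<open>Besides the partial sum, the product of the empirical copula with
      \<open>Z (1, 1)\<close> moves, by at most \<open>(2 * \<delta> + 2 / real n) * R0\<close>. The
      second bound on \<open>\<delta>\<close> limits its share to
      \<open>\<epsilon> / 16\<close>.\<close>
    define \<delta> where "\<delta> = min \<delta>1 (\<epsilon> / (32 * R0))"
    have d: "0 < \<delta>" "\<delta> \<le> \<delta>1" using d1 e R0 by (auto simp: \<delta>_def)
    have "\<delta> \<le> \<epsilon> / (32 * R0)" by (simp add: \<delta>_def)
    then have dR: "\<delta> * R0 \<le> \<epsilon> / 32" using R0 by (simp add: field_simps)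
    obtain m :: nat where m: "0 < m" "1 / real m \<le> \<delta>"
      using d(1) by (metis less_imp_le nat_approx_posE zero_less_Suc)
    define t2 where "t2 = \<epsilon> / 8"
    have t2: "0 < t2" using e by (simp add: t2_def)
    define c where "c = real (card (grid m))"
    have c: "0 < c" by (simp add: c_def card_grid)
    \<comment> \<open>At grid points with empirical copula at most \<open>\<tau>\<close>, the first
      bound controls the product with \<open>Z (1, 1)\<close>, and the second makes the Chebyshev
      bounds over all \<open>c\<close> grid points add up to at most
      \<open>\<epsilon>0 / 3\<close>.\<close>
    define \<tau> where "\<tau> = min (\<epsilon> / (8 * R0)) (\<epsilon>0 * t2\<^sup>2 / (3 * c))"
    have tau: "0 < \<tau>" using e e0 R0 t2 c by (auto simp: \<tau>_def)
    have "\<tau> \<le> \<epsilon> / (8 * R0)" "\<tau> \<le> \<epsilon>0 * t2\<^sup>2 / (3 * c)" by (auto simp: \<tau>_def)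
    then have tauR: "\<tau> * R0 \<le> \<epsilon> / 8" and tauc: "c * (\<tau> / t2\<^sup>2) \<le> \<epsilon>0 / 3"
      using R0 c t2 by (simp_all add: field_simps)
    \<comment> \<open>In this order: the mean multiplier is at least 1/2; the path and its linear
      version are \<open>\<epsilon>\<close>-close; the rounding error of the empirical copula is
      harmless.\<close>
    obtain N1 :: nat where N1: "(2 * R0)\<^sup>2 \<le> real N1" using real_arch_simple by blast
    obtain N2 :: nat where N2: "(4 * R0\<^sup>2 / \<epsilon>)\<^sup>2 \<le> real N2" using real_arch_simple by blast
    obtain N3 :: nat where N3: "32 * R0 / \<epsilon> \<le> real N3" using real_arch_simple by blast
    define n0 where "n0 = Max {1, n1, N1, N2, N3}"
    have main: "\<exists>E\<in>sets (W n). measure (W n) E \<le> \<epsilon>0 \<and> (\<forall>w\<in>space (W n) - E. good_path C n x w R \<epsilon> \<delta> (\<tau> / 2))"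
      if n: "n0 \<le> n" and nt: "no_ties n x" and Cn: "\<forall>u\<in>unit_square. \<bar>emp_copula n x u - C u\<bar> \<le> \<tau> / 2" for n x
    proof -
      have nn: "1 \<le> n" "n1 \<le> n" "N1 \<le> n" "N2 \<le> n" "N3 \<le> n" using n by (auto simp: n0_def)
      then have np: "0 < n" by simp
      have s1: "2 * R0 \<le> sqrt (real n)" using N1 nn by (intro real_le_rsqrt) linarith
      have s2: "4 * R0\<^sup>2 / \<epsilon> \<le> sqrt (real n)" using N2 nn by (intro real_le_rsqrt) linarith
      have s0: "0 < sqrt (real n)" using np by simp
      have s2': "4 * R0\<^sup>2 / sqrt (real n) \<le> \<epsilon>" using s2 e s0 by (simp add: field_simps)
      have "32 * R0 / \<epsilon> \<le> real n" using N3 nn by linarith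
      then have s3: "R0 / real n \<le> \<epsilon> / 32" using e np by (simp add: field_simps)
      let ?r = "rank_below n x 1" and ?s = "rank_below n x 2"
      let ?Z = "mult_partial_sum n ?r ?s" and ?Cn = "emp_copula n x"
      have inj: "inj_on ?r {..<n}" "inj_on ?s {..<n}" using no_ties_inj[OF nt] by auto
      interpret Wn: prob_space "W n" by (rule prob_space_W)
      obtain E1 where E1: "E1\<in>sets (W n)" "measure (W n) E1 \<le> \<epsilon>0 / 3"
        "\<And>w u. w\<in>space (W n) - E1 \<Longrightarrow> u\<in>unit_square \<Longrightarrow> \<bar>?Z w u\<bar> < R0"
        using mult_partial_sum_bounded[OF t(1) nn(1), of ?r ?s] t(2) by (auto simp: R0_def)
      obtain E2 where E2: "E2\<in>sets (W n)" "measure (W n) E2 \<le> \<epsilon>1"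
        "\<And>w u v. w\<in>space (W n) - E2 \<Longrightarrow> u\<in>unit_square \<Longrightarrow> v\<in>unit_square \<Longrightarrow>
         \<bar>fst u - fst v\<bar> \<le> \<delta>1 \<Longrightarrow> \<bar>snd u - snd v\<bar> \<le> \<delta>1 \<Longrightarrow> \<bar>?Z w u - ?Z w v\<bar> \<le> \<epsilon>1"
        using n1[OF nn(2) inj] by blast
      define G where "G = {j\<in>grid m. C (grid_point m j) \<le> \<tau> / 2}"
      have "\<exists>E\<in>sets (W n). measure (W n) E \<le> \<tau> / t2\<^sup>2 \<and> (\<forall>w\<in>space (W n) - E. \<bar>?Z w (grid_point m j)\<bar> < t2)" if j: "j \<in> G" for j
      proof -
        have gU: "grid_point m j \<in> unit_square" using j by (auto simp: G_def intro: grid_point_in[OF m(1)])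
        have "C (grid_point m j) \<le> \<tau> / 2" using j by (simp add: G_def)
        then have "?Cn (grid_point m j) \<le> \<tau>" using bspec[OF Cn gU] by linarith
        then have "real (card (below n ?r ?s (grid_point m j))) / real n / t2\<^sup>2 \<le> \<tau> / t2\<^sup>2"
          unfolding emp_copula_card[OF np] by (rule divide_right_mono) simp
        then show ?thesis using mult_partial_sum_small_at[OF t2 nn(1), of ?r ?s "grid_point m j"] by (meson order_trans)
      qed
      then obtain F where F: "\<And>j. j \<in> G \<Longrightarrow> F j \<in> sets (W n)" "\<And>j. j \<in> G \<Longrightarrow> measure (W n) (F j) \<le> \<tau> / t2\<^sup>2"
        "\<And>j w. j \<in> G \<Longrightarrow> w\<in>space (W n) - F j \<Longrightarrow> \<bar>?Z w (grid_point m j)\<bar> < t2" by metis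
      have fG: "finite G" by (simp add: G_def)
      have "measure (W n) (\<Union>j\<in>G. F j) \<le> (\<Sum>j\<in>G. measure (W n) (F j))"
        using F(1) by (intro Wn.finite_measure_subadditive_finite fG) auto
      also have "\<dots> \<le> (\<Sum>j\<in>G. \<tau> / t2\<^sup>2)" by (intro sum_mono F(2))
      also have "\<dots> = real (card G) * (\<tau> / t2\<^sup>2)" by simp
      also have "\<dots> \<le> c * (\<tau> / t2\<^sup>2)"
        unfolding c_def using tau by (intro mult_right_mono) (auto simp: G_def intro!: card_mono)
      finally have E3: "measure (W n) (\<Union>j\<in>G. F j) \<le> \<epsilon>0 / 3" using tauc by linarith
      have E3m: "(\<Union>j\<in>G. F j) \<in> sets (W n)" using F(1) fG by (intro sets.finite_UN) auto
      let ?E = "E1 \<union> E2 \<union> (\<Union>j\<in>G. F j)"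
      have "measure (W n) ?E \<le> measure (W n) E1 + measure (W n) E2 + measure (W n) (\<Union>j\<in>G. F j)"
        using measure_Un_le[of "E1 \<union> E2" "W n" "\<Union>j\<in>G. F j"] measure_Un_le[of E1 "W n" E2] E1(1) E2(1) E3m by simp
      then have mE: "measure (W n) ?E \<le> \<epsilon>0" using E1(2) E2(2) E3 e1(3) by linarith
      have "good_path C n x w R \<epsilon> \<delta> (\<tau> / 2)" if w: "w \<in> space (W n) - ?E" for w
      proof -
        have w1: "w \<in> space (W n) - E1" and w2: "w \<in> space (W n) - E2" using w by auto
        have Zb: "\<bar>?Z w u\<bar> \<le> R0" if "u \<in> unit_square" for u using E1(3)[OF w1 that] by simp
        have Z1: "\<bar>?Z w (1, 1)\<bar> \<le> R0" by (rule Zb) (simp add: unit_square_def)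
        note mm = mean_near_one[OF np Z1 s1]
        have m0: "mean n w \<noteq> 0" using mm(2) by auto
        note me = mult_process_eq_linear[OF np m0, of x]
        have lb: "\<bar>linear_process n x w u\<bar> \<le> 2 * R0" if "u \<in> unit_square" for u
        proof -
          have "?Cn u * R0 \<le> 1 * R0" using emp_copula_bounds[OF np] R0 by (intro mult_right_mono) auto
          then show ?thesis using linear_process_bounds(1)[OF np Z1, of u] Zb[OF that] by linarith
        qed
        have b: "\<bar>mult_process n x w u\<bar> \<le> R" if "u \<in> unit_square" for u
          using divide_mean_le[OF mm(2), of "linear_process n x w u"] lb[OF that] unfolding me R_def by linarith
        \<comment> \<open>Half of \<open>\<epsilon>\<close> is kept for the step from a point to its
          grid corner in the smallness bound below.\<close>
        have mod: "\<bar>mult_process n x w u - mult_process n x w v\<bar> \<le> \<epsilon> / 2"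
          if uv: "u \<in> unit_square" "v \<in> unit_square" "\<bar>fst u - fst v\<bar> \<le> \<delta>" "\<bar>snd u - snd v\<bar> \<le> \<delta>" for u v
        proof -
          have z: "\<bar>?Z w u - ?Z w v\<bar> \<le> \<epsilon> / 8" using E2(3)[OF w2 uv(1,2)] uv d(2) e1(2) by linarith
          have "\<bar>?Cn u - ?Cn v\<bar> * R0 \<le> (2 * \<delta> + 2 / real n) * R0"
            using emp_copula_approx_Lipschitz[OF nt np, of u v] uv R0 by (intro mult_right_mono) linarith+
          also have "\<dots> = 2 * (\<delta> * R0) + 2 * (R0 / real n)" by (simp add: algebra_simps)
          also have "\<dots> \<le> \<epsilon> / 8" using dR s3 by linarith
          finally have "\<bar>linear_process n x w u - linear_process n x w v\<bar> \<le> \<epsilon> / 4"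
            using linear_process_bounds(2)[OF np Z1, of u v] z by linarith
          moreover have "2 * a \<le> \<epsilon> / 2" if "a \<le> \<epsilon> / 4" for a using that by linarith
          ultimately show ?thesis
            using order_trans[OF divide_mean_le[OF mm(2)]] unfolding me diff_divide_distrib[symmetric] by blast
        qed
        have sm: "\<bar>mult_process n x w u\<bar> \<le> \<epsilon>" if u: "u \<in> unit_square" "C u \<le> \<tau> / 2" for u
        proof -
          \<comment> \<open>The copula at the corner does not exceed its value at \<open>u\<close>,
            so the corner is one of the controlled grid points.\<close>
          let ?g = "grid_point m (cell m u)"
          note cg = cell_in_grid[OF m(1) u(1)]
          have "C ?g \<le> C u" by (rule copula_mono[OF C cg(2) u(1) cg(3,4)])
          then have Cg: "C ?g \<le> \<tau> / 2" using u(2) by simp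
          then have jG: "cell m u \<in> G" using cg(1) by (simp add: G_def)
          then have z: "\<bar>?Z w ?g\<bar> < \<epsilon> / 8" using F(3)[OF jG, of w] w by (auto simp: t2_def)
          have "?Cn ?g \<le> \<tau>" using bspec[OF Cn cg(2)] Cg by linarith
          then have "?Cn ?g * R0 \<le> \<tau> * R0" using R0 by (intro mult_right_mono) auto
          then have "\<bar>linear_process n x w ?g\<bar> \<le> \<epsilon> / 4" using linear_process_bounds(1)[OF np Z1, of ?g] z tauR by linarith
          then have g: "\<bar>mult_process n x w ?g\<bar> \<le> \<epsilon> / 2"
            using divide_mean_le[OF mm(2), of "linear_process n x w ?g"] unfolding me by linarith
          have "\<bar>mult_process n x w u - mult_process n x w ?g\<bar> \<le> \<epsilon> / 2"
            by (rule mod[OF u(1) cg(2)]) (use cg m(2) in linarith)+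
          then show ?thesis using g by linarith
        qed
        have li: "\<bar>mult_process n x w u - linear_process n x w u\<bar> \<le> \<epsilon>" if u: "u \<in> unit_square" for u
        proof -
          have "mult_process n x w u - linear_process n x w u = (linear_process n x w u * (1 - mean n w)) / mean n w"
            unfolding me using m0 by (simp add: field_simps)
          then have "\<bar>mult_process n x w u - linear_process n x w u\<bar> \<le> 2 * \<bar>linear_process n x w u * (1 - mean n w)\<bar>"
            using divide_mean_le[OF mm(2)] by simp
          also have "\<bar>linear_process n x w u * (1 - mean n w)\<bar> \<le> (2 * R0) * (R0 / sqrt (real n))"
            unfolding abs_mult using lb[OF u] mm(1) R0 by (intro mult_mono) (auto simp: abs_minus_commute)
          also have "2 * ((2 * R0) * (R0 / sqrt (real n))) = 4 * R0\<^sup>2 / sqrt (real n)" by (simp add: power2_eq_square)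
          finally show ?thesis using s2' by simp
        qed
        show ?thesis unfolding good_path_def
        proof (intro conjI ballI impI)
          fix u v assume "u \<in> unit_square" "v \<in> unit_square" "\<bar>fst u - fst v\<bar> \<le> \<delta>" "\<bar>snd u - snd v\<bar> \<le> \<delta>"
          from mod[OF this] show "\<bar>mult_process n x w u - mult_process n x w v\<bar> \<le> \<epsilon>" using e by linarith
        qed (fact m0 | rule b sm li; assumption)+
      qed
      then show ?thesis using E1(1) E2(1) E3m mE by (intro bexI[of _ ?E]) auto
    qed
    have "1 \<le> n0" by (simp add: n0_def)
    then show "\<exists>\<delta>>0. \<exists>\<delta>'>0. \<exists>\<theta>>0. \<exists>n0\<ge>1. \<forall>n\<ge>n0. \<forall>x. no_ties n x \<longrightarrow>
      (\<forall>u\<in>unit_square. \<bar>emp_copula n x u - C u\<bar> \<le> \<theta>) \<longrightarrow>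
      (\<exists>E\<in>sets (W n). measure (W n) E \<le> \<epsilon>0 \<and> (\<forall>w\<in>space (W n) - E. good_path C n x w R \<epsilon> \<delta> \<delta>'))"
      using main d(1) tau by (intro exI[of _ \<delta>] exI[of _ "\<tau> / 2"] exI[of _ n0] conjI) auto
  qed
qed

end

section \<open>Conditional convergence given regular data\<close>

text \<open>An exact identity for each \<open>n\<close>: two lower-left sets intersect in the one at
  the coordinatewise minimum, so the centred indicators have the Brownian covariance with the
  empirical copula in place of \<open>C\<close>.\<close>

lemma sum_indicator_covariance:
  fixes u v x and n :: nat defines "b \<equiv> \<lambda>u i. of_bool (i \<in> ranked_below n x u) - emp_copula n x u"
  assumes n: "0 < n"
  shows "(\<Sum>i<n. b u i * b v i) / real n = brownian_cov (emp_copula n x) u v"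
proof -
  let ?I = "\<lambda>u i. of_bool (i \<in> ranked_below n x u) :: real" and ?c = "emp_copula n x"
  let ?uv = "(min (fst u) (fst v), min (snd u) (snd v))"
  have s: "(\<Sum>i<n. ?I u i) = real n * ?c u" for u
  proof -
    have "{..<n} \<inter> {i. i \<in> ranked_below n x u} = ranked_below n x u" using below_subset by blast
    then show ?thesis using n by (simp add: sum_of_bool_eq emp_copula_card del: One_nat_def)
  qed
  have p: "?I u i * ?I v i = ?I ?uv i" for i
  proof -
    have "real n * min a b = min (real n * a) (real n * b)" for a b :: real
      using n by (simp add: min_mult_distrib_left)
    then have "i \<in> ranked_below n x ?uv \<longleftrightarrow> i \<in> ranked_below n x u \<and> i \<in> ranked_below n x v"
      by (auto simp: below_def)
    then show ?thesis by (simp add: of_bool_conj)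
  qed
  have "(\<Sum>i<n. b u i * b v i) = (\<Sum>i<n. ?I ?uv i - ?c v * ?I u i - ?c u * ?I v i + ?c u * ?c v)"
    unfolding b_def p[symmetric] by (intro sum.cong refl) (simp add: algebra_simps)
  also have "\<dots> = (\<Sum>i<n. ?I ?uv i) - ?c v * (\<Sum>i<n. ?I u i) - ?c u * (\<Sum>i<n. ?I v i) + real n * (?c u * ?c v)"
    by (simp only: sum.distrib sum_subtractf sum_distrib_left[symmetric] sum_constant card_lessThan)
      (simp only: mult.left_commute[of "emp_copula n x u"])
  also have "\<dots> = real n * (?c ?uv - ?c u * ?c v)"
    unfolding s by (simp add: algebra_simps)
  finally show ?thesis using n by simp
qed

lemma linear_process_sum:
  assumes n: "0 < n"
  shows "linear_process n x w u = (\<Sum>i<n. (of_bool (i \<in> ranked_below n x u) - emp_copula n x u) / sqrt (real n) * (w i - 1))"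
proof -
  have "(\<Sum>i\<in>ranked_below n x u. w i - 1) = (\<Sum>i<n. of_bool (i \<in> ranked_below n x u) * (w i - 1))"
  proof -
    have "(\<Sum>i<n. of_bool (i \<in> ranked_below n x u) * (w i - 1)) = (\<Sum>i<n. if i \<in> ranked_below n x u then w i - 1 else 0)"
      by (intro sum.cong refl) auto
    also have "\<dots> = (\<Sum>i\<in>{..<n} \<inter> ranked_below n x u. w i - 1)" by (rule sum.inter_restrict[symmetric]) simp
    also have "{..<n} \<inter> ranked_below n x u = ranked_below n x u" using below_subset by blast
    finally show ?thesis by simp
  qed
  then have "linear_process n x w u = ((\<Sum>i<n. of_bool (i \<in> ranked_below n x u) * (w i - 1)) - emp_copula n x u * (\<Sum>i<n. w i - 1)) / sqrt (real n)"
    unfolding linear_process_def mult_partial_sum_def ranked_below_one by (simp add: diff_divide_distrib)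
  also have "\<dots> = (\<Sum>i<n. (of_bool (i \<in> ranked_below n x u) - emp_copula n x u) / sqrt (real n) * (w i - 1))"
    unfolding sum_distrib_left sum_subtractf[symmetric] sum_divide_distrib
    by (intro sum.cong refl) (simp add: left_diff_distrib)
  finally show ?thesis .
qed

lemma grid_point_inj: "0 < m \<Longrightarrow> inj_on (grid_point m) (grid m)"
  by (rule inj_onI) (auto simp: grid_point_def prod_eq_iff)

context multiplier_bootstrap
begin

text \<open>By \<open>sum_indicator_covariance\<close> the variance at a point is c minus c squared,
  with c the empirical copula there. It is at most 1 for every sample.\<close>

lemma linear_process_tight:
  assumes n: "0 < n"
  shows "tight_family J (W n) (\<lambda>j w. linear_process n x w (g j))"
proof -
  interpret Wn: prob_space "W n" by (rule prob_space_W)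
  define b where "b u i = (of_bool (i \<in> ranked_below n x u) - emp_copula n x u) / sqrt (real n)" for u i
  have rep: "linear_process n x w u = (\<Sum>i<n. b u i * (w i - 1))" for w u
    unfolding b_def by (rule linear_process_sum[OF n])
  have tail: "measure (W n) {w\<in>space (W n). R \<le> \<bar>linear_process n x w u\<bar>} \<le> 1 / R\<^sup>2" if "0 < R" for R u
  proof -
    have ind: "Wn.indep_vars (\<lambda>_. borel) (\<lambda>i w. b u i * (w i - 1)) {..<n}"
      using indep_coordinates[of "\<lambda>i x. b u i * (x - 1)"] by simp
    have "measure (W n) {w\<in>space (W n). R \<le> \<bar>\<Sum>i<n. b u i * (w i - 1)\<bar>} \<le> (\<Sum>i<n. LINT w|W n. (b u i * (w i - 1))\<^sup>2) / R\<^sup>2"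
    proof (rule Wn.Chebyshev_sum_indep[OF ind _ _ _ _ that])
      fix i assume "i \<in> {..<n}"
      then have i: "i < n" by simp
      show "integrable (W n) (\<lambda>w. (b u i * (w i - 1))\<^sup>2)"
        using integral_coordinate(2)[OF i, of "\<lambda>x. (b u i * (x - 1))\<^sup>2"] centered(3) by (simp add: power_mult_distrib)
      show "(LINT w|W n. b u i * (w i - 1)) = 0"
        using integral_coordinate(1)[OF i, of "\<lambda>x. b u i * (x - 1)"] centered(1) by simp
    qed auto
    also have "(\<Sum>i<n. LINT w|W n. (b u i * (w i - 1))\<^sup>2) = (\<Sum>i<n. b u i * b u i)"
    proof (rule sum.cong)
      fix i assume "i \<in> {..<n}"
      then have i: "i < n" by simp
      have "(LINT w|W n. (b u i * (w i - 1))\<^sup>2) = (b u i)\<^sup>2"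
        using integral_coordinate(1)[OF i, of "\<lambda>x. (b u i * (x - 1))\<^sup>2"] centered(3) var_1
        by (simp add: power_mult_distrib)
      then show "(LINT w|W n. (b u i * (w i - 1))\<^sup>2) = b u i * b u i"
        by (simp only: power2_eq_square[of "b u i"])
    qed simp
    also have "\<dots> = brownian_cov (emp_copula n x) u u"
    proof -
      have "(\<Sum>i<n. b u i * b u i) = (\<Sum>i<n. (of_bool (i \<in> ranked_below n x u) - emp_copula n x u) * (of_bool (i \<in> ranked_below n x u) - emp_copula n x u)) / real n"
        unfolding b_def sum_divide_distrib by (intro sum.cong refl) simp
      then show ?thesis using sum_indicator_covariance[OF n, of x u u] by simp
    qed
    also have "\<dots> \<le> 1"
    proof -
      have "0 \<le> emp_copula n x u * emp_copula n x u" "emp_copula n x u \<le> 1" using emp_copula_bounds[OF n] by auto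
      then have "emp_copula n x u - emp_copula n x u * emp_copula n x u \<le> 1" by linarith
      then show ?thesis by simp
    qed
    finally show ?thesis unfolding rep by (simp add: divide_right_mono)
  qed
  have "(\<lambda>w. linear_process n x w u) \<in> borel_measurable (W n)" for u
    unfolding rep by (intro borel_measurable_sum borel_measurable_times borel_measurable_diff coordinate_borel) auto
  then show ?thesis unfolding tight_family_def using prob_space_W tail by auto
qed

end

lemma brownian_tight:
  assumes B: "copula_brownian_field N C B" and C: "is_copula C" and g: "\<And>j. j \<in> J \<Longrightarrow> g j \<in> unit_square"
  shows "tight_family J N (\<lambda>j. B (g j))"
proof -
  interpret prob_space N by (rule brownian_prob_space[OF B])
  have "prob {\<omega>\<in>space N. R \<le> \<bar>B u \<omega>\<bar>} \<le> 1 / R\<^sup>2" if u: "u \<in> unit_square" and R: "0 < R" for u R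
  proof -
    note sq = brownian_square_integrable[OF B u]
    have "prob {\<omega>\<in>space N. R \<le> \<bar>B u \<omega> - expectation (B u)\<bar>} \<le> variance (B u) / R\<^sup>2"
      using sq by (intro Chebyshev_inequality R) auto
    also have "variance (B u) = brownian_cov C u u"
      using brownian_product(2)[OF B u u] sq by (simp add: power2_eq_square)
    also have "\<dots> / R\<^sup>2 \<le> 1 / R\<^sup>2"
    proof (rule divide_right_mono)
      have "0 \<le> C u * C u" "C u \<le> 1" using copula_bounds[OF C u] by auto
      then have "C u - C u * C u \<le> 1" by linarith
      then show "brownian_cov C u u \<le> 1" by simp
    qed simp
    finally show ?thesis using sq by simp
  qed
  moreover have "B u \<in> borel_measurable N" if "u \<in> unit_square" for u
    using brownian_square_integrable(1)[OF B that] by (rule borel_measurable_integrable)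
  ultimately show ?thesis unfolding tight_family_def using prob_space_axioms g by auto
qed

lemma (in smooth_copula) grid_stat_coord_vec: "grid_stat stat m (coord_vec (grid m) Y \<omega>) = grid_stat stat m (\<lambda>j. Y j \<omega>)"
  unfolding grid_stat_def coord_vec_def by (simp cong: sum.cong)

text \<open>Together with consistency of the estimator at the sample, this is what the conditional
  analysis asks of the data. Stated as a deterministic property, it turns convergence in probability
  into convergence along all such samples.\<close>

definition regular_sample :: "(real \<times> real \<Rightarrow> real) \<Rightarrow> real \<Rightarrow> nat \<Rightarrow> (nat \<Rightarrow> real \<times> real) \<Rightarrow> bool" where
  "regular_sample C \<theta> n x \<longleftrightarrow> no_ties n x \<and> (\<forall>u\<in>unit_square. \<bar>emp_copula n x u - C u\<bar> \<le> \<theta>)"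

lemma regular_sample_mono: "regular_sample C \<theta> n x \<Longrightarrow> \<theta> \<le> \<theta>' \<Longrightarrow> regular_sample C \<theta>' n x"
  unfolding regular_sample_def by force

context multiplier_bootstrap
begin

text \<open>A linear combination of grid values is a weighted multiplier sum with weights of order 1
  over \<open>sqrt (real n)\<close>, and the sum of squared weights is the quadratic form
  \<open>V\<close> at the empirical copula. The central limit theorem gives the Gaussian factor for
  that form, and continuity of \<open>V\<close> replaces the empirical copula by
  \<open>C\<close>.\<close>

lemma char_close_single:
  assumes B: "copula_brownian_field N C B" and m: "0 < m" and \<delta>: "0 < \<delta>"
  shows "\<exists>\<theta>>0. \<exists>n0\<ge>1. \<forall>n\<ge>n0. \<forall>x. regular_sample C \<theta> n x \<longrightarrow>
    char_close (grid m) {t} \<delta> (W n) (\<lambda>j w. linear_process n x w (grid_point m j)) N (\<lambda>j. B (grid_point m j))"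
proof -
  let ?g = "grid_point m"
  define V where "V c = (\<Sum>j\<in>grid m. \<Sum>k\<in>grid m. t j * t k * brownian_cov c (?g j) (?g k))" for c
  define \<tau> where "\<tau> = (\<Sum>j\<in>grid m. \<bar>t j\<bar>)"
  have tau: "0 \<le> \<tau>" by (auto simp: \<tau>_def sum_nonneg)
  have gU: "?g j \<in> unit_square" if "j \<in> grid m" for j using grid_point_in[OF m that] .
  have limit: "(LINT v|N. iexp (\<Sum>j\<in>grid m. t j * B (?g j) v)) = exp (- V C / 2)"
  proof -
    \<comment> \<open>\<open>brownian_char\<close> indexes coefficients by points of the square, so
      they are carried over from grid indices along the injective \<open>grid_point\<close>.\<close>
    define c where "c u = t (inv_into (grid m) ?g u)" for u
    have c: "c (?g j) = t j" if "j \<in> grid m" for j using that by (simp add: c_def inv_into_f_f[OF grid_point_inj[OF m]])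
    have r: "(\<Sum>u\<in>?g ` grid m. c u * f u) = (\<Sum>j\<in>grid m. t j * f (?g j))" for f :: "real \<times> real \<Rightarrow> real"
      unfolding sum.reindex[OF grid_point_inj[OF m]] comp_def by (intro sum.cong refl) (simp add: c)
    have "(\<Sum>u\<in>?g ` grid m. \<Sum>u'\<in>?g ` grid m. c u * c u' * brownian_cov C u u') =
      (\<Sum>u\<in>?g ` grid m. c u * (\<Sum>u'\<in>?g ` grid m. c u' * brownian_cov C u u'))"
      by (simp only: sum_distrib_left mult.assoc)
    also have "\<dots> = V C" unfolding r V_def by (simp only: sum_distrib_left mult.assoc)
    finally have V: "(\<Sum>u\<in>?g ` grid m. \<Sum>u'\<in>?g ` grid m. c u * c u' * brownian_cov C u u') = V C" .
    have "finite (?g ` grid m)" "?g ` grid m \<subseteq> unit_square" using gU by auto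
    from brownian_char[OF B this, of c] show ?thesis unfolding V r .
  qed
  have "isCont (\<lambda>v. exp (- v / 2)) (V C)" by (intro continuous_intros) simp
  then obtain \<kappa> where k: "0 < \<kappa>" "\<And>v. \<bar>v - V C\<bar> < \<kappa> \<Longrightarrow> \<bar>exp (- v / 2) - exp (- V C / 2)\<bar> < \<delta> / 2"
    using \<delta> unfolding continuous_at_eps_delta dist_real_def by (metis half_gt_zero)
  \<comment> \<open>Each covariance changes by at most \<open>3 * \<theta>\<close>, hence
    \<open>V\<close> by at most \<open>\<tau>\<^sup>2 * (3 * \<theta>)\<close>, which must stay
    below \<open>\<kappa>\<close>; the summand 1 keeps the denominator positive.\<close>
  define \<theta> where "\<theta> = \<kappa> / (3 * \<tau>\<^sup>2 + 1) / 2"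
  have t1: "0 < 3 * \<tau>\<^sup>2 + 1" by (simp add: add_nonneg_pos)
  have th: "0 < \<theta>" using k t1 by (simp add: \<theta>_def)
  have th2: "\<tau>\<^sup>2 * (3 * \<theta>) < \<kappa>"
  proof -
    have "\<tau>\<^sup>2 * (3 * \<theta>) \<le> (3 * \<tau>\<^sup>2 + 1) * \<theta>" using th by (simp add: algebra_simps)
    also have "\<dots> = \<kappa> / 2"
    proof -
      have "c * (\<kappa> / c / 2) = \<kappa> / 2" if "0 < c" for c using that by simp
      from this[OF t1] show ?thesis by (simp only: \<theta>_def)
    qed
    finally show ?thesis using k by linarith
  qed
  have "0 < \<delta> / 2" using \<delta> by simp
  from multiplier_CLT_char[OF this tau] obtain n1 where n1: "\<And>n b. n \<ge> n1 \<Longrightarrow> (\<forall>i<n. \<bar>b i\<bar> \<le> \<tau> / sqrt (real n)) \<Longrightarrow>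
    cmod ((LINT w|W n. iexp (\<Sum>i<n. b i * (w i - 1))) - exp (- (\<Sum>i<n. (b i)\<^sup>2) / 2)) \<le> \<delta> / 2" by blast
  have "char_close (grid m) {t} \<delta> (W n) (\<lambda>j w. linear_process n x w (?g j)) N (\<lambda>j. B (?g j))"
    if n: "max 1 n1 \<le> n" and reg: "regular_sample C \<theta> n x" for n x
  proof -
    have np: "0 < n" "n1 \<le> n" using n by auto
    have s0: "0 < sqrt (real n)" using np by simp
    let ?c = "emp_copula n x"
    define a where "a u i = of_bool (i \<in> ranked_below n x u) - ?c u" for u i
    define b where "b i = (\<Sum>j\<in>grid m. t j * a (?g j) i) / sqrt (real n)" for i
    have sum: "(\<Sum>j\<in>grid m. t j * linear_process n x w (?g j)) = (\<Sum>i<n. b i * (w i - 1))" for w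
    proof -
      have "(\<Sum>j\<in>grid m. t j * linear_process n x w (?g j)) = (\<Sum>j\<in>grid m. \<Sum>i<n. t j * (a (?g j) i / sqrt (real n) * (w i - 1)))"
        unfolding linear_process_sum[OF np(1)] a_def sum_distrib_left ..
      also have "\<dots> = (\<Sum>i<n. \<Sum>j\<in>grid m. t j * (a (?g j) i / sqrt (real n) * (w i - 1)))" by (rule sum.swap)
      also have "\<dots> = (\<Sum>i<n. b i * (w i - 1))"
        unfolding b_def sum_divide_distrib sum_distrib_right by (intro sum.cong refl) simp
      finally show ?thesis .
    qed
    have bb: "\<bar>b i\<bar> \<le> \<tau> / sqrt (real n)" for i
    proof -
      have "\<bar>a u i\<bar> \<le> 1" for u using emp_copula_bounds[OF np(1), of x u] by (auto simp: a_def of_bool_def)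
      then have "\<bar>\<Sum>j\<in>grid m. t j * a (?g j) i\<bar> \<le> \<tau>"
        unfolding \<tau>_def by (intro order_trans[OF sum_abs] sum_mono) (simp add: abs_mult mult_left_le)
      then show ?thesis unfolding b_def abs_divide using s0 by (simp add: divide_right_mono)
    qed
    have b2: "(\<Sum>i<n. (b i)\<^sup>2) = V ?c"
    proof -
      have "(\<Sum>i<n. (b i)\<^sup>2) = (\<Sum>i<n. (\<Sum>j\<in>grid m. \<Sum>k\<in>grid m. t j * t k * (a (?g j) i * a (?g k) i)) / real n)"
      proof (rule sum.cong)
        fix i
        have "(\<Sum>j\<in>grid m. t j * a (?g j) i) * (\<Sum>j\<in>grid m. t j * a (?g j) i) = (\<Sum>j\<in>grid m. \<Sum>k\<in>grid m. t j * t k * (a (?g j) i * a (?g k) i))"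
          unfolding sum_product by (intro sum.cong refl) (simp only: ac_simps)
        then show "(b i)\<^sup>2 = (\<Sum>j\<in>grid m. \<Sum>k\<in>grid m. t j * t k * (a (?g j) i * a (?g k) i)) / real n"
          by (simp add: b_def power_divide power2_eq_square)
      qed simp
      also have "\<dots> = (\<Sum>i<n. \<Sum>j\<in>grid m. \<Sum>k\<in>grid m. t j * t k * (a (?g j) i * a (?g k) i)) / real n"
        by (rule sum_divide_distrib[symmetric])
      also have "(\<Sum>i<n. \<Sum>j\<in>grid m. \<Sum>k\<in>grid m. t j * t k * (a (?g j) i * a (?g k) i)) =
        (\<Sum>j\<in>grid m. \<Sum>i<n. \<Sum>k\<in>grid m. t j * t k * (a (?g j) i * a (?g k) i))" by (rule sum.swap)
      also have "\<dots> = (\<Sum>j\<in>grid m. \<Sum>k\<in>grid m. \<Sum>i<n. t j * t k * (a (?g j) i * a (?g k) i))"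
        by (intro sum.cong refl sum.swap)
      also have "\<dots> / real n = (\<Sum>j\<in>grid m. \<Sum>k\<in>grid m. t j * t k * ((\<Sum>i<n. a (?g j) i * a (?g k) i) / real n))"
        by (simp only: sum_divide_distrib sum_distrib_left times_divide_eq_right)
      also have "\<dots> = V ?c"
        unfolding V_def a_def sum_indicator_covariance[OF np(1)] ..
      finally show ?thesis .
    qed
    have cov: "\<bar>brownian_cov ?c u v - brownian_cov C u v\<bar> \<le> 3 * \<theta>" if uv: "u \<in> unit_square" "v \<in> unit_square" for u v
    proof -
      let ?uv = "(min (fst u) (fst v), min (snd u) (snd v))"
      have muv: "?uv \<in> unit_square" using uv by (auto simp: unit_square_def)
      have r: "\<bar>?c ?uv - C ?uv\<bar> \<le> \<theta>" "\<bar>?c u - C u\<bar> \<le> \<theta>" "\<bar>?c v - C v\<bar> \<le> \<theta>"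
        using reg uv muv by (auto simp: regular_sample_def)
      have gen: "\<bar>(a - y) - (b - z)\<bar> \<le> 3 * \<theta>"
        if "\<bar>a - b\<bar> \<le> \<theta>" "y - z = p + q" "\<bar>p\<bar> \<le> \<theta>" "\<bar>q\<bar> \<le> \<theta>" for a b y z p q :: real
        using that by linarith
      have d: "?c u * ?c v - C u * C v = ?c u * (?c v - C v) + (?c u - C u) * C v" by (simp add: algebra_simps)
      have p: "\<bar>?c u * (?c v - C v)\<bar> \<le> 1 * \<theta>"
        unfolding abs_mult using emp_copula_bounds[OF np(1), of x u] r by (intro mult_mono) auto
      have q: "\<bar>(?c u - C u) * C v\<bar> \<le> \<theta> * 1"
        unfolding abs_mult using copula_bounds[OF C uv(2)] r th by (intro mult_mono) auto
      show ?thesis by (rule gen[OF r(1) d p[unfolded mult_1] q[unfolded mult_1_right]])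
    qed
    have "\<bar>V ?c - V C\<bar> = \<bar>\<Sum>j\<in>grid m. \<Sum>k\<in>grid m. t j * t k * (brownian_cov ?c (?g j) (?g k) - brownian_cov C (?g j) (?g k))\<bar>"
      unfolding V_def by (simp only: sum_subtractf[symmetric] right_diff_distrib)
    also have "\<dots> \<le> (\<Sum>j\<in>grid m. \<Sum>k\<in>grid m. \<bar>t j\<bar> * \<bar>t k\<bar> * (3 * \<theta>))"
    proof (intro order_trans[OF sum_abs] sum_mono order_trans[OF sum_abs])
      fix j k assume jk: "j \<in> grid m" "k \<in> grid m"
      have "\<bar>t j * t k\<bar> * \<bar>brownian_cov ?c (?g j) (?g k) - brownian_cov C (?g j) (?g k)\<bar> \<le> \<bar>t j * t k\<bar> * (3 * \<theta>)"
        by (rule mult_left_mono[OF cov[OF gU[OF jk(1)] gU[OF jk(2)]] abs_ge_zero])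
      then show "\<bar>t j * t k * (brownian_cov ?c (?g j) (?g k) - brownian_cov C (?g j) (?g k))\<bar> \<le> \<bar>t j\<bar> * \<bar>t k\<bar> * (3 * \<theta>)"
        by (simp only: abs_mult)
    qed
    also have "\<dots> = (\<Sum>j\<in>grid m. \<bar>t j\<bar> * (\<Sum>k\<in>grid m. \<bar>t k\<bar> * (3 * \<theta>)))"
      by (simp only: sum_distrib_left mult.assoc)
    also have "\<dots> = \<tau>\<^sup>2 * (3 * \<theta>)"
      by (simp only: \<tau>_def power2_eq_square sum_distrib_right[symmetric] mult.assoc)
    finally have "\<bar>V ?c - V C\<bar> < \<kappa>" using th2 by linarith
    from k(2)[OF this] have ex: "\<bar>exp (- V ?c / 2) - exp (- V C / 2)\<bar> < \<delta> / 2" .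
    have "cmod ((LINT w|W n. iexp (\<Sum>j\<in>grid m. t j * linear_process n x w (?g j))) - (LINT v|N. iexp (\<Sum>j\<in>grid m. t j * B (?g j) v)))
      \<le> cmod ((LINT w|W n. iexp (\<Sum>i<n. b i * (w i - 1))) - exp (- V ?c / 2)) + cmod (complex_of_real (exp (- V ?c / 2)) - exp (- V C / 2))"
      unfolding sum limit by (rule order_trans[OF _ norm_triangle_ineq]) simp
    also have "cmod (complex_of_real (exp (- V ?c / 2)) - exp (- V C / 2)) = \<bar>exp (- V ?c / 2) - exp (- V C / 2)\<bar>"
      by (simp only: of_real_diff[symmetric] norm_of_real real_norm_def)
    also have "cmod ((LINT w|W n. iexp (\<Sum>i<n. b i * (w i - 1))) - exp (- V ?c / 2)) \<le> \<delta> / 2"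
      using n1[OF np(2), of b] bb unfolding b2 by blast
    finally show ?thesis unfolding char_close_def using ex by simp
  qed
  then show ?thesis using th by (intro exI[of _ \<theta>] conjI exI[of _ "max 1 n1"]) auto
qed

lemma char_close_finite:
  assumes B: "copula_brownian_field N C B" and m: "0 < m" and \<delta>: "0 < \<delta>" and T: "finite T"
  shows "\<exists>\<theta>>0. \<exists>n0\<ge>1. \<forall>n\<ge>n0. \<forall>x. regular_sample C \<theta> n x \<longrightarrow>
    char_close (grid m) T \<delta> (W n) (\<lambda>j w. linear_process n x w (grid_point m j)) N (\<lambda>j. B (grid_point m j))"
  using T
proof induction
  case empty
  show ?case by (intro exI[of _ 1] conjI exI[of _ "1::nat"]) (auto simp: char_close_def)
next
  case (insert t T)
  let ?P = "\<lambda>T n x. char_close (grid m) T \<delta> (W n) (\<lambda>j w. linear_process n x w (grid_point m j)) N (\<lambda>j. B (grid_point m j))"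
  obtain \<theta>1 n1 where 1: "\<theta>1 > 0" "n1 \<ge> 1" "\<And>n x. n \<ge> n1 \<Longrightarrow> regular_sample C \<theta>1 n x \<Longrightarrow> ?P T n x"
    using insert.IH by blast
  obtain \<theta>2 n2 where 2: "\<theta>2 > 0" "n2 \<ge> 1" "\<And>n x. n \<ge> n2 \<Longrightarrow> regular_sample C \<theta>2 n x \<Longrightarrow> ?P {t} n x"
    using char_close_single[OF B m \<delta>] by blast
  have "?P (insert t T) n x" if "n \<ge> max n1 n2" "regular_sample C (min \<theta>1 \<theta>2) n x" for n x
  proof -
    have "?P T n x" using that regular_sample_mono[OF that(2), of \<theta>1] by (intro 1(3)) auto
    moreover have "?P {t} n x" using that regular_sample_mono[OF that(2), of \<theta>2] by (intro 2(3)) auto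
    ultimately show ?thesis by (simp add: char_close_def)
  qed
  then show ?case using 1(1,2) 2(1) by (intro exI[of _ "min \<theta>1 \<theta>2"] conjI exI[of _ "max n1 n2"]) auto
qed

lemma grid_stat_convergence:
  fixes N :: "'v measure"
  assumes s: "stat \<in> {L2_stat, KS_stat}" and B: "copula_brownian_field N C B" and m: "0 < m" and e: "0 < e"
  shows "\<exists>\<theta>>0. \<exists>n0\<ge>1. \<forall>n\<ge>n0. \<forall>x. regular_sample C \<theta> n x \<longrightarrow> (\<forall>h\<in>BL1.
    \<bar>(LINT w|W n. h (grid_stat stat m (\<lambda>j. linear_process n x w (grid_point m j)))) -
     (LINT v|N. h (grid_stat stat m (\<lambda>j. B (grid_point m j) v)))\<bar> \<le> e)"
proof -
  have tN: "tight_family (grid m) N (\<lambda>j. B (grid_point m j))"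
    by (rule brownian_tight[OF B C grid_point_in[OF m]])
  obtain \<delta> T where dT: "0 < \<delta>" "finite T" "\<And>(P::(nat \<Rightarrow> real) measure) Y h. tight_family (grid m) P Y \<Longrightarrow>
     char_close (grid m) T \<delta> P Y N (\<lambda>j. B (grid_point m j)) \<Longrightarrow> h \<in> BL1 \<Longrightarrow>
     \<bar>(LINT \<omega>|P. h (grid_stat stat m (coord_vec (grid m) Y \<omega>))) -
       (LINT \<omega>|N. h (grid_stat stat m (coord_vec (grid m) (\<lambda>j. B (grid_point m j)) \<omega>)))\<bar> \<le> e"
    using BL1_expectation_close[OF grid_stat_continuous[OF s, of m] grid_stat_nonneg[OF s, of m] finite_grid tN e] by blast
  obtain \<theta> n0 where *: "0 < \<theta>" "n0 \<ge> 1" "\<And>n x. n \<ge> n0 \<Longrightarrow> regular_sample C \<theta> n x \<Longrightarrow>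
    char_close (grid m) T \<delta> (W n) (\<lambda>j w. linear_process n x w (grid_point m j)) N (\<lambda>j. B (grid_point m j))"
    using char_close_finite[OF B m dT(1,2)] by blast
  have "\<bar>(LINT w|W n. h (grid_stat stat m (\<lambda>j. linear_process n x w (grid_point m j)))) -
     (LINT v|N. h (grid_stat stat m (\<lambda>j. B (grid_point m j) v)))\<bar> \<le> e"
    if n: "n \<ge> n0" and r: "regular_sample C \<theta> n x" and h: "h \<in> BL1" for n x and h :: "real \<Rightarrow> real"
  proof -
    have "0 < n" using n *(2) by simp
    from dT(3)[OF linear_process_tight[OF this] *(3)[OF n r] h] show ?thesis unfolding grid_stat_coord_vec .
  qed
  then show ?thesis using *(1,2) by blast
qed

end

section \<open>Passage from the grid to the limit path\<close>

context smooth_copula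
begin

text \<open>Continuity of the limit paths enters here: a path is uniformly close to the step path
  through its grid values, and the statistic of the limit functional follows by
  \<open>stat_grid_close\<close>.\<close>

lemma path_grid_limit:
  assumes s: "stat \<in> {L2_stat, KS_stat}" and A: "continuous_on unit_square A"
  shows "(\<lambda>m. grid_stat stat m (\<lambda>j. A (grid_point m j))) \<longlonglongrightarrow> stat (H_form C (dotC C) A)"
proof (rule LIMSEQ_I)
  fix e :: real assume e: "0 < e"
  have "compact (A ` unit_square)" by (rule compact_continuous_image[OF A compact_unit_square])
  then obtain R where R: "\<And>u. u \<in> unit_square \<Longrightarrow> \<bar>A u\<bar> \<le> R"
    by (metis bounded_real compact_imp_bounded imageI)
  have R0: "0 \<le> R" using R[of "(0, 0)"] by (simp add: unit_square_def)
  \<comment> \<open>For \<open>\<epsilon> \<le> 1\<close> the bound of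
    \<open>stat_grid_close\<close> with no error of its own in \<open>f\<close> is at most
    \<open>\<epsilon> * c\<close>.\<close>
  define c where "c = 12 * (24 * R + 37)"
  have c: "0 < c" using R0 by (simp add: c_def)
  define \<epsilon> where "\<epsilon> = min 1 (e / (2 * c))"
  have ep: "0 < \<epsilon>" "\<epsilon> \<le> 1" using e c by (auto simp: \<epsilon>_def)
  have "\<epsilon> \<le> e / (2 * c)" by (simp add: \<epsilon>_def)
  then have ec: "\<epsilon> * c < e" using c e by (simp add: field_simps)
  have "uniformly_continuous_on unit_square A" by (rule compact_uniformly_continuous[OF A compact_unit_square])
  then obtain d where d: "0 < d" "\<And>u v. u \<in> unit_square \<Longrightarrow> v \<in> unit_square \<Longrightarrow> dist v u < d \<Longrightarrow> dist (A v) (A u) < \<epsilon>"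
    unfolding uniformly_continuous_on_def using ep(1) by metis
  obtain M :: nat where M: "2 / d < real M" using reals_Archimedean2 by blast
  have "norm (grid_stat stat m (\<lambda>j. A (grid_point m j)) - stat (H_form C (dotC C) A)) < e" if m: "m \<ge> max 1 M" for m
  proof -
    have m0: "0 < m" "M \<le> m" using m by auto
    then have "2 / d < real m" using M by linarith
    then have md: "2 / real m < d" using d(1) m0 by (simp add: field_simps)
    have close: "\<bar>A u - A (grid_point m (cell m u))\<bar> \<le> \<epsilon>" if u: "u \<in> unit_square" for u
    proof -
      note cg = cell_in_grid[OF m0(1) u]
      let ?g = "grid_point m (cell m u)"
      have "dist u ?g \<le> \<bar>fst u - fst ?g\<bar> + \<bar>snd u - snd ?g\<bar>"
        unfolding dist_prod_def dist_real_def using sqrt_sum_squares_le_sum_abs[of "fst u - fst ?g" "snd u - snd ?g"] by simp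
      then have "dist u ?g < d" using cg(5,6) md by linarith
      from d(2)[OF cg(2) u this] show ?thesis by (simp add: dist_real_def)
    qed
    define A' where "A' u = indicat_real unit_square u *\<^sub>R A u" for u
    have A'm: "A' \<in> borel_measurable borel" unfolding A'_def
      using borel_measurable_continuous_on_indicator[OF borel_compact[OF compact_unit_square] A] by simp
    have eq: "H_form C (dotC C) A v = H_form C (dotC C) A' v" if "v \<in> unit_cube" for v
      by (rule H_form_cong[OF C01 _ _ _ that]) (auto simp: A'_def)
    have "stat (H_form C (dotC C) A) = stat (H_form C (dotC C) A')" by (rule stat_cong[OF s eq])
    moreover have "\<bar>stat (H_form C (dotC C) A') - grid_stat stat m (\<lambda>j. A (grid_point m j))\<bar> \<le>
       (0 + 12 * \<epsilon>) * (2 * (12 * (R + \<epsilon>)) + (0 + 12 * \<epsilon>) + 1)"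
      by (rule stat_grid_close[OF s m0(1) H_form_measurable[OF A'm], where A = A]) (use eq close R in auto)
    moreover have "(0 + 12 * \<epsilon>) * (2 * (12 * (R + \<epsilon>)) + (0 + 12 * \<epsilon>) + 1) \<le> \<epsilon> * c"
    proof -
      have "12 * (2 * (12 * (R + \<epsilon>)) + 12 * \<epsilon> + 1) \<le> c" using ep by (simp add: c_def)
      then have "\<epsilon> * (12 * (2 * (12 * (R + \<epsilon>)) + 12 * \<epsilon> + 1)) \<le> \<epsilon> * c" using ep by (intro mult_left_mono) auto
      then show ?thesis by (simp only: add_0_left ac_simps)
    qed
    ultimately show ?thesis using ec by (simp add: abs_minus_commute)
  qed
  then show "\<exists>no. \<forall>m\<ge>no. norm (grid_stat stat m (\<lambda>j. A (grid_point m j)) - stat (H_form C (dotC C) A)) < e" by blast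
qed

lemma grid_stat_measurable:
  assumes s: "stat \<in> {L2_stat, KS_stat}" and tf: "tight_family (grid m) P Y"
  shows "(\<lambda>v. grid_stat stat m (\<lambda>j. Y j v)) \<in> borel_measurable P"
  using measurable_compose[OF coord_vec_measurable[OF tf] borel_measurable_continuous_onI[OF grid_stat_continuous[OF s, of m]]]
  unfolding grid_stat_coord_vec .

lemma BL1_min: "h \<in> BL1 \<Longrightarrow> \<bar>h a - h b\<bar> \<le> min 2 \<bar>a - b :: real\<bar>"
  using BL1_D(1)[of h a] BL1_D(1)[of h b] BL1_D(2)[of h a b] by (simp add: dist_real_def)

lemma BL1_borel: "h \<in> BL1 \<Longrightarrow> (h :: real \<Rightarrow> real) \<in> borel_measurable borel"
  by (intro borel_measurable_continuous_onI BL1_continuous)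

text \<open>As a pointwise limit of grid statistics the limit statistic is measurable. The
  convergence is uniform over \<open>BL1\<close> because each difference of values of
  \<open>h\<close> is bounded by \<open>min 2\<close> of the distance, whatever \<open>h\<close> is,
  so dominated convergence is applied once.\<close>

lemma limit_stat:
  assumes s: "stat \<in> {L2_stat, KS_stat}" and B: "copula_brownian_field N C B"
  shows "(\<lambda>v. stat (H_limit C B v)) \<in> borel_measurable N"
    and "0 < e \<Longrightarrow> \<exists>m0. \<forall>m\<ge>m0. \<forall>h\<in>BL1. \<bar>(LINT v|N. h (grid_stat stat m (\<lambda>j. B (grid_point m j) v))) - (LINT v|N. h (stat (H_limit C B v)))\<bar> \<le> e"
proof -
  interpret prob_space N by (rule brownian_prob_space[OF B])
  let ?S = "\<lambda>v. stat (H_limit C B v)" and ?Sm = "\<lambda>m v. grid_stat stat m (\<lambda>j. B (grid_point m j) v)"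
  have lim: "(\<lambda>m. ?Sm m v) \<longlonglongrightarrow> ?S v" if "v \<in> space N" for v
  proof -
    have "continuous_on unit_square (\<lambda>u. B u v)" using B that by (simp add: copula_brownian_field_def)
    from path_grid_limit[OF s this] show ?thesis by (simp add: H_limit_def)
  qed
  \<comment> \<open>The shift to \<open>Suc m\<close> excludes the mesh number 0, by which grid
    points would be divided.\<close>
  have Smm: "?Sm (Suc m) \<in> borel_measurable N" for m
    by (rule grid_stat_measurable[OF s brownian_tight[OF B C grid_point_in]]) auto
  show Sm: "?S \<in> borel_measurable N"
    by (rule borel_measurable_LIMSEQ_real[where u = "\<lambda>m. ?Sm (Suc m)", OF LIMSEQ_Suc[OF lim] Smm])
  assume e: "0 < e"
  have "(\<lambda>m. LINT v|N. min 2 \<bar>?Sm (Suc m) v - ?S v\<bar>) \<longlonglongrightarrow> (LINT v|N. 0)"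
  proof (rule integral_dominated_convergence[where w = "\<lambda>_. 2"])
    show "AE v in N. (\<lambda>m. min 2 \<bar>?Sm (Suc m) v - ?S v\<bar>) \<longlonglongrightarrow> 0"
    proof (rule AE_I2)
      fix v assume v: "v \<in> space N"
      have "(\<lambda>m. min 2 \<bar>?Sm (Suc m) v - ?S v\<bar>) \<longlonglongrightarrow> min 2 \<bar>?S v - ?S v\<bar>"
        by (intro tendsto_intros LIMSEQ_Suc lim v)
      then show "(\<lambda>m. min 2 \<bar>?Sm (Suc m) v - ?S v\<bar>) \<longlonglongrightarrow> 0" by simp
    qed
    show "(\<lambda>v. min 2 \<bar>?Sm (Suc m) v - ?S v\<bar>) \<in> borel_measurable N" for m
      using Smm[of m] Sm by measurable
  qed auto
  then have "\<forall>\<^sub>F m in sequentially. (LINT v|N. min 2 \<bar>?Sm (Suc m) v - ?S v\<bar>) < e"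
    using e by (intro order_tendstoD(2)) auto
  then obtain M where M: "\<And>m. m \<ge> M \<Longrightarrow> (LINT v|N. min 2 \<bar>?Sm (Suc m) v - ?S v\<bar>) < e"
    by (auto simp: eventually_sequentially)
  have "\<bar>(LINT v|N. h (?Sm m v)) - (LINT v|N. h (?S v))\<bar> \<le> e" if m: "m \<ge> Suc M" and h: "h \<in> BL1" for m and h :: "real \<Rightarrow> real"
  proof -
    obtain k where k: "m = Suc k" "M \<le> k" using m by (metis Suc_le_D Suc_le_mono)
    have mm: "(\<lambda>v. h (?Sm m v)) \<in> borel_measurable N" "(\<lambda>v. h (?S v)) \<in> borel_measurable N"
      unfolding k(1) using measurable_compose[OF Smm BL1_borel[OF h]] measurable_compose[OF Sm BL1_borel[OF h]] by auto
    have i: "integrable N (\<lambda>v. h (?Sm m v))" "integrable N (\<lambda>v. h (?S v))"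
      by (rule integrable_const_bound[of _ 1]; use mm BL1_D(1)[OF h] in auto)+
    have "\<bar>(LINT v|N. h (?Sm m v)) - (LINT v|N. h (?S v))\<bar> = \<bar>LINT v|N. h (?Sm m v) - h (?S v)\<bar>" using i by simp
    also have "\<dots> \<le> (LINT v|N. \<bar>h (?Sm m v) - h (?S v)\<bar>)" by (rule integral_abs_bound)
    also have "\<dots> \<le> (LINT v|N. min 2 \<bar>?Sm m v - ?S v\<bar>)"
    proof (rule integral_mono)
      show "integrable N (\<lambda>v. min 2 \<bar>?Sm m v - ?S v\<bar>)"
        by (rule integrable_const_bound[of _ 2]) (use Smm[of k] Sm in \<open>auto simp: k(1)\<close>)
    qed (use i BL1_min[OF h] in auto)
    also have "\<dots> \<le> e" using M[OF k(2)] k(1) by simp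
    finally show ?thesis .
  qed
  then show "\<exists>m0. \<forall>m\<ge>m0. \<forall>h\<in>BL1. \<bar>(LINT v|N. h (?Sm m v)) - (LINT v|N. h (?S v))\<bar> \<le> e" by blast
qed

end

text \<open>The assumptions on the estimator read off at one fixed sample, so that the conditional
  statements can quantify over \<open>D\<close> and \<open>x\<close> without any probability on the
  data.\<close>

definition admissible_estimator ::
  "(nat \<Rightarrow> (nat \<Rightarrow> real \<times> real) \<Rightarrow> nat \<Rightarrow> real \<times> real \<Rightarrow> real) \<Rightarrow> nat \<Rightarrow> (nat \<Rightarrow> real \<times> real) \<Rightarrow> real \<Rightarrow> bool" where
  "admissible_estimator D n x K \<longleftrightarrow>
     (\<forall>p\<in>{1, 2}. \<forall>u\<in>unit_square. \<bar>D n x p u\<bar> \<le> K) \<and>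
     (\<forall>w. H_mult D n x w \<in> borel_measurable cube_measure)"

lemma H_mult_bound:
  assumes n: "0 < n" and D: "admissible_estimator D n x K"
    and A: "\<And>u. u \<in> unit_square \<Longrightarrow> \<bar>mult_process n x w u\<bar> \<le> R" and v: "v \<in> unit_cube"
  shows "\<bar>H_mult D n x w v\<bar> \<le> 12 * (max 1 K)\<^sup>2 * R"
  unfolding H_mult_def
proof (rule H_form_bound[OF _ _ A _ v])
  fix p :: nat and u assume "p \<in> {1, 2}" "u \<in> unit_square"
  then have "\<bar>D n x p u\<bar> \<le> K" using D unfolding admissible_estimator_def by blast
  then show "\<bar>D n x p u\<bar> \<le> max 1 K" by linarith
qed (use emp_copula_bounds[OF n] in auto)

text \<open>\<open>H_mult\<close> is linear in the normalised multipliers. The coefficient functions are recovered, with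
  their measurability, from the two choices \<open>w = 0\<close> and \<open>w = indicator of i\<close>.\<close>

lemma (in multiplier_law) stat_H_mult_measurable:
  assumes n: "0 < n" and D: "admissible_estimator D n x K" and s: "stat \<in> {L2_stat, KS_stat}"
  shows "(\<lambda>w. stat (H_mult D n x w)) \<in> borel_measurable (W n)"
proof -
  define a where "a w i = (if i < n then (w i / mean n w - 1) / sqrt (real n) else 0)" for w :: "nat \<Rightarrow> real" and i
  define I where "I i u = (of_bool (i \<in> ranked_below n x u) :: real)" for i u
  define f where "f i = H_form (emp_copula n x) (D n x) (I i)" for i
  have mp: "mult_process n x w u = (\<Sum>i<n. a w i * I i u)" for w u
  proof -
    have "(\<Sum>i<n. a w i * I i u) = (\<Sum>i<n. if i \<in> ranked_below n x u then (w i / mean n w - 1) / sqrt (real n) else 0)"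
      by (intro sum.cong refl) (auto simp: a_def I_def)
    also have "\<dots> = (\<Sum>i\<in>{..<n} \<inter> ranked_below n x u. (w i / mean n w - 1) / sqrt (real n))"
      by (rule sum.inter_restrict[symmetric]) simp
    also have "{..<n} \<inter> ranked_below n x u = ranked_below n x u" using below_subset by blast
    finally show ?thesis by (simp only: mult_process_sum[OF n])
  qed
  have lin: "H_mult D n x w v = (\<Sum>i<n. a w i * f i v)" for w v
  proof -
    have "mult_process n x w = (\<lambda>u. \<Sum>i<n. a w i * I i u)" by (rule ext) (rule mp)
    then show ?thesis unfolding H_mult_def f_def by (simp only: H_form_sum)
  qed
  have sn: "0 < sqrt (real n)" using n by simp
  have fm: "f i \<in> borel_measurable cube_measure" if i: "i < n" for i
  proof -
    define w1 where "w1 j = (if j = i then 1 else 0 :: real)" for j :: nat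
    have "mean n w1 = 1 / real n" using i by (simp add: mean_def w1_def)
    then have a1: "a w1 j = (if j = i then real n else 0) / sqrt (real n) - 1 / sqrt (real n)" if "j < n" for j
      using that n by (simp add: a_def w1_def diff_divide_distrib)
    \<comment> \<open>For zero multipliers the mean vanishes and the convention 0/0 = 0 leaves the
      same coefficient everywhere. The indicator choice differs from it only at index
      \<open>i\<close>, which isolates \<open>f i\<close>.\<close>
    have a0: "a (\<lambda>_. 0) j = - (1 / sqrt (real n))" if "j < n" for j using that by (simp add: a_def)
    have "H_mult D n x w1 v - H_mult D n x (\<lambda>_. 0) v = real n / sqrt (real n) * f i v" for v
    proof -
      have "H_mult D n x w1 v - H_mult D n x (\<lambda>_. 0) v = (\<Sum>j<n. (a w1 j - a (\<lambda>_. 0) j) * f j v)"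
        unfolding lin by (simp only: sum_subtractf[symmetric] left_diff_distrib)
      also have "\<dots> = (\<Sum>j<n. if j = i then real n / sqrt (real n) * f i v else 0)"
        by (intro sum.cong refl) (auto simp: a1 a0)
      also have "\<dots> = real n / sqrt (real n) * f i v" using i by simp
      finally show ?thesis .
    qed
    then have "f i v = sqrt (real n) / real n * (H_mult D n x w1 v - H_mult D n x (\<lambda>_. 0) v)" for v
      using n sn by simp
    moreover have "(\<lambda>v. sqrt (real n) / real n * (H_mult D n x w1 v - H_mult D n x (\<lambda>_. 0) v)) \<in> borel_measurable cube_measure"
      using D unfolding admissible_estimator_def by (intro borel_measurable_times borel_measurable_diff borel_measurable_const) auto
    ultimately show ?thesis by (metis (no_types, lifting) ext)
  qed
  have fb: "\<bar>f i v\<bar> \<le> 12 * (max 1 K)\<^sup>2 * 1" if "v \<in> unit_cube" for i v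
    unfolding f_def
  proof (rule H_form_bound[OF _ _ _ _ that])
    fix p :: nat and u assume "p \<in> {1, 2}" "u \<in> unit_square"
    then have "\<bar>D n x p u\<bar> \<le> K" using D unfolding admissible_estimator_def by blast
    then show "\<bar>D n x p u\<bar> \<le> max 1 K" by linarith
  qed (use emp_copula_bounds[OF n] in \<open>auto simp: I_def\<close>)
  have cont: "continuous_on UNIV (\<lambda>y. stat (\<lambda>v. \<Sum>i\<in>{..<n}. y i * f i v))"
    by (rule stat_linear_continuous[OF s]) (use fm fb in auto)
  have am: "a \<in> borel_measurable (W n)"
  proof (rule measurable_coordinatewise_then_product)
    fix i
    have "(\<lambda>w. mean n w) \<in> borel_measurable (W n)"
      unfolding mean_def by (intro borel_measurable_divide borel_measurable_sum coordinate_borel borel_measurable_const) auto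
    then show "(\<lambda>w. a w i) \<in> borel_measurable (W n)"
      by (cases "i < n") (auto simp: a_def intro!: borel_measurable_divide borel_measurable_diff coordinate_borel)
  qed
  have "(\<lambda>w. stat (\<lambda>v. \<Sum>i\<in>{..<n}. a w i * f i v)) \<in> borel_measurable (W n)"
    by (rule measurable_compose[OF am borel_measurable_continuous_onI[OF cont]])
  moreover have "H_mult D n x w = (\<lambda>v. \<Sum>i\<in>{..<n}. a w i * f i v)" for w by (rule ext) (rule lin)
  ultimately show ?thesis by simp
qed

context multiplier_bootstrap
begin

definition consistent_at where
  "consistent_at D n x a \<theta> \<longleftrightarrow> (\<forall>p\<in>{1, 2}. \<forall>u\<in>inner_strip p a. \<bar>D n x p u - dotC C p u\<bar> \<le> \<theta>)"

lemma perturbed_path_good: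
  assumes n: "0 < n" and D: "admissible_estimator D n x K" and gp: "good_path C n x w R \<epsilon> \<delta> \<delta>'" and R: "1 \<le> R" and e: "0 < \<epsilon>"
    and \<delta>: "0 < \<delta>p" "\<delta>p \<le> \<delta>" "\<delta>p \<le> \<delta>'" and \<theta>: "\<theta> \<le> \<delta>p / 2" "\<theta> \<le> \<epsilon> / R"
    and reg: "regular_sample C \<theta> n x" and con: "consistent_at D n x (\<delta>p / 2) \<theta>"
    and sm: "\<And>p u. p \<in> {1, 2} \<Longrightarrow> u \<in> inner_strip p \<delta> \<Longrightarrow> C u \<le> \<delta>p \<Longrightarrow> dotC C p u \<le> \<epsilon> / R"
    and uc: "\<And>p u v. p \<in> {1, 2} \<Longrightarrow> u \<in> inner_strip p (\<delta>p / 2) \<Longrightarrow> v \<in> inner_strip p (\<delta>p / 2) \<Longrightarrow>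
      \<bar>fst u - fst v\<bar> \<le> \<theta> \<Longrightarrow> \<bar>snd u - snd v\<bar> \<le> \<theta> \<Longrightarrow> \<bar>dotC C p u - dotC C p v\<bar> \<le> \<epsilon> / R"
  shows "perturbed_path C (emp_copula n x) (mult_process n x w) (dotC C) (D n x) (max 1 K) R \<epsilon> \<delta>p (\<epsilon> / R) \<theta>"
proof
  let ?A = "mult_process n x w"
  have m0: "mean n w \<noteq> 0" using gp by (simp add: good_path_def)
  have mod: "\<bar>?A u - ?A v\<bar> \<le> \<epsilon>" if "u \<in> unit_square" "v \<in> unit_square" "\<bar>fst u - fst v\<bar> \<le> \<delta>" "\<bar>snd u - snd v\<bar> \<le> \<delta>" for u v
    using gp that unfolding good_path_def by blast
  have bd: "\<bar>?A u\<bar> \<le> R" if "u \<in> unit_square" for u using gp that unfolding good_path_def by blast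
  note bnd = mult_process_boundary[OF n, where x = x and w = w]
  show "?A (0, t) = 0" "?A (t, 0) = 0" for t by (rule bnd)+
  show A11: "?A (1, 1) = 0" using bnd(3) m0 by blast
  show "\<bar>?A u\<bar> \<le> R" if "u \<in> unit_square" for u by (rule bd[OF that])
  show "\<bar>?A u - ?A v\<bar> \<le> \<epsilon>" if "u \<in> unit_square" "v \<in> unit_square" "\<bar>fst u - fst v\<bar> \<le> \<delta>p" "\<bar>snd u - snd v\<bar> \<le> \<delta>p" for u v
    by (rule mod) (use that \<delta> in linarith)+
  show "\<bar>D n x p u\<bar> \<le> max 1 K" if "p \<in> {1, 2}" "u \<in> unit_square" for p u
  proof -
    have "\<bar>D n x p u\<bar> \<le> K" using D that unfolding admissible_estimator_def by blast
    then show ?thesis by linarith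
  qed
  show "\<bar>dotC C p u\<bar> \<le> max 1 K" if "p \<in> {1, 2}" "u \<in> unit_square" for p u using abs_dotC_le[OF that] by linarith
  show "is_copula C" by (rule C)
  show "0 \<le> emp_copula n x u \<and> emp_copula n x u \<le> 1" for u using emp_copula_bounds[OF n] by auto
  show "\<bar>emp_copula n x u - C u\<bar> \<le> \<theta>" if "u \<in> unit_square" for u using reg that by (auto simp: regular_sample_def)
  show "\<bar>D n x p u - dotC C p u\<bar> \<le> \<epsilon> / R" if "p \<in> {1, 2}" "u \<in> unit_square" "\<delta>p / 2 \<le> coord p u" "coord p u \<le> 1 - \<delta>p / 2" for p u
  proof -
    have "\<bar>D n x p u - dotC C p u\<bar> \<le> \<theta>" using con that unfolding consistent_at_def inner_strip_def by blast
    then show ?thesis using \<theta>(2) by linarith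
  qed
  show "\<bar>dotC C p u - dotC C p v\<bar> \<le> \<epsilon> / R"
    if "p \<in> {1, 2}" "u \<in> unit_square" "v \<in> unit_square" "\<delta>p / 2 \<le> coord p u" "coord p u \<le> 1 - \<delta>p / 2"
      "\<delta>p / 2 \<le> coord p v" "coord p v \<le> 1 - \<delta>p / 2" "\<bar>fst u - fst v\<bar> \<le> \<theta>" "\<bar>snd u - snd v\<bar> \<le> \<theta>" for p u v
    by (rule uc) (use that in \<open>auto simp: inner_strip_def\<close>)
  show "\<bar>?A u\<bar> \<le> \<epsilon> \<and> \<bar>dotC C 1 u * ?A (fst u, 1)\<bar> \<le> \<epsilon> \<and> \<bar>dotC C 2 u * ?A (1, snd u)\<bar> \<le> \<epsilon>"
    if u: "u \<in> unit_square" and Cu: "C u \<le> \<delta>p" for u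
  proof -
    have c: "0 \<le> fst u" "fst u \<le> 1" "0 \<le> snd u" "snd u \<le> 1" using u by (auto simp: unit_square_def)
    have prod: "\<bar>a * b\<bar> \<le> \<epsilon>" if "0 \<le> a" "a \<le> 1" "\<bar>b\<bar> \<le> R" "a \<le> \<epsilon> / R \<or> \<bar>b\<bar> \<le> \<epsilon>" for a b :: real
      using that(4)
    proof
      assume "a \<le> \<epsilon> / R"
      then have "\<bar>a\<bar> * \<bar>b\<bar> \<le> \<epsilon> / R * R" using that e R by (intro mult_mono) auto
      then show ?thesis using R by (simp add: abs_mult)
    next
      assume "\<bar>b\<bar> \<le> \<epsilon>"
      then have "\<bar>a\<bar> * \<bar>b\<bar> \<le> 1 * \<epsilon>" using that by (intro mult_mono) auto
      then show ?thesis by (simp add: abs_mult)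
    qed
    \<comment> \<open>Away from the edges the derivative is small because the copula is; near the
      edges the marginal path is small because it vanishes at both ends.\<close>
    have 1: "dotC C 1 u \<le> \<epsilon> / R \<or> \<bar>?A (fst u, 1)\<bar> \<le> \<epsilon>"
    proof (cases "u \<in> inner_strip 1 \<delta>")
      case True then show ?thesis using sm[of 1 u] Cu by simp
    next
      case False
      then have "fst u < \<delta> \<or> 1 - \<delta> < fst u" using u by (auto simp: inner_strip_def coord_def)
      then have "\<bar>?A (fst u, 1) - ?A (0, 1)\<bar> \<le> \<epsilon> \<or> \<bar>?A (fst u, 1) - ?A (1, 1)\<bar> \<le> \<epsilon>"
      proof
        assume "fst u < \<delta>"
        then show ?thesis using mod[of "(fst u, 1)" "(0, 1)"] c \<delta> by (simp add: unit_square_iff)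
      next
        assume "1 - \<delta> < fst u"
        then show ?thesis using mod[of "(fst u, 1)" "(1, 1)"] c \<delta> by (simp add: unit_square_iff)
      qed
      then show ?thesis using bnd(1) A11 by simp
    qed
    have 2: "dotC C 2 u \<le> \<epsilon> / R \<or> \<bar>?A (1, snd u)\<bar> \<le> \<epsilon>"
    proof (cases "u \<in> inner_strip 2 \<delta>")
      case True then show ?thesis using sm[of 2 u] Cu by simp
    next
      case False
      then have "snd u < \<delta> \<or> 1 - \<delta> < snd u" using u by (auto simp: inner_strip_def coord_def)
      then have "\<bar>?A (1, snd u) - ?A (1, 0)\<bar> \<le> \<epsilon> \<or> \<bar>?A (1, snd u) - ?A (1, 1)\<bar> \<le> \<epsilon>"
      proof
        assume "snd u < \<delta>"
        then show ?thesis using mod[of "(1, snd u)" "(1, 0)"] c \<delta> by (simp add: unit_square_iff)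
      next
        assume "1 - \<delta> < snd u"
        then show ?thesis using mod[of "(1, snd u)" "(1, 1)"] c \<delta> by (simp add: unit_square_iff)
      qed
      then show ?thesis using bnd(2) A11 by simp
    qed
    have m: "(fst u, 1) \<in> unit_square" "(1, snd u) \<in> unit_square" using c by (auto simp: unit_square_iff)
    have "\<bar>?A u\<bar> \<le> \<epsilon>" using gp u Cu \<delta> unfolding good_path_def by (meson order_trans)
    then show ?thesis
      using prod[OF _ _ bd[OF m(1)] 1] prod[OF _ _ bd[OF m(2)] 2] dotC_bounds[of 1 u] dotC_bounds[of 2 u] u by simp
  qed
qed (use e R \<delta> \<theta> in auto)

text \<open>Separates the random from the deterministic: good paths are likely for every regular
  sample, and on good paths the bootstrap statistic is close to a statistic of finitely many linear
  process values, for every mesh beyond \<open>m0\<close> and every estimator near the true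
  derivatives. The first clause also serves the joint distribution, the second needs no
  measurability in the data.\<close>

lemma bootstrap_approximation:
  assumes s: "stat \<in> {L2_stat, KS_stat}" and e: "0 < e" and e0: "0 < \<epsilon>0"
  shows "\<exists>R \<epsilon> \<delta> \<delta>'. \<exists>a>0. a < 1 / 2 \<and> (\<exists>\<theta>>0. \<exists>n0\<ge>1. \<exists>m0\<ge>1. \<forall>n\<ge>n0. \<forall>x. regular_sample C \<theta> n x \<longrightarrow>
     (\<exists>E\<in>sets (W n). measure (W n) E \<le> \<epsilon>0 \<and> (\<forall>w\<in>space (W n) - E. good_path C n x w R \<epsilon> \<delta> \<delta>')) \<and>
     (\<forall>D. admissible_estimator D n x K \<longrightarrow> consistent_at D n x a \<theta> \<longrightarrow> (\<forall>w m. good_path C n x w R \<epsilon> \<delta> \<delta>' \<longrightarrow> m0 \<le> m \<longrightarrow>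
        \<bar>stat (H_mult D n x w) - grid_stat stat m (\<lambda>j. linear_process n x w (grid_point m j))\<bar> \<le> e)))"
proof -
  obtain R where R: "1 \<le> R" and Rprop: "\<And>\<epsilon>. 0 < \<epsilon> \<Longrightarrow> \<exists>\<delta>>0. \<exists>\<delta>'>0. \<exists>\<theta>>0. \<exists>n0\<ge>1. \<forall>n\<ge>n0. \<forall>x. no_ties n x \<longrightarrow>
    (\<forall>u\<in>unit_square. \<bar>emp_copula n x u - C u\<bar> \<le> \<theta>) \<longrightarrow>
    (\<exists>E\<in>sets (W n). measure (W n) E \<le> \<epsilon>0 \<and> (\<forall>w\<in>space (W n) - E. good_path C n x w R \<epsilon> \<delta> \<delta>'))"
    using good_path_probability[OF e0] by blast
  define K1 where "K1 = max 1 K"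
  \<comment> \<open>80 comes from \<open>H_form_close\<close>; 24 is 12 times the two errors of size
    \<open>\<epsilon>\<close> made on passing to the grid corner and to the linear process. With
    \<open>\<epsilon> \<le> 1\<close> the bound of \<open>stat_grid_close\<close> becomes
    \<open>\<epsilon> * c * (24 * R + 49 + c)\<close>, which dictates
    \<open>\<epsilon>\<close>.\<close>
  define c where "c = 80 * K1\<^sup>2 + 24"
  have c: "0 < c" unfolding c_def by (simp add: add_nonneg_pos)
  define \<epsilon> where "\<epsilon> = min 1 (e / (c * (24 * R + 49 + c)))"
  have cR: "0 < c * (24 * R + 49 + c)" using c R by simp
  have ep: "0 < \<epsilon>" "\<epsilon> \<le> 1" using e cR by (auto simp: \<epsilon>_def)
  have "\<epsilon> \<le> e / (c * (24 * R + 49 + c))" by (simp add: \<epsilon>_def)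
  then have epe: "\<epsilon> * (c * (24 * R + 49 + c)) \<le> e" using cR by (simp only: pos_le_divide_eq)
  from Rprop[OF ep(1)] obtain \<delta> \<delta>' \<theta>1 n0 where d: "0 < \<delta>" "0 < \<delta>'" "0 < \<theta>1" "1 \<le> n0"
    and gpp': "\<forall>n\<ge>n0. \<forall>x. no_ties n x \<longrightarrow>
    (\<forall>u\<in>unit_square. \<bar>emp_copula n x u - C u\<bar> \<le> \<theta>1) \<longrightarrow>
    (\<exists>E\<in>sets (W n). measure (W n) E \<le> \<epsilon>0 \<and> (\<forall>w\<in>space (W n) - E. good_path C n x w R \<epsilon> \<delta> \<delta>'))"
    by (elim exE conjE) (rule that)
  note gpp = gpp'[rule_format]
  define \<eta> where "\<eta> = \<epsilon> / R"
  have eta: "0 < \<eta>" using ep R by (simp add: \<eta>_def)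
  have "\<exists>\<delta>3>0. \<forall>u\<in>inner_strip p \<delta>. C u \<le> \<delta>3 \<longrightarrow> dotC C p u \<le> \<eta>" if "p \<in> {1, 2}" for p
    by (rule dotC_small[OF that d(1) eta])
  then obtain \<delta>31 \<delta>32 where d3: "0 < \<delta>31" "0 < \<delta>32"
    "\<And>u. u \<in> inner_strip 1 \<delta> \<Longrightarrow> C u \<le> \<delta>31 \<Longrightarrow> dotC C 1 u \<le> \<eta>" "\<And>u. u \<in> inner_strip 2 \<delta> \<Longrightarrow> C u \<le> \<delta>32 \<Longrightarrow> dotC C 2 u \<le> \<eta>"
    by (metis insertI1 insertI2)
  \<comment> \<open>The margin for the perturbation argument: within the modulus of the path, and
    small enough that copula values up to \<open>\<delta>p\<close> make both the path and, inside
    the strips of margin \<open>\<delta>\<close>, the derivatives small.\<close>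
  define \<delta>p where "\<delta>p = min (min \<delta> \<delta>') (min (min \<delta>31 \<delta>32) (1 / 2))"
  have dp: "0 < \<delta>p" "\<delta>p \<le> \<delta>" "\<delta>p \<le> \<delta>'" "\<delta>p \<le> \<delta>31" "\<delta>p \<le> \<delta>32" "\<delta>p / 2 < 1 / 2" using d d3 by (auto simp: \<delta>p_def)
  have dp2: "0 < \<delta>p / 2" using dp by simp
  have "\<exists>\<theta>>0. \<forall>u\<in>inner_strip p (\<delta>p / 2). \<forall>v\<in>inner_strip p (\<delta>p / 2).
    \<bar>fst u - fst v\<bar> \<le> \<theta> \<longrightarrow> \<bar>snd u - snd v\<bar> \<le> \<theta> \<longrightarrow> \<bar>dotC C p u - dotC C p v\<bar> \<le> \<eta>" if "p \<in> {1, 2}" for p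
    by (rule dotC_uniformly_continuous[OF that dp2 eta])
  then obtain \<theta>2 \<theta>3 where t23: "0 < \<theta>2" "0 < \<theta>3"
    "\<And>u v. u \<in> inner_strip 1 (\<delta>p / 2) \<Longrightarrow> v \<in> inner_strip 1 (\<delta>p / 2) \<Longrightarrow> \<bar>fst u - fst v\<bar> \<le> \<theta>2 \<Longrightarrow> \<bar>snd u - snd v\<bar> \<le> \<theta>2 \<Longrightarrow> \<bar>dotC C 1 u - dotC C 1 v\<bar> \<le> \<eta>"
    "\<And>u v. u \<in> inner_strip 2 (\<delta>p / 2) \<Longrightarrow> v \<in> inner_strip 2 (\<delta>p / 2) \<Longrightarrow> \<bar>fst u - fst v\<bar> \<le> \<theta>3 \<Longrightarrow> \<bar>snd u - snd v\<bar> \<le> \<theta>3 \<Longrightarrow> \<bar>dotC C 2 u - dotC C 2 v\<bar> \<le> \<eta>"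
    by (metis insertI1 insertI2)
  define \<theta> where "\<theta> = min (min \<theta>1 (min \<theta>2 \<theta>3)) (min (\<delta>p / 2) \<eta>)"
  have th: "0 < \<theta>" "\<theta> \<le> \<theta>1" "\<theta> \<le> \<theta>2" "\<theta> \<le> \<theta>3" "\<theta> \<le> \<delta>p / 2" "\<theta> \<le> \<eta>" using d t23 dp eta by (auto simp: \<theta>_def)
  obtain m0 :: nat where m0: "0 < m0" "1 / real m0 \<le> \<delta>"
    using d(1) by (metis less_imp_le nat_approx_posE zero_less_Suc)
  have close: "\<bar>stat (H_mult D n x w) - grid_stat stat m (\<lambda>j. linear_process n x w (grid_point m j))\<bar> \<le> e"
    if n: "n0 \<le> n" and reg: "regular_sample C \<theta> n x" and D: "admissible_estimator D n x K" and con: "consistent_at D n x (\<delta>p / 2) \<theta>"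
      and gp: "good_path C n x w R \<epsilon> \<delta> \<delta>'" and m: "m0 \<le> m" for n x D w m
  proof -
    have np: "0 < n" using n d(4) by simp
    interpret P: perturbed_path C "emp_copula n x" "mult_process n x w" "dotC C" "D n x" "max 1 K" R \<epsilon> \<delta>p "\<epsilon> / R" \<theta>
    proof (rule perturbed_path_good[OF np D gp R ep(1) dp(1-3) th(5) th(6)[unfolded \<eta>_def] reg con])
      show "dotC C p u \<le> \<epsilon> / R" if "p \<in> {1, 2}" "u \<in> inner_strip p \<delta>" "C u \<le> \<delta>p" for p u
        using that d3(3,4)[of u] dp(4,5) by (auto simp: \<eta>_def)
      show "\<bar>dotC C p u - dotC C p v\<bar> \<le> \<epsilon> / R" if "p \<in> {1, 2}" "u \<in> inner_strip p (\<delta>p / 2)" "v \<in> inner_strip p (\<delta>p / 2)"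
        "\<bar>fst u - fst v\<bar> \<le> \<theta>" "\<bar>snd u - snd v\<bar> \<le> \<theta>" for p u v
        using that t23(3,4)[of u v] th(3,4) by (auto simp: \<eta>_def)
    qed
    have mp: "0 < m" using m m0 by simp
    have "1 / real m \<le> 1 / real m0" using m m0 by (simp add: frac_le)
    then have md: "1 / real m \<le> \<delta>" using m0(2) by linarith
    have "\<bar>stat (H_mult D n x w) - grid_stat stat m (\<lambda>j. linear_process n x w (grid_point m j))\<bar> \<le>
       (80 * K1\<^sup>2 * \<epsilon> + 12 * (2 * \<epsilon>)) * (2 * (12 * (R + 2 * \<epsilon>)) + (80 * K1\<^sup>2 * \<epsilon> + 12 * (2 * \<epsilon>)) + 1)"
    proof (rule stat_grid_close[OF s mp, where A = "mult_process n x w"])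
      show "H_mult D n x w \<in> borel_measurable cube_measure" using D by (simp add: admissible_estimator_def)
      show "\<bar>H_mult D n x w v - H_form C (dotC C) (mult_process n x w) v\<bar> \<le> 80 * K1\<^sup>2 * \<epsilon>" if "v \<in> unit_cube" for v
        unfolding H_mult_def K1_def by (rule P.H_form_close[OF that])
      show "\<bar>mult_process n x w u\<bar> \<le> R" if "u \<in> unit_square" for u by (rule P.A[OF that])
      show "\<bar>mult_process n x w u - linear_process n x w (grid_point m (cell m u))\<bar> \<le> 2 * \<epsilon>" if u: "u \<in> unit_square" for u
      proof -
        let ?g = "grid_point m (cell m u)"
        note cg = cell_in_grid[OF mp u]
        have "\<bar>mult_process n x w u - mult_process n x w ?g\<bar> \<le> \<epsilon>"
          using gp u cg(2) order_trans[OF cg(5) md] order_trans[OF cg(6) md] unfolding good_path_def by blast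
        moreover have "\<bar>mult_process n x w ?g - linear_process n x w ?g\<bar> \<le> \<epsilon>"
          using gp cg(2) unfolding good_path_def by blast
        ultimately show ?thesis by linarith
      qed
    qed
    also have "80 * K1\<^sup>2 * \<epsilon> + 12 * (2 * \<epsilon>) = \<epsilon> * c" by (simp add: c_def algebra_simps)
    also have "\<epsilon> * c * (2 * (12 * (R + 2 * \<epsilon>)) + \<epsilon> * c + 1) \<le> \<epsilon> * c * (24 * R + 49 + c)"
    proof (rule mult_left_mono)
      have "\<epsilon> * c \<le> 1 * c" using ep c by (intro mult_right_mono) auto
      then show "2 * (12 * (R + 2 * \<epsilon>)) + \<epsilon> * c + 1 \<le> 24 * R + 49 + c" using ep by simp
    qed (use ep c in simp)
    also have "\<dots> \<le> e" using epe by (simp add: mult.assoc)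
    finally show ?thesis .
  qed
  have gp: "\<exists>E\<in>sets (W n). measure (W n) E \<le> \<epsilon>0 \<and> (\<forall>w\<in>space (W n) - E. good_path C n x w R \<epsilon> \<delta> \<delta>')"
    if "n0 \<le> n" "regular_sample C \<theta> n x" for n x
    by (rule gpp[OF that(1)]) (use that(2) th(2) in \<open>force simp: regular_sample_def\<close>)+
  have m1: "1 \<le> m0" using m0 by simp
  show ?thesis
    by (rule exI[of _ R], rule exI[of _ \<epsilon>], rule exI[of _ \<delta>], rule exI[of _ \<delta>'], rule exI[of _ "\<delta>p / 2"],
        rule conjI[OF dp2], rule conjI[OF dp(6)], rule exI[of _ \<theta>], rule conjI[OF th(1)], rule exI[of _ n0], rule conjI[OF d(4)],
        rule exI[of _ m0], rule conjI[OF m1]) (use gp close in blast)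
qed

text \<open>Three replacements: the statistic by its grid version (\<open>e / 4\<close> plus 2 times
  \<open>e / 8\<close> for bad paths), the grid vector by its Gaussian limit (\<open>e / 4\<close>),
  the Gaussian grid statistic by that of the limit path (\<open>e / 4\<close>). The mesh is fixed
  before \<open>n\<close>.\<close>

lemma bootstrap_convergence:
  fixes N :: "'v measure"
  assumes s: "stat \<in> {L2_stat, KS_stat}" and B: "copula_brownian_field N C B" and e: "0 < e"
  shows "\<exists>a>0. a < 1 / 2 \<and> (\<exists>\<theta>>0. \<exists>n0\<ge>1. \<forall>n\<ge>n0. \<forall>x D. regular_sample C \<theta> n x \<longrightarrow> admissible_estimator D n x K \<longrightarrow>
    consistent_at D n x a \<theta> \<longrightarrow> (\<forall>h\<in>BL1. \<bar>(LINT w|W n. h (stat (H_mult D n x w))) - (LINT v|N. h (stat (H_limit C B v)))\<bar> \<le> e))"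
proof -
  have e8: "0 < e / 4" "0 < e / 8" using e by auto
  from bootstrap_approximation[OF s e8, of K] obtain R \<epsilon> \<delta> \<delta>' a \<theta>1 n1 m1 where a: "0 < a" "a < 1 / 2" and t1: "0 < \<theta>1" "1 \<le> n1" "1 \<le> m1"
    and ba: "\<forall>n\<ge>n1. \<forall>x. regular_sample C \<theta>1 n x \<longrightarrow>
     (\<exists>E\<in>sets (W n). measure (W n) E \<le> e / 8 \<and> (\<forall>w\<in>space (W n) - E. good_path C n x w R \<epsilon> \<delta> \<delta>')) \<and>
     (\<forall>D. admissible_estimator D n x K \<longrightarrow> consistent_at D n x a \<theta>1 \<longrightarrow> (\<forall>w m. good_path C n x w R \<epsilon> \<delta> \<delta>' \<longrightarrow> m1 \<le> m \<longrightarrow>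
        \<bar>stat (H_mult D n x w) - grid_stat stat m (\<lambda>j. linear_process n x w (grid_point m j))\<bar> \<le> e / 4))"
    by (elim exE conjE) (rule that)
  note ba1 = ba[rule_format, THEN conjunct1] and ba2 = ba[rule_format, THEN conjunct2, rule_format]
  obtain m2 where m2: "\<And>m h. m \<ge> m2 \<Longrightarrow> h \<in> BL1 \<Longrightarrow>
    \<bar>(LINT v|N. h (grid_stat stat m (\<lambda>j. B (grid_point m j) v))) - (LINT v|N. h (stat (H_limit C B v)))\<bar> \<le> e / 4"
    using limit_stat(2)[OF s B e8(1)] by blast
  define m where "m = max m1 m2"
  have m: "0 < m" "m1 \<le> m" "m2 \<le> m" using t1 by (auto simp: m_def)
  obtain \<theta>2 n2 where t2: "0 < \<theta>2" "1 \<le> n2" and gc: "\<And>n x h. n \<ge> n2 \<Longrightarrow> regular_sample C \<theta>2 n x \<Longrightarrow> h \<in> BL1 \<Longrightarrow>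
    \<bar>(LINT w|W n. h (grid_stat stat m (\<lambda>j. linear_process n x w (grid_point m j)))) -
     (LINT v|N. h (grid_stat stat m (\<lambda>j. B (grid_point m j) v)))\<bar> \<le> e / 4"
    using grid_stat_convergence[OF s B m(1) e8(1)] by blast
  let ?\<theta> = "min \<theta>1 \<theta>2" and ?n = "max n1 n2"
  have "\<bar>(LINT w|W n. h (stat (H_mult D n x w))) - (LINT v|N. h (stat (H_limit C B v)))\<bar> \<le> e"
    if n: "?n \<le> n" and reg: "regular_sample C ?\<theta> n x" and D: "admissible_estimator D n x K" and con: "consistent_at D n x a ?\<theta>"
      and h: "h \<in> BL1" for n x D and h :: "real \<Rightarrow> real"
  proof -
    interpret Wn: prob_space "W n" by (rule prob_space_W)
    have np: "0 < n" "n1 \<le> n" "n2 \<le> n" using n t1 by auto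
    have r1: "regular_sample C \<theta>1 n x" and r2: "regular_sample C \<theta>2 n x" using regular_sample_mono[OF reg] by auto
    have c1: "consistent_at D n x a \<theta>1" using con unfolding consistent_at_def by force
    obtain E where E: "E\<in>sets (W n)" "measure (W n) E \<le> e / 8" "\<And>w. w\<in>space (W n) - E \<Longrightarrow> good_path C n x w R \<epsilon> \<delta> \<delta>'"
      using ba1[OF np(2) r1] by blast
    let ?S = "\<lambda>w. stat (H_mult D n x w)" and ?G = "\<lambda>w. grid_stat stat m (\<lambda>j. linear_process n x w (grid_point m j))"
    have mm: "(\<lambda>w. h (?S w)) \<in> borel_measurable (W n)" "(\<lambda>w. h (?G w)) \<in> borel_measurable (W n)"
      using measurable_compose[OF stat_H_mult_measurable[OF np(1) D s] BL1_borel[OF h]]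
        measurable_compose[OF grid_stat_measurable[OF s linear_process_tight[OF np(1)]] BL1_borel[OF h]] by auto
    have "\<bar>(LINT w|W n. h (?S w)) - (LINT w|W n. h (?G w))\<bar> \<le> e / 4 + 2 * Wn.prob E"
    proof (rule Wn.expectation_diff_le)
      show "integrable (W n) (\<lambda>w. h (?S w))" "integrable (W n) (\<lambda>w. h (?G w))"
        by (rule Wn.integrable_const_bound[of _ 1]; use mm BL1_D(1)[OF h] in auto)+
      show "\<bar>h (?S w) - h (?G w)\<bar> \<le> e / 4" if "w \<in> space (W n) - E" for w
        using BL1_min[OF h, of "?S w" "?G w"] ba2[OF np(2) r1 D c1 E(3)[OF that] m(2)] by linarith
      show "\<bar>h (?S w) - h (?G w)\<bar> \<le> 2" for w using BL1_min[OF h, of "?S w" "?G w"] by linarith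
    qed (use E e in auto)
    then show ?thesis using E(2) gc[OF np(3) r2 h] m2[OF m(3) h] by linarith
  qed
  then show ?thesis using a t1(1,2) t2(1)
    by (intro exI[of _ a] conjI exI[of _ ?\<theta>] exI[of _ ?n]) auto
qed

end

section \<open>Regularity of the data\<close>

text \<open>Outer measure is used because statements about the estimators may fail to be measurable.
  \<open>asymp_sureD\<close> recovers measurable exceptional sets, with which all estimates are
  done.\<close>

definition asymp_sure :: "'w measure \<Rightarrow> (nat \<Rightarrow> 'w \<Rightarrow> bool) \<Rightarrow> bool" where
  "asymp_sure M P \<longleftrightarrow> (\<lambda>n. outer_measure_of M {\<omega>\<in>space M. \<not> P n \<omega>}) \<longlonglongrightarrow> 0"

lemma outer_measure_of_Un:
  assumes "A \<subseteq> space M" "B \<subseteq> space M"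
  shows "outer_measure_of M (A \<union> B) \<le> outer_measure_of M A + outer_measure_of M B"
proof -
  obtain E F where E: "E \<in> sets M" "A \<subseteq> E" "outer_measure_of M A = emeasure M E"
    and F: "F \<in> sets M" "B \<subseteq> F" "outer_measure_of M B = emeasure M F"
    using outer_measure_of_attain[OF assms(1)] outer_measure_of_attain[OF assms(2)] by metis
  have "outer_measure_of M (A \<union> B) \<le> outer_measure_of M (E \<union> F)" by (rule outer_measure_of_mono) (use E F in auto)
  also have "\<dots> = emeasure M (E \<union> F)" using E F by simp
  also have "\<dots> \<le> emeasure M E + emeasure M F" by (rule emeasure_subadditive[OF E(1) F(1)])
  finally show ?thesis using E F by simp
qed

lemma asymp_sure_mono:
  assumes "asymp_sure M P" and "\<And>n \<omega>. n \<ge> n0 \<Longrightarrow> \<omega> \<in> space M \<Longrightarrow> P n \<omega> \<Longrightarrow> Q n \<omega>"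
  shows "asymp_sure M Q"
  unfolding asymp_sure_def
proof (rule tendsto_sandwich[OF _ _ tendsto_const assms(1)[unfolded asymp_sure_def]])
  show "\<forall>\<^sub>F n in sequentially. outer_measure_of M {\<omega>\<in>space M. \<not> Q n \<omega>} \<le> outer_measure_of M {\<omega>\<in>space M. \<not> P n \<omega>}"
    using assms(2) by (intro eventually_sequentiallyI[of n0] outer_measure_of_mono) auto
qed auto

lemma asymp_sure_conj:
  assumes "asymp_sure M P" "asymp_sure M Q"
  shows "asymp_sure M (\<lambda>n \<omega>. P n \<omega> \<and> Q n \<omega>)"
  unfolding asymp_sure_def
proof (rule tendsto_sandwich[OF _ _ tendsto_const])
  show "(\<lambda>n. outer_measure_of M {\<omega>\<in>space M. \<not> P n \<omega>} + outer_measure_of M {\<omega>\<in>space M. \<not> Q n \<omega>}) \<longlonglongrightarrow> 0"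
    using tendsto_add[OF assms[unfolded asymp_sure_def]] by simp
  have "outer_measure_of M {\<omega>\<in>space M. \<not> (P n \<omega> \<and> Q n \<omega>)} \<le>
     outer_measure_of M {\<omega>\<in>space M. \<not> P n \<omega>} + outer_measure_of M {\<omega>\<in>space M. \<not> Q n \<omega>}" for n
  proof -
    have "{\<omega>\<in>space M. \<not> (P n \<omega> \<and> Q n \<omega>)} = {\<omega>\<in>space M. \<not> P n \<omega>} \<union> {\<omega>\<in>space M. \<not> Q n \<omega>}" by auto
    then show ?thesis using outer_measure_of_Un[of "{\<omega>\<in>space M. \<not> P n \<omega>}" M "{\<omega>\<in>space M. \<not> Q n \<omega>}"] by auto
  qed
  then show "\<forall>\<^sub>F n in sequentially. outer_measure_of M {\<omega>\<in>space M. \<not> (P n \<omega> \<and> Q n \<omega>)} \<le>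
     outer_measure_of M {\<omega>\<in>space M. \<not> P n \<omega>} + outer_measure_of M {\<omega>\<in>space M. \<not> Q n \<omega>}" by simp
qed auto

lemma asymp_sure_measurable:
  assumes M: "prob_space M"
    and E: "\<And>\<epsilon>. 0 < \<epsilon> \<Longrightarrow> \<exists>n0. \<forall>n\<ge>n0. \<exists>E\<in>sets M. measure M E \<le> \<epsilon> \<and> (\<forall>\<omega>\<in>space M - E. P n \<omega>)"
  shows "asymp_sure M P"
proof -
  interpret prob_space M by fact
  show ?thesis unfolding asymp_sure_def
  proof (rule order_tendstoI)
    fix a :: ennreal assume a: "0 < a"
    obtain \<epsilon> where e: "0 < \<epsilon>" "ennreal \<epsilon> < a"
      using a by (metis dense ennreal_cases ennreal_less_zero_iff less_top_ennreal not_less_iff_gr_or_eq order_less_trans)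
    obtain n0 where n0: "\<And>n. n \<ge> n0 \<Longrightarrow> \<exists>E\<in>sets M. measure M E \<le> \<epsilon> \<and> (\<forall>\<omega>\<in>space M - E. P n \<omega>)" using E[OF e(1)] by blast
    have "outer_measure_of M {\<omega>\<in>space M. \<not> P n \<omega>} < a" if n: "n \<ge> n0" for n
    proof -
      obtain F where F: "F\<in>sets M" "measure M F \<le> \<epsilon>" "\<forall>\<omega>\<in>space M - F. P n \<omega>" using n0[OF n] by blast
      have "outer_measure_of M {\<omega>\<in>space M. \<not> P n \<omega>} \<le> outer_measure_of M F" by (rule outer_measure_of_mono) (use F in auto)
      also have "\<dots> = ennreal (measure M F)" using F(1) by (simp add: emeasure_eq_measure)
      also have "\<dots> \<le> ennreal \<epsilon>" using F(2) by (rule ennreal_leI)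
      finally show ?thesis using e(2) by simp
    qed
    then show "\<forall>\<^sub>F n in sequentially. outer_measure_of M {\<omega>\<in>space M. \<not> P n \<omega>} < a"
      by (rule eventually_sequentiallyI)
  qed simp
qed

lemma asymp_sureD:
  assumes M: "prob_space M" and P: "asymp_sure M P" and e: "0 < \<epsilon>"
  shows "\<exists>n0. \<forall>n\<ge>n0. \<exists>E\<in>sets M. measure M E \<le> \<epsilon> \<and> (\<forall>\<omega>\<in>space M - E. P n \<omega>)"
proof -
  interpret prob_space M by fact
  have "\<forall>\<^sub>F n in sequentially. outer_measure_of M {\<omega>\<in>space M. \<not> P n \<omega>} < ennreal \<epsilon>"
    using P e unfolding asymp_sure_def by (intro order_tendstoD(2)) auto
  then obtain n0 where n0: "\<And>n. n \<ge> n0 \<Longrightarrow> outer_measure_of M {\<omega>\<in>space M. \<not> P n \<omega>} < ennreal \<epsilon>"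
    by (auto simp: eventually_sequentially)
  have "\<exists>E\<in>sets M. measure M E \<le> \<epsilon> \<and> (\<forall>\<omega>\<in>space M - E. P n \<omega>)" if n: "n \<ge> n0" for n
  proof -
    have "{\<omega>\<in>space M. \<not> P n \<omega>} \<subseteq> space M" by auto
    from outer_measure_of_attain[OF this] obtain E where E: "E \<in> sets M" "{\<omega>\<in>space M. \<not> P n \<omega>} \<subseteq> E"
      "outer_measure_of M {\<omega>\<in>space M. \<not> P n \<omega>} = emeasure M E" by blast
    then have "ennreal (measure M E) < ennreal \<epsilon>" using n0[OF n] by (simp add: emeasure_eq_measure)
    then have "measure M E \<le> \<epsilon>" using e by (simp add: ennreal_less_iff)
    then show ?thesis using E by (intro bexI[of _ E]) auto
  qed
  then show ?thesis by blast
qed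

section \<open>Ties, frequencies and quantiles of the sample\<close>

lemma coord_borel: "coord p \<in> borel_measurable borel"
  unfolding coord_def using borel_projections(1,2) by (cases "p = 1") auto

locale copula_sample =
  fixes M :: "'w measure" and X :: "nat \<Rightarrow> 'w \<Rightarrow> real \<times> real" and C :: "real \<times> real \<Rightarrow> real"
  assumes prob_M: "prob_space M" and data_iid: "iid M UNIV X"
    and cont_margins: "\<And>p. p \<in> {1, 2} \<Longrightarrow> continuous_on UNIV (marginal_df M (X 0) p)"
    and copula_of: "is_copula_of M (X 0) C"
begin

sublocale prob_space M by (rule prob_M)

lemma indep_X: "indep_vars (\<lambda>_. borel) X UNIV" using data_iid by (simp add: iid_def)

lemma X_borel: "X i \<in> borel_measurable M" using indep_X by (auto simp: indep_vars_def)

lemma coord_X_borel: "(\<lambda>\<omega>. coord p (X i \<omega>)) \<in> borel_measurable M"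
  by (rule measurable_compose[OF X_borel coord_borel])

lemma X_events_eq:
  assumes "A \<in> sets borel" shows "prob {\<omega>\<in>space M. X i \<omega> \<in> A} = prob {\<omega>\<in>space M. X 0 \<omega> \<in> A}"
proof -
  have "measure (distr M borel (X i)) A = measure (distr M borel (X 0)) A"
    using data_iid unfolding iid_def by (metis UNIV_I)
  then show ?thesis using assms X_borel by (simp add: measure_distr vimage_def Int_def conj_commute)
qed

text \<open>By independence the pair has a product law, and the sections of the diagonal are
  singletons, which are null for a continuous margin.\<close>

lemma tie_null:
  assumes p: "p \<in> {1, 2}" and ij: "i \<noteq> j"
  shows "prob {\<omega>\<in>space M. coord p (X i \<omega>) = coord p (X j \<omega>)} = 0"
proof -
  let ?Y = "\<lambda>k \<omega>. coord p (X k \<omega>)"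
  have iv: "indep_var borel (?Y i) borel (?Y j)"
  proof -
    have "indep_var borel ((\<lambda>f. coord p (f i)) \<circ> (\<lambda>\<omega>. \<lambda>k\<in>{i}. X k \<omega>)) borel ((\<lambda>f. coord p (f j)) \<circ> (\<lambda>\<omega>. \<lambda>k\<in>{j}. X k \<omega>))"
    proof (intro indep_var_compose[OF indep_var_restrict[OF indep_X]])
      have "(\<lambda>f. coord p (f k)) \<in> borel_measurable (PiM {k} (\<lambda>_. borel))" for k :: nat
      proof -
        have "(\<lambda>f. f k) \<in> measurable (PiM {k} (\<lambda>_. borel :: (real \<times> real) measure)) borel"
          by (rule measurable_component_singleton) simp
        then show ?thesis by (rule measurable_compose[OF _ coord_borel])
      qed
      then show "(\<lambda>f. coord p (f i)) \<in> borel_measurable (PiM {i} (\<lambda>_. borel))"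
        "(\<lambda>f. coord p (f j)) \<in> borel_measurable (PiM {j} (\<lambda>_. borel))" by auto
    qed (use ij in auto)
    moreover have "(\<lambda>f. coord p (f k)) \<circ> (\<lambda>\<omega>. \<lambda>k\<in>{k}. X k \<omega>) = ?Y k" for k by auto
    ultimately show ?thesis by simp
  qed
  define \<nu>i \<nu>j where "\<nu>i = distr M borel (?Y i)" and "\<nu>j = distr M borel (?Y j)"
  have prod: "\<nu>i \<Otimes>\<^sub>M \<nu>j = distr M (borel \<Otimes>\<^sub>M borel) (\<lambda>\<omega>. (?Y i \<omega>, ?Y j \<omega>))"
    using iv unfolding indep_var_distribution_eq \<nu>i_def \<nu>j_def by simp
  interpret j: real_distribution \<nu>j unfolding \<nu>j_def by (rule real_distribution_distr[OF coord_X_borel])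
  have cdf: "cdf \<nu>j x = marginal_df M (X 0) p x" for x
  proof -
    have "{u. coord p u \<le> x} \<in> sets borel"
      using measurable_sets[OF coord_borel, of "{..x}" p] by (simp add: vimage_def)
    then have "prob {\<omega>\<in>space M. coord p (X j \<omega>) \<le> x} = prob {\<omega>\<in>space M. coord p (X 0 \<omega>) \<le> x}"
      using X_events_eq[of "{u. coord p u \<le> x}" j] by simp
    then show ?thesis
      unfolding cdf_def \<nu>j_def marginal_df_def using coord_X_borel
      by (subst measure_distr) (auto simp: vimage_def Int_def conj_commute)
  qed
  have single: "measure \<nu>j {x} = 0" for x
  proof -
    have "cdf \<nu>j = marginal_df M (X 0) p" by (rule ext) (rule cdf)
    then have "isCont (cdf \<nu>j) x" using cont_margins[OF p] by (simp add: continuous_on_eq_continuous_at)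
    then show ?thesis by (simp add: j.isCont_cdf)
  qed
  define \<Delta> where "\<Delta> = {z :: real \<times> real. fst z = snd z}"
  have Dm: "\<Delta> \<in> sets (borel \<Otimes>\<^sub>M borel)"
  proof -
    have "\<Delta> = {z \<in> space (borel \<Otimes>\<^sub>M borel). fst z = snd z}" by (simp add: \<Delta>_def space_pair_measure)
    also have "\<dots> \<in> sets (borel \<Otimes>\<^sub>M borel)" by measurable
    finally show ?thesis .
  qed
  have se: "sets (\<nu>i \<Otimes>\<^sub>M \<nu>j) = sets (borel \<Otimes>\<^sub>M borel)" by (rule sets_pair_measure_cong) (auto simp: \<nu>i_def \<nu>j_def)
  have "emeasure (\<nu>i \<Otimes>\<^sub>M \<nu>j) \<Delta> = (\<integral>\<^sup>+x. emeasure \<nu>j (Pair x -` \<Delta>) \<partial>\<nu>i)"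
    using Dm se by (intro j.emeasure_pair_measure_alt) simp
  also have "\<dots> = (\<integral>\<^sup>+x. 0 \<partial>\<nu>i)"
  proof (intro nn_integral_cong)
    fix x
    have "Pair x -` \<Delta> = {x}" by (auto simp: \<Delta>_def)
    then show "emeasure \<nu>j (Pair x -` \<Delta>) = 0" using single[of x] by (simp add: j.emeasure_eq_measure)
  qed
  finally have "emeasure (distr M (borel \<Otimes>\<^sub>M borel) (\<lambda>\<omega>. (?Y i \<omega>, ?Y j \<omega>))) \<Delta> = 0" unfolding prod[symmetric] by simp
  then have "emeasure M ((\<lambda>\<omega>. (?Y i \<omega>, ?Y j \<omega>)) -` \<Delta> \<inter> space M) = 0"
    using Dm coord_X_borel by (subst (asm) emeasure_distr) auto
  moreover have "(\<lambda>\<omega>. (?Y i \<omega>, ?Y j \<omega>)) -` \<Delta> \<inter> space M = {\<omega>\<in>space M. ?Y i \<omega> = ?Y j \<omega>}" by (auto simp: \<Delta>_def)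
  ultimately show ?thesis by (simp add: measure_def)
qed

lemma no_ties_event:
  "\<exists>E\<in>events. prob E = 0 \<and> (\<forall>\<omega>\<in>space M - E. no_ties n (sample X n \<omega>))"
proof -
  let ?S = "{(p, i, j). p \<in> {1, 2 :: nat} \<and> i < n \<and> j < n \<and> i \<noteq> j}"
  have fin: "finite ?S" by (rule finite_subset[of _ "{1, 2} \<times> {..<n} \<times> {..<n}"]) auto
  define F where "F = (\<lambda>(p, i, j). {\<omega>\<in>space M. coord p (X i \<omega>) = coord p (X j \<omega>)})"
  have Fm: "F s \<in> events" for s
  proof (cases s)
    case (fields p i j)
    have "{\<omega>\<in>space M. coord p (X i \<omega>) = coord p (X j \<omega>)} \<in> events"
      using coord_X_borel[of p i] coord_X_borel[of p j] by measurable
    then show ?thesis by (simp add: F_def fields)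
  qed
  have F0: "prob (F s) = 0" if "s \<in> ?S" for s using that tie_null by (auto simp: F_def)
  have "prob (\<Union>s\<in>?S. F s) \<le> (\<Sum>s\<in>?S. prob (F s))"
    by (rule finite_measure_subadditive_finite[OF fin]) (use Fm in auto)
  also have "\<dots> = 0" using F0 by (intro sum.neutral) blast
  finally have "prob (\<Union>s\<in>?S. F s) = 0" by (simp add: measure_le_0_iff)
  moreover have "(\<Union>s\<in>?S. F s) \<in> events" using Fm fin by (intro sets.finite_UN)
  moreover have "no_ties n (sample X n \<omega>)" if "\<omega> \<in> space M - (\<Union>s\<in>?S. F s)" for \<omega>
    unfolding no_ties_def
  proof (intro ballI inj_onI)
    fix p :: nat and i j assume p: "p \<in> {1, 2}" and ij: "i \<in> {..<n}" "j \<in> {..<n}"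
      and eq: "coord p (sample X n \<omega> i) = coord p (sample X n \<omega> j)"
    show "i = j"
    proof (rule ccontr)
      assume "i \<noteq> j"
      then have "(p, i, j) \<in> ?S" using p ij by auto
      moreover have "\<omega> \<in> F (p, i, j)" using eq ij that by (auto simp: F_def sample_def)
      ultimately show False using that by blast
    qed
  qed
  ultimately show ?thesis by (intro bexI[of _ "\<Union>s\<in>?S. F s"]) auto
qed

lemma empirical_frequency:
  assumes A: "A \<in> sets borel" and k: "0 < \<kappa>" and n: "0 < n"
  shows "\<exists>E\<in>events. prob E \<le> 1 / (real n * \<kappa>\<^sup>2) \<and>
    (\<forall>\<omega>\<in>space M - E. \<bar>real (card {i. i < n \<and> X i \<omega> \<in> A}) / real n - prob {\<omega>\<in>space M. X 0 \<omega> \<in> A}\<bar> < \<kappa>)"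
proof -
  define q where "q = prob {\<omega>\<in>space M. X 0 \<omega> \<in> A}"
  define Y where "Y i \<omega> = indicat_real A (X i \<omega>) - q" for i \<omega>
  have q: "0 \<le> q" "q \<le> 1" by (auto simp: q_def)
  have ind: "indep_vars (\<lambda>_. borel) Y {..<n}"
    unfolding Y_def using A
    by (intro indep_vars_compose2[OF indep_vars_subset[OF indep_X subset_UNIV]] borel_measurable_diff borel_measurable_indicator borel_measurable_const)
  have Ym: "Y i \<in> borel_measurable M" for i
    unfolding Y_def
    by (intro borel_measurable_diff measurable_compose[OF X_borel borel_measurable_indicator[OF A]] borel_measurable_const)
  have Yb: "\<bar>Y i \<omega>\<bar> \<le> 1" for i \<omega> using q by (auto simp: Y_def indicator_def)
  have Ai: "{\<omega>\<in>space M. X i \<omega> \<in> A} \<in> events" for i using measurable_sets[OF X_borel A, of i] by (simp add: vimage_def Int_def conj_commute)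
  have EI: "expectation (\<lambda>\<omega>. indicat_real A (X i \<omega>)) = q" for i
  proof -
    have "expectation (\<lambda>\<omega>. indicat_real A (X i \<omega>)) = expectation (indicat_real {\<omega>\<in>space M. X i \<omega> \<in> A})"
      by (rule Bochner_Integration.integral_cong) (auto simp: indicator_def)
    also have "\<dots> = q" using Ai X_events_eq[OF A, of i] by (simp add: q_def)
    finally show ?thesis .
  qed
  have iI: "integrable M (\<lambda>\<omega>. indicat_real A (X i \<omega>))" for i
    by (rule integrable_const_bound[of _ 1]) (use measurable_compose[OF X_borel[of i] borel_measurable_indicator[OF A]] in auto)
  have EY: "expectation (Y i) = 0" for i unfolding Y_def using iI EI[of i] by (simp add: prob_space)
  have iY2: "integrable M (\<lambda>\<omega>. (Y i \<omega>)\<^sup>2)" for i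
    by (rule integrable_const_bound[of _ 1]) (use Ym Yb in \<open>auto simp: abs_square_le_1\<close>)
  have EY2: "expectation (\<lambda>\<omega>. (Y i \<omega>)\<^sup>2) \<le> 1" for i
    using integral_mono[OF iY2 integrable_const[of 1], of i] Yb by (simp add: abs_square_le_1 prob_space)
  have nk: "0 < real n * \<kappa>" using n k by simp
  define E where "E = {\<omega>\<in>space M. real n * \<kappa> \<le> \<bar>\<Sum>i<n. Y i \<omega>\<bar>}"
  have "prob E \<le> (\<Sum>i<n. expectation (\<lambda>\<omega>. (Y i \<omega>)\<^sup>2)) / (real n * \<kappa>)\<^sup>2"
    unfolding E_def by (rule Chebyshev_sum_indep[OF ind _ _ iY2 EY nk]) auto
  also have "\<dots> \<le> (\<Sum>i<n. 1) / (real n * \<kappa>)\<^sup>2" by (intro divide_right_mono sum_mono EY2) simp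
  also have "\<dots> = 1 / (real n * \<kappa>\<^sup>2)" using n by (simp add: power_mult_distrib power2_eq_square)
  finally have "prob E \<le> 1 / (real n * \<kappa>\<^sup>2)" .
  moreover have "E \<in> events" unfolding E_def using Ym by measurable
  moreover have "\<bar>real (card {i. i < n \<and> X i \<omega> \<in> A}) / real n - q\<bar> < \<kappa>" if "\<omega> \<in> space M - E" for \<omega>
  proof -
    have "(\<Sum>i<n. indicat_real A (X i \<omega>)) = real (card {i. i < n \<and> X i \<omega> \<in> A})"
    proof -
      have "(\<Sum>i<n. indicat_real A (X i \<omega>)) = (\<Sum>i<n. of_bool (X i \<omega> \<in> A))"
        by (intro sum.cong refl) (simp add: indicator_def of_bool_def)
      also have "\<dots> = real (card ({..<n} \<inter> {i. X i \<omega> \<in> A}))" by (simp add: sum_of_bool_eq)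
      also have "{..<n} \<inter> {i. X i \<omega> \<in> A} = {i. i < n \<and> X i \<omega> \<in> A}" by auto
      finally show ?thesis .
    qed
    then have s: "(\<Sum>i<n. Y i \<omega>) = real (card {i. i < n \<and> X i \<omega> \<in> A}) - real n * q"
      by (simp add: Y_def sum_subtractf)
    have "\<bar>real (card {i. i < n \<and> X i \<omega> \<in> A}) - real n * q\<bar> < real n * \<kappa>" using that unfolding E_def s[symmetric] by auto
    moreover have "real (card {i. i < n \<and> X i \<omega> \<in> A}) / real n - q = (real (card {i. i < n \<and> X i \<omega> \<in> A}) - real n * q) / real n"
      using n by (simp add: diff_divide_distrib)
    ultimately show ?thesis using n by (simp add: abs_divide pos_divide_less_eq mult.commute)
  qed
  ultimately show ?thesis unfolding q_def by blast
qed

text \<open>The intermediate value theorem between the two limits of the distribution function.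
  Levels 0 and 1 need not be attained, so only interior grid points are used later.\<close>

lemma margin_quantile:
  assumes p: "p \<in> {1, 2}" and t: "0 < t" "t < 1"
  shows "\<exists>s. marginal_df M (X 0) p s = t"
proof -
  interpret \<nu>: real_distribution "distr M borel (\<lambda>\<omega>. coord p (X 0 \<omega>))" by (rule real_distribution_distr[OF coord_X_borel])
  let ?\<nu> = "distr M borel (\<lambda>\<omega>. coord p (X 0 \<omega>))" and ?F = "marginal_df M (X 0) p"
  have cdf: "cdf ?\<nu> = ?F"
    unfolding cdf_def marginal_df_def using coord_X_borel
    by (intro ext, subst measure_distr) (auto simp: vimage_def Int_def conj_commute)
  have "\<forall>\<^sub>F x in at_bot. ?F x < t" using \<nu>.cdf_lim_at_bot t unfolding cdf by (intro order_tendstoD(2)) auto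
  then obtain a where a: "\<And>x. x \<le> a \<Longrightarrow> ?F x < t" by (auto simp: eventually_at_bot_linorder)
  have "\<forall>\<^sub>F x in at_top. t < ?F x" using \<nu>.cdf_lim_at_top_prob t unfolding cdf by (intro order_tendstoD(1)) auto
  then obtain b where b: "\<And>x. b \<le> x \<Longrightarrow> t < ?F x" by (auto simp: eventually_at_top_linorder)
  have "?F (min a b) \<le> t" "t \<le> ?F (max a b)" using a[of "min a b"] b[of "max a b"] by auto
  then have "\<exists>s\<ge>min a b. s \<le> max a b \<and> ?F s = t"
    using cont_margins[OF p] by (intro IVT') (auto intro: continuous_on_subset)
  then show ?thesis by blast
qed

end

text \<open>For nested sets the symmetric difference has as many elements as the cardinalities
  differ by, so a comparison of margins controls intersections with any third set.\<close>

lemma card_Int_nested: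
  assumes "finite A" "finite R" "A \<subseteq> R \<or> R \<subseteq> A"
  shows "\<bar>real (card (R \<inter> S)) - real (card (A \<inter> S))\<bar> \<le> \<bar>real (card R) - real (card A)\<bar>"
proof -
  have one: "\<bar>real (card (R \<inter> S)) - real (card (A \<inter> S))\<bar> \<le> \<bar>real (card R) - real (card A)\<bar>"
    if "finite R" "A \<subseteq> R" for A R :: "'a set"
  proof -
    have fA: "finite A" using that finite_subset by blast
    have "card (R \<inter> S) = card (A \<inter> S) + card ((R - A) \<inter> S)"
      using that fA by (subst card_Un_disjoint[symmetric]) (auto intro: arg_cong[where f = card])
    moreover have "card R = card A + card (R - A)"
      using that fA by (subst card_Un_disjoint[symmetric]) (auto intro: arg_cong[where f = card])
    moreover have "card ((R - A) \<inter> S) \<le> card (R - A)" using that by (intro card_mono) auto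
    ultimately show ?thesis by simp
  qed
  show ?thesis
  proof (cases "A \<subseteq> R")
    case True then show ?thesis using one assms by blast
  next
    case False
    then have "R \<subseteq> A" using assms by blast
    then show ?thesis using one[of A R] assms by (simp add: abs_minus_commute)
  qed
qed

lemma rank_below_mono:
  assumes "coord p (x i) \<le> coord p (x j)" shows "rank_below n x p i \<le> rank_below n x p j"
  unfolding rank_below_def by (rule card_mono) (use assms in auto)

text \<open>The observations with small rank and those with small value are initial segments of the
  same ordering, hence nested. The empirical copula is thus compared with the joint frequency at an
  arbitrary point \<open>s\<close>, at the cost of the marginal frequencies; rounding of ranks adds
  1 over \<open>n\<close> per coordinate.\<close>

lemma emp_copula_near:
  fixes s :: "nat \<Rightarrow> real"
  assumes nt: "no_ties n x" and n: "0 < n" and u: "u \<in> unit_square"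
  shows "\<bar>emp_copula n x u - real (card {i. i < n \<and> coord 1 (x i) \<le> s 1 \<and> coord 2 (x i) \<le> s 2}) / real n\<bar>
    \<le> \<bar>real (card {i. i < n \<and> coord 1 (x i) \<le> s 1}) / real n - fst u\<bar>
      + \<bar>real (card {i. i < n \<and> coord 2 (x i) \<le> s 2}) / real n - snd u\<bar> + 2 / real n"
proof -
  define A where "A p = {i. i < n \<and> coord p (x i) \<le> s p}" for p
  define R where "R p = {i. i < n \<and> real (rank_below n x p i) < real n * coord p u}" for p
  have fin: "finite (A p)" "finite (R p)" for p
    by (auto simp: A_def R_def intro: finite_subset[of _ "{..<n}"])
  have nest: "A p \<subseteq> R p \<or> R p \<subseteq> A p" for p
  proof (rule ccontr)
    assume "\<not> (A p \<subseteq> R p \<or> R p \<subseteq> A p)"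
    then obtain i j where ij: "i \<in> A p" "i \<notin> R p" "j \<in> R p" "j \<notin> A p" by blast
    then have "coord p (x i) \<le> coord p (x j)" by (auto simp: A_def R_def)
    from rank_below_mono[of p x i j n, OF this] ij show False by (auto simp: A_def R_def)
  qed
  have cR: "\<bar>real (card (R p)) / real n - coord p u\<bar> \<le> 1 / real n" if "p \<in> {1, 2}" for p
    unfolding R_def by (rule card_rank_less[OF no_ties_inj[OF nt that] n]) (use u in \<open>auto simp: unit_square_def coord_def\<close>)
  have d: "\<bar>real (card (R p)) - real (card (A p))\<bar> / real n \<le> \<bar>real (card (A p)) / real n - coord p u\<bar> + 1 / real n"
    if "p \<in> {1, 2}" for p
  proof -
    have "\<bar>real (card (R p)) - real (card (A p))\<bar> / real n = \<bar>real (card (R p)) / real n - real (card (A p)) / real n\<bar>"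
      by (simp add: diff_divide_distrib[symmetric] abs_divide)
    then show ?thesis using cR[OF that] by linarith
  qed
  have e: "emp_copula n x u = real (card (R 1 \<inter> R 2)) / real n"
  proof -
    have "ranked_below n x u = R 1 \<inter> R 2" by (auto simp: below_def R_def coord_def)
    then show ?thesis by (simp add: emp_copula_card[OF n])
  qed
  have a: "{i. i < n \<and> coord 1 (x i) \<le> s 1 \<and> coord 2 (x i) \<le> s 2} = A 1 \<inter> A 2" by (auto simp: A_def)
  have "\<bar>real (card (R 1 \<inter> R 2)) - real (card (A 1 \<inter> A 2))\<bar>
    \<le> \<bar>real (card (R 1)) - real (card (A 1))\<bar> + \<bar>real (card (R 2)) - real (card (A 2))\<bar>"
  proof -
    have "A 1 \<inter> R 2 = R 2 \<inter> A 1" "A 2 \<inter> A 1 = A 1 \<inter> A 2" by auto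
    then show ?thesis
      using card_Int_nested[OF fin(1) fin(2) nest, of 1 "R 2"] card_Int_nested[OF fin(1) fin(2) nest, of 2 "A 1"] by simp
  qed
  then have "\<bar>real (card (R 1 \<inter> R 2)) / real n - real (card (A 1 \<inter> A 2)) / real n\<bar>
    \<le> \<bar>real (card (R 1)) - real (card (A 1))\<bar> / real n + \<bar>real (card (R 2)) - real (card (A 2))\<bar> / real n"
    using n by (simp add: diff_divide_distrib[symmetric] add_divide_distrib[symmetric] abs_divide divide_right_mono)
  moreover have "coord 1 u = fst u" "coord 2 u = snd u" by (auto simp: coord_def)
  ultimately show ?thesis
    using d[of 1] d[of 2] unfolding e a A_def[of 1, symmetric] A_def[of 2, symmetric] by simp
qed

text \<open>Grid values 0 and 1 are avoided because population quantiles are available only strictly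
  between them.\<close>

lemma near_interior_grid:
  fixes t :: real
  assumes t: "t \<in> {0..1}" and m: "2 \<le> m"
  shows "\<exists>k\<in>{1..<m}. \<bar>t - real k / real m\<bar> \<le> 1 / real m"
proof -
  have m0: "0 < real m" using m by simp
  have red: "\<bar>t - real k / real m\<bar> \<le> 1 / real m" if "\<bar>real m * t - real k\<bar> \<le> 1" for k :: nat
  proof -
    have "t - real k / real m = (real m * t - real k) / real m" using m0 by (simp add: diff_divide_distrib)
    then show ?thesis using that m0 by (simp add: abs_divide divide_right_mono)
  qed
  have mt: "0 \<le> real m * t" "real m * t \<le> real m" using t m0 by (auto simp: mult_left_le)
  consider "real m * t < 1" | "real m - 1 \<le> real m * t" | "1 \<le> real m * t" "real m * t < real m - 1" by linarith
  then show ?thesis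
  proof cases
    case 1 then show ?thesis using m mt by (intro bexI[of _ 1] red) auto
  next
    case 2 then show ?thesis using m mt by (intro bexI[of _ "m - 1"] red) (auto simp: of_nat_diff)
  next
    case 3
    define k where "k = nat \<lfloor>real m * t\<rfloor>"
    have fl: "1 \<le> \<lfloor>y\<rfloor> \<and> \<lfloor>y\<rfloor> < int m" if "1 \<le> y" "y < real m - 1" for y :: real
      using that by linarith
    have f: "1 \<le> \<lfloor>real m * t\<rfloor>" "\<lfloor>real m * t\<rfloor> < int m" using fl[OF 3] by auto
    have "real k = of_int \<lfloor>real m * t\<rfloor>" using f by (simp add: k_def)
    then have "\<bar>real m * t - real k\<bar> \<le> 1" by linarith
    moreover have "nat F \<in> {1..<m}" if "1 \<le> F" "F < int m" for F using that by auto
    from this[OF f] have "k \<in> {1..<m}" by (simp only: k_def)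
    ultimately show ?thesis using red by blast
  qed
qed

context copula_sample
begin

lemma copula_C: "is_copula C" using copula_of by (simp add: is_copula_of_def)

text \<open>At the population quantiles of \<open>u\<close> the joint frequency estimates
  \<open>C u\<close> and the marginal frequencies estimate the coordinates of \<open>u\<close>.
  Three laws of large numbers and \<open>emp_copula_near\<close> give the bound.\<close>

lemma emp_copula_at_point:
  assumes u: "0 < fst u" "fst u < 1" "0 < snd u" "snd u < 1" and k: "0 < \<kappa>" and n: "0 < n"
  shows "\<exists>E\<in>events. prob E \<le> 3 / (real n * \<kappa>\<^sup>2) \<and>
    (\<forall>\<omega>\<in>space M - E. no_ties n (sample X n \<omega>) \<longrightarrow> \<bar>emp_copula n (sample X n \<omega>) u - C u\<bar> \<le> 3 * \<kappa> + 2 / real n)"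
proof -
  obtain s1 s2 where s: "marginal_df M (X 0) 1 s1 = fst u" "marginal_df M (X 0) 2 s2 = snd u"
    using margin_quantile[of 1 "fst u"] margin_quantile[of 2 "snd u"] u by auto
  define s :: "nat \<Rightarrow> real" where "s p = (if p = 1 then s1 else s2)" for p
  have us: "u \<in> unit_square" using u by (cases u) (auto simp: unit_square_def)
  have Ap: "{v. coord p v \<le> t} \<in> sets borel" for p t
    using measurable_sets[OF coord_borel, of "{..t}" p] by (simp add: vimage_def)
  let ?A = "{v :: real \<times> real. coord 1 v \<le> s 1} \<inter> {v. coord 2 v \<le> s 2}"
  have A: "?A \<in> sets borel" by (intro sets.Int Ap)
  obtain E0 where E0: "E0 \<in> events" "prob E0 \<le> 1 / (real n * \<kappa>\<^sup>2)"
    "\<forall>\<omega>\<in>space M - E0. \<bar>real (card {i. i < n \<and> X i \<omega> \<in> ?A}) / real n - prob {\<omega>\<in>space M. X 0 \<omega> \<in> ?A}\<bar> < \<kappa>"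
    using empirical_frequency[OF A k n] by (elim bexE conjE) (rule that)
  obtain E1 where E1: "E1 \<in> events" "prob E1 \<le> 1 / (real n * \<kappa>\<^sup>2)"
    "\<forall>\<omega>\<in>space M - E1. \<bar>real (card {i. i < n \<and> X i \<omega> \<in> {v. coord 1 v \<le> s 1}}) / real n - prob {\<omega>\<in>space M. X 0 \<omega> \<in> {v. coord 1 v \<le> s 1}}\<bar> < \<kappa>"
    using empirical_frequency[OF Ap[of 1 "s 1"] k n] by (elim bexE conjE) (rule that)
  obtain E2 where E2: "E2 \<in> events" "prob E2 \<le> 1 / (real n * \<kappa>\<^sup>2)"
    "\<forall>\<omega>\<in>space M - E2. \<bar>real (card {i. i < n \<and> X i \<omega> \<in> {v. coord 2 v \<le> s 2}}) / real n - prob {\<omega>\<in>space M. X 0 \<omega> \<in> {v. coord 2 v \<le> s 2}}\<bar> < \<kappa>"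
    using empirical_frequency[OF Ap[of 2 "s 2"] k n] by (elim bexE conjE) (rule that)
  have p1: "prob {\<omega>\<in>space M. X 0 \<omega> \<in> {v. coord 1 v \<le> s 1}} = fst u" using s(1) by (simp add: marginal_df_def s_def)
  have p2: "prob {\<omega>\<in>space M. X 0 \<omega> \<in> {v. coord 2 v \<le> s 2}} = snd u" using s(2) by (simp add: marginal_df_def s_def)
  have p0: "prob {\<omega>\<in>space M. X 0 \<omega> \<in> ?A} = C u"
  proof -
    have "joint_df M (X 0) (s1, s2) = C u" using copula_of s by (simp add: is_copula_of_def)
    then show ?thesis by (simp add: joint_df_def s_def coord_def)
  qed
  let ?E = "E0 \<union> (E1 \<union> E2)"
  have "prob ?E \<le> prob E0 + (prob E1 + prob E2)"
    using measure_subadditive[of E0 M "E1 \<union> E2"] measure_subadditive[of E1 M E2] E0(1) E1(1) E2(1)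
    by (simp add: emeasure_eq_measure)
  moreover have "e \<le> 3 / c" if "e \<le> e0 + (e1 + e2)" "e0 \<le> 1 / c" "e1 \<le> 1 / c" "e2 \<le> 1 / c" for e e0 e1 e2 c :: real
    using that by simp
  ultimately have "prob ?E \<le> 3 / (real n * \<kappa>\<^sup>2)" using E0(2) E1(2) E2(2) by blast
  moreover have "?E \<in> events" using E0(1) E1(1) E2(1) by blast
  moreover have "\<bar>emp_copula n (sample X n \<omega>) u - C u\<bar> \<le> 3 * \<kappa> + 2 / real n"
    if w: "\<omega> \<in> space M - ?E" and nt: "no_ties n (sample X n \<omega>)" for \<omega>
  proof -
    let ?x = "sample X n \<omega>"
    have c0: "{i. i < n \<and> X i \<omega> \<in> ?A} = {i. i < n \<and> coord 1 (?x i) \<le> s 1 \<and> coord 2 (?x i) \<le> s 2}"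
      by (auto simp: sample_def)
    have cp: "{i. i < n \<and> X i \<omega> \<in> {v. coord p v \<le> s p}} = {i. i < n \<and> coord p (?x i) \<le> s p}" for p
      by (auto simp: sample_def)
    have "\<bar>real (card {i. i < n \<and> coord 1 (?x i) \<le> s 1 \<and> coord 2 (?x i) \<le> s 2}) / real n - C u\<bar> < \<kappa>"
      using E0(3)[rule_format, of \<omega>] w unfolding p0 c0 by blast
    moreover have "\<bar>real (card {i. i < n \<and> coord 1 (?x i) \<le> s 1}) / real n - fst u\<bar> < \<kappa>"
      using E1(3)[rule_format, of \<omega>] w unfolding p1 cp by blast
    moreover have "\<bar>real (card {i. i < n \<and> coord 2 (?x i) \<le> s 2}) / real n - snd u\<bar> < \<kappa>"
      using E2(3)[rule_format, of \<omega>] w unfolding p2 cp by blast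
    ultimately show ?thesis using emp_copula_near[OF nt n us, of s] by linarith
  qed
  ultimately show ?thesis by (intro bexI[of _ ?E]) auto
qed

text \<open>A Glivenko-Cantelli argument for the empirical copula: closeness on a finite interior
  grid extends to the square because \<open>C\<close> is Lipschitz and the empirical copula nearly
  so.\<close>

lemma regular_sample_asymp_sure:
  assumes th: "0 < \<theta>"
  shows "asymp_sure M (\<lambda>n \<omega>. regular_sample C \<theta> n (sample X n \<omega>))"
proof (rule asymp_sure_measurable[OF prob_M])
  fix \<epsilon> :: real assume eps: "0 < \<epsilon>"
  \<comment> \<open>The error is \<open>3 * \<kappa> + 4 / real n + 4 / real m\<close>; each of its
    three terms is at most \<open>\<theta> / 4\<close>.\<close>
  define \<kappa> where "\<kappa> = \<theta> / 12"
  have k: "0 < \<kappa>" using th by (simp add: \<kappa>_def)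
  obtain m :: nat where m: "max 2 (16 / \<theta>) \<le> real m" using real_arch_simple by blast
  then have m2: "2 \<le> m" and mth: "4 / real m \<le> \<theta> / 4" using th by (auto simp: field_simps)
  obtain n0 :: nat where n0: "max 1 (max (16 / \<theta>) (3 * (real m)\<^sup>2 / (\<epsilon> * \<kappa>\<^sup>2))) \<le> real n0" using real_arch_simple by blast
  have "\<exists>E\<in>events. prob E \<le> \<epsilon> \<and> (\<forall>\<omega>\<in>space M - E. regular_sample C \<theta> n (sample X n \<omega>))" if n: "n \<ge> n0" for n
  proof -
    have nn: "max 1 (max (16 / \<theta>) (3 * (real m)\<^sup>2 / (\<epsilon> * \<kappa>\<^sup>2))) \<le> real n" using n0 n by linarith
    then have n1: "0 < n" and nth: "4 / real n \<le> \<theta> / 4" and nb: "3 * (real m)\<^sup>2 / (\<epsilon> * \<kappa>\<^sup>2) \<le> real n"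
      using th by (auto simp: field_simps)
    have nb': "(real m)\<^sup>2 * (3 / (real n * \<kappa>\<^sup>2)) \<le> \<epsilon>"
      using nb n1 eps k by (simp add: field_simps)
    define g :: "nat \<times> nat \<Rightarrow> real \<times> real" where "g kl = (real (fst kl) / real m, real (snd kl) / real m)" for kl
    let ?S = "{1..<m} \<times> {1..<m}"
    have "\<exists>E\<in>events. prob E \<le> 3 / (real n * \<kappa>\<^sup>2) \<and>
      (\<forall>\<omega>\<in>space M - E. no_ties n (sample X n \<omega>) \<longrightarrow> \<bar>emp_copula n (sample X n \<omega>) (g kl) - C (g kl)\<bar> \<le> 3 * \<kappa> + 2 / real n)"
      if "kl \<in> ?S" for kl
      by (rule emp_copula_at_point[OF _ _ _ _ k n1]) (use that in \<open>auto simp: g_def\<close>)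
    then obtain E where E: "\<forall>kl\<in>?S. E kl \<in> events \<and> prob (E kl) \<le> 3 / (real n * \<kappa>\<^sup>2) \<and>
      (\<forall>\<omega>\<in>space M - E kl. no_ties n (sample X n \<omega>) \<longrightarrow> \<bar>emp_copula n (sample X n \<omega>) (g kl) - C (g kl)\<bar> \<le> 3 * \<kappa> + 2 / real n)"
      by (metis (no_types, lifting))
    obtain E' where E': "E' \<in> events" "prob E' = 0" "\<forall>\<omega>\<in>space M - E'. no_ties n (sample X n \<omega>)"
      using no_ties_event[of n] by (elim bexE conjE) (rule that)
    let ?U = "\<Union>kl\<in>?S. E kl"
    have Um: "?U \<in> events" using E by (intro sets.finite_UN) auto
    have "prob ?U \<le> (\<Sum>kl\<in>?S. prob (E kl))" by (rule finite_measure_subadditive_finite) (use E in auto)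
    also have "\<dots> \<le> (\<Sum>kl\<in>?S. 3 / (real n * \<kappa>\<^sup>2))" by (rule sum_mono) (use E in auto)
    also have "\<dots> = real ((m - 1) * (m - 1)) * (3 / (real n * \<kappa>\<^sup>2))" by (simp add: card_cartesian_product)
    also have "\<dots> \<le> (real m)\<^sup>2 * (3 / (real n * \<kappa>\<^sup>2))"
    proof (rule mult_right_mono)
      have "(m - 1) * (m - 1) \<le> m * m" by (rule mult_le_mono) auto
      then show "real ((m - 1) * (m - 1)) \<le> (real m)\<^sup>2" unfolding power2_eq_square of_nat_mult[symmetric] of_nat_le_iff .
    qed simp
    finally have "prob ?U \<le> \<epsilon>" using nb' by linarith
    then have "prob (E' \<union> ?U) \<le> \<epsilon>"
      using measure_subadditive[of E' M ?U] E'(1,2) Um by (simp add: emeasure_eq_measure)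
    moreover have "regular_sample C \<theta> n (sample X n \<omega>)" if w: "\<omega> \<in> space M - (E' \<union> ?U)" for \<omega>
    proof -
      have nt: "no_ties n (sample X n \<omega>)" using E'(3) w by blast
      have "\<bar>emp_copula n (sample X n \<omega>) u - C u\<bar> \<le> \<theta>" if u: "u \<in> unit_square" for u
      proof -
        have u01: "fst u \<in> {0..1}" "snd u \<in> {0..1}" using u by (auto simp: unit_square_def)
        obtain k' l where kl: "k' \<in> {1..<m}" "\<bar>fst u - real k' / real m\<bar> \<le> 1 / real m"
          "l \<in> {1..<m}" "\<bar>snd u - real l / real m\<bar> \<le> 1 / real m"
          using near_interior_grid[OF u01(1) m2] near_interior_grid[OF u01(2) m2] by blast
        let ?v = "g (k', l)"
        have S: "(k', l) \<in> ?S" using kl by auto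
        have vs: "?v \<in> unit_square" using kl by (auto simp: g_def unit_square_def divide_le_eq)
        have a: "\<bar>emp_copula n (sample X n \<omega>) ?v - C ?v\<bar> \<le> 3 * \<kappa> + 2 / real n"
          using bspec[OF E S] nt w S by blast
        have b: "\<bar>emp_copula n (sample X n \<omega>) u - emp_copula n (sample X n \<omega>) ?v\<bar> \<le> 2 / real m + 2 / real n"
          using emp_copula_approx_Lipschitz[OF nt n1, of u ?v] kl by (simp add: g_def)
        have c: "\<bar>C u - C ?v\<bar> \<le> 2 / real m"
          using copula_Lipschitz[OF copula_C u vs] kl by (simp add: g_def)
        have gen: "\<bar>e1 - c1\<bar> \<le> \<theta>" if "\<bar>e2 - c2\<bar> \<le> 3 * \<kappa> + 2 * a'" "\<bar>e1 - e2\<bar> \<le> 2 * b' + 2 * a'" "\<bar>c1 - c2\<bar> \<le> 2 * b'"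
          "4 * b' \<le> \<theta> / 4" "4 * a' \<le> \<theta> / 4" for e1 e2 c1 c2 a' b' :: real
          using that th unfolding \<kappa>_def by linarith
        show ?thesis by (rule gen[of _ _ "1 / real n" _ "1 / real m"]) (use a b c mth nth in auto)
      qed
      then show ?thesis using nt by (simp add: regular_sample_def)
    qed
    ultimately show ?thesis using E'(1) Um by (intro bexI[of _ "E' \<union> ?U"]) auto
  qed
  then show "\<exists>n0. \<forall>n\<ge>n0. \<exists>E\<in>events. prob E \<le> \<epsilon> \<and> (\<forall>\<omega>\<in>space M - E. regular_sample C \<theta> n (sample X n \<omega>))" by blast
qed

end

text \<open>Boundedness of the estimator makes the real supremum in the consistency assumption a
  genuine upper bound of its members; on an unbounded set it would carry no information.\<close>

lemma (in smooth_copula) estimator_asymp_sure: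
  assumes p: "p \<in> {1, 2}" and a: "0 < a" "a < 1 / 2" and th: "0 < \<theta>"
    and bd: "\<And>n \<omega> u. n \<ge> 1 \<Longrightarrow> \<omega> \<in> space M \<Longrightarrow> u \<in> unit_square \<Longrightarrow> \<bar>D n (sample X n \<omega>) p u\<bar> \<le> K"
    and con: "null_in_prob M (\<lambda>n \<omega>. SUP u\<in>{u \<in> unit_square. a \<le> coord p u \<and> coord p u \<le> 1 - a}.
        \<bar>D n (sample X n \<omega>) p u - dotC C p u\<bar>)"
  shows "asymp_sure M (\<lambda>n \<omega>. \<forall>u\<in>inner_strip p a. \<bar>D n (sample X n \<omega>) p u - dotC C p u\<bar> \<le> \<theta>)"
proof (rule asymp_sure_mono[of _ _ 1])
  let ?S = "\<lambda>n \<omega>. SUP u\<in>inner_strip p a. \<bar>D n (sample X n \<omega>) p u - dotC C p u\<bar>"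
  show "asymp_sure M (\<lambda>n \<omega>. \<bar>?S n \<omega>\<bar> \<le> \<theta>)"
    using con th unfolding asymp_sure_def null_in_prob_def inner_strip_def by (simp add: not_le)
  fix n \<omega> assume n: "n \<ge> (1 :: nat)" and w: "\<omega> \<in> space M" and S: "\<bar>?S n \<omega>\<bar> \<le> \<theta>"
  show "\<forall>u\<in>inner_strip p a. \<bar>D n (sample X n \<omega>) p u - dotC C p u\<bar> \<le> \<theta>"
  proof
    fix u assume u: "u \<in> inner_strip p a"
    have "\<bar>D n (sample X n \<omega>) p v - dotC C p v\<bar> \<le> K + 1" if "v \<in> inner_strip p a" for v
    proof -
      have "v \<in> unit_square" using that by (simp add: inner_strip_def)
      then have "\<bar>D n (sample X n \<omega>) p v\<bar> \<le> K" "\<bar>dotC C p v\<bar> \<le> 1" using bd[OF n w] abs_dotC_le[OF p] by auto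
      then show ?thesis by linarith
    qed
    then have "bdd_above ((\<lambda>u. \<bar>D n (sample X n \<omega>) p u - dotC C p u\<bar>) ` inner_strip p a)" by (intro bdd_aboveI2)
    from cSUP_upper[OF u this] S show "\<bar>D n (sample X n \<omega>) p u - dotC C p u\<bar> \<le> \<theta>" by linarith
  qed
qed

section \<open>Joint events for data and multipliers\<close>

lemma generated_algebra_component:
  assumes "j \<in> J" shows "Z j \<in> borel_measurable (generated_algebra M J Z)"
proof -
  have m: "(\<lambda>\<omega>. \<lambda>i\<in>J. Z i \<omega>) \<in> measurable (generated_algebra M J Z) (PiM J (\<lambda>_. borel))"
    unfolding generated_algebra_def by (rule measurable_vimage_algebra1) (auto simp: space_PiM)
  show ?thesis using measurable_compose[OF m measurable_component_singleton[OF assms]] assms by simp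
qed

lemma space_generated_algebra [simp]: "space (generated_algebra M J Z) = space M"
  by (simp add: generated_algebra_def)

lemma generated_algebra_subalgebra:
  assumes "\<And>j. j \<in> J \<Longrightarrow> Z j \<in> borel_measurable M"
  shows "subalgebra M (generated_algebra M J Z)"
  unfolding subalgebra_def
proof
  have m: "(\<lambda>\<omega>. \<lambda>i\<in>J. Z i \<omega>) \<in> measurable M (PiM J (\<lambda>_. borel))" using assms by (rule measurable_restrict)
  have s: "(\<lambda>\<omega>. \<lambda>i\<in>J. Z i \<omega>) \<in> space M \<rightarrow> space (PiM J (\<lambda>_. borel))" using measurable_space[OF m] by auto
  show "sets (generated_algebra M J Z) \<subseteq> sets M"
    unfolding generated_algebra_def sets_vimage_algebra2[OF s] using measurable_sets[OF m] by auto
qed simp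

text \<open>The algebra is left open since this is needed both for \<open>M\<close> and for the
  algebra generated by the data, where independence is stated.\<close>

lemma rankize_measurable:
  assumes X: "\<And>i. i < n \<Longrightarrow> X i \<in> borel_measurable \<A>"
  shows "(\<lambda>\<omega>. rankize n (sample X n \<omega>)) \<in> measurable \<A> (count_space (range (rankize n)))"
  unfolding measurable_count_space_eq2[OF finite_rankize]
proof (intro conjI ballI)
  fix \<rho> assume rho: "\<rho> \<in> range (rankize n)"
  have c: "(\<lambda>\<omega>. coord p (X i \<omega>)) \<in> borel_measurable \<A>" if "i < n" for p i
    by (rule measurable_compose[OF X[OF that] coord_borel])
  have r: "(\<lambda>\<omega>. real (rank_below n (sample X n \<omega>) p i)) \<in> borel_measurable \<A>" if i: "i < n" for p i
  proof -
    have "real (rank_below n (sample X n \<omega>) p i) = (\<Sum>j<n. if coord p (X j \<omega>) < coord p (X i \<omega>) then 1 else 0)" for \<omega>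
    proof -
      have "{j. j < n \<and> coord p (sample X n \<omega> j) < coord p (sample X n \<omega> i)} = {..<n} \<inter> {j. coord p (X j \<omega>) < coord p (X i \<omega>)}"
        using i by (auto simp: sample_def)
      then show ?thesis by (simp add: rank_below_def sum.If_cases)
    qed
    moreover have "(\<lambda>\<omega>. \<Sum>j<n. if coord p (X j \<omega>) < coord p (X i \<omega>) then 1 else 0 :: real) \<in> borel_measurable \<A>"
    proof (intro borel_measurable_sum measurable_If measurable_const)
      fix j assume "j \<in> {..<n}"
      then show "{\<omega> \<in> space \<A>. coord p (X j \<omega>) < coord p (X i \<omega>)} \<in> sets \<A>"
        by (intro borel_measurable_less c i) simp
    qed auto
    ultimately show ?thesis by simp
  qed
  have eq: "(\<lambda>\<omega>. rankize n (sample X n \<omega>)) -` {\<rho>} \<inter> space \<A> =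
    {\<omega>\<in>space \<A>. \<forall>i\<in>{..<n}. real (rank_below n (sample X n \<omega>) 1 i) = fst (\<rho> i) \<and> real (rank_below n (sample X n \<omega>) 2 i) = snd (\<rho> i)}"
    (is "?L = ?R")
  proof (intro set_eqI iffI)
    fix \<omega> assume "\<omega> \<in> ?L" then show "\<omega> \<in> ?R" by (auto simp: rankize_def)
  next
    fix \<omega> assume w: "\<omega> \<in> ?R"
    have "rankize n (sample X n \<omega>) i = \<rho> i" for i
    proof (cases "i < n")
      case True
      then show ?thesis using w unfolding rankize_def by (simp add: prod_eq_iff)
    next
      case False then show ?thesis using rho by (auto simp: rankize_def)
    qed
    then show "\<omega> \<in> ?L" using w by auto
  qed
  show "(\<lambda>\<omega>. rankize n (sample X n \<omega>)) -` {\<rho>} \<inter> space \<A> \<in> sets \<A>"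
    unfolding eq
  proof (intro sets.sets_Collect_finite_All sets.sets_Collect_conj)
    fix i assume "i \<in> {..<n}"
    then have i: "i < n" by simp
    show "{\<omega>\<in>space \<A>. real (rank_below n (sample X n \<omega>) 1 i) = fst (\<rho> i)} \<in> sets \<A>"
      by (intro borel_measurable_eq r[OF i] borel_measurable_const)
    show "{\<omega>\<in>space \<A>. real (rank_below n (sample X n \<omega>) 2 i) = snd (\<rho> i)} \<in> sets \<A>"
      by (intro borel_measurable_eq r[OF i] borel_measurable_const)
  qed (use X in auto)
qed auto

text \<open>Carries results on \<open>W n\<close> to sampled multipliers, both for the original ones
  and for each of the bootstrap copies.\<close>

lemma (in multiplier_law) sample_law:
  assumes M: "prob_space M" and ind: "prob_space.indep_vars M (\<lambda>_. borel) Z {..<n}"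
    and law: "\<And>i. i < n \<Longrightarrow> distr M borel (Z i) = \<mu>"
  shows "sample Z n \<in> measurable M (W n)" "distr M (W n) (sample Z n) = W n"
proof -
  interpret M: prob_space M by fact
  have Z: "Z i \<in> borel_measurable M" if "i < n" for i using ind that by (auto simp: M.indep_vars_def)
  have s: "sets (W n) = sets (PiM {..<n} (\<lambda>_. borel))" unfolding W_def by (rule sets_PiM_cong) (auto simp: sets_\<mu>)
  have "sample Z n \<in> measurable M (PiM {..<n} (\<lambda>_. borel))"
    unfolding sample_def by (rule measurable_restrict) (use Z in auto)
  then show "sample Z n \<in> measurable M (W n)" by (simp add: measurable_cong_sets[OF refl s])
  have "distr M (PiM {..<n} (\<lambda>_. borel)) (\<lambda>\<omega>. \<lambda>i\<in>{..<n}. Z i \<omega>) = PiM {..<n} (\<lambda>i. distr M borel (Z i))"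
  proof (cases "n = 0")
    case True
    have "distr M (PiM {} (\<lambda>_. borel :: real measure)) (\<lambda>\<omega>. \<lambda>i. undefined) = PiM {} (\<lambda>i. distr M borel (Z i))"
    proof (rule measure_eqI)
      fix A :: "(nat \<Rightarrow> real) set"
      assume "A \<in> sets (distr M (PiM {} (\<lambda>_. borel :: real measure)) (\<lambda>\<omega>. \<lambda>i. undefined))"
      then have "A = {} \<or> A = {\<lambda>i. undefined}" by (auto simp: sets_PiM_empty)
      then show "emeasure (distr M (PiM {} (\<lambda>_. borel :: real measure)) (\<lambda>\<omega>. \<lambda>i. undefined)) A = emeasure (PiM {} (\<lambda>i. distr M borel (Z i))) A"
        by (auto simp: emeasure_distr sets_PiM_empty M.emeasure_space_1 space_PiM)
    qed (simp add: sets_PiM_empty)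
    then show ?thesis using True by (simp add: restrict_def)
  next
    case False
    then show ?thesis using M.indep_vars_iff_distr_eq_PiM'[of "{..<n}" Z "\<lambda>_. borel"] ind Z by auto
  qed
  also have "\<dots> = W n" unfolding W_def by (rule PiM_cong) (use law in auto)
  finally show "distr M (W n) (sample Z n) = W n" using s unfolding sample_def by (simp cong: distr_cong)
qed

text \<open>Only the finitely many possible ranks of the data matter, so independence applies without Fubini.\<close>

lemma (in multiplier_law) joint_event:
  assumes M: "prob_space M" and n: "0 < n"
    and X: "\<And>i. X i \<in> borel_measurable M" and indep: "independent_families M UNIV X J Z"
    and Y: "Y \<in> measurable (generated_algebra M J Z) (W n)" "Y \<in> measurable M (W n)" "distr M (W n) Y = W n"
    and F: "\<And>\<rho>. F \<rho> \<in> sets (W n)" "\<And>\<rho>. measure (W n) (F \<rho>) \<le> \<epsilon>"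
  defines "E \<equiv> {\<omega>\<in>space M. Y \<omega> \<in> F (rankize n (sample X n \<omega>))}"
  shows "E \<in> sets M" "measure M E \<le> \<epsilon>"
proof -
  interpret M: prob_space M by fact
  let ?R = "range (rankize n)" and ?A = "generated_algebra M UNIV X" and ?B = "generated_algebra M J Z"
  define G where "G \<rho> = (\<lambda>\<omega>. rankize n (sample X n \<omega>)) -` {\<rho>} \<inter> space M" for \<rho>
  define H where "H \<rho> = Y -` F \<rho> \<inter> space M" for \<rho>
  have ind: "M.indep_set (sets ?A) (sets ?B)" using indep by (simp add: independent_families_def)
  have GA: "G \<rho> \<in> sets ?A" if "\<rho> \<in> ?R" for \<rho>
    using measurable_sets[OF rankize_measurable[of n X ?A], of "{\<rho>}"] that by (simp add: G_def generated_algebra_component)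
  have GM: "G \<rho> \<in> sets M" if "\<rho> \<in> ?R" for \<rho>
    using measurable_sets[OF rankize_measurable[of n X M], of "{\<rho>}"] that X by (simp add: G_def)
  have HB: "H \<rho> \<in> sets ?B" for \<rho> using measurable_sets[OF Y(1) F(1)] by (simp add: H_def)
  have HM: "H \<rho> \<in> sets M" for \<rho> using measurable_sets[OF Y(2) F(1)] by (simp add: H_def)
  have pH: "M.prob (H \<rho>) \<le> \<epsilon>" for \<rho>
  proof -
    have "measure (distr M (W n) Y) (F \<rho>) = M.prob (H \<rho>)" unfolding H_def by (rule measure_distr[OF Y(2) F(1)])
    then show ?thesis using F(2)[of \<rho>] unfolding Y(3) by simp
  qed
  \<comment> \<open>The rank vector partitions the space into finitely many data events; on each the
    exceptional set is fixed, so the probability factorises and the data weights sum to at most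
    1.\<close>
  have E: "E = (\<Union>\<rho>\<in>?R. G \<rho> \<inter> H \<rho>)" by (auto simp: E_def G_def H_def)
  show "E \<in> sets M" unfolding E using GM HM by (intro sets.finite_UN finite_rankize sets.Int) auto
  have "M.prob E \<le> (\<Sum>\<rho>\<in>?R. M.prob (G \<rho> \<inter> H \<rho>))"
    unfolding E by (rule M.finite_measure_subadditive_finite[OF finite_rankize]) (use GM HM in auto)
  also have "\<dots> = (\<Sum>\<rho>\<in>?R. M.prob (G \<rho>) * M.prob (H \<rho>))"
    by (intro sum.cong refl M.indep_setD[OF ind] GA HB)
  also have "\<dots> \<le> (\<Sum>\<rho>\<in>?R. M.prob (G \<rho>) * \<epsilon>)" by (intro sum_mono mult_left_mono pH) simp
  also have "\<dots> = M.prob (\<Union>\<rho>\<in>?R. G \<rho>) * \<epsilon>"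
  proof -
    have "M.prob (\<Union>\<rho>\<in>?R. G \<rho>) = (\<Sum>\<rho>\<in>?R. M.prob (G \<rho>))"
      by (rule M.finite_measure_finite_Union[OF finite_rankize]) (use GM in \<open>auto simp: disjoint_family_on_def G_def\<close>)
    then show ?thesis by (simp add: sum_distrib_right)
  qed
  also have "\<dots> \<le> 1 * \<epsilon>"
  proof (rule mult_right_mono)
    show "0 \<le> \<epsilon>" using order_trans[OF measure_nonneg F(2)] .
  qed simp
  finally show "M.prob E \<le> \<epsilon>" by simp
qed

section \<open>Measurable majorants\<close>

context prob_space
begin

text \<open>The integral is minimised over the measurable majorants bounded by 1; the pointwise
  infimum of a minimising sequence attains the minimum.\<close>

lemma majorant_exists:
  assumes Y: "\<And>\<omega>. \<bar>Y \<omega>\<bar> \<le> 1"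
  shows "\<exists>Z. is_majorant M Y Z"
proof -
  define S where "S = {U. U \<in> borel_measurable M \<and> (\<forall>\<omega>\<in>space M. Y \<omega> \<le> U \<omega> \<and> U \<omega> \<le> 1)}"
  have iS: "integrable M U" if "U \<in> S" for U
  proof (rule integrable_const_bound[of _ 1])
    have "\<bar>U \<omega>\<bar> \<le> 1" if "\<omega> \<in> space M" for \<omega> using \<open>U \<in> S\<close> that Y[of \<omega>] unfolding S_def abs_le_iff by force
    then show "AE \<omega> in M. norm (U \<omega>) \<le> 1" by (intro AE_I2) simp
  qed (use that in \<open>simp add: S_def\<close>)
  have lb: "-1 \<le> integral\<^sup>L M U" if "U \<in> S" for U
  proof -
    have "-1 \<le> U \<omega>" if "\<omega> \<in> space M" for \<omega> using \<open>U \<in> S\<close> that Y[of \<omega>] unfolding S_def abs_le_iff by force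
    then have "integral\<^sup>L M (\<lambda>_. -1) \<le> integral\<^sup>L M U" by (intro integral_mono iS[OF that] integrable_const) auto
    then show ?thesis by (simp add: prob_space)
  qed
  have one: "(\<lambda>_. 1) \<in> S" using Y unfolding S_def abs_le_iff by auto
  define I where "I = integral\<^sup>L M ` S"
  have bI: "bdd_below I" unfolding I_def using lb by (intro bdd_belowI2[of _ "-1"])
  have "\<exists>U\<in>S. integral\<^sup>L M U < Inf I + 1 / real (Suc k)" for k
  proof -
    have "\<exists>x\<in>I. x < Inf I + 1 / real (Suc k)" using one by (intro cInf_lessD) (auto simp: I_def)
    then show ?thesis by (auto simp: I_def)
  qed
  then obtain U where U: "\<And>k. U k \<in> S" "\<And>k. integral\<^sup>L M (U k) < Inf I + 1 / real (Suc k)" by metis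
  define Z where "Z \<omega> = (INF k. U k \<omega>)" for \<omega>
  have bU: "bdd_below (range (\<lambda>k. U k \<omega>))" if "\<omega> \<in> space M" for \<omega>
    using U(1) that by (intro bdd_belowI2[of _ "Y \<omega>"]) (auto simp: S_def)
  have ZU: "Z \<omega> \<le> U k \<omega>" if "\<omega> \<in> space M" for \<omega> k unfolding Z_def by (rule cINF_lower[OF bU[OF that]]) simp
  have YZ: "Y \<omega> \<le> Z \<omega>" if "\<omega> \<in> space M" for \<omega>
    unfolding Z_def by (rule cINF_greatest) (use U(1) that in \<open>auto simp: S_def\<close>)
  have Zm: "Z \<in> borel_measurable M"
    unfolding Z_def by (intro borel_measurable_cINF_real) (use U(1) in \<open>auto simp: S_def\<close>)
  have ZS: "Z \<in> S"
    unfolding S_def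
  proof (intro CollectI conjI ballI Zm YZ)
    fix \<omega> assume w: "\<omega> \<in> space M"
    have "U 0 \<omega> \<le> 1" using U(1)[of 0] w by (auto simp: S_def)
    then show "Z \<omega> \<le> 1" using ZU[OF w, of 0] by linarith
  qed
  have ZI: "integral\<^sup>L M Z \<le> Inf I"
  proof (rule field_le_epsilon)
    fix e :: real assume "0 < e"
    then obtain k where k: "1 / real (Suc k) < e" using nat_approx_posE by blast
    have "integral\<^sup>L M Z \<le> integral\<^sup>L M (U k)" by (rule integral_mono[OF iS[OF ZS] iS[OF U(1)] ZU])
    then show "integral\<^sup>L M Z \<le> Inf I + e" using U(2)[of k] k by linarith
  qed
  have "AE \<omega> in M. Z \<omega> \<le> V \<omega>" if V: "V \<in> borel_measurable M" "AE \<omega> in M. Y \<omega> \<le> V \<omega>" for V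
  proof -
    obtain N where N: "{\<omega>\<in>space M. \<not> Y \<omega> \<le> V \<omega>} \<subseteq> N" "emeasure M N = 0" "N \<in> sets M" using V(2) by (rule AE_E)
    \<comment> \<open>\<open>Z\<close> lowered to \<open>V\<close> outside the null set where
      \<open>V\<close> fails to majorise. It competes in the minimisation, so it agrees with
      \<open>Z\<close> almost everywhere, and therefore \<open>Z\<close> is below \<open>V\<close>
      there.\<close>
    define V' where "V' \<omega> = (if \<omega> \<in> N then Z \<omega> else min (Z \<omega>) (V \<omega>))" for \<omega>
    have V'Z: "V' \<omega> \<le> Z \<omega>" for \<omega> by (simp add: V'_def)
    have V'S: "V' \<in> S"
      unfolding S_def
    proof (intro CollectI conjI ballI)
      show "V' \<in> borel_measurable M" unfolding V'_def using Zm V(1) N(3) by measurable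
      fix \<omega> assume w: "\<omega> \<in> space M"
      show "Y \<omega> \<le> V' \<omega>" using YZ[OF w] N(1) w by (auto simp: V'_def)
      show "V' \<omega> \<le> 1" using V'Z[of \<omega>] ZS w by (auto simp: S_def)
    qed
    have "Inf I \<le> integral\<^sup>L M V'" using V'S by (intro cInf_lower[OF _ bI]) (simp add: I_def)
    then have "integral\<^sup>L M (\<lambda>\<omega>. Z \<omega> - V' \<omega>) \<le> 0" using ZI iS[OF ZS] iS[OF V'S] by simp
    moreover have "0 \<le> integral\<^sup>L M (\<lambda>\<omega>. Z \<omega> - V' \<omega>)" using V'Z by (intro integral_nonneg_AE) simp
    ultimately have "integral\<^sup>L M (\<lambda>\<omega>. Z \<omega> - V' \<omega>) = 0" by simp
    then have "AE \<omega> in M. Z \<omega> - V' \<omega> = 0"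
      using V'Z iS[OF ZS] iS[OF V'S] by (subst (asm) integral_nonneg_eq_0_iff_AE) auto
    moreover have "AE \<omega> in M. \<omega> \<notin> N" using N(2,3) by (intro AE_not_in) (simp add: null_sets_def)
    ultimately show ?thesis
    proof eventually_elim
      case (elim \<omega>) then show ?case by (simp add: V'_def min_def split: if_splits)
    qed
  qed
  then have "is_majorant M Y Z" using Zm YZ by (simp add: is_majorant_def)
  then show ?thesis by blast
qed

lemma majorant_props:
  assumes "\<And>\<omega>. \<bar>Y \<omega>\<bar> \<le> 1"
  shows "majorant M Y \<in> borel_measurable M" "\<And>\<omega>. \<omega> \<in> space M \<Longrightarrow> Y \<omega> \<le> majorant M Y \<omega>"
    "\<And>U. U \<in> borel_measurable M \<Longrightarrow> (\<And>\<omega>. \<omega> \<in> space M \<Longrightarrow> Y \<omega> \<le> U \<omega>) \<Longrightarrow> AE \<omega> in M. majorant M Y \<omega> \<le> U \<omega>"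
proof -
  have "is_majorant M Y (majorant M Y)"
    unfolding majorant_def using majorant_exists[OF assms] by (rule someI_ex)
  then show "majorant M Y \<in> borel_measurable M" "\<And>\<omega>. \<omega> \<in> space M \<Longrightarrow> Y \<omega> \<le> majorant M Y \<omega>"
    "\<And>U. U \<in> borel_measurable M \<Longrightarrow> (\<And>\<omega>. \<omega> \<in> space M \<Longrightarrow> Y \<omega> \<le> U \<omega>) \<Longrightarrow> AE \<omega> in M. majorant M Y \<omega> \<le> U \<omega>"
    unfolding is_majorant_def by (auto intro: AE_I2)
qed

text \<open>\<open>Y\<close> lies within \<open>e\<close> plus twice the indicator of
  \<open>E\<close> of the measurable \<open>U\<close>, which bounds both majorant and minorant; the
  gap is at most twice that. Conditional expectation preserves its mean, and Markov's inequality
  finishes.\<close>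

lemma cond_exp_majorant_gap:
  assumes F: "subalgebra M F" and Y: "\<And>\<omega>. \<bar>Y \<omega>\<bar> \<le> 1" and U: "U \<in> borel_measurable M" "\<And>\<omega>. \<bar>U \<omega>\<bar> \<le> 1"
    and E: "E \<in> events" "\<And>\<omega>. \<omega> \<in> space M - E \<Longrightarrow> \<bar>Y \<omega> - U \<omega>\<bar> \<le> e" and e: "0 < e" and t: "0 < t"
  shows "\<exists>A\<in>events. prob A \<le> (2 * e + 4 * prob E) / t \<and>
    (\<forall>\<omega>\<in>space M - A. \<bar>real_cond_exp M F (majorant M Y) \<omega> - real_cond_exp M F (minorant M Y) \<omega>\<bar> \<le> t)"
proof -
  interpret F: finite_measure_subalgebra M F by unfold_locales (rule F)
  let ?a = "majorant M Y" and ?b = "minorant M Y"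
  have Y': "\<bar>- Y \<omega>\<bar> \<le> 1" for \<omega> using Y by simp
  note a = majorant_props[of Y, OF Y] and b' = majorant_props[of "\<lambda>\<omega>. - Y \<omega>", OF Y']
  have am: "?a \<in> borel_measurable M" by (rule a(1))
  have bm: "?b \<in> borel_measurable M" unfolding minorant_def using b'(1) by simp
  have YU: "\<bar>Y \<omega> - U \<omega>\<bar> \<le> e + 2 * indicat_real E \<omega>" if "\<omega> \<in> space M" for \<omega>
  proof (cases "\<omega> \<in> E")
    case True then show ?thesis using Y[of \<omega>] U(2)[of \<omega>] e by (simp add: abs_le_iff)
  next
    case False then show ?thesis using E(2)[of \<omega>] that by simp
  qed
  have bnd: "AE \<omega> in M. ?a \<omega> \<le> U \<omega> + (e + 2 * indicat_real E \<omega>)"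
  proof (rule a(3))
    fix \<omega> assume "\<omega> \<in> space M"
    from YU[OF this] show "Y \<omega> \<le> U \<omega> + (e + 2 * indicat_real E \<omega>)" by (simp add: abs_le_iff)
  qed (use U(1) E(1) in measurable)
  have bnd': "AE \<omega> in M. majorant M (\<lambda>\<omega>. - Y \<omega>) \<omega> \<le> - U \<omega> + (e + 2 * indicat_real E \<omega>)"
  proof (rule b'(3))
    fix \<omega> assume "\<omega> \<in> space M"
    from YU[OF this] show "- Y \<omega> \<le> - U \<omega> + (e + 2 * indicat_real E \<omega>)" by (simp add: abs_le_iff)
  qed (use U(1) E(1) in measurable)
  have gap: "AE \<omega> in M. ?a \<omega> - ?b \<omega> \<le> 2 * e + 4 * indicat_real E \<omega>"
    using bnd bnd' by eventually_elim (simp add: minorant_def)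
  have le1: "AE \<omega> in M. ?a \<omega> \<le> 1" using Y by (intro a(3)) (auto simp: abs_le_iff)
  have le1': "AE \<omega> in M. majorant M (\<lambda>\<omega>. - Y \<omega>) \<omega> \<le> 1" using Y by (intro b'(3)) (auto simp: abs_le_iff minus_le_iff)
  have ia: "integrable M ?a"
  proof (rule integrable_const_bound[OF _ am])
    have "AE \<omega> in M. Y \<omega> \<le> ?a \<omega>" using a(2) by (rule AE_I2)
    then show "AE \<omega> in M. norm (?a \<omega>) \<le> 1"
      using le1
    proof eventually_elim
      case (elim \<omega>) then show ?case using Y[of \<omega>] by (simp add: abs_le_iff)
    qed
  qed
  have ib: "integrable M ?b"
  proof (rule integrable_const_bound[OF _ bm])
    have "AE \<omega> in M. - Y \<omega> \<le> majorant M (\<lambda>\<omega>. - Y \<omega>) \<omega>" using b'(2) by (rule AE_I2)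
    then show "AE \<omega> in M. norm (?b \<omega>) \<le> 1"
      using le1'
    proof eventually_elim
      case (elim \<omega>) then show ?case using Y[of \<omega>] by (simp add: abs_le_iff minorant_def)
    qed
  qed
  let ?g = "\<lambda>\<omega>. ?a \<omega> - ?b \<omega>"
  have g: "integrable M ?g" using ia ib by simp
  have g0: "0 \<le> ?g \<omega>" if "\<omega> \<in> space M" for \<omega> using a(2)[OF that] b'(2)[OF that] by (simp add: minorant_def)
  have iE: "integrable M (indicat_real E)"
    by (rule integrable_const_bound[of _ 1]) (use E(1) in auto)
  have Eg: "expectation ?g \<le> 2 * e + 4 * prob E"
  proof -
    have "expectation ?g \<le> expectation (\<lambda>\<omega>. 2 * e + 4 * indicat_real E \<omega>)"
      by (intro integral_mono_AE g gap Bochner_Integration.integrable_add integrable_const integrable_mult_right iE)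
    also have "\<dots> = 2 * e + 4 * prob E" using E(1) iE by (simp add: prob_space)
    finally show ?thesis .
  qed
  define d where "d \<omega> = real_cond_exp M F ?a \<omega> - real_cond_exp M F ?b \<omega>" for \<omega>
  have ad: "AE \<omega> in M. real_cond_exp M F ?g \<omega> = d \<omega>" unfolding d_def by (rule F.real_cond_exp_diff[OF ia ib])
  have "AE \<omega> in M. 0 \<le> real_cond_exp M F ?g \<omega>"
    by (rule F.real_cond_exp_pos) (use g g0 in auto)
  with ad have d0: "AE \<omega> in M. 0 \<le> d \<omega>" by eventually_elim simp
  have dm: "d \<in> borel_measurable M" unfolding d_def by simp
  have id: "integrable M d" unfolding d_def using F.real_cond_exp_int(1)[OF ia] F.real_cond_exp_int(1)[OF ib] by simp
  have Ed: "expectation d = expectation ?g"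
    unfolding d_def using F.real_cond_exp_int[OF ia] F.real_cond_exp_int[OF ib] ia ib by simp
  have iabs: "integrable M (\<lambda>\<omega>. \<bar>d \<omega>\<bar>)" using id by simp
  have Eabs: "expectation (\<lambda>\<omega>. \<bar>d \<omega>\<bar>) = expectation d"
    by (rule integral_cong_AE) (use dm d0 in auto)
  define A where "A = {\<omega>\<in>space M. t \<le> \<bar>d \<omega>\<bar>}"
  have Am: "A \<in> events" unfolding A_def using dm by measurable
  have "prob A \<le> expectation (\<lambda>\<omega>. \<bar>d \<omega>\<bar>) / t"
    unfolding A_def using integral_Markov_inequality_measure[OF iabs _ _ t, of A] Am t by (simp add: A_def)
  also have "\<dots> \<le> (2 * e + 4 * prob E) / t" unfolding Eabs Ed using Eg t by (intro divide_right_mono) auto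
  finally have "prob A \<le> (2 * e + 4 * prob E) / t" .
  then show ?thesis using Am by (intro bexI[of _ A]) (auto simp: A_def d_def)
qed

end

section \<open>The bootstrap under the data distribution\<close>

lemma (in multiplier_law) sample_measurable:
  assumes "\<And>i. Z i \<in> borel_measurable \<A>" shows "sample Z n \<in> measurable \<A> (W n)"
proof -
  have s: "sets (W n) = sets (PiM {..<n} (\<lambda>_. borel))" unfolding W_def by (rule sets_PiM_cong) (auto simp: sets_\<mu>)
  have "sample Z n \<in> measurable \<A> (PiM {..<n} (\<lambda>_. borel))"
    unfolding sample_def by (rule measurable_restrict) (rule assms)
  then show ?thesis by (simp add: measurable_cong_sets[OF refl s])
qed

locale bootstrap_test = copula_sample M X C
  for M :: "'w measure" and X :: "nat \<Rightarrow> 'w \<Rightarrow> real \<times> real" and C :: "real \<times> real \<Rightarrow> real" +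
  fixes D :: "nat \<Rightarrow> (nat \<Rightarrow> real \<times> real) \<Rightarrow> nat \<Rightarrow> real \<times> real \<Rightarrow> real"
    and K :: real and \<xi> :: "nat \<Rightarrow> 'w \<Rightarrow> real"
  assumes partial_exists: "\<And>p u. p \<in> {1, 2} \<Longrightarrow> u \<in> strip p \<Longrightarrow>
      (\<lambda>t. C (replace_coord p t u)) field_differentiable (at (coord p u))"
    and partial_continuous: "\<And>p. p \<in> {1, 2} \<Longrightarrow> continuous_on (strip p) (dotC C p)"
    and estimator_bounded: "\<And>p n \<omega> u. p \<in> {1, 2} \<Longrightarrow> n \<ge> 1 \<Longrightarrow> \<omega> \<in> space M \<Longrightarrow> u \<in> unit_square \<Longrightarrow>
      \<bar>D n (sample X n \<omega>) p u\<bar> \<le> K"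
    and estimator_consistent: "\<And>p \<delta>. p \<in> {1, 2} \<Longrightarrow> 0 < \<delta> \<Longrightarrow> \<delta> < 1 / 2 \<Longrightarrow>
      null_in_prob M (\<lambda>n \<omega>. SUP u\<in>{u \<in> unit_square. \<delta> \<le> coord p u \<and> coord p u \<le> 1 - \<delta>}.
        \<bar>D n (sample X n \<omega>) p u - dotC C p u\<bar>)"
    and estimator_measurable: "\<And>n \<omega> w. n \<ge> 1 \<Longrightarrow> \<omega> \<in> space M \<Longrightarrow>
      H_mult D n (sample X n \<omega>) w \<in> borel_measurable (lebesgue_on unit_cube)"
    and mult_iid: "iid M UNIV \<xi>"
    and mult_indep: "independent_families M UNIV X UNIV \<xi>"
    and mult_mean: "integrable M (\<xi> 0)" "integral\<^sup>L M (\<xi> 0) = 1"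
    and mult_variance: "integrable M (\<lambda>\<omega>. (\<xi> 0 \<omega>)\<^sup>2)" "prob_space.variance M (\<xi> 0) = 1"
begin

lemma indep_mult: "indep_vars (\<lambda>_. borel) \<xi> UNIV" using mult_iid by (simp add: iid_def)

lemma mult_borel: "\<xi> i \<in> borel_measurable M" using indep_mult by (auto simp: indep_vars_def)

lemma mult_law: "distr M borel (\<xi> i) = distr M borel (\<xi> 0)" using mult_iid by (simp add: iid_def)

sublocale boot: multiplier_bootstrap "distr M borel (\<xi> 0)" C
proof -
  note m = mult_borel[of 0]
  show "multiplier_bootstrap (distr M borel (\<xi> 0)) C"
  proof (intro multiplier_bootstrap.intro multiplier_law.intro smooth_copula.intro)
    show "prob_space (distr M borel (\<xi> 0))" by (rule prob_space_distr[OF m])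
    show "integrable (distr M borel (\<xi> 0)) (\<lambda>x. x)" using mult_mean(1) m by (subst integrable_distr_eq) auto
    show "integrable (distr M borel (\<xi> 0)) (\<lambda>x. x\<^sup>2)" using mult_variance(1) m by (subst integrable_distr_eq) auto
    show "(LINT x|distr M borel (\<xi> 0). x) = 1" using mult_mean(2) m by (subst integral_distr) auto
    show "(LINT x|distr M borel (\<xi> 0). (x - 1)\<^sup>2) = 1"
      using mult_variance(2) mult_mean(2) m by (subst integral_distr) auto
  qed (use copula_C partial_exists partial_continuous in auto)
qed

lemma admissible:
  assumes "n \<ge> 1" "\<omega> \<in> space M" shows "admissible_estimator D n (sample X n \<omega>) K"
  unfolding admissible_estimator_def
  using estimator_bounded[OF _ assms] estimator_measurable[OF assms] by blast

lemma good_data: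
  assumes a: "0 < a" "a < 1 / 2" and th: "0 < \<theta>"
  shows "asymp_sure M (\<lambda>n \<omega>. regular_sample C \<theta> n (sample X n \<omega>) \<and> boot.consistent_at D n (sample X n \<omega>) a \<theta>)"
proof (rule asymp_sure_conj[OF regular_sample_asymp_sure[OF th]])
  have e: "asymp_sure M (\<lambda>n \<omega>. \<forall>u\<in>boot.inner_strip p a. \<bar>D n (sample X n \<omega>) p u - dotC C p u\<bar> \<le> \<theta>)"
    if p: "p \<in> {1, 2}" for p
    by (rule boot.estimator_asymp_sure[where M = M and X = X and D = D and K = K, OF p a th estimator_bounded[OF p] estimator_consistent[OF p a]])
  show "asymp_sure M (\<lambda>n \<omega>. boot.consistent_at D n (sample X n \<omega>) a \<theta>)"
    using asymp_sure_conj[OF e[of 1] e[of 2]] unfolding boot.consistent_at_def by simp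
qed

lemma sample_mult_law:
  "sample \<xi> n \<in> measurable M (boot.W n)" "distr M (boot.W n) (sample \<xi> n) = boot.W n"
  using boot.sample_law[OF prob_M indep_vars_subset[OF indep_mult subset_UNIV] mult_law] by auto

text \<open>The link to the fixed-sample analysis: integrating out the multipliers with the data
  held fixed is integration against \<open>W n\<close>.\<close>

lemma mult_expectation_law:
  assumes n: "n \<ge> 1" and w: "\<omega> \<in> space M" and s: "stat \<in> {L2_stat, KS_stat}" and h: "h \<in> BL1"
  shows "mult_expectation M X \<xi> n (\<lambda>x w. h (stat (H_mult D n x w))) \<omega> =
    (LINT w|boot.W n. h (stat (H_mult D n (sample X n \<omega>) w)))"
proof -
  have n0: "0 < n" using n by simp
  have m: "(\<lambda>w. h (stat (H_mult D n (sample X n \<omega>) w))) \<in> borel_measurable (boot.W n)"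
    by (rule measurable_compose[OF boot.stat_H_mult_measurable[OF n0 admissible[OF n w] s] boot.BL1_borel[OF h]])
  show ?thesis unfolding mult_expectation_def
    using integral_distr[OF sample_mult_law(1) m] unfolding sample_mult_law(2) by simp
qed

lemma conditional_law_converges:
  fixes N :: "'v measure"
  assumes s: "stat \<in> {L2_stat, KS_stat}" and B: "copula_brownian_field N C B"
  shows "null_in_prob M (\<lambda>n \<omega>. SUP h\<in>BL1.
    \<bar>mult_expectation M X \<xi> n (\<lambda>x w. h (stat (H_mult D n x w))) \<omega> - (LINT v|N. h (stat (H_limit C B v)))\<bar>)"
  unfolding null_in_prob_def
proof (intro allI impI)
  fix \<epsilon> :: real assume e: "0 < \<epsilon>"
  let ?f = "\<lambda>n \<omega> h. \<bar>mult_expectation M X \<xi> n (\<lambda>x w. h (stat (H_mult D n x w))) \<omega> - (LINT v|N. h (stat (H_limit C B v)))\<bar>"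
  obtain a \<theta> n0 where a: "0 < a" "a < 1 / 2" "0 < \<theta>" "1 \<le> n0"
    and bc: "\<forall>n\<ge>n0. \<forall>x D. regular_sample C \<theta> n x \<longrightarrow> admissible_estimator D n x K \<longrightarrow>
      boot.consistent_at D n x a \<theta> \<longrightarrow> (\<forall>h\<in>BL1. \<bar>(LINT w|boot.W n. h (stat (H_mult D n x w))) - (LINT v|N. h (stat (H_limit C B v)))\<bar> \<le> \<epsilon>)"
    using boot.bootstrap_convergence[OF s B e, of K] by (elim exE conjE) (rule that)
  have "asymp_sure M (\<lambda>n \<omega>. \<bar>SUP h\<in>BL1. ?f n \<omega> h\<bar> \<le> \<epsilon>)"
  proof (rule asymp_sure_mono[OF good_data[OF a(1-3)]])
    fix n \<omega> assume n: "n \<ge> n0" and w: "\<omega> \<in> space M"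
      and g: "regular_sample C \<theta> n (sample X n \<omega>) \<and> boot.consistent_at D n (sample X n \<omega>) a \<theta>"
    have n1: "n \<ge> 1" using n a(4) by simp
    have f: "?f n \<omega> h \<le> \<epsilon>" if "h \<in> BL1" for h
      unfolding mult_expectation_law[OF n1 w s that]
      by (rule bc[rule_format, OF n conjunct1[OF g] admissible[OF n1 w] conjunct2[OF g] that])
    \<comment> \<open>The zero function makes the index set nonempty and shows the supremum to be
      nonnegative, which deals with the outer absolute value.\<close>
    have z: "(\<lambda>_. 0) \<in> BL1" by (simp add: BL1_def)
    have "(SUP h\<in>BL1. ?f n \<omega> h) \<le> \<epsilon>" using z by (intro cSUP_least f) auto
    moreover have "?f n \<omega> (\<lambda>_. 0) \<le> (SUP h\<in>BL1. ?f n \<omega> h)"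
      by (rule cSUP_upper[OF z]) (rule bdd_aboveI2[of _ _ \<epsilon>], rule f)
    then have "0 \<le> (SUP h\<in>BL1. ?f n \<omega> h)" by (rule order_trans[OF abs_ge_zero])
    ultimately show "\<bar>SUP h\<in>BL1. ?f n \<omega> h\<bar> \<le> \<epsilon>" by linarith
  qed
  then show "(\<lambda>n. outer_measure_of M {\<omega>\<in>space M. \<epsilon> < \<bar>SUP h\<in>BL1. ?f n \<omega> h\<bar>}) \<longlonglongrightarrow> 0"
    unfolding asymp_sure_def not_le .
qed

text \<open>Provides the measurable variable for \<open>cond_exp_majorant_gap\<close>. For each of
  the finitely many rank vectors the linear process is measurable in the multipliers, and the rank
  vector is measurable.\<close>

lemma grid_approximation_measurable:
  assumes n: "0 < n" and s: "stat \<in> {L2_stat, KS_stat}"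
  shows "(\<lambda>\<omega>. boot.grid_stat stat m (\<lambda>j. linear_process n (sample X n \<omega>) (sample \<xi> n \<omega>) (grid_point m j))) \<in> borel_measurable M"
proof -
  have R: "(\<lambda>\<omega>. rankize n (sample X n \<omega>)) \<in> measurable M (count_space (range (rankize n)))"
    by (rule rankize_measurable[OF X_borel])
  have rl: "linear_process n x w u = linear_process n (rankize n x) w u" for x w u
    unfolding linear_process_def mult_partial_sum_def by (simp only: emp_copula_rankize[OF n] ranked_below_rankize)
  have l: "(\<lambda>\<omega>. linear_process n (sample X n \<omega>) (sample \<xi> n \<omega>) u) \<in> borel_measurable M" for u
  proof -
    have "(\<lambda>\<omega>. linear_process n \<rho> (sample \<xi> n \<omega>) u) \<in> borel_measurable M" for \<rho>
      unfolding linear_process_sum[OF n]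
      by (intro borel_measurable_sum borel_measurable_times borel_measurable_diff borel_measurable_const
        measurable_compose[OF sample_mult_law(1) boot.coordinate_borel]) auto
    from measurable_compose_countable'[where f = "\<lambda>\<rho> \<omega>. linear_process n \<rho> (sample \<xi> n \<omega>) u", OF this R countable_finite[OF finite_rankize]]
    show ?thesis unfolding rl[symmetric] .
  qed
  have "coord_vec (grid m) (\<lambda>j \<omega>. linear_process n (sample X n \<omega>) (sample \<xi> n \<omega>) (grid_point m j)) \<in> borel_measurable M" (is "coord_vec _ ?Y \<in> _")
  proof (rule measurable_coordinatewise_then_product)
    fix i show "(\<lambda>\<omega>. coord_vec (grid m) ?Y \<omega> i) \<in> borel_measurable M"
      using l by (cases "i \<in> grid m") (auto simp: coord_vec_def)
  qed
  from measurable_compose[OF this borel_measurable_continuous_onI[OF boot.grid_stat_continuous[OF s, of m]]]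
  show ?thesis unfolding boot.grid_stat_coord_vec .
qed

text \<open>The bootstrap statistic may be non-measurable through the estimator, but outside an
  event of small probability it is close to the measurable grid statistic, which narrows the gap
  between majorant and minorant.\<close>

lemma conditional_measurability:
  fixes h :: "real \<Rightarrow> real"
  assumes s: "stat \<in> {L2_stat, KS_stat}" and h: "h \<in> BL1"
  shows "null_in_prob M (\<lambda>n \<omega>.
     real_cond_exp M (generated_algebra M {..<n} X) (majorant M (\<lambda>\<omega>. h (stat (H_mult D n (sample X n \<omega>) (sample \<xi> n \<omega>))))) \<omega> -
     real_cond_exp M (generated_algebra M {..<n} X) (minorant M (\<lambda>\<omega>. h (stat (H_mult D n (sample X n \<omega>) (sample \<xi> n \<omega>))))) \<omega>)"
  unfolding null_in_prob_def
proof (intro allI impI)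
  fix t :: real assume t: "0 < t"
  let ?Y = "\<lambda>n \<omega>. h (stat (H_mult D n (sample X n \<omega>) (sample \<xi> n \<omega>)))"
  let ?d = "\<lambda>n \<omega>. real_cond_exp M (generated_algebra M {..<n} X) (majorant M (?Y n)) \<omega> -
     real_cond_exp M (generated_algebra M {..<n} X) (minorant M (?Y n)) \<omega>"
  have "asymp_sure M (\<lambda>n \<omega>. \<bar>?d n \<omega>\<bar> \<le> t)"
  proof (rule asymp_sure_measurable[OF prob_M])
    fix \<eta> :: real assume eta: "0 < \<eta>"
    \<comment> \<open>Two exceptional events of probability \<open>e\<close> make the bound
      \<open>(2 * e + 4 * (2 * e)) / t\<close>, which is then below \<open>\<eta>\<close>.\<close>
    define e where "e = \<eta> * t / 16"
    have e: "0 < e" using eta t by (simp add: e_def)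
    obtain R \<epsilon> \<delta> \<delta>' a \<theta> n0 m0 where a: "0 < a" "a < 1 / 2" "0 < \<theta>" "1 \<le> n0" "1 \<le> m0"
      and ba: "\<forall>n\<ge>n0. \<forall>x. regular_sample C \<theta> n x \<longrightarrow>
     (\<exists>E\<in>sets (boot.W n). measure (boot.W n) E \<le> e \<and> (\<forall>w\<in>space (boot.W n) - E. good_path C n x w R \<epsilon> \<delta> \<delta>')) \<and>
     (\<forall>D. admissible_estimator D n x K \<longrightarrow> boot.consistent_at D n x a \<theta> \<longrightarrow> (\<forall>w m. good_path C n x w R \<epsilon> \<delta> \<delta>' \<longrightarrow> m0 \<le> m \<longrightarrow>
        \<bar>stat (H_mult D n x w) - boot.grid_stat stat m (\<lambda>j. linear_process n x w (grid_point m j))\<bar> \<le> e))"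
      using boot.bootstrap_approximation[OF s e e, of K] by (elim exE conjE) (rule that)
    note ba1 = ba[rule_format, THEN conjunct1] and ba2 = ba[rule_format, THEN conjunct2, rule_format]
    obtain n1 where n1: "\<forall>n\<ge>n1. \<exists>E\<in>events. prob E \<le> e \<and> (\<forall>\<omega>\<in>space M - E. regular_sample C \<theta> n (sample X n \<omega>) \<and> boot.consistent_at D n (sample X n \<omega>) a \<theta>)"
      using asymp_sureD[OF prob_M good_data[OF a(1-3)] e] by blast
    have "\<exists>A\<in>events. prob A \<le> \<eta> \<and> (\<forall>\<omega>\<in>space M - A. \<bar>?d n \<omega>\<bar> \<le> t)" if n: "n \<ge> max n0 n1" for n
    proof -
      have nn: "n \<ge> n0" "n \<ge> n1" "n \<ge> 1" "0 < n" using n a(4) by auto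
      obtain E1 where E1: "E1 \<in> events" "prob E1 \<le> e"
        "\<forall>\<omega>\<in>space M - E1. regular_sample C \<theta> n (sample X n \<omega>) \<and> boot.consistent_at D n (sample X n \<omega>) a \<theta>"
        using n1[rule_format, OF nn(2)] by (elim bexE conjE) (rule that)
      \<comment> \<open>The exceptional set of multipliers is chosen as a function of the rank
        vector, as \<open>joint_event\<close> requires; for rank vectors of no regular sample the
        empty set is taken.\<close>
      define good where "good \<rho> F \<longleftrightarrow> F \<in> sets (boot.W n) \<and> measure (boot.W n) F \<le> e \<and>
        ((\<exists>x. regular_sample C \<theta> n x \<and> \<rho> = rankize n x) \<longrightarrow> (\<forall>w\<in>space (boot.W n) - F. good_path C n \<rho> w R \<epsilon> \<delta> \<delta>'))" for \<rho> F
      have "\<exists>F. good \<rho> F" for \<rho>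
      proof (cases "\<exists>x. regular_sample C \<theta> n x \<and> \<rho> = rankize n x")
        case True
        then obtain x where x: "regular_sample C \<theta> n x" "\<rho> = rankize n x" by blast
        from ba1[OF nn(1) x(1)] obtain F where "F \<in> sets (boot.W n)" "measure (boot.W n) F \<le> e"
          "\<forall>w\<in>space (boot.W n) - F. good_path C n x w R \<epsilon> \<delta> \<delta>'" by (elim bexE conjE) (rule that)
        then have "good \<rho> F" unfolding good_def x(2) good_path_rankize[OF nn(4)] by blast
        then show ?thesis by blast
      next
        case False
        have "measure (boot.W n) {} \<le> e" using e by simp
        then have "good \<rho> {}" unfolding good_def using False sets.empty_sets by blast
        then show ?thesis by blast
      qed
      then obtain F where F: "\<And>\<rho>. good \<rho> (F \<rho>)" by metis
      have Fs: "F \<rho> \<in> sets (boot.W n)" "measure (boot.W n) (F \<rho>) \<le> e" for \<rho> using F[of \<rho>] unfolding good_def by auto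
      have Ym: "sample \<xi> n \<in> measurable (generated_algebra M UNIV \<xi>) (boot.W n)"
        by (rule boot.sample_measurable) (rule generated_algebra_component, simp)
      define E2 where "E2 = {\<omega>\<in>space M. sample \<xi> n \<omega> \<in> F (rankize n (sample X n \<omega>))}"
      have E2: "E2 \<in> events" "prob E2 \<le> e"
        unfolding E2_def
        using boot.joint_event[OF prob_M nn(4) X_borel mult_indep Ym sample_mult_law Fs] by auto
      let ?E = "E1 \<union> E2"
      have Ee: "?E \<in> events" using E1(1) E2(1) by blast
      have pE: "prob ?E \<le> 2 * e"
        using measure_subadditive[of E1 M E2] E1(1,2) E2 by (simp add: emeasure_eq_measure)
      let ?U = "\<lambda>\<omega>. h (boot.grid_stat stat m0 (\<lambda>j. linear_process n (sample X n \<omega>) (sample \<xi> n \<omega>) (grid_point m0 j)))"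
      have close: "\<bar>?Y n \<omega> - ?U \<omega>\<bar> \<le> e" if w: "\<omega> \<in> space M - ?E" for \<omega>
      proof -
        have ws: "\<omega> \<in> space M" using w by blast
        have r: "regular_sample C \<theta> n (sample X n \<omega>)" "boot.consistent_at D n (sample X n \<omega>) a \<theta>" using E1(3) w by auto
        have "sample \<xi> n \<omega> \<in> space (boot.W n) - F (rankize n (sample X n \<omega>))"
          using w measurable_space[OF sample_mult_law(1) ws] unfolding E2_def by blast
        then have "good_path C n (rankize n (sample X n \<omega>)) (sample \<xi> n \<omega>) R \<epsilon> \<delta> \<delta>'"
          using F[of "rankize n (sample X n \<omega>)"] r(1) unfolding good_def by blast
        then have gp: "good_path C n (sample X n \<omega>) (sample \<xi> n \<omega>) R \<epsilon> \<delta> \<delta>'" unfolding good_path_rankize[OF nn(4)] .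
        have st: "\<bar>stat (H_mult D n (sample X n \<omega>) (sample \<xi> n \<omega>)) - boot.grid_stat stat m0 (\<lambda>j. linear_process n (sample X n \<omega>) (sample \<xi> n \<omega>) (grid_point m0 j))\<bar> \<le> e"
          by (rule ba2[OF nn(1) r(1) admissible[OF nn(3) ws] r(2) gp order_refl])
        show ?thesis by (rule order_trans[OF order_trans[OF boot.BL1_min[OF h] min.cobounded2] st])
      qed
      have Um: "?U \<in> borel_measurable M"
        by (rule measurable_compose[OF grid_approximation_measurable[OF nn(4) s] boot.BL1_borel[OF h]])
      have sub: "subalgebra M (generated_algebra M {..<n} X)" by (rule generated_algebra_subalgebra) (rule X_borel)
      have "\<exists>A\<in>events. prob A \<le> (2 * e + 4 * prob ?E) / t \<and> (\<forall>\<omega>\<in>space M - A. \<bar>?d n \<omega>\<bar> \<le> t)"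
        by (rule cond_exp_majorant_gap[OF sub BL1_D(1)[OF h] Um BL1_D(1)[OF h] Ee close e t])
      then obtain A where A: "A \<in> events" "prob A \<le> (2 * e + 4 * prob ?E) / t" "\<forall>\<omega>\<in>space M - A. \<bar>?d n \<omega>\<bar> \<le> t"
        by (elim bexE conjE) (rule that)
      have "(2 * e + 4 * prob ?E) / t \<le> (2 * e + 4 * (2 * e)) / t" using pE t by (intro divide_right_mono) auto
      also have "\<dots> \<le> \<eta>" using eta t by (simp add: e_def)
      finally show ?thesis using A by (intro bexI[of _ A]) auto
    qed
    then show "\<exists>n0. \<forall>n\<ge>n0. \<exists>A\<in>events. prob A \<le> \<eta> \<and> (\<forall>\<omega>\<in>space M - A. \<bar>?d n \<omega>\<bar> \<le> t)" by blast
  qed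
  then show "(\<lambda>n. outer_measure_of M {\<omega>\<in>space M. t < \<bar>?d n \<omega>\<bar>}) \<longlonglongrightarrow> 0"
    unfolding asymp_sure_def not_le .
qed

lemma conditional_weak_convergence:
  fixes N :: "'v measure"
  assumes s: "stat \<in> {L2_stat, KS_stat}" and B: "copula_brownian_field N C B"
  shows "cond_weak_conv M X \<xi> (\<lambda>n x w. stat (H_mult D n x w)) N (\<lambda>v. stat (H_limit C B v))"
  unfolding cond_weak_conv_def using conditional_law_converges[OF s B] conditional_measurability[OF s] by blast

end

section \<open>Consistency against non-associative copulas\<close>

lemma emp_copula_borel:
  assumes n: "0 < n" shows "emp_copula n x \<in> borel_measurable borel"
proof -
  have eq: "emp_copula n x = (\<lambda>u. (\<Sum>i<n. if real (rank_below n x 1 i) < real n * fst u \<and> real (rank_below n x 2 i) < real n * snd u then 1 else 0) / real n)"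
  proof
    fix u
    have "ranked_below n x u = {..<n} \<inter> {i. real (rank_below n x 1 i) < real n * fst u \<and> real (rank_below n x 2 i) < real n * snd u}"
      by (auto simp: below_def)
    then show "emp_copula n x u = (\<Sum>i<n. if real (rank_below n x 1 i) < real n * fst u \<and> real (rank_below n x 2 i) < real n * snd u then 1 else 0) / real n"
      by (simp add: emp_copula_card[OF n] sum.If_cases)
  qed
  note [measurable] = borel_projections(1,2)
  show ?thesis unfolding eq by measurable
qed

lemma H_emp_measurable:
  assumes n: "0 < n" shows "H_emp n x \<in> borel_measurable cube_measure"
proof -
  note E = emp_copula_borel[OF n] and proj = borel_projections
  have eq: "H_emp n x = (\<lambda>v. sqrt (real n) * (emp_copula n x (fst v, emp_copula n x (snd v)) -
      emp_copula n x (emp_copula n x (fst v, fst (snd v)), snd (snd v))))" by (auto simp: H_emp_def)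
  have c1: "(\<lambda>v :: real \<times> real \<times> real. (fst v, emp_copula n x (snd v))) \<in> borel_measurable borel"
    by (intro borel_measurable_Pair proj measurable_compose[OF proj(4) E])
  have c3: "(\<lambda>v :: real \<times> real \<times> real. (fst v, fst (snd v))) \<in> borel_measurable borel"
    by (intro borel_measurable_Pair proj)
  have c2: "(\<lambda>v :: real \<times> real \<times> real. (emp_copula n x (fst v, fst (snd v)), snd (snd v))) \<in> borel_measurable borel"
    by (intro borel_measurable_Pair proj measurable_compose[OF c3 E])
  have "H_emp n x \<in> borel_measurable borel" unfolding eq
    by (intro borel_measurable_times borel_measurable_diff borel_measurable_const measurable_compose[OF c1 E] measurable_compose[OF c2 E])
  then show ?thesis by (rule borel_measurable_cube)
qed

lemma copula_compose_Lipschitz: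
  assumes C: "is_copula C" and v: "(x, y, z) \<in> unit_cube" "(x', y', z') \<in> unit_cube"
  shows "\<bar>C (x, C (y, z)) - C (x', C (y', z'))\<bar> \<le> \<bar>x - x'\<bar> + \<bar>y - y'\<bar> + \<bar>z - z'\<bar>"
    "\<bar>C (C (x, y), z) - C (C (x', y'), z')\<bar> \<le> \<bar>x - x'\<bar> + \<bar>y - y'\<bar> + \<bar>z - z'\<bar>"
proof -
  have in_sq: "(a, C u) \<in> unit_square" "(C u, a) \<in> unit_square" if "a \<in> {0..1}" "u \<in> unit_square" for a u
    using copula_bounds(1,4)[OF C that(2)] that(1) by (auto simp: unit_square_def)
  have m: "x \<in> {0..1}" "z \<in> {0..1}" "x' \<in> {0..1}" "z' \<in> {0..1}"
    "(y, z) \<in> unit_square" "(y', z') \<in> unit_square" "(x, y) \<in> unit_square" "(x', y') \<in> unit_square"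
    using v by (auto simp: unit_cube_def unit_square_def)
  show "\<bar>C (x, C (y, z)) - C (x', C (y', z'))\<bar> \<le> \<bar>x - x'\<bar> + \<bar>y - y'\<bar> + \<bar>z - z'\<bar>"
    using copula_Lipschitz[OF C in_sq(1)[OF m(1) m(5)] in_sq(1)[OF m(3) m(6)]] copula_Lipschitz[OF C m(5) m(6)] by simp
  show "\<bar>C (C (x, y), z) - C (C (x', y'), z')\<bar> \<le> \<bar>x - x'\<bar> + \<bar>y - y'\<bar> + \<bar>z - z'\<bar>"
    using copula_Lipschitz[OF C in_sq(2)[OF m(2) m(7)] in_sq(2)[OF m(4) m(8)]] copula_Lipschitz[OF C m(7) m(8)] by simp
qed

text \<open>A defect at one point persists on a neighbourhood because compositions of copulas are
  Lipschitz. Positive volume is needed for the integral statistic, nonemptiness for the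
  supremum.\<close>

lemma nonassociative_box:
  assumes C: "is_copula C" and na: "\<not> associative_copula C"
  shows "\<exists>b>0. \<exists>Box\<in>sets cube_measure. 0 < measure cube_measure Box \<and>
    (\<forall>(x, y, z)\<in>Box. b \<le> \<bar>C (x, C (y, z)) - C (C (x, y), z)\<bar>)"
proof -
  obtain x y z where v: "x \<in> {0..1}" "y \<in> {0..1}" "z \<in> {0..1}" "C (x, C (y, z)) \<noteq> C (C (x, y), z)"
    using na unfolding associative_copula_def by blast
  define b where "b = \<bar>C (x, C (y, z)) - C (C (x, y), z)\<bar> / 2"
  have b: "0 < b" using v(4) by (simp add: b_def)
  \<comment> \<open>On a box of half-width \<open>b / 6\<close> each of the two compositions moves
    by at most \<open>b / 2\<close>, so the defect \<open>2 * b\<close> drops to no less than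
    \<open>b\<close>. Clipping to the unit interval leaves sides of positive length.\<close>
  define lo hi where "lo t = max 0 (t - b / 6)" and "hi t = min 1 (t + b / 6)" for t :: real
  have lh: "lo t < hi t" "0 \<le> lo t" "hi t \<le> 1" if "t \<in> {0..1}" for t using b that by (auto simp: lo_def hi_def)
  define Box where "Box = cbox (lo x, lo y, lo z) (hi x, hi y, hi z)"
  have cube: "Box \<subseteq> unit_cube" using lh[OF v(1)] lh[OF v(2)] lh[OF v(3)] by (auto simp: Box_def unit_cube_def cbox_Pair_eq)
  have "Box \<in> sets lebesgue" by (simp add: Box_def)
  then have sets: "Box \<in> sets cube_measure" using cube unit_cube_sets(1) by (simp add: sets_restrict_space_iff)
  have "measure cube_measure Box = measure lebesgue Box"
    using cube unit_cube_sets(1) by (intro measure_restrict_space) auto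
  also have "\<dots> = (hi x - lo x) * ((hi y - lo y) * (hi z - lo z))"
    using lh(1)[OF v(1)] lh(1)[OF v(2)] lh(1)[OF v(3)] by (simp add: Box_def content_Pair)
  also have "0 < \<dots>" using lh(1)[OF v(1)] lh(1)[OF v(2)] lh(1)[OF v(3)] by simp
  finally have pos: "0 < measure cube_measure Box" .
  have "b \<le> \<bar>C (x', C (y', z')) - C (C (x', y'), z')\<bar>" if w: "(x', y', z') \<in> Box" for x' y' z'
  proof -
    have near: "\<bar>t - t'\<bar> \<le> b / 6" if "lo t \<le> t'" "t' \<le> hi t" for t t'
      using that unfolding lo_def hi_def by linarith
    have d: "\<bar>x - x'\<bar> \<le> b / 6" "\<bar>y - y'\<bar> \<le> b / 6" "\<bar>z - z'\<bar> \<le> b / 6"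
      by (rule near; use w in \<open>simp add: Box_def cbox_Pair_eq\<close>)+
    have vc: "(x, y, z) \<in> unit_cube" using v by (simp add: unit_cube_def)
    note L = copula_compose_Lipschitz[OF C vc subsetD[OF cube w]]
    have "\<bar>C (x, C (y, z)) - C (C (x, y), z)\<bar> = 2 * b" by (simp add: b_def)
    then show ?thesis using L d by linarith
  qed
  then show ?thesis using b sets pos by (intro exI[of _ b] conjI bexI[of _ Box]) auto
qed

text \<open>Puts both statistics on one scale: \<open>\<psi>\<close> is the identity for the
  supremum and the square for the integral, and \<open>c\<close> is 1 or the root of the volume of
  the box. The same \<open>\<psi>\<close> bounds from below and above, so statistic and bootstrap
  can be compared inside it.\<close>

lemma stat_scale:
  assumes s: "stat \<in> {L2_stat, KS_stat}" and Box: "Box \<in> sets cube_measure" "0 < measure cube_measure Box"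
  shows "\<exists>c>0. \<exists>\<psi>\<in>{\<lambda>t. t, \<lambda>t :: real. t\<^sup>2}.
    (\<forall>f r R. f \<in> borel_measurable cube_measure \<longrightarrow> (\<forall>v\<in>unit_cube. \<bar>f v\<bar> \<le> R) \<longrightarrow> 0 \<le> r \<longrightarrow> (\<forall>v\<in>Box. r \<le> \<bar>f v\<bar>) \<longrightarrow> \<psi> (c * r) \<le> stat f) \<and>
    (\<forall>f r. f \<in> borel_measurable cube_measure \<longrightarrow> (\<forall>v\<in>unit_cube. \<bar>f v\<bar> \<le> r) \<longrightarrow> stat f \<le> \<psi> r)"
proof -
  interpret cube: prob_space cube_measure by (rule prob_space_cube)
  have sub: "Box \<subseteq> unit_cube" using sets.sets_into_space[OF Box(1)] by simp
  consider "stat = KS_stat" | "stat = L2_stat" using s by blast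
  then show ?thesis
  proof cases
    case 1
    have "Box \<noteq> {}" using Box(2) by auto
    then obtain v where v: "v \<in> Box" by blast
    have "1 * r \<le> stat f" if "\<forall>v\<in>unit_cube. \<bar>f v\<bar> \<le> R" "\<forall>v\<in>Box. r \<le> \<bar>f v\<bar>" for f r R
    proof -
      have "\<bar>f v\<bar> \<le> KS_stat f" by (rule KS_stat_lower[of v f R]) (use v sub that in auto)
      then show ?thesis using that(2) v 1 by fastforce
    qed
    moreover have "stat f \<le> r" if "\<forall>v\<in>unit_cube. \<bar>f v\<bar> \<le> r" for f r
      unfolding 1 by (rule KS_stat_upper) (use that in auto)
    ultimately show ?thesis by (intro exI[of _ 1] conjI bexI[of _ "\<lambda>t. t"]) auto
  next
    case 2
    let ?m = "measure cube_measure Box"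
    have "(sqrt ?m * r)\<^sup>2 \<le> stat f"
      if f: "f \<in> borel_measurable cube_measure" "\<forall>v\<in>unit_cube. \<bar>f v\<bar> \<le> R" and r: "0 \<le> r" "\<forall>v\<in>Box. r \<le> \<bar>f v\<bar>" for f r R
    proof -
      have i: "integrable cube_measure (indicat_real Box)"
        by (rule cube.integrable_const_bound[of _ 1]) (use Box(1) in auto)
      have "(sqrt ?m * r)\<^sup>2 = (LINT v|cube_measure. r\<^sup>2 * indicat_real Box v)"
        using Box sub by (simp add: power_mult_distrib Int_absorb2)
      also have "\<dots> \<le> (LINT v|cube_measure. (f v)\<^sup>2)"
      proof (rule integral_mono)
        show "integrable cube_measure (\<lambda>v. (f v)\<^sup>2)" using L2_stat_integrable[OF f(1)] f(2) by blast
        fix v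
        show "r\<^sup>2 * indicat_real Box v \<le> (f v)\<^sup>2"
        proof (cases "v \<in> Box")
          case True
          have "r\<^sup>2 \<le> \<bar>f v\<bar>\<^sup>2" by (rule power_mono) (use r True in auto)
          then show ?thesis using True by simp
        qed simp
      qed (use i in simp)
      finally show ?thesis by (simp add: 2 L2_stat_def)
    qed
    moreover have "stat f \<le> r\<^sup>2" if f: "f \<in> borel_measurable cube_measure" "\<forall>v\<in>unit_cube. \<bar>f v\<bar> \<le> r" for f r
    proof -
      have "(LINT v|cube_measure. (f v)\<^sup>2) \<le> (LINT v|cube_measure. r\<^sup>2)"
      proof (rule integral_mono)
        show "integrable cube_measure (\<lambda>v. (f v)\<^sup>2)" using L2_stat_integrable[OF f(1)] f(2) by blast
        fix v assume "v \<in> space cube_measure"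
        then have "\<bar>f v\<bar> \<le> r" using f(2) by simp
        then have "\<bar>f v\<bar>\<^sup>2 \<le> r\<^sup>2" by (rule power_mono) simp
        then show "(f v)\<^sup>2 \<le> r\<^sup>2" by simp
      qed simp
      then show ?thesis using cube.prob_space by (simp add: 2 L2_stat_def)
    qed
    ultimately show ?thesis using Box(2) by (intro exI[of _ "sqrt ?m"] conjI bexI[of _ "\<lambda>t. t\<^sup>2"]) auto
  qed
qed

text \<open>Each composition is off by \<open>2 * \<theta>\<close>: one \<open>\<theta>\<close> for
  the outer empirical copula, another for the inner one through the Lipschitz bound. Two
  compositions give \<open>4 * \<theta>\<close>.\<close>

lemma H_emp_lower:
  assumes C: "is_copula C" and n: "0 < n" and r: "regular_sample C \<theta> n x" and v: "(a, b, c) \<in> unit_cube"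
    and B: "B + 4 * \<theta> \<le> \<bar>C (a, C (b, c)) - C (C (a, b), c)\<bar>"
  shows "B * sqrt (real n) \<le> \<bar>H_emp n x (a, b, c)\<bar>"
proof -
  let ?E = "emp_copula n x"
  have e01: "?E u \<in> {0..1}" for u using emp_copula_bounds[OF n] by simp
  have close: "\<bar>?E u - C u\<bar> \<le> \<theta>" if "u \<in> unit_square" for u using r that unfolding regular_sample_def by blast
  have m: "a \<in> {0..1}" "c \<in> {0..1}" "(b, c) \<in> unit_square" "(a, b) \<in> unit_square"
    using v by (auto simp: unit_cube_def unit_square_def)
  have c01: "C u \<in> {0..1}" if "u \<in> unit_square" for u using copula_bounds(1,4)[OF C that] by simp
  have s: "(a, ?E (b, c)) \<in> unit_square" "(?E (a, b), c) \<in> unit_square" "(a, C (b, c)) \<in> unit_square" "(C (a, b), c) \<in> unit_square"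
    using m e01[of "(b, c)"] e01[of "(a, b)"] c01[OF m(3)] c01[OF m(4)] unfolding unit_square_def by blast+
  have 1: "\<bar>?E (a, ?E (b, c)) - C (a, C (b, c))\<bar> \<le> 2 * \<theta>"
    using close[OF s(1)] copula_Lipschitz[OF C s(1) s(3)] close[OF m(3)] by simp
  have 2: "\<bar>?E (?E (a, b), c) - C (C (a, b), c)\<bar> \<le> 2 * \<theta>"
    using close[OF s(2)] copula_Lipschitz[OF C s(2) s(4)] close[OF m(4)] by simp
  let ?A = "?E (a, ?E (b, c)) - ?E (?E (a, b), c)"
  have H: "\<bar>H_emp n x (a, b, c)\<bar> = \<bar>?A\<bar> * sqrt (real n)" by (simp add: H_emp_def abs_mult)
  have "B \<le> \<bar>?A\<bar>" using 1 2 B by linarith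
  then show ?thesis unfolding H by (intro mult_right_mono) auto
qed

lemma H_emp_bounded:
  assumes n: "0 < n" shows "\<bar>H_emp n x v\<bar> \<le> 2 * sqrt (real n)"
proof (cases v)
  case (fields a b c)
  let ?E = "emp_copula n x"
  have e: "0 \<le> ?E u" "?E u \<le> 1" for u using emp_copula_bounds[OF n] by auto
  have H: "\<bar>H_emp n x (a, b, c)\<bar> = \<bar>?E (a, ?E (b, c)) - ?E (?E (a, b), c)\<bar> * sqrt (real n)" by (simp add: H_emp_def abs_mult)
  have "\<bar>?E (a, ?E (b, c)) - ?E (?E (a, b), c)\<bar> \<le> 2"
    using e[of "(a, ?E (b, c))"] e[of "(?E (a, b), c)"] by (simp add: abs_le_iff)
  then show ?thesis unfolding H fields by (intro mult_right_mono) auto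
qed

text \<open>The empirical distribution function is 1 at the maximum, so a quantile of any level up
  to 1 is at most the maximum.\<close>

lemma emp_quantile_less:
  assumes "1 \<le> B" "q \<le> 1" "\<And>b. b < B \<Longrightarrow> T b < t"
  shows "emp_quantile B T q < ereal t"
proof -
  define m where "m = Max (T ` {..<B})"
  have ne: "T ` {..<B} \<noteq> {}" using assms(1) by (auto simp: lessThan_empty_iff)
  have "T b \<le> m" if "b < B" for b unfolding m_def using that by (intro Max_ge) auto
  then have "(\<Sum>b<B. of_bool (T b \<le> m)) = (\<Sum>b<B. 1 :: real)" by (intro sum.cong) auto
  then have "q \<le> (\<Sum>b<B. of_bool (T b \<le> m)) / real B" using assms(1,2) by simp
  then have "emp_quantile B T q \<le> ereal m" unfolding emp_quantile_def gen_inv_def by (intro Inf_lower) blast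
  moreover have "m < t" unfolding m_def using ne assms(3) by (subst Max_less_iff) auto
  ultimately show ?thesis by (simp add: order_le_less_trans)
qed

lemma inner_measure_tendsto_1:
  assumes M: "prob_space M" and P: "asymp_sure M P"
  shows "(\<lambda>n. inner_measure_of M {\<omega>\<in>space M. P n \<omega>}) \<longlonglongrightarrow> 1"
proof (rule order_tendstoI)
  interpret prob_space M by fact
  fix a :: ennreal
  { assume "1 < a"
    moreover have "inner_measure_of M {\<omega>\<in>space M. P n \<omega>} \<le> 1" for n
      unfolding inner_measure_of_def by (intro SUP_least) (simp add: emeasure_le_1)
    ultimately show "\<forall>\<^sub>F n in sequentially. inner_measure_of M {\<omega>\<in>space M. P n \<omega>} < a"
      by (intro always_eventually allI) (rule order_le_less_trans)
  }
  assume a: "a < 1"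
  then obtain r where r: "a = ennreal r" "0 \<le> r" "r < 1"
    by (cases a) (auto simp: ennreal_less_one_iff)
  obtain n0 where n0: "\<And>n. n \<ge> n0 \<Longrightarrow> \<exists>E\<in>events. prob E \<le> (1 - r) / 2 \<and> (\<forall>\<omega>\<in>space M - E. P n \<omega>)"
    using asymp_sureD[OF M P, of "(1 - r) / 2"] r(3) by auto
  have "a < inner_measure_of M {\<omega>\<in>space M. P n \<omega>}" if n: "n \<ge> n0" for n
  proof -
    obtain E where E: "E \<in> events" "prob E \<le> (1 - r) / 2" "\<forall>\<omega>\<in>space M - E. P n \<omega>" using n0[OF n] by blast
    have "r < prob (space M - E)" using E(1,2) r(3) by (simp add: prob_compl)
    then have "a < emeasure M (space M - E)" using r by (simp add: emeasure_eq_measure ennreal_less_iff)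
    also have "\<dots> \<le> inner_measure_of M {\<omega>\<in>space M. P n \<omega>}"
      unfolding inner_measure_of_def using E(1,3) by (intro SUP_upper) auto
    finally show ?thesis .
  qed
  then show "\<forall>\<^sub>F n in sequentially. a < inner_measure_of M {\<omega>\<in>space M. P n \<omega>}" by (rule eventually_sequentiallyI)
qed

context bootstrap_test
begin

lemma H_emp_stat_lower:
  assumes s: "stat \<in> {L2_stat, KS_stat}" and na: "\<not> associative_copula C"
  shows "\<exists>c>0. \<exists>\<theta>>0. \<exists>\<psi>\<in>{\<lambda>t. t, \<lambda>t :: real. t\<^sup>2}.
    (\<forall>n\<ge>1. \<forall>x. regular_sample C \<theta> n x \<longrightarrow> \<psi> (c * sqrt (real n)) \<le> stat (H_emp n x)) \<and>
    (\<forall>f r. f \<in> borel_measurable cube_measure \<longrightarrow> (\<forall>v\<in>unit_cube. \<bar>f v\<bar> \<le> r) \<longrightarrow> stat f \<le> \<psi> r)"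
proof -
  obtain b Box where b: "0 < b" and Box: "Box \<in> sets cube_measure" "0 < measure cube_measure Box"
    and Bb: "\<forall>(x, y, z)\<in>Box. b \<le> \<bar>C (x, C (y, z)) - C (C (x, y), z)\<bar>"
    using nonassociative_box[OF copula_C na] by (elim exE bexE conjE) (rule that)
  obtain c \<psi> where c: "0 < c" "\<psi> \<in> {\<lambda>t. t, \<lambda>t :: real. t\<^sup>2}"
    and lo: "\<forall>f r R. f \<in> borel_measurable cube_measure \<longrightarrow> (\<forall>v\<in>unit_cube. \<bar>f v\<bar> \<le> R) \<longrightarrow> 0 \<le> r \<longrightarrow> (\<forall>v\<in>Box. r \<le> \<bar>f v\<bar>) \<longrightarrow> \<psi> (c * r) \<le> stat f"
    and up: "\<forall>f r. f \<in> borel_measurable cube_measure \<longrightarrow> (\<forall>v\<in>unit_cube. \<bar>f v\<bar> \<le> r) \<longrightarrow> stat f \<le> \<psi> r"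
    using stat_scale[OF s Box] by (elim exE bexE conjE) (rule that)
  have sub: "Box \<subseteq> unit_cube" using sets.sets_into_space[OF Box(1)] by simp
  \<comment> \<open>With tolerance \<open>b / 8\<close> the loss of four times the tolerance is
    \<open>b / 2\<close>, so half of the defect on the box remains.\<close>
  have "\<psi> (c * b / 2 * sqrt (real n)) \<le> stat (H_emp n x)" if n: "n \<ge> 1" and r: "regular_sample C (b / 8) n x" for n x
  proof -
    have n0: "0 < n" using n by simp
    have "b / 2 * sqrt (real n) \<le> \<bar>H_emp n x v\<bar>" if v: "v \<in> Box" for v
    proof (cases v)
      case (fields x1 x2 x3)
      have "b / 2 + 4 * (b / 8) \<le> \<bar>C (x1, C (x2, x3)) - C (C (x1, x2), x3)\<bar>" using Bb v unfolding fields by auto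
      then show ?thesis using H_emp_lower[OF copula_C n0 r] v sub unfolding fields by blast
    qed
    then have "\<psi> (c * (b / 2 * sqrt (real n))) \<le> stat (H_emp n x)"
      by (intro lo[rule_format, OF H_emp_measurable[OF n0] H_emp_bounded[OF n0]]) (use b in simp)
    then show ?thesis by (simp add: mult.assoc)
  qed
  then show ?thesis using c b up by (intro exI[of _ "c * b / 2"] conjI exI[of _ "b / 8"] bexI[of _ \<psi>]) auto
qed

lemma statistic_diverges:
  assumes s: "stat \<in> {L2_stat, KS_stat}" and na: "\<not> associative_copula C"
  shows "infinite_in_prob M (\<lambda>n \<omega>. stat (H_emp n (sample X n \<omega>)))"
  unfolding infinite_in_prob_def
proof
  fix t :: real
  obtain c \<theta> \<psi> where c: "0 < c" "0 < \<theta>" "\<psi> \<in> {\<lambda>t. t, \<lambda>t :: real. t\<^sup>2}"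
    and lo: "\<forall>n\<ge>1. \<forall>x. regular_sample C \<theta> n x \<longrightarrow> \<psi> (c * sqrt (real n)) \<le> stat (H_emp n x)"
    using H_emp_stat_lower[OF s na] by (elim exE bexE conjE) (rule that)
  \<comment> \<open>Makes \<open>c * sqrt (real n)\<close> exceed both 1 and \<open>t\<close>;
    squaring does not decrease a number above 1, so the choice suits both forms of
    \<open>\<psi>\<close>.\<close>
  obtain n0 :: nat where n0: "((max 1 t + 1) / c)\<^sup>2 \<le> real n0" using real_arch_simple by blast
  have "asymp_sure M (\<lambda>n \<omega>. t < stat (H_emp n (sample X n \<omega>)))"
  proof (rule asymp_sure_mono[OF regular_sample_asymp_sure[OF c(2)]])
    fix n \<omega> assume n: "n \<ge> max 1 n0" and r: "regular_sample C \<theta> n (sample X n \<omega>)"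
    have "(max 1 t + 1) / c \<le> sqrt (real n)" using n0 n by (intro real_le_rsqrt) linarith
    then have "max 1 t + 1 \<le> c * sqrt (real n)" using c(1) by (simp add: pos_divide_le_eq mult.commute)
    then have 1: "1 \<le> c * sqrt (real n)" "t < c * sqrt (real n)" by auto
    have "t < \<psi> (c * sqrt (real n))"
    proof (cases "\<psi> = (\<lambda>t. t)")
      case False
      then have "\<psi> = (\<lambda>t. t\<^sup>2)" using c(3) by blast
      moreover have "c * sqrt (real n) * 1 \<le> c * sqrt (real n) * (c * sqrt (real n))" using 1 by (intro mult_left_mono) auto
      ultimately show ?thesis using 1 by (simp add: power2_eq_square)
    qed (use 1 in simp)
    also have "\<dots> \<le> stat (H_emp n (sample X n \<omega>))" by (rule lo[rule_format, OF _ r]) (use n in simp)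
    finally show "t < stat (H_emp n (sample X n \<omega>))" .
  qed
  then show "(\<lambda>n. outer_measure_of M {\<omega>\<in>space M. stat (H_emp n (sample X n \<omega>)) \<le> t}) \<longlonglongrightarrow> 0"
    unfolding asymp_sure_def not_less .
qed

lemma copies_law:
  assumes cp: "multiplier_copies M X \<xi> B \<Xi>" and b: "b < B"
  shows "sample (\<Xi> b) n \<in> measurable M (boot.W n)" "distr M (boot.W n) (sample (\<Xi> b) n) = boot.W n"
    "sample (\<Xi> b) n \<in> measurable (generated_algebra M ({..<B} \<times> UNIV) (\<lambda>(b, i). \<Xi> b i)) (boot.W n)"
proof -
  have iv: "indep_vars (\<lambda>_. borel) (\<lambda>(b, i). \<Xi> b i) ({..<B} \<times> UNIV)" using cp by (simp add: multiplier_copies_def iid_def)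
  have "indep_vars (\<lambda>i. PiM {(b, i)} (\<lambda>_. borel)) (\<lambda>i \<omega>. \<lambda>k\<in>{(b, i)}. (\<lambda>(b, i). \<Xi> b i) k \<omega>) {..<n}"
    by (rule indep_vars_restrict[OF iv]) (use b in \<open>auto simp: disjoint_family_on_def\<close>)
  from indep_vars_compose2[OF this, where Y = "\<lambda>i f. f (b, i)" and N = "\<lambda>_. borel"]
  have ind: "indep_vars (\<lambda>_. borel) (\<Xi> b) {..<n}" by (simp add: measurable_component_singleton)
  have law: "distr M borel (\<Xi> b i) = distr M borel (\<xi> 0)" for i using cp b by (simp add: multiplier_copies_def)
  show "sample (\<Xi> b) n \<in> measurable M (boot.W n)" "distr M (boot.W n) (sample (\<Xi> b) n) = boot.W n"
    using boot.sample_law[OF prob_M ind law] by auto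
  show "sample (\<Xi> b) n \<in> measurable (generated_algebra M ({..<B} \<times> UNIV) (\<lambda>(b, i). \<Xi> b i)) (boot.W n)"
  proof (rule boot.sample_measurable)
    fix i show "\<Xi> b i \<in> borel_measurable (generated_algebra M ({..<B} \<times> UNIV) (\<lambda>(b, i). \<Xi> b i))"
      using generated_algebra_component[of "(b, i)" "{..<B} \<times> UNIV" "\<lambda>(b, i). \<Xi> b i" M] b by simp
  qed
qed

text \<open>The fixed-sample bound is transferred by choosing the exceptional set from the rank
  vector. Independence of the data from the whole array of copies covers each single copy.\<close>

lemma copies_bounded:
  assumes cp: "multiplier_copies M X \<xi> B \<Xi>" and b: "b < B" and t: "0 < t" and n: "0 < n" and big: "18 * t \<le> sqrt (real n)"
  shows "\<exists>E\<in>events. prob E \<le> 9 / t\<^sup>2 \<and> (\<forall>\<omega>\<in>space M - E. \<forall>u\<in>unit_square. \<bar>mult_process n (sample X n \<omega>) (sample (\<Xi> b) n \<omega>) u\<bar> \<le> 36 * t)"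
proof -
  have "\<forall>\<rho>. \<exists>E. E \<in> sets (boot.W n) \<and> measure (boot.W n) E \<le> 9 / t\<^sup>2 \<and> (\<forall>w\<in>space (boot.W n) - E. \<forall>u\<in>unit_square. \<bar>mult_process n \<rho> w u\<bar> \<le> 36 * t)"
  proof
    fix \<rho>
    obtain E where "E \<in> sets (boot.W n)" "measure (boot.W n) E \<le> 9 / t\<^sup>2"
      "\<forall>w\<in>space (boot.W n) - E. mean n w \<noteq> 0 \<and> (\<forall>u\<in>unit_square. \<bar>mult_process n \<rho> w u\<bar> \<le> 36 * t)"
      using boot.mult_process_bounded[OF t n big, of \<rho>] by (elim bexE conjE) (rule that)
    then show "\<exists>E. E \<in> sets (boot.W n) \<and> measure (boot.W n) E \<le> 9 / t\<^sup>2 \<and> (\<forall>w\<in>space (boot.W n) - E. \<forall>u\<in>unit_square. \<bar>mult_process n \<rho> w u\<bar> \<le> 36 * t)"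
      by (intro exI[of _ E]) simp
  qed
  then obtain F where F: "\<forall>\<rho>. F \<rho> \<in> sets (boot.W n) \<and> measure (boot.W n) (F \<rho>) \<le> 9 / t\<^sup>2 \<and>
    (\<forall>w\<in>space (boot.W n) - F \<rho>. \<forall>u\<in>unit_square. \<bar>mult_process n \<rho> w u\<bar> \<le> 36 * t)" by (rule choice[THEN exE])
  have Fs: "F \<rho> \<in> sets (boot.W n)" "measure (boot.W n) (F \<rho>) \<le> 9 / t\<^sup>2" for \<rho> using F by auto
  define E where "E = {\<omega>\<in>space M. sample (\<Xi> b) n \<omega> \<in> F (rankize n (sample X n \<omega>))}"
  have indep: "independent_families M UNIV X ({..<B} \<times> UNIV) (\<lambda>(b, i). \<Xi> b i)" using cp by (simp add: multiplier_copies_def)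
  have E: "E \<in> events" "prob E \<le> 9 / t\<^sup>2"
    unfolding E_def using boot.joint_event[OF prob_M n X_borel indep copies_law(3)[OF cp b] copies_law(1,2)[OF cp b] Fs] by auto
  have "\<bar>mult_process n (sample X n \<omega>) (sample (\<Xi> b) n \<omega>) u\<bar> \<le> 36 * t" if w: "\<omega> \<in> space M - E" and u: "u \<in> unit_square" for \<omega> u
  proof -
    have "sample (\<Xi> b) n \<omega> \<in> space (boot.W n) - F (rankize n (sample X n \<omega>))"
      using w measurable_space[OF copies_law(1)[OF cp b], of \<omega>] unfolding E_def by blast
    then have "\<bar>mult_process n (rankize n (sample X n \<omega>)) (sample (\<Xi> b) n \<omega>) u\<bar> \<le> 36 * t" using F u by blast
    then show ?thesis unfolding mult_process_rankize[OF n] .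
  qed
  then show ?thesis using E by (intro bexI[of _ E]) auto
qed

text \<open>With probability tending to 1 all \<open>B\<close> bootstrap statistics lie below the
  test statistic, hence so does their quantile. The test statistic is at least \<open>\<psi>\<close>
  at \<open>c * sqrt (real n)\<close>, each copy at most \<open>\<psi>\<close> at a smaller multiple
  of \<open>sqrt (real n)\<close>.\<close>

lemma test_consistent:
  assumes s: "stat \<in> {L2_stat, KS_stat}" and na: "\<not> associative_copula C"
    and \<alpha>: "0 < \<alpha>" and B: "B \<ge> 1" and cp: "multiplier_copies M X \<xi> B \<Xi>"
  shows "(\<lambda>n. inner_measure_of M {\<omega> \<in> space M.
             emp_quantile B (\<lambda>b. stat (H_mult D n (sample X n \<omega>) (sample (\<Xi> b) n \<omega>))) (1 - \<alpha>)
               < ereal (stat (H_emp n (sample X n \<omega>)))}) \<longlonglongrightarrow> 1"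
proof (rule inner_measure_tendsto_1[OF prob_M])
  obtain c \<theta> \<psi> where c: "0 < c" "0 < \<theta>" "\<psi> \<in> {\<lambda>t. t, \<lambda>t :: real. t\<^sup>2}"
    and lo: "\<forall>n\<ge>1. \<forall>x. regular_sample C \<theta> n x \<longrightarrow> \<psi> (c * sqrt (real n)) \<le> stat (H_emp n x)"
    and up: "\<forall>f r. f \<in> borel_measurable cube_measure \<longrightarrow> (\<forall>v\<in>unit_cube. \<bar>f v\<bar> \<le> r) \<longrightarrow> stat f \<le> \<psi> r"
    using H_emp_stat_lower[OF s na] by (elim exE bexE conjE) (rule that)
  \<comment> \<open>The factor between the level \<open>t\<close> in
    \<open>mult_process_bounded\<close> and the resulting bound on \<open>H_mult\<close>.\<close>
  define k where "k = 12 * (max 1 K)\<^sup>2 * 36"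
  have k: "0 < k" by (simp add: k_def)
  \<comment> \<open>Applying the path bound at level \<open>\<tau> * sqrt (real n)\<close> makes the
    failure probability of order \<open>1 / real n\<close>. The first term meets the growth
    condition of that bound, the second keeps \<open>k * \<tau>\<close> below
    \<open>c\<close>.\<close>
  define \<tau> where "\<tau> = min (1 / 18) (c / (2 * k))"
  have tau: "0 < \<tau>" "18 * \<tau> \<le> 1" "k * \<tau> < c"
  proof -
    show "0 < \<tau>" using c k by (simp add: \<tau>_def)
    show "18 * \<tau> \<le> 1" by (simp add: \<tau>_def)
    have "k * \<tau> \<le> k * (c / (2 * k))" using k by (intro mult_left_mono) (auto simp: \<tau>_def)
    also have "\<dots> < c" using k c by simp
    finally show "k * \<tau> < c" .
  qed
  let ?T = "\<lambda>n \<omega> b. stat (H_mult D n (sample X n \<omega>) (sample (\<Xi> b) n \<omega>))"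
  have small: "asymp_sure M (\<lambda>n \<omega>. \<forall>b<B. \<forall>u\<in>unit_square. \<bar>mult_process n (sample X n \<omega>) (sample (\<Xi> b) n \<omega>) u\<bar> \<le> 36 * (\<tau> * sqrt (real n)))"
  proof (rule asymp_sure_measurable[OF prob_M])
    fix \<epsilon> :: real assume e: "0 < \<epsilon>"
    obtain n0 :: nat where n0: "real B * 9 / (\<epsilon> * \<tau>\<^sup>2) \<le> real n0" using real_arch_simple by blast
    have "\<exists>E\<in>events. prob E \<le> \<epsilon> \<and> (\<forall>\<omega>\<in>space M - E. \<forall>b<B. \<forall>u\<in>unit_square. \<bar>mult_process n (sample X n \<omega>) (sample (\<Xi> b) n \<omega>) u\<bar> \<le> 36 * (\<tau> * sqrt (real n)))"
      if n: "n \<ge> max 1 n0" for n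
    proof -
      have n1: "0 < n" using n by simp
      have t: "0 < \<tau> * sqrt (real n)" using tau n1 by simp
      have big: "18 * (\<tau> * sqrt (real n)) \<le> sqrt (real n)"
        using mult_right_mono[OF tau(2), of "sqrt (real n)"] by (simp add: mult.assoc)
      have "\<forall>b\<in>{..<B}. \<exists>E. E \<in> events \<and> prob E \<le> 9 / (\<tau> * sqrt (real n))\<^sup>2 \<and>
        (\<forall>\<omega>\<in>space M - E. \<forall>u\<in>unit_square. \<bar>mult_process n (sample X n \<omega>) (sample (\<Xi> b) n \<omega>) u\<bar> \<le> 36 * (\<tau> * sqrt (real n)))"
        using copies_bounded[OF cp _ t n1 big] by blast
      then obtain E where E: "\<forall>b\<in>{..<B}. E b \<in> events \<and> prob (E b) \<le> 9 / (\<tau> * sqrt (real n))\<^sup>2 \<and>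
        (\<forall>\<omega>\<in>space M - E b. \<forall>u\<in>unit_square. \<bar>mult_process n (sample X n \<omega>) (sample (\<Xi> b) n \<omega>) u\<bar> \<le> 36 * (\<tau> * sqrt (real n)))"
        by (rule bchoice[THEN exE])
      let ?U = "\<Union>b\<in>{..<B}. E b"
      have Um: "?U \<in> events" using E by (intro sets.finite_UN) auto
      have "prob ?U \<le> (\<Sum>b<B. prob (E b))" by (rule finite_measure_subadditive_finite) (use E in auto)
      also have "\<dots> \<le> (\<Sum>b<B. 9 / (\<tau> * sqrt (real n))\<^sup>2)" by (rule sum_mono) (use E in auto)
      also have "\<dots> = real B * 9 / (\<tau>\<^sup>2 * real n)" by (simp add: power_mult_distrib)
      also have "\<dots> \<le> \<epsilon>"
      proof -
        have "real B * 9 / (\<epsilon> * \<tau>\<^sup>2) \<le> real n" using n0 n by linarith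
        then show ?thesis using e tau(1) n1 by (simp add: field_simps)
      qed
      finally show ?thesis using Um E by (intro bexI[of _ ?U]) auto
    qed
    then show "\<exists>n0. \<forall>n\<ge>n0. \<exists>E\<in>events. prob E \<le> \<epsilon> \<and>
      (\<forall>\<omega>\<in>space M - E. \<forall>b<B. \<forall>u\<in>unit_square. \<bar>mult_process n (sample X n \<omega>) (sample (\<Xi> b) n \<omega>) u\<bar> \<le> 36 * (\<tau> * sqrt (real n)))" by blast
  qed
  show "asymp_sure M (\<lambda>n \<omega>. emp_quantile B (?T n \<omega>) (1 - \<alpha>) < ereal (stat (H_emp n (sample X n \<omega>))))"
  proof (rule asymp_sure_mono[OF asymp_sure_conj[OF regular_sample_asymp_sure[OF c(2)] small]])
    fix n \<omega> assume n: "n \<ge> 1" and w: "\<omega> \<in> space M"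
      and g: "regular_sample C \<theta> n (sample X n \<omega>) \<and> (\<forall>b<B. \<forall>u\<in>unit_square. \<bar>mult_process n (sample X n \<omega>) (sample (\<Xi> b) n \<omega>) u\<bar> \<le> 36 * (\<tau> * sqrt (real n)))"
    have n0: "0 < n" using n by simp
    have less: "k * \<tau> * sqrt (real n) < c * sqrt (real n)" "0 \<le> k * \<tau> * sqrt (real n)" using tau k n0 by auto
    have psi: "\<psi> (k * \<tau> * sqrt (real n)) < \<psi> (c * sqrt (real n))"
    proof (cases "\<psi> = (\<lambda>t. t)")
      case False
      then have "\<psi> = (\<lambda>t. t\<^sup>2)" using c(3) by blast
      then show ?thesis using power_strict_mono[OF less, of 2] by simp
    qed (use less in simp)
    show "emp_quantile B (?T n \<omega>) (1 - \<alpha>) < ereal (stat (H_emp n (sample X n \<omega>)))"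
    proof (rule emp_quantile_less[OF B])
      fix b assume b: "b < B"
      have "\<bar>H_mult D n (sample X n \<omega>) (sample (\<Xi> b) n \<omega>) v\<bar> \<le> k * \<tau> * sqrt (real n)" if "v \<in> unit_cube" for v
      proof -
        have "\<bar>H_mult D n (sample X n \<omega>) (sample (\<Xi> b) n \<omega>) v\<bar> \<le> 12 * (max 1 K)\<^sup>2 * (36 * (\<tau> * sqrt (real n)))"
          by (rule H_mult_bound[OF n0 admissible[OF n w] _ that]) (use g b in blast)
        then show ?thesis by (simp add: k_def mult.assoc)
      qed
      then have "?T n \<omega> b \<le> \<psi> (k * \<tau> * sqrt (real n))" using up estimator_measurable[OF n w] by blast
      also note psi
      also have "\<psi> (c * sqrt (real n)) \<le> stat (H_emp n (sample X n \<omega>))" by (rule lo[rule_format, OF n conjunct1[OF g]])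
      finally show "?T n \<omega> b < stat (H_emp n (sample X n \<omega>))" .
    qed (use \<alpha> in simp)
  qed
qed

end

theorem mainTheorem4:
  fixes M :: "'w measure"
    and X :: "nat \<Rightarrow> 'w \<Rightarrow> real \<times> real"
    and C :: "real \<times> real \<Rightarrow> real"
    and D :: "nat \<Rightarrow> (nat \<Rightarrow> real \<times> real) \<Rightarrow> nat \<Rightarrow> real \<times> real \<Rightarrow> real"
    and K :: real
    and \<xi> :: "nat \<Rightarrow> 'w \<Rightarrow> real"
  assumes "prob_space M"
    and data_iid: "iid M UNIV X"
    and cont_F: "continuous_on UNIV (joint_df M (X 0))"
    and cont_margins: "\<And>p. p \<in> {1, 2} \<Longrightarrow> continuous_on UNIV (marginal_df M (X 0) p)"
    and copula: "is_copula_of M (X 0) C"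
    and partial_exists: "\<And>p u. p \<in> {1, 2} \<Longrightarrow> u \<in> strip p \<Longrightarrow>
      (\<lambda>t. C (replace_coord p t u)) field_differentiable (at (coord p u))"
    and partial_continuous: "\<And>p. p \<in> {1, 2} \<Longrightarrow> continuous_on (strip p) (dotC C p)"
    and estimator_bounded: "\<And>p n \<omega> u. p \<in> {1, 2} \<Longrightarrow> n \<ge> 1 \<Longrightarrow> \<omega> \<in> space M \<Longrightarrow> u \<in> unit_square \<Longrightarrow>
      \<bar>D n (sample X n \<omega>) p u\<bar> \<le> K"
    and estimator_consistent: "\<And>p \<delta>. p \<in> {1, 2} \<Longrightarrow> 0 < \<delta> \<Longrightarrow> \<delta> < 1 / 2 \<Longrightarrow>
      null_in_prob M (\<lambda>n \<omega>. SUP u\<in>{u \<in> unit_square. \<delta> \<le> coord p u \<and> coord p u \<le> 1 - \<delta>}.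
        \<bar>D n (sample X n \<omega>) p u - dotC C p u\<bar>)"
    and estimator_measurable: "\<And>n \<omega> w. n \<ge> 1 \<Longrightarrow> \<omega> \<in> space M \<Longrightarrow>
      H_mult D n (sample X n \<omega>) w \<in> borel_measurable (lebesgue_on unit_cube)"
    and mult_iid: "iid M UNIV \<xi>"
    and mult_indep: "independent_families M UNIV X UNIV \<xi>"
    and mult_mean: "integrable M (\<xi> 0)" "integral\<^sup>L M (\<xi> 0) = 1"
    and mult_variance: "integrable M (\<lambda>\<omega>. (\<xi> 0 \<omega>)\<^sup>2)" "prob_space.variance M (\<xi> 0) = 1"
    and mult_tail: "set_integrable lborel {0..} (\<lambda>x. sqrt (measure M {\<omega> \<in> space M. x < \<bar>\<xi> 0 \<omega>\<bar>}))"
  shows "\<forall>stat\<in>{L2_stat, KS_stat}.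
    (\<forall>(N :: 'v measure) B. copula_brownian_field N C B \<longrightarrow>
       cond_weak_conv M X \<xi> (\<lambda>n x w. stat (H_mult D n x w)) N (\<lambda>v. stat (H_limit C B v))) \<and>
    (\<not> associative_copula C \<longrightarrow>
       infinite_in_prob M (\<lambda>n \<omega>. stat (H_emp n (sample X n \<omega>))) \<and>
       (\<forall>\<alpha> B \<Xi>. 0 < \<alpha> \<and> \<alpha> < 1 \<and> B \<ge> 1 \<and> multiplier_copies M X \<xi> B \<Xi> \<longrightarrow>
          (\<lambda>n. inner_measure_of M {\<omega> \<in> space M.
             emp_quantile B (\<lambda>b. stat (H_mult D n (sample X n \<omega>) (sample (\<Xi> b) n \<omega>))) (1 - \<alpha>)
               < ereal (stat (H_emp n (sample X n \<omega>)))}) \<longlonglongrightarrow> 1))"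
proof -
  interpret bootstrap_test M X C D K \<xi>
    by (intro bootstrap_test.intro copula_sample.intro bootstrap_test_axioms.intro assms)
  show ?thesis
    by (intro ballI conjI allI impI conditional_weak_convergence statistic_diverges test_consistent) auto
qed

end
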